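(* Let $M$ be a hyperbolic surface with metric tensor $g$ and constant curvature $R$, and let $S$ be a symmetric $2$-tensor on $M$ with associated symmetric $2$-tensor $S^*$. Then the equation $D^*S=0$ is valid if and only if locally there is a function $E$ with $$S^*=\nabla dE+R\,g\,E ,$$ where $\nabla$ is the covariant derivative. Moreover, the kernel $K$ of the operator $\nabla d+Rg$ (that is, $E\mapsto\nabla dE+R\,g\,E$) corresponds to functions $E$ which are the Hamiltonians for the action of the symmetry group $\mathrm{SO}(2,1)$ with respect to the natural symplectic form on $M$.
   Context: A hyperbolic surface is a Riemannian surface of constant negative curvature, locally modelled on the hyperbolic plane $H^2$ (in the upper half plane with metric $(dx^2+dy^2)/y^2$, $R=-1$). $\nabla$ is the Levi-Civita covariant derivative of $g$, so $\nabla dE$ is the Hessian of $E$. $S$ is a section of the symmetric tensor product of $T^*M$ with itself; it may only be in $L^1$, in which case the equations are interpreted distributionally. Regarding $S$ as a one-form with values in $T^*M$, $D$ is the covariant derivative form of the exterior differential $d$, and $D^*S=0$ says that $S$ is (covariantly) divergence free. The tensor $S^*$ is obtained from $S$ by taking the dual (Hodge star) of both indices: in a local orthonormal frame, $S^*_{(1,1)}=S_{(2,2)}$, $S^*_{(2,2)}=S_{(1,1)}$, $S^*_{(1,2)}=S^*_{(2,1)}=-S_{(1,2)}=-S_{(2,1)}$. The natural symplectic form is the area form of $g$. The symmetry group $\mathrm{SO}(2,1)$ acts by isometries on $H^2$, its infinitesimal action giving the (local) Killing vector fields; a Hamiltonian for the action is a function whose Hamiltonian vector field, with respect to the symplectic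 form, is such a Killing field. The kernel $K$ is taken on functions on $H^2$ (equivalently, on local functions on $M$). *)

theory Defs
  imports "HOL-Analysis.Analysis"
begin

section \<open>Smooth functions on open subsets of the plane\<close>

definition pd :: "2 \<Rightarrow> (real^2 \<Rightarrow> real) \<Rightarrow> real^2 \<Rightarrow> real" where
  "pd i f x = frechet_derivative f (at x) (axis i 1)"

text \<open>The following notions are only used on open sets.\<close>

primrec Ck_on :: "nat \<Rightarrow> (real^2 \<Rightarrow> real) \<Rightarrow> (real^2) set \<Rightarrow> bool" where
  "Ck_on 0 f W \<longleftrightarrow> continuous_on W f"
| "Ck_on (Suc k) f W \<longleftrightarrow> (\<forall>x\<in>W. f differentiable (at x)) \<and> (\<forall>i. Ck_on k (pd i f) W)"

definition smooth_fun :: "(real^2 \<Rightarrow> real) \<Rightarrow> (real^2) set \<Rightarrow> bool" where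
  "smooth_fun f W \<longleftrightarrow> (\<forall>k. Ck_on k f W)"

definition smooth_map :: "(real^2 \<Rightarrow> real^2) \<Rightarrow> (real^2) set \<Rightarrow> bool" where
  "smooth_map F W \<longleftrightarrow> (\<forall>i. smooth_fun (\<lambda>x. F x $ i) W)"

definition smooth_mat :: "(real^2 \<Rightarrow> real^2^2) \<Rightarrow> (real^2) set \<Rightarrow> bool" where
  "smooth_mat T W \<longleftrightarrow> (\<forall>i j. smooth_fun (\<lambda>x. T x $ i $ j) W)"


section \<open>Distributions\<close>

text \<open>Distributions are represented as functionals on test functions; only their values on
  test functions supported in the open set under consideration are relevant.\<close>

type_synonym distr = "(real^2 \<Rightarrow> real) \<Rightarrow> real"

definition test_fun :: "(real^2) set \<Rightarrow> (real^2 \<Rightarrow> real) \<Rightarrow> bool" where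
  "test_fun W \<phi> \<longleftrightarrow> smooth_fun \<phi> UNIV \<and> (\<exists>K. compact K \<and> K \<subseteq> W \<and> (\<forall>x. x \<notin> K \<longrightarrow> \<phi> x = 0))"

definition L1_loc :: "(real^2 \<Rightarrow> real) \<Rightarrow> (real^2) set \<Rightarrow> bool" where
  "L1_loc f W \<longleftrightarrow> (\<forall>K. compact K \<and> K \<subseteq> W \<longrightarrow> f absolutely_integrable_on K)"

definition dist_of :: "(real^2 \<Rightarrow> real) \<Rightarrow> distr" where
  "dist_of f \<phi> = (LINT x|lebesgue. f x * \<phi> x)"

definition dist_pd :: "2 \<Rightarrow> distr \<Rightarrow> distr" where
  "dist_pd i T \<phi> = - T (pd i \<phi>)"

definition dist_scale :: "(real^2 \<Rightarrow> real) \<Rightarrow> distr \<Rightarrow> distr" where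
  "dist_scale a T \<phi> = T (\<lambda>x. a x * \<phi> x)"


section \<open>Riemannian geometry in a coordinate chart\<close>

text \<open>A covariant 2-tensor, in particular the metric \<open>G\<close>, is given by its matrix of components.\<close>

definition christoffel :: "(real^2 \<Rightarrow> real^2^2) \<Rightarrow> 2 \<Rightarrow> 2 \<Rightarrow> 2 \<Rightarrow> real^2 \<Rightarrow> real" where
  "christoffel G k i j x = (1/2) * (\<Sum>l\<in>UNIV. matrix_inv (G x) $ k $ l *
     (pd i (\<lambda>y. G y $ j $ l) x + pd j (\<lambda>y. G y $ i $ l) x - pd l (\<lambda>y. G y $ i $ j) x))"

text \<open>\<open>riemann G l k i j\<close> is the coefficient of \<open>\<partial>\<^sub>l\<close> in \<open>R(\<partial>\<^sub>i, \<partial>\<^sub>j) \<partial>\<^sub>k\<close>, where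
  \<open>R(X, Y) = [\<nabla>\<^sub>X, \<nabla>\<^sub>Y] - \<nabla>\<^bsub>[X, Y]\<^esub>\<close>.  The constant \<open>R\<close> in the theorem is the Gauss curvature.\<close>

definition riemann :: "(real^2 \<Rightarrow> real^2^2) \<Rightarrow> 2 \<Rightarrow> 2 \<Rightarrow> 2 \<Rightarrow> 2 \<Rightarrow> real^2 \<Rightarrow> real" where
  "riemann G l k i j x = pd i (christoffel G l j k) x - pd j (christoffel G l i k) x
     + (\<Sum>m\<in>UNIV. christoffel G l i m x * christoffel G m j k x
               - christoffel G l j m x * christoffel G m i k x)"

definition gauss_curvature :: "(real^2 \<Rightarrow> real^2^2) \<Rightarrow> real^2 \<Rightarrow> real" where
  "gauss_curvature G x = (\<Sum>l\<in>UNIV. G x $ 1 $ l * riemann G l 2 1 2 x) / det (G x)"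

definition area_form :: "real^2^2 \<Rightarrow> real^2^2" where
  "area_form G = (\<chi> i j. sqrt (det G) *
     (if i = 1 \<and> j = 2 then 1 else if i = 2 \<and> j = 1 then -1 else 0))"

text \<open>The Hodge star of a one-form is \<open>(\<star>\<alpha>)\<^sub>j = \<alpha>\<^sub>i g\<^sup>i\<^sup>k \<epsilon>\<^sub>k\<^sub>j\<close> with \<open>\<epsilon>\<close> the area form; here it is
  applied to both indices.  The orientation of the chart enters twice and cancels.\<close>

definition star2 :: "real^2^2 \<Rightarrow> real^2^2 \<Rightarrow> real^2^2" where
  "star2 G S = transpose (area_form G) ** matrix_inv G ** S ** matrix_inv G ** area_form G"

definition hessian :: "(real^2 \<Rightarrow> real^2^2) \<Rightarrow> (real^2 \<Rightarrow> real) \<Rightarrow> real^2 \<Rightarrow> real^2^2" where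
  "hessian G E x =
     (\<chi> i j. pd i (pd j E) x - (\<Sum>k\<in>UNIV. christoffel G k i j x * pd k E x))"

definition dist_hessian :: "(real^2 \<Rightarrow> real^2^2) \<Rightarrow> distr \<Rightarrow> 2 \<Rightarrow> 2 \<Rightarrow> distr" where
  "dist_hessian G T i j \<phi> = dist_pd i (dist_pd j T) \<phi>
     - (\<Sum>k\<in>UNIV. dist_scale (christoffel G k i j) (dist_pd k T) \<phi>)"

text \<open>\<open>cov_deriv G S i k j\<close> is \<open>(\<nabla>\<^sub>i S)\<^sub>k\<^sub>j\<close>, and \<open>Dstar G S j\<close> is \<open>(D\<^sup>*S)\<^sub>j = - g\<^sup>i\<^sup>k (\<nabla>\<^sub>i S)\<^sub>k\<^sub>j\<close>,
  the formal adjoint of \<open>\<alpha> \<mapsto> D\<alpha> = \<nabla>\<alpha>\<close> on one-forms.\<close>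

definition cov_deriv ::
    "(real^2 \<Rightarrow> real^2^2) \<Rightarrow> (real^2 \<Rightarrow> real^2^2) \<Rightarrow> 2 \<Rightarrow> 2 \<Rightarrow> 2 \<Rightarrow> real^2 \<Rightarrow> real" where
  "cov_deriv G S i k j x = pd i (\<lambda>y. S y $ k $ j) x
     - (\<Sum>l\<in>UNIV. christoffel G l i k x * S x $ l $ j)
     - (\<Sum>l\<in>UNIV. christoffel G l i j x * S x $ k $ l)"

definition Dstar ::
    "(real^2 \<Rightarrow> real^2^2) \<Rightarrow> (real^2 \<Rightarrow> real^2^2) \<Rightarrow> 2 \<Rightarrow> real^2 \<Rightarrow> real" where
  "Dstar G S j x = - (\<Sum>i\<in>UNIV. \<Sum>k\<in>UNIV. matrix_inv (G x) $ i $ k * cov_deriv G S i k j x)"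

definition dist_cov_deriv ::
    "(real^2 \<Rightarrow> real^2^2) \<Rightarrow> (2 \<Rightarrow> 2 \<Rightarrow> distr) \<Rightarrow> 2 \<Rightarrow> 2 \<Rightarrow> 2 \<Rightarrow> distr" where
  "dist_cov_deriv G T i k j \<phi> = dist_pd i (T k j) \<phi>
     - (\<Sum>l\<in>UNIV. dist_scale (christoffel G l i k) (T l j) \<phi>)
     - (\<Sum>l\<in>UNIV. dist_scale (christoffel G l i j) (T k l) \<phi>)"

definition dist_Dstar ::
    "(real^2 \<Rightarrow> real^2^2) \<Rightarrow> (2 \<Rightarrow> 2 \<Rightarrow> distr) \<Rightarrow> 2 \<Rightarrow> distr" where
  "dist_Dstar G T j \<phi> = - (\<Sum>i\<in>UNIV. \<Sum>k\<in>UNIV.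
     dist_scale (\<lambda>x. matrix_inv (G x) $ i $ k) (dist_cov_deriv G T i k j) \<phi>)"

definition in_kernel ::
    "(real^2 \<Rightarrow> real^2^2) \<Rightarrow> real \<Rightarrow> (real^2) set \<Rightarrow> (real^2 \<Rightarrow> real) \<Rightarrow> bool" where
  "in_kernel G R W E \<longleftrightarrow> smooth_fun E W \<and> (\<forall>x\<in>W. hessian G E x + (R * E x) *\<^sub>R G x = 0)"

text \<open>Vanishing of the Lie derivative of the metric.\<close>

definition killing_field ::
    "(real^2 \<Rightarrow> real^2^2) \<Rightarrow> (real^2) set \<Rightarrow> (real^2 \<Rightarrow> real^2) \<Rightarrow> bool" where
  "killing_field G W X \<longleftrightarrow> smooth_map X W \<and> (\<forall>x\<in>W. \<forall>i j.
     (\<Sum>k\<in>UNIV. X x $ k * pd k (\<lambda>y. G y $ i $ j) x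
       + G x $ k $ j * pd i (\<lambda>y. X y $ k) x + G x $ i $ k * pd j (\<lambda>y. X y $ k) x) = 0)"

text \<open>\<open>X\<close> is the Hamiltonian vector field of \<open>E\<close>, i.e. \<open>\<iota>\<^sub>X \<omega> = dE\<close> for the area form \<open>\<omega>\<close>.\<close>

definition hamiltonian_field ::
    "(real^2 \<Rightarrow> real^2^2) \<Rightarrow> (real^2) set \<Rightarrow> (real^2 \<Rightarrow> real) \<Rightarrow> (real^2 \<Rightarrow> real^2) \<Rightarrow> bool" where
  "hamiltonian_field G W E X \<longleftrightarrow>
     (\<forall>x\<in>W. \<forall>j. (\<Sum>i\<in>UNIV. X x $ i * area_form (G x) $ i $ j) = pd j E x)"

text \<open>A Hamiltonian is determined by its vector field only up to a constant, and constants are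
  not in the kernel.  Hence the correspondence between the kernel and the Hamiltonians of the
  vector fields in \<open>V\<close> means: passing to the Hamiltonian vector field is a bijection from the
  kernel onto \<open>V\<close> (everything being restricted to the connected set \<open>W\<close>), and the Hamiltonians
  of fields in \<open>V\<close> are exactly the elements of the kernel up to additive constants.\<close>

definition kernel_corresponds ::
    "(real^2 \<Rightarrow> real^2^2) \<Rightarrow> real \<Rightarrow> (real^2) set \<Rightarrow> ((real^2 \<Rightarrow> real^2) \<Rightarrow> bool) \<Rightarrow> bool" where
  "kernel_corresponds G R W V \<longleftrightarrow>
     (\<forall>E. in_kernel G R W E \<longrightarrow> (\<exists>X. V X \<and> hamiltonian_field G W E X)) \<and>
     (\<forall>X. V X \<longrightarrow> (\<exists>E. in_kernel G R W E \<and> hamiltonian_field G W E X \<and>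
        (\<forall>E'. in_kernel G R W E' \<and> hamiltonian_field G W E' X \<longrightarrow> (\<forall>x\<in>W. E' x = E x)))) \<and>
     (\<forall>E. smooth_fun E W \<longrightarrow>
        ((\<exists>X. V X \<and> hamiltonian_field G W E X) \<longleftrightarrow> (\<exists>a. in_kernel G R W (\<lambda>x. E x + a))))"


section \<open>The hyperbolic plane and the action of SO(2,1)\<close>

definition H2 :: "(real^2) set" where
  "H2 = {z. z $ 2 > 0}"

definition hyp_metric :: "real \<Rightarrow> real^2 \<Rightarrow> real^2^2" where
  "hyp_metric R z = (1 / (- R * (z $ 2)\<^sup>2)) *\<^sub>R mat 1"

definition lorentz :: "real^3^3" where
  "lorentz = (\<chi> i j. if i \<noteq> j then 0 else if i = 3 then -1 else 1)"

definition SO21 :: "(real^3^3) set" where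
  "SO21 = {A. transpose A ** lorentz ** A = lorentz \<and> det A = 1}"

text \<open>The standard isometry of the upper half plane onto the upper sheet of the hyperboloid
  \<open>v\<^sub>1\<^sup>2 + v\<^sub>2\<^sup>2 - v\<^sub>3\<^sup>2 = -1\<close>.\<close>

definition hyperboloid :: "real^2 \<Rightarrow> real^3" where
  "hyperboloid z = vector
     [z $ 1 / z $ 2,
      ((z $ 1)\<^sup>2 + (z $ 2)\<^sup>2 - 1) / (2 * z $ 2),
      ((z $ 1)\<^sup>2 + (z $ 2)\<^sup>2 + 1) / (2 * z $ 2)]"

text \<open>Elements of SO(2,1) may exchange the two sheets; the hyperbolic plane is identified with
  the set of lines through the hyperboloid.\<close>

definition so21_act :: "real^3^3 \<Rightarrow> real^2 \<Rightarrow> real^2" where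
  "so21_act A z = (THE w. w \<in> H2 \<and>
     (hyperboloid w = A *v hyperboloid z \<or> hyperboloid w = - (A *v hyperboloid z)))"

definition one_parameter_subgroup :: "(real \<Rightarrow> real^3^3) \<Rightarrow> bool" where
  "one_parameter_subgroup \<gamma> \<longleftrightarrow> (\<forall>t. \<gamma> t \<in> SO21) \<and> (\<forall>s t. \<gamma> (s + t) = \<gamma> s ** \<gamma> t) \<and>
     continuous_on UNIV \<gamma>"

definition infinitesimal_action :: "(real^2) set \<Rightarrow> (real^2 \<Rightarrow> real^2) \<Rightarrow> bool" where
  "infinitesimal_action W X \<longleftrightarrow> (\<exists>\<gamma>. one_parameter_subgroup \<gamma> \<and>
     (\<forall>z\<in>W. ((\<lambda>t. so21_act (\<gamma> t) z) has_vector_derivative X z) (at 0)))"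


section \<open>Hyperbolic surfaces\<close>

text \<open>The underlying space of the surface is a whole type; a chart is a domain together with a
  coordinate map.\<close>

type_synonym 'a chart = "'a set \<times> ('a \<Rightarrow> real^2)"

abbreviation cdom :: "'a chart \<Rightarrow> 'a set" where "cdom \<equiv> fst"

abbreviation cmap :: "'a chart \<Rightarrow> 'a \<Rightarrow> real^2" where "cmap \<equiv> snd"

definition cinv :: "'a chart \<Rightarrow> real^2 \<Rightarrow> 'a" where
  "cinv c = inv_into (cdom c) (cmap c)"

definition cimg :: "'a chart \<Rightarrow> 'a set \<Rightarrow> (real^2) set" where
  "cimg c U = cmap c ` (cdom c \<inter> U)"

definition transition :: "'a chart \<Rightarrow> 'a chart \<Rightarrow> real^2 \<Rightarrow> real^2" where
  "transition c d x = cmap d (cinv c x)"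

definition smooth_atlas :: "'a::topological_space chart set \<Rightarrow> bool" where
  "smooth_atlas A \<longleftrightarrow> (\<Union>c\<in>A. cdom c) = UNIV \<and>
     (\<forall>c\<in>A. open (cdom c) \<and> open (cimg c UNIV) \<and>
        homeomorphism (cdom c) (cimg c UNIV) (cmap c) (cinv c)) \<and>
     (\<forall>c\<in>A. \<forall>d\<in>A. smooth_map (transition c d) (cimg c (cdom d)))"

definition pullback :: "(real^2 \<Rightarrow> real^2) \<Rightarrow> (real^2 \<Rightarrow> real^2^2) \<Rightarrow> real^2 \<Rightarrow> real^2^2" where
  "pullback f T x = transpose (jacobian f (at x)) ** T (f x) ** jacobian f (at x)"

text \<open>A tensor field is given by its components in every chart of the atlas, subject to the
  transformation law.  The same is used for tensors that are merely locally integrable: an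
  almost everywhere class of sections has a representative defined everywhere.\<close>

definition sym2_tensor :: "'a chart set \<Rightarrow> ('a chart \<Rightarrow> real^2 \<Rightarrow> real^2^2) \<Rightarrow> bool" where
  "sym2_tensor A S \<longleftrightarrow> (\<forall>c\<in>A. (\<forall>x\<in>cimg c UNIV. transpose (S c x) = S c x) \<and>
     (\<forall>d\<in>A. \<forall>x\<in>cimg c (cdom d). S c x = pullback (transition c d) (S d) x))"

definition smooth_tensor :: "'a chart set \<Rightarrow> ('a chart \<Rightarrow> real^2 \<Rightarrow> real^2^2) \<Rightarrow> bool" where
  "smooth_tensor A S \<longleftrightarrow> (\<forall>c\<in>A. smooth_mat (S c) (cimg c UNIV))"

definition L1_loc_tensor :: "'a chart set \<Rightarrow> ('a chart \<Rightarrow> real^2 \<Rightarrow> real^2^2) \<Rightarrow> bool" where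
  "L1_loc_tensor A S \<longleftrightarrow> (\<forall>c\<in>A. \<forall>i j. L1_loc (\<lambda>x. S c x $ i $ j) (cimg c UNIV))"

definition riemannian_metric :: "'a chart set \<Rightarrow> ('a chart \<Rightarrow> real^2 \<Rightarrow> real^2^2) \<Rightarrow> bool" where
  "riemannian_metric A g \<longleftrightarrow> sym2_tensor A g \<and> smooth_tensor A g \<and>
     (\<forall>c\<in>A. \<forall>x\<in>cimg c UNIV. \<forall>v. v \<noteq> 0 \<longrightarrow> v \<bullet> (g c x *v v) > 0)"

definition locally_hyperbolic ::
    "'a chart set \<Rightarrow> ('a chart \<Rightarrow> real^2 \<Rightarrow> real^2^2) \<Rightarrow> real \<Rightarrow> bool" where
  "locally_hyperbolic A g R \<longleftrightarrow> (\<forall>p. \<exists>c\<in>A. p \<in> cdom c \<and> (\<exists>W f h.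
     open W \<and> cmap c p \<in> W \<and> W \<subseteq> cimg c UNIV \<and> open (f ` W) \<and> f ` W \<subseteq> H2 \<and>
     smooth_map f W \<and> smooth_map h (f ` W) \<and> (\<forall>x\<in>W. h (f x) = x) \<and>
     (\<forall>x\<in>W. g c x = pullback f (hyp_metric R) x)))"

definition hyperbolic_surface ::
    "'a::{t2_space,second_countable_topology} chart set \<Rightarrow>
     ('a chart \<Rightarrow> real^2 \<Rightarrow> real^2^2) \<Rightarrow> real \<Rightarrow> bool" where
  "hyperbolic_surface A g R \<longleftrightarrow> smooth_atlas A \<and> riemannian_metric A g \<and> R < 0 \<and>
     (\<forall>c\<in>A. \<forall>x\<in>cimg c UNIV. gauss_curvature (g c) x = R) \<and> locally_hyperbolic A g R"


section \<open>The two equations on a surface\<close>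

definition divergence_free ::
    "'a chart set \<Rightarrow> ('a chart \<Rightarrow> real^2 \<Rightarrow> real^2^2) \<Rightarrow> ('a chart \<Rightarrow> real^2 \<Rightarrow> real^2^2) \<Rightarrow> bool"
  where
  "divergence_free A g S \<longleftrightarrow> (\<forall>c\<in>A. \<forall>x\<in>cimg c UNIV. \<forall>j. Dstar (g c) (S c) j x = 0)"

definition dist_divergence_free ::
    "'a chart set \<Rightarrow> ('a chart \<Rightarrow> real^2 \<Rightarrow> real^2^2) \<Rightarrow> ('a chart \<Rightarrow> real^2 \<Rightarrow> real^2^2) \<Rightarrow> bool"
  where
  "dist_divergence_free A g S \<longleftrightarrow> (\<forall>c\<in>A. \<forall>\<phi>. test_fun (cimg c UNIV) \<phi> \<longrightarrow>
     (\<forall>j. dist_Dstar (g c) (\<lambda>k l. dist_of (\<lambda>x. S c x $ k $ l)) j \<phi> = 0))"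

definition star_tensor ::
    "('a chart \<Rightarrow> real^2 \<Rightarrow> real^2^2) \<Rightarrow> ('a chart \<Rightarrow> real^2 \<Rightarrow> real^2^2) \<Rightarrow>
     'a chart \<Rightarrow> real^2 \<Rightarrow> real^2^2" where
  "star_tensor g S c x = star2 (g c x) (S c x)"

text \<open>\<open>S\<^sup>* = \<nabla>dE + R g E\<close> on the open set \<open>U\<close>, classically with smooth \<open>E\<close>, and in the sense of
  distributions with locally integrable \<open>E\<close>.\<close>

definition potential_on ::
    "'a chart set \<Rightarrow> ('a chart \<Rightarrow> real^2 \<Rightarrow> real^2^2) \<Rightarrow> real \<Rightarrow>
     ('a chart \<Rightarrow> real^2 \<Rightarrow> real^2^2) \<Rightarrow> 'a set \<Rightarrow> ('a \<Rightarrow> real) \<Rightarrow> bool" where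
  "potential_on A g R S U E \<longleftrightarrow> (\<forall>c\<in>A. smooth_fun (E \<circ> cinv c) (cimg c U) \<and>
     (\<forall>x\<in>cimg c U. star_tensor g S c x
        = hessian (g c) (E \<circ> cinv c) x + (R * (E \<circ> cinv c) x) *\<^sub>R g c x))"

definition dist_potential_on ::
    "'a chart set \<Rightarrow> ('a chart \<Rightarrow> real^2 \<Rightarrow> real^2^2) \<Rightarrow> real \<Rightarrow>
     ('a chart \<Rightarrow> real^2 \<Rightarrow> real^2^2) \<Rightarrow> 'a set \<Rightarrow> ('a \<Rightarrow> real) \<Rightarrow> bool" where
  "dist_potential_on A g R S U E \<longleftrightarrow> (\<forall>c\<in>A. L1_loc (E \<circ> cinv c) (cimg c U) \<and>
     (\<forall>\<phi>. test_fun (cimg c U) \<phi> \<longrightarrow> (\<forall>i j.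
        dist_of (\<lambda>x. star_tensor g S c x $ i $ j) \<phi>
        = dist_hessian (g c) (dist_of (E \<circ> cinv c)) i j \<phi>
          + dist_of (\<lambda>x. R * g c x $ i $ j * (E \<circ> cinv c) x) \<phi>)))"

end

theory Submission
  imports Defs
begin

text \<open>Locally the surface is embedded in \<open>\<real>\<^bsup>2,1\<^esup>\<close> by \<open>e\<close> with \<open>\<langle>e, e\<rangle> = -1\<close> and
  \<open>\<langle>\<partial>\<^sub>ie, \<partial>\<^sub>je\<rangle> = -R g\<^sub>i\<^sub>j\<close>, and the Gauss formula gives \<open>\<nabla>de = -R g e\<close>: the components of \<open>e\<close> lie in
  the kernel of \<open>\<nabla>d + R g\<close>.  The vector valued one-form \<open>u = S\<^sup>*(grad e)\<close> is closed if and only if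
  \<open>D\<^sup>*S = 0\<close>.  If \<open>S\<^sup>* = \<nabla>dE + R g E\<close>, then \<open>c = -E e - R\<^sup>-\<^sup>1 dE(grad e)\<close> satisfies \<open>-R dc = u\<close>, so \<open>u\<close>
  is closed.  Conversely, if \<open>u\<close> is closed, the Poincare lemma gives such a \<open>c\<close>, and
  \<open>E = \<langle>e, c\<rangle>\<close> is the required function.  For locally integrable \<open>S\<close> the primitive \<open>c\<close> is obtained by averaging
  path integrals over their starting points, so that \<open>c\<close> is locally integrable.

  For \<open>S = 0\<close> the function \<open>c\<close> is constant, and the Hamiltonian fields of the functions \<open>\<langle>e, c\<rangle>\<close> are
  the generators of the action of \<open>SO(2,1)\<close>.\<close>

section \<open>Calculus in the plane\<close>

text \<open>Neither the divergence nor the Hessian is ever transformed between charts. A potential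
  must satisfy its equation in every chart meeting \<open>U\<close>. The frame conditions pull back
  by the chain rule, \<open>u\<close> pulls back as a one-form, and the coefficients
  \<open>c\<close> are carried along; in each chart the same pointwise argument is then repeated.
  The curl of \<open>u\<close> is the divergence of \<open>S\<close> contracted with the rotated
  \<open>de\<close>: the only second derivatives are those of \<open>e\<close>, and the part of them
  along \<open>e\<close> is a multiple of \<open>g\<close>, which cancels because \<open>S\<close>
  is symmetric. As \<open>u\<close> is orthogonal to \<open>e\<close>, the function
  \<open>E = ip e c\<close> has \<open>dE = ip de c\<close>; one more derivative produces the dual
  of \<open>S\<close> from \<open>dc\<close> and the term \<open>- R g E\<close> from the Hessian of
  \<open>e\<close>. When \<open>S\<close> is only locally integrable, derivatives are moved onto the
  test function until both sides are integrals of explicit functions, which are compared pointwise;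
  charts are changed by substitution and the Piola identity.\<close>

lemma sum_axis_mult [simp]: "(\<Sum>j\<in>UNIV. axis i 1 $ j * (F j :: real)) = F i"
proof -
  have "(\<Sum>j\<in>UNIV. axis i 1 $ j * F j) = (\<Sum>j\<in>UNIV. if j = i then F j else 0)"
    by (intro sum.cong) (auto simp: axis_def)
  then show ?thesis by simp
qed

lemma pd_eqI: "(f has_derivative f') (at x) \<Longrightarrow> pd i f x = f' (axis i 1)"
  unfolding pd_def using frechet_derivative_at by metis

lemma has_derivative_pd:
  assumes "f differentiable (at x)"
  shows "(f has_derivative (\<lambda>h. \<Sum>j\<in>UNIV. h $ j * pd j f x)) (at x)"
proof -
  let ?D = "frechet_derivative f (at x)"
  have D: "(f has_derivative ?D) (at x)"
    using assms frechet_derivative_works by blast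
  then have lin: "linear ?D" by (rule has_derivative_linear)
  have "?D = (\<lambda>h. \<Sum>j\<in>UNIV. h $ j * pd j f x)"
  proof
    fix h :: "real^2"
    have "?D h = ?D (\<Sum>j\<in>UNIV. h $ j *s axis j 1)" by (simp add: basis_expansion)
    also have "\<dots> = (\<Sum>j\<in>UNIV. h $ j * pd j f x)"
      by (simp add: linear_sum[OF lin] scalar_mult_eq_scaleR linear_scale[OF lin] pd_def)
    finally show "?D h = (\<Sum>j\<in>UNIV. h $ j * pd j f x)" .
  qed
  then show ?thesis using D by simp
qed

lemma has_derivative_cong_open:
  assumes "open W" "x \<in> W" "\<And>y. y \<in> W \<Longrightarrow> f y = g y"
  shows "(f has_derivative D) (at x) \<longleftrightarrow> (g has_derivative D) (at x)"
  using assms by (metis has_derivative_transform_within_open)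

lemma pd_cong:
  assumes "open W" "x \<in> W" "\<And>y. y \<in> W \<Longrightarrow> f y = g y"
  shows "pd i f x = pd i g x"
proof -
  have "(f has_derivative D) (at x) \<longleftrightarrow> (g has_derivative D) (at x)" for D
    using assms by (rule has_derivative_cong_open)
  then show ?thesis by (simp add: pd_def frechet_derivative_def)
qed

lemma differentiable_cong_open:
  assumes "open W" "x \<in> W" "\<And>y. y \<in> W \<Longrightarrow> f y = g y"
  shows "f differentiable (at x) \<longleftrightarrow> g differentiable (at x)"
proof -
  have "(f has_derivative D) (at x) \<longleftrightarrow> (g has_derivative D) (at x)" for D
    using assms by (rule has_derivative_cong_open)
  then show ?thesis by (simp add: differentiable_def)
qed

lemma pd_const [simp]: "pd i (\<lambda>x. c) x = 0"
  by (rule trans[OF pd_eqI]) (auto intro!: derivative_eq_intros)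

lemma has_derivative_coord: "((\<lambda>x::real^2. x $ j) has_derivative (\<lambda>h. h $ j)) (at x)"
  by (rule bounded_linear_imp_has_derivative) (rule bounded_linear_vec_nth)

lemma pd_coord: "pd i (\<lambda>x. x $ j) x = (if i = j then 1 else 0)"
  by (subst pd_eqI[OF has_derivative_coord]) (simp add: axis_def)

context
  fixes f g :: "real^2 \<Rightarrow> real" and x :: "real^2"
  assumes f: "f differentiable (at x)"
begin

lemma pd_cmult: "pd i (\<lambda>y. c * f y) x = c * pd i f x"
proof -
  have "((\<lambda>y. c * f y) has_derivative (\<lambda>h. c * (\<Sum>j\<in>UNIV. h $ j * pd j f x))) (at x)"
    by (intro has_derivative_mult_right has_derivative_pd f)
  from pd_eqI[OF this] show ?thesis by simp
qed

lemma pd_minus: "pd i (\<lambda>y. - f y) x = - pd i f x"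
  using pd_cmult[of i "-1"] by simp

lemma pd_chain1:
  assumes "(h has_real_derivative d) (at (f x))"
  shows "(\<lambda>y. h (f y)) differentiable (at x)" "pd i (\<lambda>y. h (f y)) x = d * pd i f x"
proof -
  have *: "((\<lambda>y. h (f y)) has_derivative (\<lambda>v. d * (\<Sum>j\<in>UNIV. v $ j * pd j f x))) (at x)"
    using has_derivative_compose[OF has_derivative_pd[OF f], of h "(*) d"] assms
    by (simp add: has_field_derivative_def)
  show "(\<lambda>y. h (f y)) differentiable (at x)" using * differentiable_def by blast
  show "pd i (\<lambda>y. h (f y)) x = d * pd i f x"
    by (subst pd_eqI[OF *]) simp
qed

lemma pd_add:
  assumes g: "g differentiable (at x)"
  shows "pd i (\<lambda>y. f y + g y) x = pd i f x + pd i g x"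
  by (rule trans[OF pd_eqI[OF has_derivative_add[OF has_derivative_pd[OF f] has_derivative_pd[OF g]]]])
     simp

lemma pd_diff:
  assumes g: "g differentiable (at x)"
  shows "pd i (\<lambda>y. f y - g y) x = pd i f x - pd i g x"
  by (rule trans[OF pd_eqI[OF has_derivative_diff[OF has_derivative_pd[OF f] has_derivative_pd[OF g]]]])
     simp

lemma pd_mult:
  assumes g: "g differentiable (at x)"
  shows "pd i (\<lambda>y. f y * g y) x = f x * pd i g x + pd i f x * g x"
  by (rule trans[OF pd_eqI[OF has_derivative_mult[OF has_derivative_pd[OF f] has_derivative_pd[OF g]]]])
     simp

end

lemma pd_sum:
  assumes "finite I" "\<And>k. k \<in> I \<Longrightarrow> f k differentiable (at x)"
  shows "pd i (\<lambda>y. \<Sum>k\<in>I. f k y) x = (\<Sum>k\<in>I. pd i (f k) x)"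
  using assms
  by (induction I rule: finite_induct) (auto simp: pd_add differentiable_sum)

lemma pd_compose:
  assumes F: "\<And>k. (\<lambda>y. F y $ k) differentiable (at x)" and f: "f differentiable (at (F x))"
  shows "(\<lambda>y. f (F y)) differentiable (at x)"
    "pd i (\<lambda>y. f (F y)) x = (\<Sum>k\<in>UNIV. pd k f (F x) * pd i (\<lambda>y. F y $ k) x)"
proof -
  have "(F has_derivative (\<lambda>h. \<chi> k. \<Sum>j\<in>UNIV. h $ j * pd j (\<lambda>y. F y $ k) x)) (at x)"
    unfolding has_derivative_componentwise_within[of F]
    by (auto simp: Basis_vec_def inner_axis intro!: has_derivative_pd F)
  from has_derivative_compose[OF this has_derivative_pd[OF f]]
  have *: "((\<lambda>y. f (F y)) has_derivative
     (\<lambda>h. \<Sum>l\<in>UNIV. (\<Sum>j\<in>UNIV. h $ j * pd j (\<lambda>y. F y $ l) x) * pd l f (F x))) (at x)"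
    by simp
  show "(\<lambda>y. f (F y)) differentiable (at x)" using * differentiable_def by blast
  show "pd i (\<lambda>y. f (F y)) x = (\<Sum>k\<in>UNIV. pd k f (F x) * pd i (\<lambda>y. F y $ k) x)"
    by (subst pd_eqI[OF *]) (simp add: mult.commute)
qed

section \<open>Closure properties of smooth functions on open sets\<close>

lemma Ck_on_Suc_imp: "Ck_on (Suc k) f W \<Longrightarrow> Ck_on k f W"
proof (induction k arbitrary: f)
  case 0
  then show ?case
    by (auto intro!: continuous_at_imp_continuous_on differentiable_imp_continuous_within)
qed auto

lemma Ck_on_subset: "Ck_on k f W \<Longrightarrow> V \<subseteq> W \<Longrightarrow> Ck_on k f V"
  by (induction k arbitrary: f) (auto intro: continuous_on_subset)

lemma Ck_on_cong:
  assumes "open W" "\<And>y. y \<in> W \<Longrightarrow> f y = g y"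
  shows "Ck_on k f W \<longleftrightarrow> Ck_on k g W"
  using assms(2)
proof (induction k arbitrary: f g)
  case 0
  then show ?case by (auto cong: continuous_on_cong)
next
  case (Suc k)
  have "Ck_on k (pd i f) W \<longleftrightarrow> Ck_on k (pd i g) W" for i
    by (rule Suc.IH) (use Suc.prems assms(1) pd_cong in blast)
  then show ?case
    using differentiable_cong_open[OF assms(1) _ Suc.prems] by auto
qed

lemma Ck_on_Un:
  assumes "open V" "open W" "Ck_on k f V" "Ck_on k f W"
  shows "Ck_on k f (V \<union> W)"
  using assms(3-)
  by (induction k arbitrary: f) (auto intro: continuous_on_open_Un assms)

lemma Ck_on_const: "Ck_on k (\<lambda>x. c) W"
proof (induction k arbitrary: c)
  case (Suc k)
  have "pd i (\<lambda>x. c) = (\<lambda>x. 0)" for i by (rule ext) simp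
  with Suc show ?case by simp
qed auto

lemma Ck_on_coord: "Ck_on k (\<lambda>x. x $ j) W"
proof (cases k)
  case 0
  then show ?thesis by (auto intro: continuous_intros)
next
  case (Suc n)
  have "pd i (\<lambda>x. x $ j) = (\<lambda>x. if i = j then 1 else 0)" for i
    by (rule ext) (rule pd_coord)
  then show ?thesis
    unfolding Suc using has_derivative_coord by (auto simp: differentiable_def Ck_on_const)
qed

lemma Ck_on_add:
  assumes "open W"
  shows "Ck_on k f W \<Longrightarrow> Ck_on k g W \<Longrightarrow> Ck_on k (\<lambda>x. f x + g x) W"
proof (induction k arbitrary: f g)
  case (Suc k)
  have "Ck_on k (pd i (\<lambda>x. f x + g x)) W" for i
    by (rule Ck_on_cong[THEN iffD2, OF assms _ Suc.IH[of "pd i f" "pd i g"]])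
       (use Suc.prems in \<open>auto simp: pd_add\<close>)
  then show ?case using Suc.prems by auto
qed (auto intro: continuous_intros)

lemma Ck_on_mult:
  assumes "open W"
  shows "Ck_on k f W \<Longrightarrow> Ck_on k g W \<Longrightarrow> Ck_on k (\<lambda>x. f x * g x) W"
proof (induction k arbitrary: f g)
  case (Suc k)
  have "Ck_on k (\<lambda>x. f x * pd i g x + pd i f x * g x) W" for i
    using Suc.prems Ck_on_Suc_imp[OF Suc.prems(1)] Ck_on_Suc_imp[OF Suc.prems(2)]
    by (intro Ck_on_add assms Suc.IH) auto
  then have "Ck_on k (pd i (\<lambda>x. f x * g x)) W" for i
    by (subst Ck_on_cong[OF assms]) (use Suc.prems in \<open>auto simp: pd_mult\<close>)
  then show ?case using Suc.prems by auto
qed (auto intro: continuous_intros)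

lemma Ck_on_sum:
  assumes "open W" "finite I" "\<And>i. i \<in> I \<Longrightarrow> Ck_on k (f i) W"
  shows "Ck_on k (\<lambda>x. \<Sum>i\<in>I. f i x) W"
  using assms(2,3) by (induction I rule: finite_induct) (auto intro: Ck_on_add Ck_on_const assms)

lemma Ck_on_compose:
  assumes "open V" "open W" and sub: "\<And>x. x \<in> V \<Longrightarrow> F x \<in> W"
    and F: "\<And>j. Ck_on k (\<lambda>x. F x $ j) V"
  shows "Ck_on k f W \<Longrightarrow> Ck_on k (\<lambda>x. f (F x)) V"
  using F
proof (induction k arbitrary: f)
  case 0
  have "continuous_on V (\<lambda>x. F x $ j)" for j
    using 0(2)[of j] by simp
  then have "continuous_on V (\<lambda>x. (\<chi> j. F x $ j))"
    by (intro continuous_on_vec_lambda)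
  then have F: "continuous_on V F" by simp
  have f: "continuous_on W f" using 0(1) by simp
  have "F ` V \<subseteq> W" using sub by blast
  from continuous_on_compose2[OF f F this] show ?case by simp
next
  case (Suc k)
  have F': "\<And>j. Ck_on k (\<lambda>x. F x $ j) V" by (rule Ck_on_Suc_imp) (rule Suc.prems(2))
  have f': "Ck_on k (pd l f) W" and df: "x \<in> W \<Longrightarrow> f differentiable (at x)" for l x
    using Suc.prems(1) by simp_all
  have F'': "Ck_on k (pd i (\<lambda>y. F y $ l)) V" and dF: "x \<in> V \<Longrightarrow> (\<lambda>y. F y $ l) differentiable (at x)" for i l x
    using Suc.prems(2)[of l] by simp_all
  have "Ck_on k (\<lambda>x. pd l f (F x) * pd i (\<lambda>y. F y $ l) x) V" for i l
    by (rule Ck_on_mult[OF assms(1) Suc.IH[OF f' F'] F''])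
  then have "Ck_on k (\<lambda>x. \<Sum>l\<in>UNIV. pd l f (F x) * pd i (\<lambda>y. F y $ l) x) V" for i
    by (intro Ck_on_sum assms finite)
  moreover have "pd i (\<lambda>x. f (F x)) x = (\<Sum>l\<in>UNIV. pd l f (F x) * pd i (\<lambda>y. F y $ l) x)"
    and "(\<lambda>x. f (F x)) differentiable (at x)" if "x \<in> V" for i x
    using pd_compose[OF dF[OF that] df[OF sub[OF that]]] by auto
  ultimately show ?case
    using Ck_on_cong[OF \<open>open V\<close>, of "pd _ (\<lambda>x. f (F x))"] by simp
qed

lemma Ck_on_inverse:
  assumes "open W" "\<And>x. x \<in> W \<Longrightarrow> f x \<noteq> 0"
  shows "Ck_on k f W \<Longrightarrow> Ck_on k (\<lambda>x. inverse (f x)) W"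
proof (induction k)
  case 0
  then show ?case using assms by (auto intro: continuous_intros)
next
  case (Suc k)
  have d: "(inverse has_real_derivative - (inverse (f x) * inverse (f x))) (at (f x))" if "x \<in> W" for x
    using assms(2)[OF that] by (auto intro!: derivative_eq_intros)
  have IH: "Ck_on k (\<lambda>x. inverse (f x)) W" using Suc Ck_on_Suc_imp by blast
  have "Ck_on k (\<lambda>x. (-1) * (inverse (f x) * inverse (f x)) * pd i f x) W" for i
    using Suc.prems by (intro Ck_on_mult Ck_on_const IH assms) auto
  then have "Ck_on k (pd i (\<lambda>x. inverse (f x))) W" for i
    by (subst Ck_on_cong[OF \<open>open W\<close>]) (use Suc.prems in \<open>auto simp: pd_chain1(2)[OF _ d]\<close>)
  moreover have "\<forall>x\<in>W. (\<lambda>x. inverse (f x)) differentiable (at x)"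
    using Suc.prems d by (auto intro: pd_chain1(1))
  ultimately show ?case by auto
qed

lemma Ck_on_sqrt:
  assumes "open W" "\<And>x. x \<in> W \<Longrightarrow> f x > 0"
  shows "Ck_on k f W \<Longrightarrow> Ck_on k (\<lambda>x. sqrt (f x)) W"
proof (induction k)
  case 0
  then show ?case using assms by (auto intro: continuous_intros)
next
  case (Suc k)
  have d: "(sqrt has_real_derivative (1/2) * inverse (sqrt (f x))) (at (f x))" if "x \<in> W" for x
    using assms(2)[OF that] by (auto intro!: derivative_eq_intros)
  have IH: "Ck_on k (\<lambda>x. sqrt (f x)) W" using Suc Ck_on_Suc_imp by blast
  have "Ck_on k (\<lambda>x. (1/2) * inverse (sqrt (f x)) * pd i f x) W" for i
    using Suc.prems assms(2)
    by (intro Ck_on_mult Ck_on_const Ck_on_inverse IH assms) (auto simp: less_imp_neq[symmetric])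
  then have "Ck_on k (pd i (\<lambda>x. sqrt (f x))) W" for i
    by (subst Ck_on_cong[OF \<open>open W\<close>]) (use Suc.prems in \<open>auto simp: pd_chain1(2)[OF _ d]\<close>)
  moreover have "\<forall>x\<in>W. (\<lambda>x. sqrt (f x)) differentiable (at x)"
    using Suc.prems d by (auto intro: pd_chain1(1))
  ultimately show ?case by auto
qed

lemma smooth_fun_differentiable: "smooth_fun f W \<Longrightarrow> x \<in> W \<Longrightarrow> f differentiable (at x)"
  using Ck_on.simps(2)[of 0 f W] unfolding smooth_fun_def by blast

lemma smooth_fun_continuous: "smooth_fun f W \<Longrightarrow> continuous_on W f"
  using Ck_on.simps(1)[of f W] unfolding smooth_fun_def by blast

lemma smooth_fun_pd: "smooth_fun f W \<Longrightarrow> smooth_fun (pd i f) W"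
  using Ck_on.simps(2)[of _ f W] unfolding smooth_fun_def by blast

lemma smooth_fun_subset: "smooth_fun f W \<Longrightarrow> V \<subseteq> W \<Longrightarrow> smooth_fun f V"
  unfolding smooth_fun_def using Ck_on_subset by blast

lemma smooth_fun_cong:
  "open W \<Longrightarrow> (\<And>y. y \<in> W \<Longrightarrow> f y = g y) \<Longrightarrow> smooth_fun f W \<longleftrightarrow> smooth_fun g W"
  unfolding smooth_fun_def using Ck_on_cong by blast

lemma smooth_fun_Un:
  "open V \<Longrightarrow> open W \<Longrightarrow> smooth_fun f V \<Longrightarrow> smooth_fun f W \<Longrightarrow> smooth_fun f (V \<union> W)"
  unfolding smooth_fun_def using Ck_on_Un by blast

lemma smooth_fun_const [simp]: "smooth_fun (\<lambda>x. c) W"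
  unfolding smooth_fun_def using Ck_on_const by blast

lemma smooth_fun_coord [simp]: "smooth_fun (\<lambda>x. x $ j) W"
  unfolding smooth_fun_def using Ck_on_coord by blast

lemma smooth_fun_add: "open W \<Longrightarrow> smooth_fun f W \<Longrightarrow> smooth_fun g W \<Longrightarrow> smooth_fun (\<lambda>x. f x + g x) W"
  unfolding smooth_fun_def using Ck_on_add by blast

lemma smooth_fun_mult: "open W \<Longrightarrow> smooth_fun f W \<Longrightarrow> smooth_fun g W \<Longrightarrow> smooth_fun (\<lambda>x. f x * g x) W"
  unfolding smooth_fun_def using Ck_on_mult by blast

lemma smooth_fun_minus: "open W \<Longrightarrow> smooth_fun f W \<Longrightarrow> smooth_fun (\<lambda>x. - f x) W"
  using smooth_fun_mult[of W "\<lambda>x. -1" f] by simp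

lemma smooth_fun_diff: "open W \<Longrightarrow> smooth_fun f W \<Longrightarrow> smooth_fun g W \<Longrightarrow> smooth_fun (\<lambda>x. f x - g x) W"
  using smooth_fun_add[of W f "\<lambda>x. - g x"] smooth_fun_minus by simp

lemma smooth_fun_sum:
  "open W \<Longrightarrow> finite I \<Longrightarrow> (\<And>i. i \<in> I \<Longrightarrow> smooth_fun (f i) W) \<Longrightarrow> smooth_fun (\<lambda>x. \<Sum>i\<in>I. f i x) W"
  unfolding smooth_fun_def using Ck_on_sum by blast

lemma smooth_fun_inverse:
  "open W \<Longrightarrow> smooth_fun f W \<Longrightarrow> (\<And>x. x \<in> W \<Longrightarrow> f x \<noteq> 0) \<Longrightarrow> smooth_fun (\<lambda>x. inverse (f x)) W"
  unfolding smooth_fun_def using Ck_on_inverse by blast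

lemma smooth_fun_divide:
  "open W \<Longrightarrow> smooth_fun f W \<Longrightarrow> smooth_fun g W \<Longrightarrow> (\<And>x. x \<in> W \<Longrightarrow> g x \<noteq> 0) \<Longrightarrow> smooth_fun (\<lambda>x. f x / g x) W"
  unfolding divide_inverse by (intro smooth_fun_mult smooth_fun_inverse)

lemma smooth_fun_sqrt:
  "open W \<Longrightarrow> smooth_fun f W \<Longrightarrow> (\<And>x. x \<in> W \<Longrightarrow> f x > 0) \<Longrightarrow> smooth_fun (\<lambda>x. sqrt (f x)) W"
  unfolding smooth_fun_def using Ck_on_sqrt by blast

lemma smooth_fun_power: "open W \<Longrightarrow> smooth_fun f W \<Longrightarrow> smooth_fun (\<lambda>x. f x ^ n) W"
  by (induction n) (auto intro: smooth_fun_mult)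

lemma smooth_fun_if: "(P \<Longrightarrow> smooth_fun f W) \<Longrightarrow> (\<not> P \<Longrightarrow> smooth_fun g W) \<Longrightarrow> smooth_fun (\<lambda>x. if P then f x else g x) W"
  by (cases P) auto

lemma smooth_fun_compose:
  "open V \<Longrightarrow> open W \<Longrightarrow> smooth_map F V \<Longrightarrow> F ` V \<subseteq> W \<Longrightarrow> smooth_fun f W \<Longrightarrow> smooth_fun (\<lambda>x. f (F x)) V"
  unfolding smooth_fun_def smooth_map_def using Ck_on_compose[of V W F _ f] by blast

lemmas smooth_intros = smooth_fun_const smooth_fun_coord smooth_fun_add smooth_fun_mult
  smooth_fun_minus smooth_fun_diff smooth_fun_sum smooth_fun_divide smooth_fun_sqrt smooth_fun_power smooth_fun_pd
  smooth_fun_if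

text \<open>The left-hand side is symmetric in \<open>i\<close> and \<open>j\<close>; letting \<open>h \<rightarrow> 0\<close> yields Schwarz's theorem.\<close>

lemma mixed_difference:
  assumes f: "Ck_on 2 f (ball x r)" and h: "0 < h" "2 * h < r"
  shows "\<exists>p\<in>cball x (2 * h). f (x + h *\<^sub>R axis i 1 + h *\<^sub>R axis j 1) - f (x + h *\<^sub>R axis i 1)
     - f (x + h *\<^sub>R axis j 1) + f x = h * h * pd j (pd i f) p"
proof -
  have inb: "x + s *\<^sub>R axis i 1 + t *\<^sub>R axis j 1 \<in> cball x (2*h)"
    "x + s *\<^sub>R axis i 1 + t *\<^sub>R axis j 1 \<in> ball x r" if "0 \<le> s" "s \<le> h" "0 \<le> t" "t \<le> h" for s t
  proof -
    have "dist x (x + s *\<^sub>R axis i 1 + t *\<^sub>R axis j 1) = norm (s *\<^sub>R axis i (1::real) + t *\<^sub>R axis j 1)"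
      unfolding dist_norm by (subst norm_minus_cancel[symmetric]) simp
    also have "\<dots> \<le> s + t"
      using norm_triangle_ineq[of "s *\<^sub>R axis i (1::real)" "t *\<^sub>R axis j 1"] that
      by (simp add: norm_axis_1)
    finally show "x + s *\<^sub>R axis i 1 + t *\<^sub>R axis j 1 \<in> cball x (2*h)"
      "x + s *\<^sub>R axis i 1 + t *\<^sub>R axis j 1 \<in> ball x r" using that h by auto
  qed
  have line: "((\<lambda>s. g (a + s *\<^sub>R axis k 1)) has_real_derivative pd k g (a + s *\<^sub>R axis k 1)) (at s)"
    if "g differentiable (at (a + s *\<^sub>R axis k 1))" for g :: "real^2 \<Rightarrow> real" and a k s
  proof -
    have "((\<lambda>s. a + s *\<^sub>R axis k 1) has_derivative (\<lambda>u. u *\<^sub>R axis k (1::real))) (at s)"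
      by (auto intro!: derivative_eq_intros)
    from has_derivative_compose[OF this has_derivative_pd[OF that]] show ?thesis
      by (simp add: has_field_derivative_def mult.assoc mult_commute_abs flip: sum_distrib_left)
  qed
  have df: "f differentiable (at y)" "pd k f differentiable (at y)" if "y \<in> ball x r" for y k
    using f that by (auto simp: numeral_2_eq_2)
  \<comment> \<open>The second difference is \<open>F h - F 0\<close>; the mean value theorem in
    direction \<open>i\<close>, then in direction \<open>j\<close>, leaves one mixed
    derivative.\<close>
  define F where "F s = f (x + h *\<^sub>R axis j 1 + s *\<^sub>R axis i 1) - f (x + s *\<^sub>R axis i 1)" for s
  have dF: "(F has_real_derivative pd i f (x + h *\<^sub>R axis j 1 + s *\<^sub>R axis i 1) - pd i f (x + s *\<^sub>R axis i 1)) (at s)"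
    if "0 \<le> s" "s \<le> h" for s
    unfolding F_def
  proof (intro DERIV_diff line df)
    show "x + h *\<^sub>R axis j 1 + s *\<^sub>R axis i 1 \<in> ball x r"
      using inb(2)[of s h] that h by (simp add: algebra_simps)
    show "x + s *\<^sub>R axis i 1 \<in> ball x r"
      using inb(2)[of s 0] that h by simp
  qed
  from MVT2[OF h(1) dF] obtain s where s: "0 < s" "s < h"
    "F h - F 0 = h * (pd i f (x + h *\<^sub>R axis j 1 + s *\<^sub>R axis i 1) - pd i f (x + s *\<^sub>R axis i 1))"
    by auto
  have dG: "((\<lambda>t. pd i f (x + s *\<^sub>R axis i 1 + t *\<^sub>R axis j 1)) has_real_derivative
      pd j (pd i f) (x + s *\<^sub>R axis i 1 + t *\<^sub>R axis j 1)) (at t)" if "0 \<le> t" "t \<le> h" for t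
    by (rule line, rule df, rule inb) (use that s in auto)
  from MVT2[OF h(1) dG] obtain t where t: "0 < t" "t < h"
    "pd i f (x + s *\<^sub>R axis i 1 + h *\<^sub>R axis j 1) - pd i f (x + s *\<^sub>R axis i 1)
      = h * pd j (pd i f) (x + s *\<^sub>R axis i 1 + t *\<^sub>R axis j 1)"
    by auto
  show ?thesis
  proof (rule bexI[of _ "x + s *\<^sub>R axis i 1 + t *\<^sub>R axis j 1"])
    show "x + s *\<^sub>R axis i 1 + t *\<^sub>R axis j 1 \<in> cball x (2 * h)"
      by (rule inb) (use s t in auto)
    show "f (x + h *\<^sub>R axis i 1 + h *\<^sub>R axis j 1) - f (x + h *\<^sub>R axis i 1)
     - f (x + h *\<^sub>R axis j 1) + f x = h * h * pd j (pd i f) (x + s *\<^sub>R axis i 1 + t *\<^sub>R axis j 1)"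
      using s(3) t(3) by (simp add: F_def algebra_simps)
  qed
qed

lemma pd_commute:
  assumes f: "smooth_fun f W" and "open W" "x \<in> W"
  shows "pd i (pd j f) x = pd j (pd i f) x"
proof -
  obtain r where r: "r > 0" "ball x r \<subseteq> W" using assms(2,3) open_contains_ball by metis
  have f2: "Ck_on 2 f (ball x r)" using f r Ck_on_subset smooth_fun_def by blast
  have cont: "isCont (pd k (pd l f)) x" for k l
    using smooth_fun_differentiable[OF smooth_fun_pd[OF smooth_fun_pd[OF f]] assms(3)]
    by (rule differentiable_imp_continuous_within)
  have lim: "\<exists>p q. (p \<longlonglongrightarrow> x) \<and> (q \<longlonglongrightarrow> x) \<and> (\<forall>n. pd i (pd j f) (p n) = pd j (pd i f) (q n))"
  proof -
    \<comment> \<open>The denominator 4 keeps \<open>2 * h n\<close>, the distance allowed for the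
      intermediate points, below \<open>r\<close>.\<close>
    define h where "h n = r / (4 * real (Suc n))" for n
    have h: "0 < h n" "2 * h n < r" for n
    proof -
      have "h n \<le> r / 4" unfolding h_def using r(1) by (intro divide_left_mono) auto
      then show "2 * h n < r" using r(1) by linarith
    qed (use r in \<open>simp add: h_def\<close>)
    have "\<exists>p\<in>cball x (2 * h n). \<exists>q\<in>cball x (2 * h n). pd i (pd j f) p = pd j (pd i f) q" for n
    proof -
      obtain p where p: "p \<in> cball x (2 * h n)"
        "f (x + h n *\<^sub>R axis j 1 + h n *\<^sub>R axis i 1) - f (x + h n *\<^sub>R axis j 1)
          - f (x + h n *\<^sub>R axis i 1) + f x = h n * h n * pd i (pd j f) p"
        using mixed_difference[OF f2 h, of n j i] by blast
      obtain q where q: "q \<in> cball x (2 * h n)"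
        "f (x + h n *\<^sub>R axis i 1 + h n *\<^sub>R axis j 1) - f (x + h n *\<^sub>R axis i 1)
          - f (x + h n *\<^sub>R axis j 1) + f x = h n * h n * pd j (pd i f) q"
        using mixed_difference[OF f2 h, of n i j] by blast
      have "x + h n *\<^sub>R axis j 1 + h n *\<^sub>R axis i 1 = x + h n *\<^sub>R axis i 1 + h n *\<^sub>R axis j 1"
        by (simp add: add_ac)
      then have "h n * h n * pd i (pd j f) p = h n * h n * pd j (pd i f) q"
        using p(2) q(2) by (simp only:)
      moreover have "h n * h n \<noteq> 0" using h(1)[of n] by simp
      ultimately have "pd i (pd j f) p = pd j (pd i f) q" by (metis mult_left_cancel)
      then show ?thesis using p(1) q(1) by blast
    qed
    then obtain p q where pq: "\<And>n. p n \<in> cball x (2 * h n)" "\<And>n. q n \<in> cball x (2 * h n)"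
      "\<And>n. pd i (pd j f) (p n) = pd j (pd i f) (q n)" by metis
    have h0: "(\<lambda>n. 2 * h n) \<longlonglongrightarrow> 0"
    proof -
      have "(\<lambda>n. (r / 2) * inverse (real (Suc n))) \<longlonglongrightarrow> (r/2) * 0"
        by (intro tendsto_mult tendsto_const LIMSEQ_inverse_real_of_nat)
      moreover have "(r / 2) * inverse (real (Suc n)) = 2 * h n" for n
        by (simp add: h_def divide_simps del: of_nat_Suc)
      ultimately show ?thesis by simp
    qed
    have "(\<lambda>n. dist (u n) x) \<longlonglongrightarrow> 0" if "\<And>n. u n \<in> cball x (2 * h n)" for u
      by (rule tendsto_sandwich[OF _ _ tendsto_const h0]) (use that in \<open>auto simp: dist_commute\<close>)
    then show ?thesis using pq tendsto_dist_iff by blast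
  qed
  then obtain p q where "p \<longlonglongrightarrow> x" "q \<longlonglongrightarrow> x" and pq: "\<And>n. pd i (pd j f) (p n) = pd j (pd i f) (q n)" by blast
  have 1: "(\<lambda>n. pd i (pd j f) (p n)) \<longlonglongrightarrow> pd i (pd j f) x"
    by (rule isCont_tendsto_compose) fact+
  have 2: "(\<lambda>n. pd j (pd i f) (q n)) \<longlonglongrightarrow> pd j (pd i f) x"
    by (rule isCont_tendsto_compose) fact+
  show ?thesis using LIMSEQ_unique[OF 1] 2 pq by simp
qed

section \<open>A smooth function that is flat at the origin\<close>

definition flat :: "nat \<Rightarrow> real \<Rightarrow> real" where
  "flat n t = (if t > 0 then inverse t ^ n * exp (- inverse t) else 0)"

text \<open>With 1/t as variable the exponential beats every power at infinity; from the left the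
  function is 0.\<close>

lemma flat_tendsto_0: "(flat n \<longlongrightarrow> 0) (at 0)"
proof (rule filterlim_split_at)
  have "((\<lambda>t. inverse t ^ n / exp (inverse t :: real)) \<longlongrightarrow> 0) (at_right 0)"
    by (rule filterlim_compose[OF tendsto_power_div_exp_0 filterlim_inverse_at_top_right])
  moreover have "\<forall>\<^sub>F t in at_right 0. inverse t ^ n / exp (inverse t) = flat n t"
    by (auto simp: eventually_at_right_less flat_def exp_minus divide_inverse intro!: eventually_at_rightI[of 0 1])
  ultimately show "(flat n \<longlongrightarrow> 0) (at_right 0)"
    by (rule Lim_transform_eventually)
  have "\<forall>\<^sub>F t in at_left 0. 0 = flat n t"
    by (auto simp: flat_def intro!: eventually_at_leftI[of "-1"])
  then show "(flat n \<longlongrightarrow> 0) (at_left 0)"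
    by (rule Lim_transform_eventually[OF tendsto_const])
qed

text \<open>The powers of 1/t belong to the family so that its span is closed under differentiation:
  the exponential raises the index by 2, the power by 1.\<close>

lemma flat_has_derivative:
  "(flat n has_real_derivative flat (n + 2) t - real n * flat (n + 1) t) (at t)"
proof -
  consider "t < 0" | "t = 0" | "t > 0" by linarith
  then show ?thesis
  proof cases
    case 1
    have "((\<lambda>t. 0) has_real_derivative 0) (at t)" by simp
    then have "(flat n has_real_derivative 0) (at t)"
      by (rule has_field_derivative_transform_within_open[of _ _ _ "{..<0}"]) (use 1 in \<open>auto simp: flat_def\<close>)
    then show ?thesis using 1 by (simp add: flat_def)
  next
    case 2
    \<comment> \<open>At the origin the difference quotient of \<open>flat n\<close> is
      \<open>flat (n + 1)\<close>, whose limit is already known.\<close>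
    have "flat (n + 1) h = (flat n (0 + h) - flat n 0) / h" for h
      by (auto simp: flat_def divide_inverse)
    then have "(\<lambda>h. (flat n (0 + h) - flat n 0) / h) \<midarrow>0\<rightarrow> 0"
      using flat_tendsto_0[of "n + 1"] by presburger
    then show ?thesis unfolding 2 by (simp add: DERIV_def flat_def)
  next
    case 3
    have "((\<lambda>t. inverse t ^ n * exp (- inverse t)) has_real_derivative
       flat (n + 2) t - real n * flat (n + 1) t) (at t)"
      using 3 by (cases n) (auto intro!: derivative_eq_intros simp: flat_def algebra_simps,
        metis One_nat_def mult.commute neq0_conv power_minus_mult)
    then show ?thesis
      by (rule has_field_derivative_transform_within_open[of _ _ _ "{0<..}"]) (use 3 in \<open>auto simp: flat_def\<close>)
  qed
qed

text \<open>The index \<open>n\<close> varies in the induction, because one derivative of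
  \<open>flat n\<close> involves \<open>flat (n + 2)\<close> and
  \<open>flat (n + 1)\<close>.\<close>

lemma Ck_on_flat:
  assumes "open W"
  shows "Ck_on k f W \<Longrightarrow> Ck_on k (\<lambda>x. flat n (f x)) W"
proof (induction k arbitrary: n)
  case 0
  have "continuous_on UNIV (flat n)"
    by (rule continuous_at_imp_continuous_on) (use flat_has_derivative DERIV_isCont in blast)
  from continuous_on_compose2[OF this, of W f] 0 show ?case by simp
next
  case (Suc k)
  have f: "Ck_on k f W" "\<And>i. Ck_on k (pd i f) W" and df: "\<And>x. x \<in> W \<Longrightarrow> f differentiable (at x)"
    using Ck_on_Suc_imp[OF Suc.prems] Suc.prems by auto
  have "Ck_on k (\<lambda>x. (flat (n + 2) (f x) + - real n * flat (n + 1) (f x)) * pd i f x) W" for i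
    by (intro Ck_on_mult Ck_on_add Ck_on_const Suc.IH f assms)
  then have "Ck_on k (pd i (\<lambda>x. flat n (f x))) W" for i
    by (subst Ck_on_cong[OF assms]) (auto simp: pd_chain1(2)[OF df flat_has_derivative])
  then show ?case using pd_chain1(1)[OF df flat_has_derivative] by simp
qed

lemma smooth_fun_flat: "open W \<Longrightarrow> smooth_fun f W \<Longrightarrow> smooth_fun (\<lambda>x. flat n (f x)) W"
  unfolding smooth_fun_def using Ck_on_flat by blast

lemma flat_pos: "t > 0 \<Longrightarrow> flat n t > 0" and flat_nonpos: "t \<le> 0 \<Longrightarrow> flat n t = 0"
  and flat_ge0: "flat n t \<ge> 0"
  by (auto simp: flat_def)

section \<open>Test functions and partitions of unity\<close>

lemma test_funE:
  assumes "test_fun W \<phi>"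
  obtains K where "smooth_fun \<phi> UNIV" "compact K" "K \<subseteq> W" "\<And>x. x \<notin> K \<Longrightarrow> \<phi> x = 0"
  using assms unfolding test_fun_def by blast

lemma test_fun_outside: "test_fun W \<phi> \<Longrightarrow> x \<notin> W \<Longrightarrow> \<phi> x = 0"
  unfolding test_fun_def by blast

lemma test_fun_smooth: "test_fun W \<phi> \<Longrightarrow> smooth_fun \<phi> V"
  unfolding test_fun_def using smooth_fun_subset by blast

lemma test_fun_differentiable: "test_fun W \<phi> \<Longrightarrow> \<phi> differentiable (at x)"
  using test_fun_smooth smooth_fun_differentiable[of _ UNIV] by blast

lemma test_fun_subset: "test_fun V \<phi> \<Longrightarrow> V \<subseteq> W \<Longrightarrow> test_fun W \<phi>"
  unfolding test_fun_def by blast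

text \<open>\<open>f\<close> is smooth on \<open>W\<close> and zero on the open complement of
  \<open>K\<close>, and these two sets cover the plane. This is how factors that are smooth only on
  \<open>W\<close> enter test functions.\<close>

lemma test_funI_local:
  assumes "open W" "smooth_fun f W" "compact K" "K \<subseteq> W" "\<And>x. x \<notin> K \<Longrightarrow> f x = 0"
  shows "test_fun W f"
proof -
  have "smooth_fun f (- K)"
    using smooth_fun_cong[of "- K" f "\<lambda>x. 0"] assms by (simp add: open_Compl compact_imp_closed)
  with assms have "smooth_fun f (W \<union> - K)"
    by (intro smooth_fun_Un) (auto simp: open_Compl compact_imp_closed)
  moreover have "W \<union> - K = UNIV" using assms by blast
  ultimately show ?thesis using assms unfolding test_fun_def by auto
qed

lemma test_fun_mult:
  assumes "open W" "smooth_fun a W" "test_fun W \<phi>"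
  shows "test_fun W (\<lambda>x. a x * \<phi> x)"
  using assms(3)
proof (rule test_funE)
  fix K assume K: "smooth_fun \<phi> UNIV" "compact K" "K \<subseteq> W" "\<And>x. x \<notin> K \<Longrightarrow> \<phi> x = 0"
  then show ?thesis
    using assms smooth_fun_subset[OF K(1)]
    by (intro test_funI_local[of _ _ K] smooth_fun_mult) auto
qed

lemma test_fun_add:
  assumes "test_fun W \<phi>" "test_fun W \<psi>"
  shows "test_fun W (\<lambda>x. \<phi> x + \<psi> x)"
proof -
  obtain K where K: "smooth_fun \<phi> UNIV" "compact K" "K \<subseteq> W" "\<And>x. x \<notin> K \<Longrightarrow> \<phi> x = 0"
    using assms(1) by (rule test_funE) blast
  obtain L where L: "smooth_fun \<psi> UNIV" "compact L" "L \<subseteq> W" "\<And>x. x \<notin> L \<Longrightarrow> \<psi> x = 0"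
    using assms(2) by (rule test_funE) blast
  show ?thesis unfolding test_fun_def
    using K L by (intro conjI exI[of _ "K \<union> L"] smooth_fun_add) (auto intro: compact_Un)
qed

lemma test_fun_zero [simp]: "test_fun W (\<lambda>x. 0)"
  unfolding test_fun_def by auto

lemma test_fun_sum: "finite I \<Longrightarrow> (\<And>i. i \<in> I \<Longrightarrow> test_fun W (f i)) \<Longrightarrow> test_fun W (\<lambda>x. \<Sum>i\<in>I. f i x)"
  by (induction I rule: finite_induct) (auto intro: test_fun_add)

lemma test_fun_cmult: "test_fun W \<phi> \<Longrightarrow> test_fun W (\<lambda>x. c * \<phi> x)"
  unfolding test_fun_def by (auto intro: smooth_fun_mult)

lemma test_fun_minus: "test_fun W \<phi> \<Longrightarrow> test_fun W (\<lambda>x. - \<phi> x)"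
  using test_fun_cmult[of W \<phi> "-1"] by simp

lemma test_fun_diff: "test_fun W \<phi> \<Longrightarrow> test_fun W \<psi> \<Longrightarrow> test_fun W (\<lambda>x. \<phi> x - \<psi> x)"
  using test_fun_add[of W \<phi> "\<lambda>x. - \<psi> x"] test_fun_minus by simp

lemma test_fun_pd:
  assumes "test_fun W \<phi>"
  shows "test_fun W (pd i \<phi>)"
  using assms
proof (rule test_funE)
  fix K assume K: "smooth_fun \<phi> UNIV" "compact K" "K \<subseteq> W" "\<And>x. x \<notin> K \<Longrightarrow> \<phi> x = 0"
  have "pd i \<phi> x = 0" if "x \<notin> K" for x
    using pd_cong[of "- K" x \<phi> "\<lambda>x. 0"] K that by (simp add: open_Compl compact_imp_closed)
  then show ?thesis using K smooth_fun_pd unfolding test_fun_def by blast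
qed

text \<open>Valid on the whole plane although \<open>a\<close> is controlled only on
  \<open>W\<close>: elsewhere \<open>\<phi>\<close> and the product vanish together with their
  derivatives.\<close>

lemma pd_mult_test:
  assumes "smooth_fun a W" "open W" "test_fun W \<phi>"
  shows "pd i (\<lambda>y. a y * \<phi> y) x = a x * pd i \<phi> x + pd i a x * \<phi> x"
proof (cases "x \<in> W")
  case True
  then show ?thesis
    using assms smooth_fun_differentiable test_fun_differentiable by (intro pd_mult) blast+
next
  case False
  then show ?thesis
    using test_fun_outside[OF test_fun_pd[OF assms(3)]] test_fun_outside[OF assms(3)]
      test_fun_outside[OF test_fun_pd[OF test_fun_mult[OF assms(2,1,3)]]] by simp
qed

lemma bump_exists:
  fixes x :: "real^2"
  assumes "r > 0"
  shows "\<exists>\<beta>. test_fun (ball x r) \<beta> \<and> \<beta> x > 0 \<and> (\<forall>y. \<beta> y \<ge> 0)"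
proof -
  \<comment> \<open>The radius \<open>r/2\<close> makes the support a closed ball inside
    \<open>ball x r\<close>.\<close>
  define \<beta> :: "real^2 \<Rightarrow> real" where "\<beta> y = flat 0 ((r/2)\<^sup>2 - ((y $ 1 - x $ 1)\<^sup>2 + (y $ 2 - x $ 2)\<^sup>2))" for y
  have eq: "(y $ 1 - x $ 1)\<^sup>2 + (y $ 2 - x $ 2)\<^sup>2 = (dist x y)\<^sup>2" for y
    by (simp add: dist_vec_def L2_set_def sum_2 dist_real_def power2_commute)
  have "\<beta> y = 0" if "y \<notin> cball x (r/2)" for y
    unfolding \<beta>_def eq using that assms by (intro flat_nonpos) (auto intro!: power_mono)
  moreover have "smooth_fun \<beta> UNIV"
    unfolding \<beta>_def by (intro smooth_fun_flat smooth_intros open_UNIV)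
  moreover have "cball x (r/2) \<subseteq> ball x r" using assms by auto
  ultimately have "test_fun (ball x r) \<beta>" unfolding test_fun_def using compact_cball by blast
  moreover have "\<beta> x > 0" "\<forall>y. \<beta> y \<ge> 0" using assms by (auto simp: \<beta>_def flat_ge0 intro: flat_pos)
  ultimately show ?thesis by blast
qed

text \<open>A partition of unity for functionals that are only known to be additive: finitely many
  bumps, each of which moves test functions to where \<open>L\<close> vanishes, cover the support of
  \<open>\<phi>\<close>, and \<open>\<phi>\<close> is split by dividing by their sum.\<close>

lemma local_imp_zero:
  assumes W: "open W"
    and add: "\<And>\<phi> \<psi>. test_fun W \<phi> \<Longrightarrow> test_fun W \<psi> \<Longrightarrow> L (\<lambda>x. \<phi> x + \<psi> x) = (L \<phi> + L \<psi> :: real)"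
    and loc: "\<And>x. x \<in> W \<Longrightarrow> \<exists>V. open V \<and> x \<in> V \<and> V \<subseteq> W \<and> (\<forall>\<phi>. test_fun V \<phi> \<longrightarrow> L \<phi> = 0)"
    and \<phi>: "test_fun W \<phi>"
  shows "L \<phi> = 0"
  using \<phi>
proof (rule test_funE)
  fix K assume K: "smooth_fun \<phi> UNIV" "compact K" "K \<subseteq> W" "\<And>x. x \<notin> K \<Longrightarrow> \<phi> x = 0"
  \<comment> \<open>What is kept of a bump at \<open>x\<close>: multiplication by it sends every
    test function on \<open>W\<close> to one on which \<open>L\<close> is zero.\<close>
  define good where "good \<beta> x \<longleftrightarrow> smooth_fun \<beta> UNIV \<and> \<beta> x > 0 \<and> (\<forall>y. \<beta> y \<ge> 0) \<and>
    (\<forall>\<psi>. test_fun W \<psi> \<longrightarrow> test_fun W (\<lambda>x. \<beta> x * \<psi> x) \<and> L (\<lambda>x. \<beta> x * \<psi> x) = 0)" for \<beta> and x :: "real^2"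
  have "\<exists>\<beta>. good \<beta> x" if x: "x \<in> W" for x
  proof -
    obtain V where V: "open V" "x \<in> V" "V \<subseteq> W" "\<And>\<phi>. test_fun V \<phi> \<Longrightarrow> L \<phi> = 0" using loc[OF x] by blast
    obtain r where r: "r > 0" "ball x r \<subseteq> V" using V open_contains_ball by metis
    obtain \<beta> where \<beta>: "test_fun (ball x r) \<beta>" "\<beta> x > 0" "\<forall>y. \<beta> y \<ge> 0" using bump_exists[OF r(1)] by blast
    have "test_fun V (\<lambda>x. \<beta> x * \<psi> x)" if "test_fun W \<psi>" for \<psi>
    proof -
      have "test_fun V (\<lambda>x. \<psi> x * \<beta> x)"
        by (rule test_fun_mult[OF V(1) test_fun_smooth[OF that] test_fun_subset[OF \<beta>(1) r(2)]])
      then show ?thesis by (simp add: mult.commute)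
    qed
    then have "good \<beta> x"
      unfolding good_def using \<beta>(2,3) V(4) test_fun_smooth[OF \<beta>(1)] test_fun_subset[OF _ V(3)] by simp
    then show ?thesis by blast
  qed
  then obtain \<beta> where "\<And>x. x \<in> W \<Longrightarrow> good (\<beta> x) x" by metis
  then have \<beta>: "\<And>x. x \<in> W \<Longrightarrow> smooth_fun (\<beta> x) UNIV" "\<And>x. x \<in> W \<Longrightarrow> \<beta> x x > 0"
    "\<And>x y. x \<in> W \<Longrightarrow> \<beta> x y \<ge> 0"
    "\<And>x \<psi>. x \<in> W \<Longrightarrow> test_fun W \<psi> \<Longrightarrow> test_fun W (\<lambda>y. \<beta> x y * \<psi> y)"
    "\<And>x \<psi>. x \<in> W \<Longrightarrow> test_fun W \<psi> \<Longrightarrow> L (\<lambda>y. \<beta> x y * \<psi> y) = 0"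
    by (auto simp: good_def)
  have pos_open: "open {y. f y > 0}" if "smooth_fun f UNIV" for f
    using smooth_fun_continuous[OF that] by (simp add: open_Collect_less)
  have "K \<subseteq> (\<Union>x\<in>K. {y. \<beta> x y > 0})" using \<beta>(2) K(3) by auto
  moreover have "\<And>x. x \<in> K \<Longrightarrow> open {y. \<beta> x y > 0}" using pos_open \<beta>(1) K(3) by blast
  ultimately obtain T where T: "T \<subseteq> K" "finite T" "K \<subseteq> (\<Union>x\<in>T. {y. \<beta> x y > 0})"
    using compactE_image[OF K(2), of K "\<lambda>x. {y. \<beta> x y > 0}"] by blast
  define B where "B y = (\<Sum>x\<in>T. \<beta> x y)" for y
  define Z where "Z = {y. B y > 0} \<inter> W"
  have TW: "x \<in> T \<Longrightarrow> x \<in> W" for x using T K by blast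
  have B: "smooth_fun B UNIV" unfolding B_def using T \<beta>(1) TW by (intro smooth_fun_sum) auto
  have Z: "open Z" unfolding Z_def using pos_open[OF B] W by blast
  have KZ: "K \<subseteq> Z"
  proof
    fix y assume y: "y \<in> K"
    then obtain x where "x \<in> T" "\<beta> x y > 0" using T by blast
    then have "B y > 0" unfolding B_def using T \<beta>(3) TW by (intro sum_pos2[of _ x]) auto
    then show "y \<in> Z" using y K unfolding Z_def by blast
  qed
  have \<phi>Z: "test_fun Z \<phi>" using K KZ unfolding test_fun_def by blast
  have iB: "smooth_fun (\<lambda>x. inverse (B x)) Z"
    using smooth_fun_subset[OF B] Z by (intro smooth_fun_inverse) (auto simp: Z_def)
  \<comment> \<open>\<open>B\<close> is positive near the support of \<open>\<phi>\<close>, so the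
    quotient is a test function, and \<open>\<phi>\<close> is the sum of the products
    \<open>\<beta> z * \<psi>\<close>.\<close>
  define \<psi> where "\<psi> x = inverse (B x) * \<phi> x" for x
  have \<psi>: "test_fun W \<psi>"
    unfolding \<psi>_def using test_fun_mult[OF Z iB \<phi>Z] by (rule test_fun_subset) (auto simp: Z_def)
  have "\<phi> x = (\<Sum>z\<in>T. \<beta> z x * \<psi> x)" for x
  proof (cases "x \<in> K")
    case True
    then have "B x > 0" using KZ by (auto simp: Z_def)
    then show ?thesis unfolding \<psi>_def by (simp add: B_def flip: sum_distrib_right)
  qed (use K in \<open>simp add: \<psi>_def\<close>)
  then have "\<phi> = (\<lambda>x. \<Sum>z\<in>T. \<beta> z x * \<psi> x)" by (rule ext)
  moreover have "L (\<lambda>x. \<Sum>z\<in>S. \<beta> z x * \<psi> x) = 0" if "finite S" "S \<subseteq> T" for S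
    using that
  proof (induction S rule: finite_induct)
    case empty
    show ?case using add[of "\<lambda>x. 0" "\<lambda>x. 0"] by simp
  next
    case (insert z S)
    have "test_fun W (\<lambda>x. \<Sum>z\<in>S. \<beta> z x * \<psi> x)"
      using insert TW \<beta>(4) \<psi> by (intro test_fun_sum) auto
    then show ?case using insert TW \<beta>(4,5) \<psi> add by auto
  qed
  ultimately show "L \<phi> = 0" using T(2) by blast
qed

section \<open>Locally integrable functions as distributions\<close>

lemma absolutely_integrable_cont_mult:
  fixes f a :: "real^2 \<Rightarrow> real"
  assumes "compact K" "f absolutely_integrable_on K" "continuous_on K a"
  shows "(\<lambda>x. a x * f x) absolutely_integrable_on K"
proof (rule absolutely_integrable_bounded_measurable_product[OF bilinear_times _ _ _ assms(2)])
  show "K \<in> sets lebesgue" using assms(1) lmeasurable_compact fmeasurableD by blast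
  then show "a \<in> borel_measurable (lebesgue_on K)"
    using assms(3) by (rule continuous_imp_measurable_on_sets_lebesgue[rotated])
  show "bounded (a ` K)" using assms compact_continuous_image compact_imp_bounded by blast
qed

lemma L1_loc_subset: "L1_loc f W \<Longrightarrow> V \<subseteq> W \<Longrightarrow> L1_loc f V"
  unfolding L1_loc_def by blast

lemma L1_loc_cong: "(\<And>x. x \<in> W \<Longrightarrow> f x = g x) \<Longrightarrow> L1_loc f W \<longleftrightarrow> L1_loc g W"
  unfolding L1_loc_def by (metis (no_types, lifting) absolutely_integrable_spike_eq empty_iff negligible_empty subsetD Diff_empty)

lemma L1_loc_cont_mult: "continuous_on W a \<Longrightarrow> L1_loc f W \<Longrightarrow> L1_loc (\<lambda>x. a x * f x) W"
  unfolding L1_loc_def by (blast intro: absolutely_integrable_cont_mult continuous_on_subset)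

lemma L1_loc_continuous: "continuous_on W f \<Longrightarrow> L1_loc f W"
  unfolding L1_loc_def
proof (intro allI impI)
  fix K assume f: "continuous_on W f" and K: "compact K \<and> K \<subseteq> W"
  have "(\<lambda>x. f x * 1) absolutely_integrable_on K"
    using f K continuous_on_subset lmeasurable_compact
    by (intro absolutely_integrable_cont_mult absolutely_integrable_on_const) auto
  then show "f absolutely_integrable_on K" by simp
qed

lemma L1_loc_add: "L1_loc f W \<Longrightarrow> L1_loc g W \<Longrightarrow> L1_loc (\<lambda>x. f x + g x) W"
  unfolding L1_loc_def by (auto intro: set_integral_add)

lemma L1_loc_zero: "L1_loc (\<lambda>x. 0) W"
  by (rule L1_loc_continuous) auto

lemma L1_loc_sum: "finite I \<Longrightarrow> (\<And>i. i \<in> I \<Longrightarrow> L1_loc (f i) W) \<Longrightarrow> L1_loc (\<lambda>x. \<Sum>i\<in>I. f i x) W"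
  by (induction I rule: finite_induct) (auto intro: L1_loc_add L1_loc_zero)

lemma L1_loc_test_integrable:
  assumes "L1_loc f W" "test_fun W \<phi>"
  shows "integrable lebesgue (\<lambda>x. f x * \<phi> x)"
  using assms(2)
proof (rule test_funE)
  fix K assume K: "smooth_fun \<phi> UNIV" "compact K" "K \<subseteq> W" "\<And>x. x \<notin> K \<Longrightarrow> \<phi> x = 0"
  have "(\<lambda>x. \<phi> x * f x) absolutely_integrable_on K"
    using K assms(1) smooth_fun_continuous[OF smooth_fun_subset[OF K(1)]]
    by (intro absolutely_integrable_cont_mult) (auto simp: L1_loc_def)
  moreover have "(\<lambda>x. indicator K x *\<^sub>R (\<phi> x * f x)) = (\<lambda>x. f x * \<phi> x)"
  proof
    fix x show "indicator K x *\<^sub>R (\<phi> x * f x) = f x * \<phi> x"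
      using K(4)[of x] by (cases "x \<in> K") auto
  qed
  ultimately show ?thesis by (simp only: set_integrable_def)
qed

lemma dist_of_add:
  "L1_loc f W \<Longrightarrow> test_fun W \<phi> \<Longrightarrow> test_fun W \<psi> \<Longrightarrow> dist_of f (\<lambda>x. \<phi> x + \<psi> x) = dist_of f \<phi> + dist_of f \<psi>"
  unfolding dist_of_def distrib_left by (rule Bochner_Integration.integral_add) (auto intro: L1_loc_test_integrable)

lemma dist_of_diff:
  "L1_loc f W \<Longrightarrow> test_fun W \<phi> \<Longrightarrow> test_fun W \<psi> \<Longrightarrow> dist_of f (\<lambda>x. \<phi> x - \<psi> x) = dist_of f \<phi> - dist_of f \<psi>"
  unfolding dist_of_def right_diff_distrib by (rule Bochner_Integration.integral_diff) (auto intro: L1_loc_test_integrable)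

lemma dist_of_sum:
  assumes "L1_loc f W" "finite I" "\<And>i. i \<in> I \<Longrightarrow> test_fun W (\<phi> i)"
  shows "dist_of f (\<lambda>x. \<Sum>i\<in>I. \<phi> i x) = (\<Sum>i\<in>I. dist_of f (\<phi> i))"
  unfolding dist_of_def sum_distrib_left using assms
  by (intro Bochner_Integration.integral_sum) (auto intro: L1_loc_test_integrable)

lemma dist_of_cmult: "dist_of f (\<lambda>x. c * \<phi> x) = c * dist_of f \<phi>"
  unfolding dist_of_def by (simp add: mult.left_commute)

lemma dist_of_sum_left:
  assumes "finite I" "\<And>i. i \<in> I \<Longrightarrow> L1_loc (f i) W" "test_fun W \<phi>"
  shows "dist_of (\<lambda>x. \<Sum>i\<in>I. f i x) \<phi> = (\<Sum>i\<in>I. dist_of (f i) \<phi>)"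
  unfolding dist_of_def sum_distrib_right using assms
  by (intro Bochner_Integration.integral_sum) (auto intro: L1_loc_test_integrable)

lemma dist_of_cong:
  assumes "\<And>x. x \<in> W \<Longrightarrow> f x * \<phi> x = g x * \<psi> x" "test_fun W \<phi>" "test_fun W \<psi>"
  shows "dist_of f \<phi> = dist_of g \<psi>"
proof -
  have "f x * \<phi> x = g x * \<psi> x" for x
    using assms(1) test_fun_outside[OF assms(2)] test_fun_outside[OF assms(3)] by (cases "x \<in> W") simp_all
  then show ?thesis unfolding dist_of_def by simp
qed

section \<open>Poincare lemmas\<close>

lemma has_derivative_vecI:
  fixes F :: "'a::real_normed_vector \<Rightarrow> real^2"
  assumes "\<And>k. ((\<lambda>y. F y $ k) has_derivative (\<lambda>h. D h $ k)) (at x)"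
  shows "(F has_derivative D) (at x)"
  unfolding has_derivative_componentwise_within[of F]
  using assms by (auto simp: Basis_vec_def inner_axis)

text \<open>The contraction towards \<open>a\<close> in the coordinates from \<open>T\<close>.  With \<open>T = UNIV\<close> it yields the
  radial primitive of a closed form, with \<open>T = {i}\<close> the primitive of a function in direction \<open>i\<close>.\<close>

definition squeeze :: "2 set \<Rightarrow> real^2 \<Rightarrow> real \<Rightarrow> real^2 \<Rightarrow> real^2" where
  "squeeze T a t x = (\<chi> i. if i \<in> T then a $ i + t * (x $ i - a $ i) else x $ i)"

text \<open>The weight \<open>t ^ n\<close> is there because each derivative in a direction of
  \<open>T\<close> produces a factor \<open>t\<close>; the family is thus closed under
  differentiation.\<close>

definition pint :: "2 set \<Rightarrow> real^2 \<Rightarrow> nat \<Rightarrow> (real^2 \<Rightarrow> real) \<Rightarrow> real^2 \<Rightarrow> real" where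
  "pint T a n g x = integral {0..1} (\<lambda>t. t ^ n * g (squeeze T a t x))"

lemma squeeze_nth: "squeeze T a t x $ i = (if i \<in> T then a $ i + t * (x $ i - a $ i) else x $ i)"
  by (simp add: squeeze_def)

lemma squeeze_1 [simp]: "squeeze T a 1 x = x"
  by (simp add: squeeze_def vec_eq_iff)

lemma continuous_squeeze:
  "continuous_on S f \<Longrightarrow> continuous_on S h \<Longrightarrow> continuous_on S (\<lambda>z. squeeze T a (f z) (h z))"
  unfolding squeeze_def
proof (rule continuous_on_vec_lambda)
  fix i assume "continuous_on S f" "continuous_on S h"
  then show "continuous_on S (\<lambda>z. if i \<in> T then a $ i + f z * (h z $ i - a $ i) else h z $ i)"
    by (cases "i \<in> T") (auto intro!: continuous_intros)
qed

lemma pd_squeeze: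
  assumes "g differentiable (at (squeeze T a t x))"
  shows "(\<lambda>x. g (squeeze T a t x)) differentiable (at x)"
    "pd i (\<lambda>x. g (squeeze T a t x)) x = (if i \<in> T then t else 1) * pd i g (squeeze T a t x)"
proof -
  have *: "((\<lambda>x. squeeze T a t x $ k) has_derivative (\<lambda>h. (if k \<in> T then t else 1) * h $ k)) (at x)" for k
    unfolding squeeze_nth by (cases "k \<in> T") (auto intro!: derivative_eq_intros has_derivative_coord)
  then have d: "\<And>k. (\<lambda>x. squeeze T a t x $ k) differentiable (at x)"
    using differentiable_def by blast
  show "(\<lambda>x. g (squeeze T a t x)) differentiable (at x)" by (rule pd_compose(1)[OF d assms])
  show "pd i (\<lambda>x. g (squeeze T a t x)) x = (if i \<in> T then t else 1) * pd i g (squeeze T a t x)"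
    by (subst pd_compose(2)[OF d assms])
       (simp add: pd_eqI[OF *] mult.left_commute mult.commute flip: sum_distrib_left)
qed

context
  fixes T :: "2 set" and a :: "real^2" and U :: "(real^2) set"
  assumes U: "open U" "convex U"
    and stays: "\<And>x t. x \<in> U \<Longrightarrow> 0 \<le> t \<Longrightarrow> t \<le> 1 \<Longrightarrow> squeeze T a t x \<in> U"
begin

lemma continuous_on_pint_integrand:
  assumes "smooth_fun g U" "x \<in> U"
  shows "continuous_on {0..1} (\<lambda>t. t ^ n * g (squeeze T a t x))"
proof -
  have "continuous_on {0..1} (\<lambda>t. g (squeeze T a t x))"
    by (rule continuous_on_compose2[OF smooth_fun_continuous[OF assms(1)]])
       (auto intro!: continuous_squeeze continuous_intros stays assms)
  then show ?thesis by (intro continuous_intros)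
qed

text \<open>Differentiation under the integral sign: the Leibniz rule is applied to the total
  derivative as a bounded linear map, jointly continuous in point and parameter, which is then
  evaluated on an axis.\<close>

lemma pd_pint:
  assumes g: "smooth_fun g U" and x: "x \<in> U"
  shows "pint T a n g differentiable (at x)"
    "pd i (pint T a n g) x = pint T a (if i \<in> T then Suc n else n) (pd i g) x"
proof -
  define fx :: "real^2 \<Rightarrow> real \<Rightarrow> (real^2) \<Rightarrow>\<^sub>L real" where
    "fx x t = (\<Sum>j\<in>UNIV. (t ^ n * ((if j \<in> T then t else 1) * pd j g (squeeze T a t x))) *\<^sub>R Blinfun (\<lambda>h. h $ j))" for x t
  have fx: "blinfun_apply (fx x t) h = (\<Sum>j\<in>UNIV. h $ j * (t ^ n * ((if j \<in> T then t else 1) * pd j g (squeeze T a t x))))" for x t h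
    by (simp add: fx_def blinfun.sum_left blinfun.scaleR_left bounded_linear_Blinfun_apply bounded_linear_vec_nth mult.commute)
  have D: "((\<lambda>x. t ^ n * g (squeeze T a t x)) has_derivative blinfun_apply (fx x t)) (at x within U)"
    if "x \<in> U" "t \<in> cbox 0 1" for x t
  proof -
    have d: "g differentiable (at (squeeze T a t x))"
      using that stays by (intro smooth_fun_differentiable[OF g]) auto
    have "((\<lambda>x. t ^ n * g (squeeze T a t x)) has_derivative
      (\<lambda>h. t ^ n * (\<Sum>j\<in>UNIV. h $ j * pd j (\<lambda>x. g (squeeze T a t x)) x))) (at x)"
      by (intro has_derivative_mult_right has_derivative_pd pd_squeeze d)
    then show ?thesis
      by (simp add: pd_squeeze(2)[OF d] fx[abs_def] sum_distrib_left mult.left_commute has_derivative_at_withinI)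
  qed
  have cont: "continuous_on (U \<times> cbox 0 1) (\<lambda>(x, t). fx x t)"
  proof -
    have "continuous_on (U \<times> cbox 0 1) (\<lambda>z. pd j g (squeeze T a (snd z) (fst z)))" for j
      by (rule continuous_on_compose2[OF smooth_fun_continuous[OF smooth_fun_pd[OF g]]])
         (auto intro!: continuous_squeeze continuous_intros stays)
    moreover have "continuous_on (U \<times> cbox 0 1) (\<lambda>z. if j \<in> T then snd z else 1)" for j
      by (cases "j \<in> T") (auto intro!: continuous_intros)
    ultimately show ?thesis
      unfolding fx_def split_beta by (intro continuous_intros)
  qed
  have "((\<lambda>x. integral (cbox 0 1) (\<lambda>t. t ^ n * g (squeeze T a t x))) has_derivative integral (cbox 0 1) (fx x)) (at x within U)"
    by (rule leibniz_rule[OF D _ cont x U(2)])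
       (auto intro!: integrable_continuous_real continuous_on_pint_integrand g)
  then have P: "(pint T a n g has_derivative integral (cbox 0 1) (fx x)) (at x)"
    using at_within_open[OF x U(1)] by (simp add: pint_def[abs_def])
  then show "pint T a n g differentiable (at x)" using differentiable_def by blast
  have "continuous_on (cbox 0 1) (fx x)"
  proof -
    have "continuous_on (cbox 0 1) (\<lambda>t. (x, t :: real))" by (intro continuous_intros)
    from continuous_on_compose2[OF cont this] show ?thesis using x by auto
  qed
  then have "fx x integrable_on cbox 0 1" by (rule integrable_continuous)
  from integral_linear[OF this, of "\<lambda>b. blinfun_apply b (axis i 1)"]
  have "blinfun_apply (integral (cbox 0 1) (fx x)) (axis i 1) = integral (cbox 0 1) (\<lambda>t. blinfun_apply (fx x t) (axis i 1))"
    by (simp add: o_def blinfun.bounded_linear_left)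
  also have "\<dots> = integral (cbox 0 1) (\<lambda>t. t ^ n * ((if i \<in> T then t else 1) * pd i g (squeeze T a t x)))"
    by (simp add: fx)
  finally have "blinfun_apply (integral (cbox 0 1) (fx x)) (axis i 1) = \<dots>" .
  then show "pd i (pint T a n g) x = pint T a (if i \<in> T then Suc n else n) (pd i g) x"
    by (simp add: pd_eqI[OF P] pint_def mult_ac)
qed

lemma smooth_pint:
  assumes "smooth_fun g U"
  shows "smooth_fun (pint T a n g) U"
  unfolding smooth_fun_def
proof
  fix k show "Ck_on k (pint T a n g) U" using assms
  proof (induction k arbitrary: n g)
    case 0
    then show ?case
      by (auto intro!: continuous_at_imp_continuous_on differentiable_imp_continuous_within pd_pint)
  next
    case (Suc k)
    have "Ck_on k (pd i (pint T a n g)) U" for i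
      by (subst Ck_on_cong[OF U(1) pd_pint(2)]) (auto intro!: Suc smooth_fun_pd)
    then show ?case using pd_pint(1) Suc by auto
  qed
qed

text \<open>The left-hand side is the integral over the unit interval of the derivative of
  \<open>t * g (squeeze T a t x)\<close>, which is 0 at \<open>t = 0\<close> and \<open>g x\<close>
  at \<open>t = 1\<close>.\<close>

lemma pint_FTC:
  assumes g: "smooth_fun g U" and x: "x \<in> U" and T: "T \<noteq> {}"
  shows "pint T a 0 g x + (\<Sum>i\<in>T. (x $ i - a $ i) * pint T a 1 (pd i g) x) = g x"
proof -
  have fin: "finite T" by simp
  have D: "((\<lambda>t. t * g (squeeze T a t x)) has_vector_derivative
     g (squeeze T a t x) + (\<Sum>i\<in>T. (x $ i - a $ i) * (t * pd i g (squeeze T a t x)))) (at t within {0..1})"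
    if "t \<in> {0..1}" for t
  proof -
    have d: "g differentiable (at (squeeze T a t x))"
      using that stays x by (intro smooth_fun_differentiable[OF g]) auto
    have "((\<lambda>t. squeeze T a t x) has_derivative (\<lambda>s. \<chi> k. if k \<in> T then s * (x $ k - a $ k) else 0)) (at t)"
    proof (rule has_derivative_vecI)
      fix k show "((\<lambda>t. squeeze T a t x $ k) has_derivative
          (\<lambda>s. (\<chi> k. if k \<in> T then s * (x $ k - a $ k) else 0) $ k)) (at t)"
        by (cases "k \<in> T") (auto simp: squeeze_nth intro!: derivative_eq_intros)
    qed
    from has_derivative_compose[OF this has_derivative_pd[OF d]]
    have "((\<lambda>t. g (squeeze T a t x)) has_derivative
      (\<lambda>s. \<Sum>j\<in>UNIV. (if j \<in> T then s * (x $ j - a $ j) else 0) * pd j g (squeeze T a t x))) (at t)"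
      by simp
    moreover have "(\<Sum>j\<in>UNIV. (if j \<in> T then s * (x $ j - a $ j) else 0) * pd j g (squeeze T a t x))
       = s * (\<Sum>j\<in>T. (x $ j - a $ j) * pd j g (squeeze T a t x))" for s
    proof -
      have "(\<Sum>j\<in>UNIV. (if j \<in> T then s * (x $ j - a $ j) else 0) * pd j g (squeeze T a t x))
        = (\<Sum>j\<in>UNIV. if j \<in> T then s * ((x $ j - a $ j) * pd j g (squeeze T a t x)) else 0)"
        by (intro sum.cong) auto
      also have "\<dots> = (\<Sum>j\<in>T. s * ((x $ j - a $ j) * pd j g (squeeze T a t x)))"
        by (subst sum.inter_restrict[symmetric]) auto
      finally show ?thesis by (simp add: sum_distrib_left)
    qed
    ultimately have "((\<lambda>t. g (squeeze T a t x)) has_real_derivative (\<Sum>j\<in>T. (x $ j - a $ j) * pd j g (squeeze T a t x))) (at t)"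
      by (simp add: has_field_derivative_def mult_commute_abs)
    then have "((\<lambda>t. t * g (squeeze T a t x)) has_real_derivative
      g (squeeze T a t x) + (\<Sum>i\<in>T. (x $ i - a $ i) * (t * pd i g (squeeze T a t x)))) (at t)"
      by (auto intro!: derivative_eq_intros simp: sum_distrib_left algebra_simps)
    then show ?thesis
      using has_real_derivative_iff_has_vector_derivative has_vector_derivative_at_within by blast
  qed
  from fundamental_theorem_of_calculus[OF _ D]
  have I: "((\<lambda>t. g (squeeze T a t x) + (\<Sum>i\<in>T. (x $ i - a $ i) * (t * pd i g (squeeze T a t x)))) has_integral g x) {0..1}"
    by simp
  have int: "(\<lambda>t. t ^ n * h (squeeze T a t x)) integrable_on {0..1}" if "smooth_fun h U" for h n
    by (intro integrable_continuous_real continuous_on_pint_integrand that x)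
  have "((\<lambda>t. t ^ 0 * g (squeeze T a t x) + (\<Sum>i\<in>T. (x $ i - a $ i) * (t ^ 1 * pd i g (squeeze T a t x)))) has_integral
     pint T a 0 g x + (\<Sum>i\<in>T. (x $ i - a $ i) * pint T a 1 (pd i g) x)) {0..1}"
    unfolding pint_def
    by (intro has_integral_add has_integral_sum has_integral_mult_right integrable_integral int g smooth_fun_pd fin)
  then show ?thesis using I by (simp add: has_integral_unique)
qed

end

text \<open>The radial homotopy formula: closedness exchanges the indices in the differentiated
  integrals, and \<open>pint_FTC\<close> then collects them to \<open>u k\<close>.\<close>

lemma poincare_smooth:
  assumes U: "open U" "convex U" "a \<in> U" and u: "\<And>i. smooth_fun (u i) U"
    and closed: "\<And>x i k. x \<in> U \<Longrightarrow> pd k (u i) x = pd i (u k) x"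
  shows "\<exists>C. smooth_fun C U \<and> (\<forall>x\<in>U. \<forall>k. pd k C x = u k x)"
proof -
  have stays: "squeeze UNIV a t x \<in> U" if "x \<in> U" "0 \<le> t" "t \<le> 1" for x t
  proof -
    have "squeeze UNIV a t x = (1 - t) *\<^sub>R a + t *\<^sub>R x"
      by (simp add: squeeze_def vec_eq_iff algebra_simps)
    then show ?thesis using convexD_alt[OF U(2,3) that(1)] that by simp
  qed
  note pi = pd_pint[OF U(1,2) stays] smooth_pint[OF U(1,2) stays] pint_FTC[OF U(1,2) stays]
  define C where "C x = (\<Sum>i\<in>UNIV. (x $ i - a $ i) * pint UNIV a 0 (u i) x)" for x
  have C: "smooth_fun C U"
    unfolding C_def using U by (intro smooth_intros pi u) auto
  have "pd k C x = u k x" if x: "x \<in> U" for k x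
  proof -
    have "pd k C x = (\<Sum>i\<in>UNIV. pd k (\<lambda>x. (x $ i - a $ i) * pint UNIV a 0 (u i) x) x)"
      unfolding C_def using U
      by (intro pd_sum finite smooth_fun_differentiable[OF _ x] smooth_intros pi u)
    also have "\<dots> = (\<Sum>i\<in>UNIV. (x $ i - a $ i) * pint UNIV a 1 (pd k (u i)) x + (if k = i then 1 else 0) * pint UNIV a 0 (u i) x)"
    proof (intro sum.cong refl)
      fix i :: 2
      have "(\<lambda>x::real^2. x $ i - a $ i) differentiable (at x)"
        by (intro smooth_fun_differentiable[OF _ x] smooth_intros U)
      moreover have "pd k (\<lambda>x::real^2. x $ i - a $ i) x = (if k = i then 1 else 0)"
        by (subst pd_diff) (auto simp: pd_coord intro: smooth_fun_differentiable[of _ UNIV])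
      ultimately show "pd k (\<lambda>x. (x $ i - a $ i) * pint UNIV a 0 (u i) x) x
        = (x $ i - a $ i) * pint UNIV a 1 (pd k (u i)) x + (if k = i then 1 else 0) * pint UNIV a 0 (u i) x"
        by (subst pd_mult) (auto simp: pi u x)
    qed
    also have "\<dots> = (\<Sum>i\<in>UNIV. (x $ i - a $ i) * pint UNIV a 1 (pd i (u k)) x) + pint UNIV a 0 (u k) x"
    proof -
      have "pint UNIV a 1 (pd k (u i)) x = pint UNIV a 1 (pd i (u k)) x" for i
        unfolding pint_def by (rule integral_cong) (use closed stays x in auto)
      then show ?thesis by (simp add: sum.distrib if_distrib[of "\<lambda>c. c * _"] cong: if_cong)
    qed
    also have "\<dots> = u k x"
      using pi(4)[OF _ _ _ u x, of k] by simp
    finally show ?thesis .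
  qed
  then show ?thesis using C by blast
qed

text \<open>Integration along one coordinate, taken as the contraction in the single direction
  \<open>i\<close>: written as \<open>x $ i - s\<close> times an integral over the unit interval, it
  is smooth in all variables by \<open>smooth_pint\<close>.\<close>

lemma primitive_exists:
  assumes g: "smooth_fun g UNIV"
  shows "\<exists>P. smooth_fun P UNIV \<and> pd i P = g \<and> (\<forall>x. x $ i = s \<longrightarrow> P x = 0)"
proof -
  define a :: "real^2" where "a = (\<chi> k. s)"
  note pi = pd_pint[OF open_UNIV convex_UNIV UNIV_I] smooth_pint[OF open_UNIV convex_UNIV UNIV_I]
    pint_FTC[OF open_UNIV convex_UNIV UNIV_I]
  define P where "P x = (x $ i - s) * pint {i} a 0 g x" for x
  have P: "smooth_fun P UNIV"
    unfolding P_def by (intro smooth_intros pi g open_UNIV)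
  have "pd i P x = g x" for x
  proof -
    have "(\<lambda>x::real^2. x $ i - s) differentiable (at x)"
      by (rule smooth_fun_differentiable[of _ UNIV]) (auto intro!: smooth_intros)
    moreover have "pd i (\<lambda>x::real^2. x $ i - s) x = 1"
      by (subst pd_diff) (auto simp: pd_coord intro: smooth_fun_differentiable[of _ UNIV])
    ultimately have "pd i P x = (x $ i - s) * pint {i} a 1 (pd i g) x + pint {i} a 0 g x"
      unfolding P_def by (subst pd_mult) (auto simp: pi g)
    also have "\<dots> = g x" using pi(4)[OF g UNIV_I, of "{i}" a x] by (simp add: a_def)
    finally show ?thesis .
  qed
  then show ?thesis using P by (intro exI[of _ P]) (auto simp: P_def)
qed

section \<open>Integration along coordinate lines\<close>

lemma measurable_nth_real2 [measurable]: "(\<lambda>z::real^2. z $ k) \<in> borel_measurable borel"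
  by (intro borel_measurable_continuous_onI continuous_intros)

text \<open>The point with coordinate \<open>p\<close> in direction \<open>i\<close> and
  \<open>q\<close> in the other one. With \<open>i\<close> variable, the same Fubini statements
  serve both orders of integration.\<close>

definition pl :: "2 \<Rightarrow> real \<Rightarrow> real \<Rightarrow> real^2" where
  "pl i p q = (\<chi> k. if k = i then p else q)"

text \<open>The primitive in direction \<open>i\<close> starts at minus infinity, so for integrable
  \<open>u\<close> it exists on almost every line without a choice of base point.\<close>

definition vprim :: "2 \<Rightarrow> (real^2 \<Rightarrow> real) \<Rightarrow> real^2 \<Rightarrow> real" where
  "vprim i u z = (\<integral>s. u (\<chi> k. if k = i then s else z $ k) * indicator {..z $ i} s \<partial>lborel)"

lemma pl_nth [simp]: "pl i p q $ k = (if k = i then p else q)"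
  by (simp add: pl_def)

lemma vprim_pl: "vprim i u (pl i p q) = (\<integral>s. u (pl i s q) * indicator {..p} s \<partial>lborel)"
proof -
  have "(\<chi> k. if k = i then s else pl i p q $ k) = pl i s q" for s
    by (simp add: pl_def vec_eq_iff)
  then show ?thesis by (simp add: vprim_def)
qed

lemma integrable_mult_pair:
  fixes f g :: "real \<Rightarrow> real"
  assumes "integrable lborel f" "integrable lborel g"
  shows "integrable (lborel \<Otimes>\<^sub>M lborel) (\<lambda>z. f (fst z) * g (snd z))"
proof (rule lborel_pair.Fubini_integrable)
  have [measurable]: "f \<in> borel_measurable borel" "g \<in> borel_measurable borel"
    using assms by (auto dest: borel_measurable_integrable)
  show "(\<lambda>z. f (fst z) * g (snd z)) \<in> borel_measurable (lborel \<Otimes>\<^sub>M lborel)" by measurable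
  show "integrable lborel (\<lambda>x. \<integral>y. norm (f (fst (x, y)) * g (snd (x, y))) \<partial>lborel)"
    using assms by (simp add: abs_mult)
  show "AE x in lborel. integrable lborel (\<lambda>y. f (fst (x, y)) * g (snd (x, y)))"
    using assms by simp
qed

lemma integrable_mult_bounded:
  fixes f h :: "real^2 \<Rightarrow> real"
  assumes f: "integrable lborel f" and h: "continuous_on UNIV h" "compact K" "\<And>x. x \<notin> K \<Longrightarrow> h x = 0"
  shows "integrable lborel (\<lambda>z. f z * h z)"
proof -
  have "bounded (h ` K)" using h continuous_on_subset compact_continuous_image compact_imp_bounded by blast
  then obtain B where B: "\<And>x. x \<in> K \<Longrightarrow> norm (h x) \<le> B" unfolding bounded_iff by blast
  have "norm (h x) \<le> \<bar>B\<bar>" for x using B[of x] h(3)[of x] by (cases "x \<in> K") auto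
  then have "norm (f z * h z) \<le> norm (\<bar>B\<bar> * f z)" for z
    unfolding real_norm_def abs_mult by (subst mult.commute) (auto intro!: mult_right_mono)
  moreover have "h \<in> borel_measurable borel" using h(1) by (rule borel_measurable_continuous_onI)
  ultimately show ?thesis
    using f by (intro Bochner_Integration.integrable_bound[OF integrable_mult_right[OF f, of "\<bar>B\<bar>"]] AE_I2) auto
qed

lemma outside_imp_pd_0:
  assumes "smooth_fun \<psi> UNIV" "\<And>z. z \<notin> cbox a b \<Longrightarrow> \<psi> z = 0" "z \<notin> cbox a (b::real^2)"
  shows "pd k \<psi> z = 0"
  using pd_cong[of "- cbox a b" z \<psi> "\<lambda>z. 0"] assms by (simp add: open_Compl closed_cbox)

context
  fixes i j :: 2
  assumes ij: "i \<noteq> j"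
begin

lemma all_ij: "(\<forall>k. P k) \<longleftrightarrow> P i \<and> P j"
  using ij exhaust_2 by (metis (full_types))

lemma pl_eta: "pl i (z $ i) (z $ j) = z"
  using ij by (simp add: vec_eq_iff all_ij)

lemma mem_cbox_ij: "(z::real^2) \<in> cbox a b \<longleftrightarrow> a $ i \<le> z $ i \<and> z $ i \<le> b $ i \<and> a $ j \<le> z $ j \<and> z $ j \<le> b $ j"
  by (auto simp: mem_box_cart all_ij)

lemma continuous_pl: "continuous_on S f \<Longrightarrow> continuous_on S g \<Longrightarrow> continuous_on S (\<lambda>z. pl i (f z) (g z))"
  unfolding pl_def
proof (rule continuous_on_vec_lambda)
  fix k assume "continuous_on S f" "continuous_on S g"
  then show "continuous_on S (\<lambda>z. if k = i then f z else g z)" by (cases "k = i") auto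
qed

lemma measurable_pl [measurable]: "(\<lambda>z. pl i (fst z) (snd z)) \<in> borel_measurable (borel \<Otimes>\<^sub>M borel)"
  unfolding borel_prod by (intro borel_measurable_continuous_onI continuous_pl continuous_intros)

lemma measurable_pl' [measurable (raw)]:
  assumes "f \<in> borel_measurable M" "g \<in> borel_measurable M"
  shows "(\<lambda>z. pl i (f z) (g z)) \<in> borel_measurable M"
  using measurable_compose[OF measurable_Pair[OF assms] measurable_pl] by simp

text \<open>Lebesgue measure is determined by the volumes of boxes, and these are products of side
  lengths in either order of the coordinates.\<close>

lemma lborel_pl: "lborel = distr (lborel \<Otimes>\<^sub>M lborel) borel (\<lambda>z. pl i (fst z) (snd z))"
proof (rule lborel_eqI)
  fix l u :: "real^2"
  assume lu: "\<And>b. b \<in> Basis \<Longrightarrow> l \<bullet> b \<le> u \<bullet> b"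
  have B: "Basis = {axis i (1::real), axis j 1}"
  proof -
    have "k \<in> {i, j}" for k using all_ij[of "\<lambda>k. k \<in> {i, j}"] by simp
    then have U: "UNIV = {i, j}" by blast
    show ?thesis unfolding Basis_vec_def U by auto
  qed
  have lu': "l $ k \<le> u $ k" for k
    using lu[of "axis k 1"] by (simp add: axis_in_Basis_iff inner_axis)
  have "(\<lambda>z. pl i (fst z) (snd z)) -` box l u = {l $ i<..<u $ i} \<times> {l $ j<..<u $ j}"
    using ij by (auto simp: mem_box_cart all_ij)
  then have "emeasure (distr (lborel \<Otimes>\<^sub>M lborel) borel (\<lambda>z. pl i (fst z) (snd z))) (box l u)
     = emeasure (lborel \<Otimes>\<^sub>M lborel) ({l $ i<..<u $ i} \<times> {l $ j<..<u $ j})"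
    by (subst emeasure_distr) (auto simp: space_pair_measure)
  also have "\<dots> = ennreal (u $ i - l $ i) * ennreal (u $ j - l $ j)"
    by (subst lborel.emeasure_pair_measure_Times) (auto simp: lu')
  also have "\<dots> = ennreal (\<Prod>b\<in>Basis. (u - l) \<bullet> b)"
    using ij lu' by (simp add: B axis_eq_axis inner_axis ennreal_mult)
  finally show "emeasure (distr (lborel \<Otimes>\<^sub>M lborel) borel (\<lambda>z. pl i (fst z) (snd z))) (box l u)
    = ennreal (\<Prod>b\<in>Basis. (u - l) \<bullet> b)" .
qed simp

lemma integrable_pl_iff:
  fixes f :: "real^2 \<Rightarrow> real"
  assumes [measurable]: "f \<in> borel_measurable borel"
  shows "integrable lborel f \<longleftrightarrow> integrable (lborel \<Otimes>\<^sub>M lborel) (\<lambda>(p, q). f (pl i p q))"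
  by (subst lborel_pl, subst integrable_distr_eq) (auto simp: split_beta')

lemma fubini_pl:
  fixes f :: "real^2 \<Rightarrow> real"
  assumes f: "integrable lborel f"
  shows "integrable lborel (\<lambda>q. \<integral>p. f (pl i p q) \<partial>lborel)"
    "(\<integral>z. f z \<partial>lborel) = (\<integral>q. (\<integral>p. f (pl i p q) \<partial>lborel) \<partial>lborel)"
    "AE q in lborel. integrable lborel (\<lambda>p. f (pl i p q))"
proof -
  have [measurable]: "f \<in> borel_measurable borel" using f by auto
  have *: "integrable (lborel \<Otimes>\<^sub>M lborel) (\<lambda>(p, q). f (pl i p q))" using f integrable_pl_iff by simp
  show "integrable lborel (\<lambda>q. \<integral>p. f (pl i p q) \<partial>lborel)" by (rule lborel_pair.integrable_snd[OF *])
  show "AE q in lborel. integrable lborel (\<lambda>p. f (pl i p q))" by (rule lborel_pair.AE_integrable_snd[OF *])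
  have "(\<integral>z. f z \<partial>lborel) = (\<integral>z. f (pl i (fst z) (snd z)) \<partial>(lborel \<Otimes>\<^sub>M lborel))"
    by (subst lborel_pl, subst integral_distr) auto
  then show "(\<integral>z. f z \<partial>lborel) = (\<integral>q. (\<integral>p. f (pl i p q) \<partial>lborel) \<partial>lborel)"
    using lborel_pair.integral_snd[OF *] by (simp add: split_beta')
qed

lemma nn_integral_pl:
  assumes [measurable]: "f \<in> borel_measurable borel"
  shows "(\<integral>\<^sup>+z. f z \<partial>lborel) = (\<integral>\<^sup>+q. (\<integral>\<^sup>+p. f (pl i p q) \<partial>lborel) \<partial>lborel)"
proof -
  have "(\<integral>\<^sup>+z. f z \<partial>lborel) = (\<integral>\<^sup>+z. f (pl i (fst z) (snd z)) \<partial>(lborel \<Otimes>\<^sub>M lborel))"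
    by (subst lborel_pl, subst nn_integral_distr) auto
  also have "\<dots> = (\<integral>\<^sup>+q. (\<integral>\<^sup>+p. f (pl i p q) \<partial>lborel) \<partial>lborel)"
    using lborel_pair.nn_integral_snd[of "\<lambda>z. f (pl i (fst z) (snd z))"] by simp
  finally show ?thesis .
qed

lemma integrable_product_pl:
  fixes f g :: "real \<Rightarrow> real"
  assumes "integrable lborel f" "integrable lborel g"
  shows "integrable lborel (\<lambda>z. f (z $ i) * g (z $ j))"
proof -
  have [measurable]: "f \<in> borel_measurable borel" "g \<in> borel_measurable borel"
    using assms by (auto dest: borel_measurable_integrable)
  show ?thesis
    using integrable_mult_pair[OF assms] ij by (subst integrable_pl_iff) (auto simp: split_beta')
qed

lemma borel_measurable_vprim [measurable]:
  assumes [measurable]: "u \<in> borel_measurable borel"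
  shows "vprim i u \<in> borel_measurable borel"
proof -
  have *: "(\<chi> k. if k = i then s else z $ k) = pl i s (z $ j)" for z :: "real^2" and s
    using ij by (simp add: vec_eq_iff all_ij)
  have "(\<lambda>z. \<integral>s. u (pl i s (z $ j)) * (if s \<le> z $ i then 1 else 0) \<partial>lborel) \<in> borel_measurable borel"
    by measurable
  then show ?thesis
    unfolding vprim_def[abs_def] * indicator_def by (simp add: atMost_iff of_bool_def)
qed

text \<open>On each line the primitive is bounded by the full integral of the absolute value of
  \<open>u\<close>; over the box the other integration contributes only a finite length, by
  Tonelli.\<close>

lemma integrable_vprim:
  assumes u: "integrable lborel u"
  shows "integrable lborel (\<lambda>z. indicator (cbox a b) z * vprim i u z)"
proof (rule integrableI_bounded)
  have [measurable]: "u \<in> borel_measurable borel" using u by auto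
  show "(\<lambda>z. indicator (cbox a b) z * vprim i u z) \<in> borel_measurable lborel" by simp
  let ?m = "\<lambda>q. \<integral>\<^sup>+s. norm (u (pl i s q)) \<partial>lborel"
  have bound: "ennreal (norm (vprim i u (pl i p q))) \<le> ?m q" for p q
  proof (cases "integrable lborel (\<lambda>s. u (pl i s q) * indicator {..p} s)")
    case True
    have "ennreal (norm (vprim i u (pl i p q))) \<le> (\<integral>\<^sup>+s. norm (u (pl i s q) * indicator {..p} s) \<partial>lborel)"
      unfolding vprim_pl by (rule integral_norm_bound_ennreal[OF True])
    also have "\<dots> \<le> ?m q"
      by (intro nn_integral_mono) (auto simp: indicator_def)
    finally show ?thesis .
  \<comment> \<open>Where the section is not integrable, the integral defining \<open>vprim\<close>
    is 0 by convention and the bound is trivial.\<close>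
  qed (simp add: vprim_pl not_integrable_integral_eq)
  have "(\<integral>\<^sup>+z. ennreal (norm (indicator (cbox a b) z * vprim i u z)) \<partial>lborel)
    = (\<integral>\<^sup>+q. (\<integral>\<^sup>+p. ennreal (norm (indicator (cbox a b) (pl i p q) * vprim i u (pl i p q))) \<partial>lborel) \<partial>lborel)"
    by (rule nn_integral_pl) simp
  also have "\<dots> \<le> (\<integral>\<^sup>+q. (\<integral>\<^sup>+p. indicator {a $ i..b $ i} p * ?m q \<partial>lborel) \<partial>lborel)"
  proof (intro nn_integral_mono)
    fix p q
    show "ennreal (norm (indicator (cbox a b) (pl i p q) * vprim i u (pl i p q))) \<le> indicator {a $ i..b $ i} p * ?m q"
      using bound[of p q] by (auto simp: indicator_def mem_cbox_ij)
  qed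
  also have "\<dots> = (\<integral>\<^sup>+q. emeasure lborel {a $ i..b $ i} * ?m q \<partial>lborel)"
    by (simp add: nn_integral_multc)
  also have "\<dots> = emeasure lborel {a $ i..b $ i} * (\<integral>\<^sup>+q. ?m q \<partial>lborel)"
    by (simp add: nn_integral_cmult)
  also have "(\<integral>\<^sup>+q. ?m q \<partial>lborel) = (\<integral>\<^sup>+z. norm (u z) \<partial>lborel)"
    by (rule nn_integral_pl[symmetric]) simp
  also have "emeasure lborel {a $ i..b $ i} * (\<integral>\<^sup>+z. norm (u z) \<partial>lborel) < \<infinity>"
    using u emeasure_compact_finite[of "{a $ i..b $ i}"]
    by (simp add: integrable_iff_bounded ennreal_mult_less_top)
  finally show "(\<integral>\<^sup>+z. ennreal (norm (indicator (cbox a b) z * vprim i u z)) \<partial>lborel) < \<infinity>" .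
qed

lemma pl_has_derivative:
  assumes "smooth_fun \<psi> UNIV"
  shows "((\<lambda>p. \<psi> (pl i p q)) has_real_derivative pd i \<psi> (pl i p q)) (at p)"
proof -
  have "((\<lambda>p. pl i p q) has_derivative (\<lambda>s. s *\<^sub>R axis i 1)) (at p)"
  proof (rule has_derivative_vecI)
    fix k show "((\<lambda>p. pl i p q $ k) has_derivative (\<lambda>s. (s *\<^sub>R axis i 1) $ k)) (at p)"
      by (cases "k = i") (auto simp: axis_def intro!: derivative_eq_intros)
  qed
  from has_derivative_compose[OF this has_derivative_pd[OF smooth_fun_differentiable[OF assms UNIV_I]]]
  show ?thesis
    by (simp add: has_field_derivative_def mult.assoc mult_commute_abs flip: sum_distrib_left)
qed

lemma isCont_pl:
  assumes "smooth_fun g UNIV"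
  shows "isCont (\<lambda>p. g (pl i p q)) p"
  using DERIV_isCont[OF pl_has_derivative[OF assms]] .

lemma FTC_pl:
  assumes P: "smooth_fun P UNIV" and "p \<le> p'"
  shows "(\<integral>t. pd i P (pl i t q) * indicator {p..p'} t \<partial>lborel) = P (pl i p' q) - P (pl i p q)"
  by (rule integral_FTC_Icc_real[OF assms(2) pl_has_derivative[OF P]]) (rule isCont_pl[OF smooth_fun_pd[OF P]])

lemma const_pl:
  assumes P: "smooth_fun P UNIV" and 0: "\<And>t. min p p' \<le> t \<Longrightarrow> t \<le> max p p' \<Longrightarrow> pd i P (pl i t q) = 0"
  shows "P (pl i p' q) = P (pl i p q)"
proof -
  have "P (pl i s' q) = P (pl i s q)" if "s \<le> s'" "min p p' \<le> s" "s' \<le> max p p'" for s s'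
  proof -
    have "(\<lambda>t. pd i P (pl i t q) * indicator {s..s'} t) = (\<lambda>t. 0)"
    proof
      fix t show "pd i P (pl i t q) * indicator {s..s'} t = 0"
        using 0[of t] that by (cases "t \<in> {s..s'}") auto
    qed
    then show ?thesis using FTC_pl[OF P that(1), of q] by simp
  qed
  from this[of "min p p'" "max p p'"] show ?thesis by (cases "p \<le> p'") (auto simp: min_def max_def)
qed

lemma integrable_pl_section:
  assumes "continuous_on UNIV h" "\<And>z. z \<notin> cbox a b \<Longrightarrow> h z = 0"
  shows "integrable lborel (\<lambda>p. h (pl i p q) :: real)"
proof -
  have "continuous_on UNIV (\<lambda>p. h (pl i p q))"
    by (rule continuous_on_compose2[OF assms(1)]) (auto intro!: continuous_pl continuous_intros)
  then have "integrable lborel (\<lambda>p. indicator {a $ i..b $ i} p *\<^sub>R h (pl i p q))"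
    by (intro borel_integrable_compact) (auto intro: continuous_on_subset)
  moreover have "(\<lambda>p. indicator {a $ i..b $ i} p *\<^sub>R h (pl i p q)) = (\<lambda>p. h (pl i p q))"
  proof
    fix p show "indicator {a $ i..b $ i} p *\<^sub>R h (pl i p q) = h (pl i p q)"
      using assms(2)[of "pl i p q"] by (auto simp: indicator_def mem_cbox_ij)
  qed
  ultimately show ?thesis by (simp only:)
qed

text \<open>Integration by parts without regularity of \<open>u\<close>: Fubini exchanges the
  variables on the half plane where \<open>s\<close> is at most \<open>p\<close>, and the
  fundamental theorem is applied to the smooth \<open>\<psi>\<close> only.\<close>

lemma integral_vprim_pd:
  assumes u: "integrable lborel u" and \<psi>: "smooth_fun \<psi> UNIV" "\<And>z. z \<notin> cbox a b \<Longrightarrow> \<psi> z = 0"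
  shows "integrable lborel (\<lambda>z. vprim i u z * pd i \<psi> z)"
    "(\<integral>z. vprim i u z * pd i \<psi> z \<partial>lborel) = - (\<integral>z. u z * \<psi> z \<partial>lborel)"
proof -
  have [measurable]: "u \<in> borel_measurable borel" using u by auto
  note out = outside_imp_pd_0[OF \<psi>(1), of a b, OF \<psi>(2)]
  have c: "continuous_on UNIV (pd i \<psi>)" "continuous_on UNIV \<psi>"
    using \<psi> by (auto intro: smooth_fun_continuous smooth_fun_pd)
  have "integrable lborel (\<lambda>z. indicator (cbox a b) z * vprim i u z * pd i \<psi> z)"
    by (rule integrable_mult_bounded[OF integrable_vprim[OF u] c(1) compact_cbox out])
  moreover have "(\<lambda>z. indicator (cbox a b) z * vprim i u z * pd i \<psi> z) = (\<lambda>z. vprim i u z * pd i \<psi> z)"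
  proof
    fix z show "indicator (cbox a b) z * vprim i u z * pd i \<psi> z = vprim i u z * pd i \<psi> z"
      using out[of z] by (cases "z \<in> cbox a b") auto
  qed
  ultimately show int: "integrable lborel (\<lambda>z. vprim i u z * pd i \<psi> z)" by (simp only:)
  have int2: "integrable lborel (\<lambda>z. u z * \<psi> z)"
    by (rule integrable_mult_bounded[OF u c(2) compact_cbox \<psi>(2)])
  have ftc: "(\<integral>p. indicator {..p} s * pd i \<psi> (pl i p q) \<partial>lborel) = - \<psi> (pl i s q)" for s q
  proof -
    \<comment> \<open>An upper limit beyond the box, where \<open>\<psi>\<close> is zero; the
      maximum with \<open>s\<close> keeps the interval nonempty.\<close>
    define M where "M = max s (b $ i + 1)"
    have "(\<lambda>p. indicator {..p} s * pd i \<psi> (pl i p q)) = (\<lambda>p. pd i \<psi> (pl i p q) * indicator {s..M} p)"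
    proof
      fix p show "indicator {..p} s * pd i \<psi> (pl i p q) = pd i \<psi> (pl i p q) * indicator {s..M} p"
        using out[of "pl i p q"] by (auto simp: indicator_def M_def mem_cbox_ij max_def split: if_splits)
    qed
    moreover have "\<psi> (pl i M q) = 0" by (rule \<psi>(2)) (simp add: mem_cbox_ij M_def)
    ultimately show ?thesis using FTC_pl[OF \<psi>(1), of s M q] by (simp add: M_def)
  qed
  have inner: "(\<integral>p. vprim i u (pl i p q) * pd i \<psi> (pl i p q) \<partial>lborel) = - (\<integral>s. u (pl i s q) * \<psi> (pl i s q) \<partial>lborel)"
    if U: "integrable lborel (\<lambda>s. u (pl i s q))" for q
  proof -
    have D: "integrable lborel (\<lambda>p. pd i \<psi> (pl i p q))"
      by (rule integrable_pl_section[OF c(1) out])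
    have [measurable]: "(\<lambda>p. pd i \<psi> (pl i p q)) \<in> borel_measurable borel" "(\<lambda>s. u (pl i s q)) \<in> borel_measurable borel"
      using D U by (auto dest: borel_measurable_integrable)
    have I: "integrable (lborel \<Otimes>\<^sub>M lborel) (\<lambda>(p, s). u (pl i s q) * indicator {..p} s * pd i \<psi> (pl i p q))"
    proof (rule Bochner_Integration.integrable_bound[OF integrable_mult_pair[OF D U]])
      have "(\<lambda>z. u (pl i (snd z) q) * (if snd z \<le> fst z then 1 else 0) * pd i \<psi> (pl i (fst z) q)) \<in> borel_measurable (lborel \<Otimes>\<^sub>M lborel)"
        by measurable
      then show "(\<lambda>(p, s). u (pl i s q) * indicator {..p} s * pd i \<psi> (pl i p q)) \<in> borel_measurable (lborel \<Otimes>\<^sub>M lborel)"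
        by (simp add: split_beta' indicator_def of_bool_def)
    qed (auto simp: indicator_def abs_mult intro!: AE_I2)
    have "(\<integral>p. vprim i u (pl i p q) * pd i \<psi> (pl i p q) \<partial>lborel)
      = (\<integral>p. (\<integral>s. u (pl i s q) * indicator {..p} s * pd i \<psi> (pl i p q) \<partial>lborel) \<partial>lborel)"
      by (simp add: vprim_pl)
    also have "\<dots> = (\<integral>s. (\<integral>p. u (pl i s q) * indicator {..p} s * pd i \<psi> (pl i p q) \<partial>lborel) \<partial>lborel)"
      by (rule lborel_pair.Fubini_integral[OF I, symmetric])
    also have "\<dots> = (\<integral>s. u (pl i s q) * (- \<psi> (pl i s q)) \<partial>lborel)"
      unfolding mult.assoc by (simp add: ftc del: mult_minus_right)
    finally show ?thesis by simp
  qed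
  have "(\<integral>z. vprim i u z * pd i \<psi> z \<partial>lborel)
      = (\<integral>q. (\<integral>p. vprim i u (pl i p q) * pd i \<psi> (pl i p q) \<partial>lborel) \<partial>lborel)"
    by (rule fubini_pl(2)[OF int])
  also have "\<dots> = (\<integral>q. - (\<integral>s. u (pl i s q) * \<psi> (pl i s q) \<partial>lborel) \<partial>lborel)"
  proof (rule integral_cong_AE)
    show "AE q in lborel. (\<integral>p. vprim i u (pl i p q) * pd i \<psi> (pl i p q) \<partial>lborel) = - (\<integral>s. u (pl i s q) * \<psi> (pl i s q) \<partial>lborel)"
      using fubini_pl(3)[OF u] inner by (auto elim!: eventually_mono)
  qed (use fubini_pl(1)[OF int] fubini_pl(1)[OF int2] in auto)
  also have "\<dots> = - (\<integral>z. u z * \<psi> z \<partial>lborel)"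
    using fubini_pl(2)[OF int2] by simp
  finally show "(\<integral>z. vprim i u z * pd i \<psi> z \<partial>lborel) = - (\<integral>z. u z * \<psi> z \<partial>lborel)" .
qed

text \<open>As a function on the plane \<open>F\<close> does not decay in direction
  \<open>i\<close>; the compact support of \<open>h\<close> supplies the cut-off.\<close>

lemma integral_section_mult:
  assumes F: "integrable lborel F" and h: "continuous_on UNIV h" "\<And>z. z \<notin> cbox a b \<Longrightarrow> h z = 0"
  shows "integrable lborel (\<lambda>z. F (z $ j) * h z :: real)"
    "(\<integral>z. F (z $ j) * h z \<partial>lborel) = (\<integral>q. F q * (\<integral>p. h (pl i p q) \<partial>lborel) \<partial>lborel)"
proof -
  have "integrable lborel (\<lambda>z. indicator {a $ i..b $ i} (z $ i) * F (z $ j))"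
    by (rule integrable_product_pl) (auto simp: F emeasure_lborel_Icc_eq)
  from integrable_mult_bounded[OF this h(1) compact_cbox h(2)]
  have "integrable lborel (\<lambda>z. indicator {a $ i..b $ i} (z $ i) * F (z $ j) * h z)" .
  moreover have "(\<lambda>z. indicator {a $ i..b $ i} (z $ i) * F (z $ j) * h z) = (\<lambda>z. F (z $ j) * h z)"
  proof
    fix z show "indicator {a $ i..b $ i} (z $ i) * F (z $ j) * h z = F (z $ j) * h z"
      using h(2)[of z] by (auto simp: indicator_def mem_cbox_ij)
  qed
  ultimately show int: "integrable lborel (\<lambda>z. F (z $ j) * h z)" by (simp only:)
  show "(\<integral>z. F (z $ j) * h z \<partial>lborel) = (\<integral>q. F q * (\<integral>p. h (pl i p q) \<partial>lborel) \<partial>lborel)"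
    using fubini_pl(2)[OF int] ij by simp
qed

text \<open>Fubini: averaging with weight \<open>X\<close> along lines is adjoint to taking line
  integrals and multiplying by \<open>X\<close>, so an average can be moved from \<open>f\<close> to
  the test function.\<close>

lemma integral_average_swap:
  fixes f h H :: "real^2 \<Rightarrow> real" and X :: "real \<Rightarrow> real"
  assumes f: "integrable lborel f" and h: "continuous_on UNIV h" "\<And>z. z \<notin> cbox a b \<Longrightarrow> h z = 0"
    and X: "continuous_on UNIV X" "\<And>z. z \<notin> cbox a b \<Longrightarrow> X (z $ i) * H z = 0"
    and H: "continuous_on UNIV H" "\<And>z. H z = (\<integral>p. h (pl i p (z $ j)) \<partial>lborel)"
    and X': "\<And>p. p \<notin> {a $ i..b $ i} \<Longrightarrow> X p = 0"
  defines "Af \<equiv> \<lambda>q. \<integral>p. f (pl i p q) * X p \<partial>lborel"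
  shows "integrable lborel Af" "integrable lborel (\<lambda>z. Af (z $ j) * h z)"
    "(\<integral>z. Af (z $ j) * h z \<partial>lborel) = (\<integral>z. f z * (X (z $ i) * H z) \<partial>lborel)"
proof -
  have "bounded (X ` {a $ i..b $ i})"
    using X(1) continuous_on_subset compact_continuous_image compact_imp_bounded compact_Icc by blast
  then obtain B where B: "\<And>p. p \<in> {a $ i..b $ i} \<Longrightarrow> norm (X p) \<le> B" unfolding bounded_iff by blast
  have B': "norm (X p) \<le> \<bar>B\<bar>" for p using B[of p] X'[of p] by (cases "p \<in> {a $ i..b $ i}") auto
  have [measurable]: "X \<in> borel_measurable borel" using X(1) by (rule borel_measurable_continuous_onI)
  have "integrable lborel (\<lambda>z. f z * X (z $ i))"
  proof (rule Bochner_Integration.integrable_bound[of lborel "\<lambda>z. \<bar>B\<bar> * f z"])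
    show "AE z in lborel. norm (f z * X (z $ i)) \<le> norm (\<bar>B\<bar> * f z)"
    proof (rule AE_I2)
      fix z show "norm (f z * X (z $ i)) \<le> norm (\<bar>B\<bar> * f z)"
        using mult_right_mono[OF B'[of "z $ i"], of "\<bar>f z\<bar>"] by (simp add: abs_mult mult.commute)
    qed
  qed (use f in auto)
  from fubini_pl(1)[OF this] show Af: "integrable lborel Af" by (simp add: Af_def)
  show "integrable lborel (\<lambda>z. Af (z $ j) * h z)" by (rule integral_section_mult(1)[OF Af h])
  have XH: "continuous_on UNIV (\<lambda>z. X (z $ i) * H z)"
    by (intro continuous_intros H continuous_on_compose2[OF X(1)]) auto
  have int: "integrable lborel (\<lambda>z. f z * (X (z $ i) * H z))"
    by (rule integrable_mult_bounded[OF f XH compact_cbox X(2)])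
  have "(\<integral>z. Af (z $ j) * h z \<partial>lborel) = (\<integral>q. Af q * (\<integral>p. h (pl i p q) \<partial>lborel) \<partial>lborel)"
    by (rule integral_section_mult(2)[OF Af h])
  also have "\<dots> = (\<integral>q. (\<integral>p. f (pl i p q) * (X p * H (pl i p q)) \<partial>lborel) \<partial>lborel)"
    using ij by (simp add: Af_def H(2) flip: mult.assoc)
  also have "\<dots> = (\<integral>z. f z * (X (z $ i) * H z) \<partial>lborel)"
    using fubini_pl(2)[OF int] by simp
  finally show "(\<integral>z. Af (z $ j) * h z \<partial>lborel) = (\<integral>z. f z * (X (z $ i) * H z) \<partial>lborel)" .
qed

end

section \<open>The Poincare lemma for integrable one-forms\<close>

lemma compact_in_box:
  fixes a b :: "real^2"
  assumes K: "compact K" "K \<subseteq> box a b" and ab: "\<And>k. a $ k < b $ k"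
  shows "\<exists>a' b'. K \<subseteq> cbox a' b' \<and> (\<forall>k. a $ k < a' $ k \<and> b' $ k < b $ k)"
proof (cases "K = {}")
  case True
  have "a $ k < ((1/2) *\<^sub>R (a + b)) $ k \<and> ((1/2) *\<^sub>R (a + b)) $ k < b $ k" for k using ab[of k] by simp
  then show ?thesis using True by blast
next
  case False
  have "\<exists>x\<in>K. \<forall>y\<in>K. x $ k \<le> y $ k" for k
    by (rule continuous_attains_inf[OF K(1) False]) (intro continuous_intros)
  then obtain l where l: "\<And>k. l k \<in> K" "\<And>k y. y \<in> K \<Longrightarrow> l k $ k \<le> y $ k" by metis
  have "\<exists>x\<in>K. \<forall>y\<in>K. y $ k \<le> x $ k" for k
    by (rule continuous_attains_sup[OF K(1) False]) (intro continuous_intros)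
  then obtain m where m: "\<And>k. m k \<in> K" "\<And>k y. y \<in> K \<Longrightarrow> y $ k \<le> m k $ k" by metis
  have "a $ k < l k $ k" "m k $ k < b $ k" for k
    using l(1)[of k] m(1)[of k] K(2) by (auto simp: mem_box_cart)
  then show ?thesis using l(2) m(2)
    by (intro exI[of _ "\<chi> k. l k $ k"] exI[of _ "\<chi> k. m k $ k"]) (auto simp: mem_box_cart)
qed

text \<open>\<open>P\<close> is the primitive of \<open>X\<close> in direction 1, and its increase 1
  across the box says that \<open>X\<close> has integral 1. The margins \<open>r\<close> and
  \<open>s\<close> keep the support of \<open>X\<close> off the sides.\<close>

lemma normalized_bump_exists:
  fixes a b :: "real^2"
  assumes ab: "a $ 1 < b $ 1"
  shows "\<exists>X P r s. a $ 1 < r \<and> s < b $ 1 \<and> (\<forall>p. p < r \<or> s < p \<longrightarrow> X p = (0::real)) \<and>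
    continuous_on UNIV X \<and> smooth_fun (\<lambda>z. X (z $ 1)) UNIV \<and> smooth_fun P UNIV \<and>
    (\<forall>z. pd 1 P z = X (z $ 1)) \<and> (\<forall>q. P (pl 1 (a $ 1) q) = 0) \<and> (\<forall>q. P (pl 1 (b $ 1) q) = 1)"
proof -
  define m where "m = (a $ 1 + b $ 1) / 2"
  define r where "r = (b $ 1 - a $ 1) / 4"
  have r: "r > 0" "a $ 1 < m - r" "m + r < b $ 1" using ab by (auto simp: m_def r_def field_simps)
  define X where "X p = flat 0 (r\<^sup>2 - (p - m)\<^sup>2)" for p
  have Xge: "X p \<ge> 0" for p by (simp add: X_def flat_ge0)
  have Xpos: "X p > 0" if "m - r / 2 < p" "p < m + r / 2" for p
    unfolding X_def
  proof (rule flat_pos)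
    have "\<bar>p - m\<bar> < \<bar>r\<bar>" using that r by linarith
    then have "\<not> r\<^sup>2 \<le> (p - m)\<^sup>2" using abs_le_square_iff[of r "p - m"] by simp
    then show "0 < r\<^sup>2 - (p - m)\<^sup>2" by simp
  qed
  have X0: "X p = 0" if "p < m - r \<or> m + r < p" for p
    unfolding X_def
  proof (rule flat_nonpos)
    have "\<bar>r\<bar> \<le> \<bar>p - m\<bar>" using that r by linarith
    then show "r\<^sup>2 - (p - m)\<^sup>2 \<le> 0" using abs_le_square_iff by auto
  qed
  have smX: "smooth_fun (\<lambda>z. X (z $ 1)) UNIV"
    unfolding X_def by (intro smooth_fun_flat smooth_intros open_UNIV)
  have cX: "continuous_on UNIV X"
  proof -
    have "continuous_on UNIV (\<lambda>p. X (pl 1 p 0 $ 1))"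
      by (rule continuous_on_compose2[OF smooth_fun_continuous[OF smX]])
         (auto intro!: continuous_pl[of 1 2] continuous_intros)
    then show ?thesis by simp
  qed
  obtain P0 where P0: "smooth_fun P0 UNIV" "pd 1 P0 = (\<lambda>z. X (z $ 1))" "\<And>z. z $ 1 = a $ 1 \<Longrightarrow> P0 z = 0"
    using primitive_exists[OF smX, of 1 "a $ 1"] by blast
  have ij: "(1::2) \<noteq> 2" by simp
  note D = pl_has_derivative[OF ij P0(1)]
  define N where "N = P0 (pl 1 (b $ 1) 0)"
  have N: "P0 (pl 1 (b $ 1) q) = N" for q
    using FTC_pl[OF ij P0(1), of "a $ 1" "b $ 1"] ab P0(2,3) by (simp add: N_def)
  have mono: "P0 (pl 1 p 0) \<le> P0 (pl 1 p' 0)" if "p \<le> p'" for p p'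
    by (rule DERIV_nonneg_imp_nondecreasing[OF that]) (use D P0(2) Xge in auto)
  \<comment> \<open>\<open>X\<close> is positive on the middle half of its support, hence the total
    mass \<open>N\<close> is positive and can be divided out.\<close>
  obtain \<xi> where \<xi>: "m - r / 2 < \<xi>" "\<xi> < m + r / 2"
    "P0 (pl 1 (m + r / 2) 0) - P0 (pl 1 (m - r / 2) 0) = ((m + r/2) - (m - r/2)) * pd 1 P0 (pl 1 \<xi> 0)"
    using MVT2[of "m - r / 2" "m + r / 2" "\<lambda>p. P0 (pl 1 p 0)" "\<lambda>p. pd 1 P0 (pl 1 p 0)"] D r(1) by auto
  have "P0 (pl 1 (m - r / 2) 0) < P0 (pl 1 (m + r / 2) 0)"
    using \<xi>(3) mult_pos_pos[OF r(1) Xpos[OF \<xi>(1,2)]] by (simp add: P0(2))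
  moreover have "0 \<le> P0 (pl 1 (m - r / 2) 0)"
    using mono[of "a $ 1" "m - r / 2"] P0(3)[of "pl 1 (a $ 1) 0"] r by simp
  moreover have "P0 (pl 1 (m + r / 2) 0) \<le> N" unfolding N_def using mono r by simp
  ultimately have Npos: "N > 0" by linarith
  have sP: "smooth_fun (\<lambda>z. inverse N * P0 z) UNIV" "smooth_fun (\<lambda>z. inverse N * X (z $ 1)) UNIV"
    by (intro smooth_intros P0 smX open_UNIV)+
  have "pd 1 (\<lambda>z. inverse N * P0 z) z = inverse N * X (z $ 1)" for z
    using pd_cmult[OF smooth_fun_differentiable[OF P0(1) UNIV_I]] P0(2) by simp
  with Npos sP X0 cX r show ?thesis
    by (intro exI[of _ "\<lambda>p. inverse N * X p"] exI[of _ "\<lambda>z. inverse N * P0 z"] exI[of _ "m - r"] exI[of _ "m + r"])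
       (auto simp: N P0(3) intro!: continuous_intros)
qed

lemma smooth_fun_section:
  assumes "smooth_fun f UNIV"
  shows "smooth_fun (\<lambda>z. f (pl i p (z $ j))) UNIV"
proof (rule smooth_fun_compose[OF open_UNIV open_UNIV _ _ assms])
  show "smooth_map (\<lambda>z. pl i p (z $ j)) UNIV"
    unfolding smooth_map_def by (auto intro!: smooth_intros)
qed simp

lemma pd_section:
  assumes "smooth_fun f UNIV" "i \<noteq> j"
  shows "pd i (\<lambda>z. f (pl i p (z $ j))) z = 0" "pd j (\<lambda>z. f (pl i p (z $ j))) z = pd j f (pl i p (z $ j))"
proof -
  have d: "\<And>k. (\<lambda>z. pl i p (z $ j) $ k) differentiable (at z)"
    by (rule smooth_fun_differentiable[of _ UNIV]) (auto intro!: smooth_intros)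
  have c: "pd l (\<lambda>z. pl i p (z $ j) $ k) z = (if k = i \<or> l \<noteq> j then 0 else 1)" for l k
    by (cases "k = i"; cases "l = j") (auto simp: pd_coord)
  have U: "UNIV = {i, j}" using assms(2) exhaust_2 by (auto simp: UNIV_2) (metis exhaust_2)+
  note p = pd_compose(2)[OF d smooth_fun_differentiable[OF assms(1) UNIV_I]]
  show "pd i (\<lambda>z. f (pl i p (z $ j))) z = 0" "pd j (\<lambda>z. f (pl i p (z $ j))) z = pd j f (pl i p (z $ j))"
    using assms(2) by (simp_all add: p c U pd_coord)
qed

text \<open>The potential is the average, with weight \<open>X\<close> in the first coordinate of the base point, of
  the integrals of \<open>u\<close> along paths that run first in the second and then in the first direction.  For
  \<open>\<partial>\<^sub>2\<close> one uses that \<open>\<phi>\<close> minus \<open>X\<close> times the integral of \<open>\<phi>\<close> over the first variable is \<open>\<partial>\<^sub>1\<close> of a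
  test function.\<close>

lemma poincare_L1_borel:
  fixes u :: "2 \<Rightarrow> real^2 \<Rightarrow> real" and a b :: "real^2"
  assumes ab: "\<And>k. a $ k < b $ k" and u: "\<And>k. integrable lborel (u k)"
    and closed: "\<And>\<psi>. test_fun (box a b) \<psi> \<Longrightarrow>
      (\<integral>z. u 2 z * pd 1 \<psi> z \<partial>lborel) = (\<integral>z. u 1 z * pd 2 \<psi> z \<partial>lborel)"
  shows "\<exists>c. integrable lborel (\<lambda>z. indicator (cbox a b) z * c z) \<and>
    (\<forall>\<phi> k. test_fun (box a b) \<phi> \<longrightarrow> (\<integral>z. c z * pd k \<phi> z \<partial>lborel) = - (\<integral>z. u k z * \<phi> z \<partial>lborel))"
proof -
  have ij: "(1::2) \<noteq> 2" and ji: "(2::2) \<noteq> 1" by simp_all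
  obtain X PX r s where X: "a $ 1 < r" "s < b $ 1" "\<And>p. p < r \<or> s < p \<Longrightarrow> X p = (0::real)"
    "continuous_on UNIV X" "smooth_fun (\<lambda>z. X (z $ 1)) UNIV"
    and PX: "smooth_fun PX UNIV" "\<And>z. pd 1 PX z = X (z $ 1)" "\<And>q. PX (pl 1 (a $ 1) q) = 0"
      "\<And>q. PX (pl 1 (b $ 1) q) = 1"
    using normalized_bump_exists[OF ab[of 1]] by blast
  define Q where "Q = cbox a b"
  \<comment> \<open>The primitive of \<open>u 1\<close> in direction 1, cut off to the closed box so
    that it is integrable.\<close>
  define v where "v z = indicator Q z * vprim 1 (u 1) z" for z
  have v: "integrable lborel v" unfolding v_def Q_def by (rule integrable_vprim[OF ij u])
  define A where "A f q = (\<integral>p. f (pl 1 p q) * X p \<partial>lborel)" for f and q :: real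
  \<comment> \<open>Over the width of the box \<open>u'\<close> is the averaged \<open>u 2\<close>,
    a function of the second coordinate alone; its primitive there is \<open>D\<close>.\<close>
  define u' where "u' z = indicator {a $ 1..b $ 1} (z $ 1) * A (u 2) (z $ 2)" for z :: "real^2"
  have X': "\<And>p. p \<notin> {a $ 1..b $ 1} \<Longrightarrow> X p = 0" using X(1-3) by force
  have iA: "integrable lborel (A f)" if f: "integrable lborel f" for f
    unfolding A_def
    by (rule integral_average_swap(1)[OF ij f, where h = "\<lambda>z. 0" and H = "\<lambda>z. 0" and a = a and b = b])
       (use X X' in auto)
  have u': "integrable lborel u'"
    unfolding u'_def by (rule integrable_product_pl[OF ij]) (auto simp: iA u emeasure_lborel_Icc_eq)
  define D where "D q = (\<integral>t. A (u 2) t * indicator {..q} t \<partial>lborel)" for q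
  have D: "vprim 2 u' z = D (z $ 2)" if "z $ 1 \<in> {a $ 1..b $ 1}" for z
    using that by (simp add: vprim_def u'_def D_def)
  \<comment> \<open>From a base point with first coordinate \<open>s\<close>, the path integral is
    that of \<open>u 2\<close> along the vertical line through \<open>s\<close>, plus
    \<open>v z\<close>, minus \<open>v\<close> at the point with first coordinate \<open>s\<close>
    and the height of \<open>z\<close>. Averaging over \<open>s\<close> with the weight
    \<open>X\<close> of mass 1 gives this formula.\<close>
  define c where "c z = v z + (vprim 2 u' z - A v (z $ 2))" for z
  have Dint: "integrable lborel (\<lambda>q. indicator {a $ 2..b $ 2} q * D q)"
  proof -
    have eq: "indicator Q z * vprim 2 u' z = indicator {a $ 1..b $ 1} (z $ 1) * (indicator {a $ 2..b $ 2} (z $ 2) * D (z $ 2))" for z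
      using D[of z] by (auto simp: Q_def indicator_def mem_cbox_ij[OF ij])
    have "integrable lborel (\<lambda>z. indicator Q z * vprim 2 u' z)"
      unfolding Q_def by (rule integrable_vprim[OF ji u'])
    from fubini_pl(1)[OF ij this[unfolded eq]]
    have "integrable lborel (\<lambda>q. (b $ 1 - a $ 1) * (indicator {a $ 2..b $ 2} q * D q))"
      using ab[of 1] by simp
    then show ?thesis using ab[of 1] by (subst (asm) integrable_mult_left_iff) auto
  qed
  have c_int: "integrable lborel (\<lambda>z. indicator Q z * c z)"
  proof -
    have "integrable lborel (\<lambda>z::real^2. indicator {a $ 1..b $ 1} (z $ 1) * (indicator {a $ 2..b $ 2} (z $ 2) * A v (z $ 2)))"
      by (rule integrable_product_pl[OF ij])
         (use integrable_real_mult_indicator[OF _ iA[OF v], of "{a $ 2..b $ 2}"] in \<open>auto simp: emeasure_lborel_Icc_eq mult.commute\<close>)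
    moreover have "indicator {a $ 1..b $ 1} (z $ 1) * (indicator {a $ 2..b $ 2} (z $ 2) * A v (z $ 2)) = indicator Q z * A v (z $ 2)" for z :: "real^2"
      by (auto simp: Q_def indicator_def mem_cbox_ij[OF ij])
    ultimately have 1: "integrable lborel (\<lambda>z. indicator Q z * A v (z $ 2))" by simp
    have 2: "integrable lborel (\<lambda>z. indicator Q z * vprim 2 u' z)"
      unfolding Q_def by (rule integrable_vprim[OF ji u'])
    have "indicator Q z * c z = v z + (indicator Q z * vprim 2 u' z - indicator Q z * A v (z $ 2))" for z
      by (simp add: c_def v_def indicator_def algebra_simps)
    then show ?thesis using v 1 2 by simp
  qed
  have weak: "(\<integral>z. c z * pd k \<phi> z \<partial>lborel) = - (\<integral>z. u k z * \<phi> z \<partial>lborel)"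
    if \<phi>: "test_fun (box a b) \<phi>" for \<phi> k
  proof -
    obtain K where K: "smooth_fun \<phi> UNIV" "compact K" "K \<subseteq> box a b" "\<And>x. x \<notin> K \<Longrightarrow> \<phi> x = 0"
      using \<phi> by (rule test_funE) blast
    obtain a0 b0 where ab0: "K \<subseteq> cbox a0 b0" "\<And>k. a $ k < a0 $ k" "\<And>k. b0 $ k < b $ k"
      using compact_in_box[OF K(2,3) ab] by blast
    \<comment> \<open>In direction 1 the box around the support is enlarged to contain the support
      of \<open>X\<close> as well, so that \<open>X * \<theta>\<close> also vanishes outside
      it.\<close>
    define a' where "a' = pl 1 (min r (a0 $ 1)) (a0 $ 2)"
    define b' where "b' = pl 1 (max s (b0 $ 1)) (b0 $ 2)"
    have a'b': "a $ k < a' $ k" "b' $ k < b $ k" for k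
      using ab0(2,3)[of k] ab0(2,3)[of 2] X(1,2) exhaust_2[of k] by (auto simp: a'_def b'_def)
    have \<phi>0: "\<phi> z = 0" if "z \<notin> cbox a' b'" for z
    proof (rule K(4))
      show "z \<notin> K"
      proof
        assume "z \<in> K"
        then have "z \<in> cbox a0 b0" using ab0(1) by blast
        then have "z \<in> cbox a' b'" by (auto simp: mem_cbox_ij[OF ij] a'_def b'_def)
        then show False using that by blast
      qed
    qed
    have sub: "cbox a' b' \<subseteq> box a b"
    proof
      fix z assume "z \<in> cbox a' b'"
      then have "a' $ k \<le> z $ k \<and> z $ k \<le> b' $ k" for k by (simp add: mem_box_cart)
      then show "z \<in> box a b" using a'b' by (auto simp: mem_box_cart) (metis less_le_trans, metis le_less_trans)
    qed
    have subQ: "cbox a' b' \<subseteq> Q" using sub box_subset_cbox unfolding Q_def by blast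
    have \<phi>Q: "\<phi> z = 0" if "z \<notin> Q" for z using \<phi>0 subQ that by blast
    have pdQ: "pd l \<phi> z = 0" if "z \<notin> Q" for l z
      using outside_imp_pd_0[OF K(1), of a b] \<phi>Q that by (simp add: Q_def)
    have X0: "X (z $ 1) = 0" if "\<not> (a' $ 1 \<le> z $ 1 \<and> z $ 1 \<le> b' $ 1)" for z :: "real^2"
      by (rule X(3)) (use that in \<open>auto simp: a'_def b'_def\<close>)
    have c\<phi>: "continuous_on UNIV \<phi>" "continuous_on UNIV (pd l \<phi>)" for l
      using K(1) by (auto intro: smooth_fun_continuous smooth_fun_pd)
    obtain P where P: "smooth_fun P UNIV" "pd 1 P = \<phi>" "\<And>z. z $ 1 = a $ 1 \<Longrightarrow> P z = 0"
      using primitive_exists[OF K(1), of 1 "a $ 1"] by blast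
    have P2: "smooth_fun (pd 2 P) UNIV" "pd 1 (pd 2 P) = pd 2 \<phi>"
      using P(2) pd_commute[OF P(1) open_UNIV UNIV_I, of 1 2] smooth_fun_pd[OF P(1)]
      by (auto simp only: fun_eq_iff P(2))
    have P_left: "P z = 0" if "z $ 1 < a' $ 1" for z
    proof -
      have "P (pl 1 (z $ 1) (z $ 2)) = P (pl 1 (a $ 1) (z $ 2))"
      proof (rule const_pl[OF ij P(1)])
        fix t assume "t \<le> max (a $ 1) (z $ 1)"
        then have "t < a' $ 1" using that a'b'(1)[of 1] by linarith
        then show "pd 1 P (pl 1 t (z $ 2)) = 0" unfolding P(2) by (intro \<phi>0) (auto simp: mem_cbox_ij[OF ij])
      qed
      then show ?thesis using P(3)[of "pl 1 (a $ 1) (z $ 2)"] pl_eta[OF ij] by simp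
    qed
    have P2_a: "pd 2 P (pl 1 (a $ 1) q) = 0" for q
    proof -
      have "pd 2 P (pl 1 (a $ 1) q) = pd 2 (\<lambda>z. 0) (pl 1 (a $ 1) q)"
      proof (rule pd_cong)
        show "open {z::real^2. z $ 1 < a' $ 1}" by (intro open_Collect_less continuous_intros)
      qed (use P_left a'b' in auto)
      then show ?thesis by simp
    qed
    \<comment> \<open>The line integral of \<open>\<phi>\<close> in direction 1, written as the
      value of its primitive on the right side so that smoothness is immediate;
      \<open>\<theta>'\<close> is the same for \<open>pd 2 \<phi>\<close>.\<close>
    define \<theta> where "\<theta> z = P (pl 1 (b $ 1) (z $ 2))" for z :: "real^2"
    define \<theta>' where "\<theta>' z = pd 2 P (pl 1 (b $ 1) (z $ 2))" for z :: "real^2"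
    have s\<theta>: "smooth_fun \<theta> UNIV" "smooth_fun \<theta>' UNIV"
      unfolding \<theta>_def \<theta>'_def by (intro smooth_fun_section P P2)+
    have pd\<theta>: "pd 1 \<theta> z = 0" "pd 2 \<theta> z = \<theta>' z" for z
      unfolding \<theta>_def \<theta>'_def by (rule pd_section[OF P(1) ij])+
    have full: "(\<integral>p. pd 1 F (pl 1 p q) \<partial>lborel) = F (pl 1 (b $ 1) q) - F (pl 1 (a $ 1) q)"
      if F: "smooth_fun F UNIV" "\<And>z. z \<notin> Q \<Longrightarrow> pd 1 F z = 0" for F q
    proof -
      have "(\<lambda>p. pd 1 F (pl 1 p q)) = (\<lambda>p. pd 1 F (pl 1 p q) * indicator {a $ 1..b $ 1} p)"
        using F(2)[of "pl 1 _ q"] by (auto simp: fun_eq_iff indicator_def Q_def mem_cbox_ij[OF ij])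
      then show ?thesis using FTC_pl[OF ij F(1), of "a $ 1" "b $ 1" q] ab[of 1] by simp
    qed
    have H\<theta>: "\<theta> z = (\<integral>p. \<phi> (pl 1 p (z $ 2)) \<partial>lborel)" for z
      using full[OF P(1)] \<phi>Q P(2,3) by (simp add: \<theta>_def)
    have H\<theta>': "\<theta>' z = (\<integral>p. pd 2 \<phi> (pl 1 p (z $ 2)) \<partial>lborel)" for z
      using full[OF P2(1)] pdQ P2(2) P2_a by (simp add: \<theta>'_def)
    have \<theta>0: "\<theta> z = 0" "\<theta>' z = 0" if "\<not> (a' $ 2 \<le> z $ 2 \<and> z $ 2 \<le> b' $ 2)" for z
    proof -
      have "pl 1 p (z $ 2) \<notin> cbox a' b'" for p using that by (auto simp: mem_cbox_ij[OF ij])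
      then have "\<phi> (pl 1 p (z $ 2)) = 0" "pd 2 \<phi> (pl 1 p (z $ 2)) = 0" for p
        using \<phi>0 outside_imp_pd_0[OF K(1) \<phi>0] by blast+
      then show "\<theta> z = 0" "\<theta>' z = 0" by (simp_all add: H\<theta> H\<theta>')
    qed
    have X\<theta>0: "X (z $ 1) * \<theta> z = 0" "X (z $ 1) * \<theta>' z = 0" if "z \<notin> Q" for z
    proof -
      have "z \<notin> cbox a' b'" using subQ that by blast
      then show "X (z $ 1) * \<theta> z = 0" "X (z $ 1) * \<theta>' z = 0"
        using X0 \<theta>0 by (auto simp: mem_cbox_ij[OF ij])
    qed
    \<comment> \<open>\<open>\<phi>\<close> minus \<open>X * \<theta>\<close> has line integral 0,
      so its primitive \<open>\<Psi>\<close> returns to 0 on the right and is a test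
      function.\<close>
    define \<Psi> where "\<Psi> z = P z - PX z * \<theta> z" for z
    have s\<Psi>: "smooth_fun \<Psi> UNIV" unfolding \<Psi>_def by (intro smooth_intros P PX s\<theta> open_UNIV)
    have \<Psi>0: "\<Psi> z = 0" if z: "z \<notin> cbox a' b'" for z
    proof -
      consider "\<not> (a' $ 2 \<le> z $ 2 \<and> z $ 2 \<le> b' $ 2)" | "z $ 1 < a' $ 1" | "b' $ 1 < z $ 1"
        using z by (auto simp: mem_cbox_ij[OF ij])
      then show ?thesis
      proof cases
        case 1
        have "P (pl 1 (z $ 1) (z $ 2)) = P (pl 1 (a $ 1) (z $ 2))"
          by (rule const_pl[OF ij P(1)]) (use 1 in \<open>auto simp: P(2) mem_cbox_ij[OF ij] intro!: \<phi>0\<close>)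
        then have "P z = 0" using P(3)[of "pl 1 (a $ 1) (z $ 2)"] pl_eta[OF ij] by simp
        then show ?thesis using \<theta>0(1)[OF 1] by (simp add: \<Psi>_def)
      next
        case 2
        have "PX (pl 1 (z $ 1) (z $ 2)) = PX (pl 1 (a $ 1) (z $ 2))"
        proof (rule const_pl[OF ij PX(1)])
          fix t assume "t \<le> max (a $ 1) (z $ 1)"
          then have "t < a' $ 1" using 2 a'b'(1)[of 1] by linarith
          then show "pd 1 PX (pl 1 t (z $ 2)) = 0" using X0[of "pl 1 t (z $ 2)"] by (simp add: PX(2))
        qed
        then have "PX z = 0" using PX(3) pl_eta[OF ij] by simp
        then show ?thesis using P_left[OF 2] by (simp add: \<Psi>_def)
      next
        case 3
        have t: "b' $ 1 < t" if "min (b $ 1) (z $ 1) \<le> t" for t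
          using 3 a'b'(2)[of 1] that by linarith
        have "P (pl 1 (z $ 1) (z $ 2)) = P (pl 1 (b $ 1) (z $ 2))"
        proof (rule const_pl[OF ij P(1)])
          fix p assume "min (b $ 1) (z $ 1) \<le> p"
          then show "pd 1 P (pl 1 p (z $ 2)) = 0" using t[of p] by (auto simp: P(2) mem_cbox_ij[OF ij] intro!: \<phi>0)
        qed
        moreover have "PX (pl 1 (z $ 1) (z $ 2)) = PX (pl 1 (b $ 1) (z $ 2))"
        proof (rule const_pl[OF ij PX(1)])
          fix p assume "min (b $ 1) (z $ 1) \<le> p"
          then show "pd 1 PX (pl 1 p (z $ 2)) = 0" using t[of p] X0[of "pl 1 p (z $ 2)"] by (simp add: PX(2))
        qed
        ultimately have "P z = \<theta> z" "PX z = 1" using PX(4) pl_eta[OF ij] by (simp_all add: \<theta>_def)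
        then show ?thesis by (simp add: \<Psi>_def)
      qed
    qed
    have t\<Psi>: "test_fun (box a b) \<Psi>"
      unfolding test_fun_def using s\<Psi> \<Psi>0 sub compact_cbox by blast
    have pd1\<Psi>: "pd 1 \<Psi> = (\<lambda>z. \<phi> z - X (z $ 1) * \<theta> z)"
    proof
      fix z
      have d: "P differentiable (at z)" "PX differentiable (at z)" "\<theta> differentiable (at z)"
        using P(1) PX(1) s\<theta>(1) smooth_fun_differentiable by blast+
      show "pd 1 \<Psi> z = \<phi> z - X (z $ 1) * \<theta> z"
        unfolding \<Psi>_def by (simp add: pd_diff pd_mult d differentiable_mult P(2) PX(2) pd\<theta>)
    qed
    have pd12\<Psi>: "pd 1 (pd 2 \<Psi>) = (\<lambda>z. pd 2 \<phi> z - X (z $ 1) * \<theta>' z)"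
    proof
      fix z
      have d: "\<phi> differentiable (at z)" "(\<lambda>z. X (z $ 1)) differentiable (at z)" "\<theta> differentiable (at z)"
        using K(1) X(5) s\<theta>(1) smooth_fun_differentiable by blast+
      have "pd 2 (\<lambda>z::real^2. X (z $ 1)) z = pd 1 (pd 2 PX) z"
        using pd_commute[OF PX(1) open_UNIV UNIV_I, of 1 2 z] PX(2) by (simp add: PX(2)[abs_def])
      also have "pd 2 (\<lambda>z::real^2. X (z $ 1)) z = 0"
      proof -
        have "((\<lambda>z::real^2. X (pl 2 0 (z $ 1) $ 1))) = (\<lambda>z. X (z $ 1))" by simp
        then show ?thesis using pd_section(1)[OF X(5) ji, of 0 z] by simp
      qed
      finally have "pd 2 (\<lambda>z::real^2. X (z $ 1)) z = 0"
        using pd_section(1)[OF X(5) ji, of 0 z] by simp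
      then show "pd 1 (pd 2 \<Psi>) z = pd 2 \<phi> z - X (z $ 1) * \<theta>' z"
        by (simp add: pd_commute[OF s\<Psi> open_UNIV UNIV_I, of 1 2] pd1\<Psi> pd_diff pd_mult d differentiable_mult pd\<theta>)
    qed
    have v_vprim: "(\<integral>z. v z * h z \<partial>lborel) = (\<integral>z. vprim 1 (u 1) z * h z \<partial>lborel)" if "\<And>z. z \<notin> Q \<Longrightarrow> h z = 0" for h
    proof -
      have "v z * h z = vprim 1 (u 1) z * h z" for z
        using that[of z] by (cases "z \<in> Q") (auto simp: v_def)
      then show ?thesis by presburger
    qed
    have v_int: "integrable lborel (\<lambda>z. v z * h z)" if "continuous_on UNIV h" "\<And>z. z \<notin> Q \<Longrightarrow> h z = 0" for h
      by (rule integrable_mult_bounded[OF v that(1) compact_cbox[of a b]]) (use that(2) in \<open>auto simp: Q_def\<close>)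
    have u_int: "integrable lborel (\<lambda>z. u l z * h z)" if "continuous_on UNIV h" "\<And>z. z \<notin> Q \<Longrightarrow> h z = 0" for h l
      by (rule integrable_mult_bounded[OF u that(1) compact_cbox[of a b]]) (use that(2) in \<open>auto simp: Q_def\<close>)
    have X\<theta>c: "continuous_on UNIV (\<lambda>z. X (z $ 1) * \<theta> z)" "continuous_on UNIV (\<lambda>z. X (z $ 1) * \<theta>' z)"
      using X(5) s\<theta> by (intro continuous_intros; blast intro: smooth_fun_continuous)+
    have swap: "integrable lborel (\<lambda>z. A f (z $ 2) * h z)"
      "(\<integral>z. A f (z $ 2) * h z \<partial>lborel) = (\<integral>z. f z * (X (z $ 1) * H z) \<partial>lborel)"
      if "integrable lborel f" "continuous_on UNIV h" "\<And>z. z \<notin> Q \<Longrightarrow> h z = 0"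
        "\<And>z. z \<notin> Q \<Longrightarrow> X (z $ 1) * H z = 0" "continuous_on UNIV H" "\<And>z. H z = (\<integral>p. h (pl 1 p (z $ 2)) \<partial>lborel)" for f h H
      using integral_average_swap(2,3)[OF ij that(1,2) _ X(4) _ that(5,6), of a b] that(3,4) X'
      unfolding A_def Q_def by blast+
    have zero_int: "(\<integral>p. pd 1 \<phi> (pl 1 p q) \<partial>lborel) = 0" for q
      using full[OF K(1), of q] pdQ \<phi>0[of "pl 1 (a $ 1) q"] \<phi>0[of "pl 1 (b $ 1) q"] a'b'(1)[of 1] a'b'(2)[of 1]
      by (simp add: mem_cbox_ij[OF ij])
    have u'_\<phi>: "u' z * \<phi> z = A (u 2) (z $ 2) * \<phi> z" for z
      using \<phi>Q[of z] by (auto simp: u'_def Q_def mem_cbox_ij[OF ij] indicator_def)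
    note vp1 = integral_vprim_pd[OF ij u, of _ a b 1]
    note vp2 = integral_vprim_pd[OF ji u' K(1), of a b]
    have I3: "integrable lborel (\<lambda>z. A v (z $ 2) * pd l \<phi> z)" for l
      by (rule integral_section_mult(1)[OF ij iA[OF v] c\<phi>(2), of a b]) (use pdQ in \<open>auto simp: Q_def\<close>)
    consider "k = 1" | "k = 2" using exhaust_2 by blast
    then show ?thesis
    proof cases
      case 1
      \<comment> \<open>On the box \<open>D\<close> and \<open>A v\<close> depend on the second
        coordinate only, and \<open>pd 1 \<phi>\<close> has line integral 0; only \<open>v\<close>
        contributes.\<close>
      have "vprim 2 u' z * pd 1 \<phi> z = (indicator {a $ 2..b $ 2} (z $ 2) * D (z $ 2)) * pd 1 \<phi> z" for z
        using pdQ[of z 1] D[of z] by (cases "z \<in> Q") (auto simp: Q_def mem_cbox_ij[OF ij])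
      note eq = this
      have sec: "integrable lborel (\<lambda>z. F (z $ 2) * pd 1 \<phi> z)" "(\<integral>z. F (z $ 2) * pd 1 \<phi> z \<partial>lborel) = 0"
        if "integrable lborel F" for F
        using integral_section_mult[OF ij that c\<phi>(2), of a b 1] pdQ by (simp_all add: Q_def zero_int)
      have "(\<integral>z. c z * pd 1 \<phi> z \<partial>lborel) = (\<integral>z. v z * pd 1 \<phi> z + (vprim 2 u' z * pd 1 \<phi> z - A v (z $ 2) * pd 1 \<phi> z) \<partial>lborel)"
        by (simp add: c_def algebra_simps)
      also have "\<dots> = (\<integral>z. v z * pd 1 \<phi> z \<partial>lborel) + ((\<integral>z. vprim 2 u' z * pd 1 \<phi> z \<partial>lborel) - (\<integral>z. A v (z $ 2) * pd 1 \<phi> z \<partial>lborel))"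
        using v_int[OF c\<phi>(2) pdQ] sec(1)[OF Dint] I3 by (simp add: eq)
      also have "\<dots> = (\<integral>z. vprim 1 (u 1) z * pd 1 \<phi> z \<partial>lborel)"
        using sec(2)[OF Dint] sec(2)[OF iA[OF v]] v_vprim[of "pd 1 \<phi>"] pdQ by (simp add: eq)
      also have "\<dots> = - (\<integral>z. u 1 z * \<phi> z \<partial>lborel)"
        using vp1(2)[OF K(1)] \<phi>Q by (simp add: Q_def)
      finally show ?thesis using 1 by simp
    next
      case 2
      have S1: "(\<integral>z. A (u 2) (z $ 2) * \<phi> z \<partial>lborel) = (\<integral>z. u 2 z * (X (z $ 1) * \<theta> z) \<partial>lborel)"
        by (rule swap(2)[OF u c\<phi>(1) \<phi>Q X\<theta>0(1) smooth_fun_continuous[OF s\<theta>(1)] H\<theta>])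
      have S2: "(\<integral>z. A v (z $ 2) * pd 2 \<phi> z \<partial>lborel) = (\<integral>z. v z * (X (z $ 1) * \<theta>' z) \<partial>lborel)"
        by (rule swap(2)[OF v c\<phi>(2) pdQ X\<theta>0(2) smooth_fun_continuous[OF s\<theta>(2)] H\<theta>'])
      have V2: "integrable lborel (\<lambda>z. vprim 2 u' z * pd 2 \<phi> z)"
        "(\<integral>z. vprim 2 u' z * pd 2 \<phi> z \<partial>lborel) = - (\<integral>z. u 2 z * (X (z $ 1) * \<theta> z) \<partial>lborel)"
        using vp2 \<phi>Q by (simp_all add: Q_def u'_\<phi> S1)
      have "(\<integral>z. c z * pd 2 \<phi> z \<partial>lborel) = (\<integral>z. v z * pd 2 \<phi> z + (vprim 2 u' z * pd 2 \<phi> z - A v (z $ 2) * pd 2 \<phi> z) \<partial>lborel)"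
        by (simp add: c_def algebra_simps)
      also have "\<dots> = (\<integral>z. v z * pd 2 \<phi> z \<partial>lborel) + ((\<integral>z. vprim 2 u' z * pd 2 \<phi> z \<partial>lborel) - (\<integral>z. A v (z $ 2) * pd 2 \<phi> z \<partial>lborel))"
        using v_int[OF c\<phi>(2) pdQ] V2(1) I3 by simp
      \<comment> \<open>By \<open>S2\<close> the two terms with \<open>v\<close> combine to
        \<open>v\<close> tested against \<open>pd 1 (pd 2 \<Psi>)\<close>. Integration by parts
        gives \<open>u 1\<close> against \<open>pd 2 \<Psi>\<close>, and closedness for
        \<open>\<Psi>\<close> replaces it by \<open>u 2\<close> against
        \<open>pd 1 \<Psi>\<close>.\<close>
      also have "\<dots> = (\<integral>z. v z * pd 1 (pd 2 \<Psi>) z \<partial>lborel) - (\<integral>z. u 2 z * (X (z $ 1) * \<theta> z) \<partial>lborel)"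
        unfolding V2(2) S2 pd12\<Psi> using v_int[OF c\<phi>(2) pdQ] v_int[OF X\<theta>c(2) X\<theta>0(2)]
        by (simp add: right_diff_distrib)
      also have "(\<integral>z. v z * pd 1 (pd 2 \<Psi>) z \<partial>lborel) = (\<integral>z. vprim 1 (u 1) z * pd 1 (pd 2 \<Psi>) z \<partial>lborel)"
        using v_vprim[of "pd 1 (pd 2 \<Psi>)"] pdQ X\<theta>0(2) by (simp add: pd12\<Psi>)
      also have "\<dots> = - (\<integral>z. u 1 z * pd 2 \<Psi> z \<partial>lborel)"
        by (rule vp1(2)[OF smooth_fun_pd[OF s\<Psi>]]) (use outside_imp_pd_0[OF s\<Psi> \<Psi>0] subQ Q_def in blast)
      also have "\<dots> = - (\<integral>z. u 2 z * pd 1 \<Psi> z \<partial>lborel)" using closed[OF t\<Psi>] by simp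
      also have "\<dots> = - (\<integral>z. u 2 z * \<phi> z \<partial>lborel) + (\<integral>z. u 2 z * (X (z $ 1) * \<theta> z) \<partial>lborel)"
        unfolding pd1\<Psi> using u_int[OF c\<phi>(1) \<phi>Q, of 2] u_int[OF X\<theta>c(1) X\<theta>0(1), of 2]
        by (simp add: right_diff_distrib)
      finally show ?thesis using 2 by simp
    qed
  qed
  show ?thesis using c_int weak unfolding Q_def by blast
qed

definition weak_grad :: "(real^2) set \<Rightarrow> (real^2 \<Rightarrow> real) \<Rightarrow> (2 \<Rightarrow> real^2 \<Rightarrow> real) \<Rightarrow> bool" where
  "weak_grad W c u \<longleftrightarrow> L1_loc c W \<and> (\<forall>k. L1_loc (u k) W) \<and>
     (\<forall>\<phi> k. test_fun W \<phi> \<longrightarrow> dist_of c (pd k \<phi>) = - dist_of (u k) \<phi>)"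

lemma weak_grad_subset: "weak_grad W c u \<Longrightarrow> V \<subseteq> W \<Longrightarrow> weak_grad V c u"
  unfolding weak_grad_def using L1_loc_subset test_fun_subset by blast

text \<open>The passage from Lebesgue to Borel: on the closed box \<open>u\<close> has integrable
  Borel representatives with the same values on test functions. The closed box lies in
  \<open>W\<close>, so local integrability gives integrability up to the sides.\<close>

lemma poincare_weak:
  fixes u :: "2 \<Rightarrow> real^2 \<Rightarrow> real" and a b :: "real^2"
  assumes ab: "\<And>k. a $ k < b $ k" and u: "\<And>k. L1_loc (u k) W" and sub: "cbox a b \<subseteq> W"
    and closed: "\<And>\<psi>. test_fun (box a b) \<psi> \<Longrightarrow> dist_of (u 2) (pd 1 \<psi>) = dist_of (u 1) (pd 2 \<psi>)"
  shows "\<exists>c. weak_grad (box a b) c u"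
proof -
  define g where "g k z = indicator (cbox a b) z *\<^sub>R u k z" for k z
  have g: "integrable lebesgue (g k)" for k
    using u[of k] sub compact_cbox unfolding L1_loc_def set_integrable_def g_def by blast
  have "\<exists>g'\<in>borel_measurable lborel. AE x in lborel. g k x = g' x" for k
    by (rule completion_ex_borel_measurable_real) (use g in blast)
  then obtain g' where g': "\<And>k. g' k \<in> borel_measurable lborel" "\<And>k. AE x in lborel. g k x = g' k x"
    by metis
  have g'L: "g' k \<in> borel_measurable lebesgue" for k using g'(1)[of k] by (rule measurable_completion)
  have "integrable lebesgue (g' k)" for k
    using g[of k] g'L[of k] AE_completion[OF g'(2)[of k]]
    by (subst integrable_cong_AE[symmetric]) auto
  then have g'int: "integrable lborel (g' k)" for k
    using integrable_completion[OF g'(1)] by blast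
  have eq: "(\<integral>z. g' k z * h z \<partial>lborel) = dist_of (u k) h"
    if h: "continuous_on UNIV h" "\<And>z. z \<notin> cbox a b \<Longrightarrow> h z = 0" for h k
  proof -
    have hm: "h \<in> borel_measurable lborel" using borel_measurable_continuous_onI[OF h(1)] by simp
    have "(\<integral>z. g' k z * h z \<partial>lborel) = (\<integral>z. g' k z * h z \<partial>lebesgue)"
      using hm g'(1) by (intro integral_completion[symmetric] borel_measurable_times)
    also have "\<dots> = (\<integral>z. g k z * h z \<partial>lebesgue)"
    proof (rule integral_cong_AE)
      show "AE z in lebesgue. g' k z * h z = g k z * h z"
        using AE_completion[OF g'(2)[of k]] by (rule eventually_mono) simp
    qed (use g'L measurable_completion[OF hm] g borel_measurable_integrable in \<open>blast intro: borel_measurable_times\<close>)+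
    also have "(\<lambda>z. g k z * h z) = (\<lambda>z. u k z * h z)"
    proof
      fix z show "g k z * h z = u k z * h z"
        using h(2)[of z] by (cases "z \<in> cbox a b") (auto simp: g_def)
    qed
    finally show ?thesis by (simp add: dist_of_def)
  qed
  have test: "continuous_on UNIV \<phi>" "continuous_on UNIV (pd k \<phi>)" "z \<notin> cbox a b \<Longrightarrow> \<phi> z = 0" "z \<notin> cbox a b \<Longrightarrow> pd k \<phi> z = 0"
    if "test_fun (box a b) \<phi>" for \<phi> k z
  proof -
    have "test_fun (cbox a b) \<phi>" using that by (rule test_fun_subset) (rule box_subset_cbox)
    then show "z \<notin> cbox a b \<Longrightarrow> \<phi> z = 0" "z \<notin> cbox a b \<Longrightarrow> pd k \<phi> z = 0"
      using test_fun_outside test_fun_outside[OF test_fun_pd] by blast+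
    show "continuous_on UNIV \<phi>" "continuous_on UNIV (pd k \<phi>)"
      using smooth_fun_continuous test_fun_smooth[OF that] test_fun_smooth[OF test_fun_pd[OF that]] by blast+
  qed
  have "\<exists>c. integrable lborel (\<lambda>z. indicator (cbox a b) z * c z) \<and>
    (\<forall>\<phi> k. test_fun (box a b) \<phi> \<longrightarrow> (\<integral>z. c z * pd k \<phi> z \<partial>lborel) = - (\<integral>z. g' k z * \<phi> z \<partial>lborel))"
  proof (rule poincare_L1_borel[OF ab g'int])
    fix \<psi> assume \<psi>: "test_fun (box a b) \<psi>"
    show "(\<integral>z. g' 2 z * pd 1 \<psi> z \<partial>lborel) = (\<integral>z. g' 1 z * pd 2 \<psi> z \<partial>lborel)"
      using closed[OF \<psi>] by (simp add: eq test[OF \<psi>])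
  qed
  then obtain c where c: "integrable lborel (\<lambda>z. indicator (cbox a b) z * c z)"
    "\<And>\<phi> k. test_fun (box a b) \<phi> \<Longrightarrow> (\<integral>z. c z * pd k \<phi> z \<partial>lborel) = - (\<integral>z. g' k z * \<phi> z \<partial>lborel)" by blast
  define c' where "c' z = indicator (cbox a b) z * c z" for z
  have c'm: "c' \<in> borel_measurable lborel" and c'int: "integrable lebesgue c'"
    using c(1) integrable_completion unfolding c'_def by blast+
  have "L1_loc c' (box a b)"
    unfolding L1_loc_def
  proof (intro allI impI)
    fix K :: "(real^2) set" assume K: "compact K \<and> K \<subseteq> box a b"
    have "c' absolutely_integrable_on UNIV" using c'int by (simp add: set_integrable_def)
    then show "c' absolutely_integrable_on K"
      by (rule set_integrable_subset) (use K lmeasurable_compact in blast, simp)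
  qed
  moreover have "L1_loc (u k) (box a b)" for k
    using u sub box_subset_cbox L1_loc_subset by blast
  moreover have "dist_of c' (pd k \<phi>) = - dist_of (u k) \<phi>" if \<phi>: "test_fun (box a b) \<phi>" for \<phi> k
  proof -
    have hm: "pd k \<phi> \<in> borel_measurable lborel" using borel_measurable_continuous_onI[OF test(2)[OF \<phi>]] by simp
    have "dist_of c' (pd k \<phi>) = (\<integral>z. c' z * pd k \<phi> z \<partial>lborel)"
      unfolding dist_of_def by (intro integral_completion borel_measurable_times hm c'm)
    also have "(\<lambda>z. c' z * pd k \<phi> z) = (\<lambda>z. c z * pd k \<phi> z)"
      using test(4)[OF \<phi>] by (auto simp: c'_def indicator_def fun_eq_iff)
    finally show ?thesis using c(2)[OF \<phi>] by (simp add: eq test[OF \<phi>])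
  qed
  ultimately show ?thesis unfolding weak_grad_def by blast
qed

lemma dist_of_supported:
  assumes "g absolutely_integrable_on K" "\<And>x. x \<notin> K \<Longrightarrow> g x = 0"
  shows "(LINT x|lebesgue. g x) = integral K (g :: real^2 \<Rightarrow> real)"
proof -
  have "(\<lambda>x. indicator K x *\<^sub>R g x) = g"
    using assms(2) by (auto simp: indicator_def fun_eq_iff)
  then show ?thesis
    using set_lebesgue_integral_eq_integral(2)[OF assms(1)] by (simp add: set_lebesgue_integral_def)
qed

section \<open>Change of charts\<close>

lemma cramer2:
  fixes a b c d p q r s :: real
  assumes "p * a + q * c = r" "p * b + q * d = s"
  shows "p * (a * d - b * c) = r * d - s * c" "q * (a * d - b * c) = s * a - r * b"
  unfolding assms[symmetric] by (simp_all add: algebra_simps)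

text \<open>\<open>T\<close> and \<open>S\<close> are the Jacobian matrices of \<open>\<tau>\<close> and of its inverse \<open>\<sigma>\<close>; \<open>J\<close> and \<open>N\<close> are the
  determinant and the cofactor matrix of \<open>S\<close>.\<close>

locale chart_change =
  fixes V V' :: "(real^2) set" and \<tau> \<sigma> :: "real^2 \<Rightarrow> real^2"
  assumes V: "open V" and V': "open V'"
    and \<tau>: "smooth_map \<tau> V'" "\<tau> ` V' \<subseteq> V" and \<sigma>: "smooth_map \<sigma> V" "\<sigma> ` V \<subseteq> V'"
    and \<tau>\<sigma>: "\<And>y. y \<in> V \<Longrightarrow> \<tau> (\<sigma> y) = y" and \<sigma>\<tau>: "\<And>x. x \<in> V' \<Longrightarrow> \<sigma> (\<tau> x) = x"
begin

definition "T k i x = pd i (\<lambda>x. \<tau> x $ k) x"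
definition "S k i y = pd i (\<lambda>y. \<sigma> y $ k) y"
definition "J y = S 1 1 y * S 2 2 y - S 1 2 y * S 2 1 y"

definition N :: "2 \<Rightarrow> 2 \<Rightarrow> real^2 \<Rightarrow> real" where
  "N k i y = (if k = 1 then (if i = 1 then S 2 2 y else - S 1 2 y)
    else (if i = 1 then - S 2 1 y else S 1 1 y))"

lemma \<tau>_mem: "x \<in> V' \<Longrightarrow> \<tau> x \<in> V" and \<sigma>_mem: "y \<in> V \<Longrightarrow> \<sigma> y \<in> V'"
  using \<tau> \<sigma> by auto

lemma smooth_\<sigma>: "smooth_fun (\<lambda>y. \<sigma> y $ k) V" and smooth_\<tau>: "smooth_fun (\<lambda>y. \<tau> y $ k) V'"
  using \<sigma> \<tau> by (auto simp: smooth_map_def)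

lemma smooth_S: "smooth_fun (S k i) V"
  unfolding S_def[abs_def] by (intro smooth_fun_pd smooth_\<sigma>)

lemma smooth_J: "smooth_fun J V"
  unfolding J_def[abs_def] by (intro smooth_intros smooth_S V)

lemma smooth_N: "smooth_fun (N k i) V"
  unfolding N_def[abs_def] by (intro smooth_intros smooth_S V)

lemma continuous_\<tau>: "continuous_on V' \<tau>"
proof -
  have "continuous_on V' (\<lambda>x. \<chi> k. \<tau> x $ k)"
    by (intro continuous_on_vec_lambda smooth_fun_continuous smooth_\<tau>)
  then show ?thesis by simp
qed

lemma chain: "y \<in> V \<Longrightarrow> T k 1 (\<sigma> y) * S 1 j y + T k 2 (\<sigma> y) * S 2 j y = (if j = k then 1 else 0)"
proof -
  assume y: "y \<in> V"
  have "pd j (\<lambda>y. \<tau> (\<sigma> y) $ k) y = (\<Sum>l\<in>UNIV. T k l (\<sigma> y) * S l j y)"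
    unfolding S_def T_def
    by (rule pd_compose(2)) (use smooth_\<sigma> smooth_\<tau> smooth_fun_differentiable \<sigma>_mem y in blast)+
  moreover have "pd j (\<lambda>y. \<tau> (\<sigma> y) $ k) y = pd j (\<lambda>y. y $ k) y"
    by (rule pd_cong[OF V y]) (simp add: \<tau>\<sigma>)
  ultimately show ?thesis by (simp add: sum_2 pd_coord)
qed

text \<open>Cramer's rule for the inverse Jacobian, in a form without division, from which
  \<open>J_nz\<close> can be derived.\<close>

lemma T_N: "y \<in> V \<Longrightarrow> T k i (\<sigma> y) * J y = N k i y"
proof -
  assume y: "y \<in> V"
  note c = cramer2[OF chain[OF y, of k 1] chain[OF y, of k 2]]
  have "k = 1 \<or> k = 2" "i = 1 \<or> i = 2" by (rule exhaust_2)+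
  then show ?thesis
    using c by (elim disjE) (simp_all add: N_def J_def)
qed

lemma J_nz: "y \<in> V \<Longrightarrow> J y \<noteq> 0"
proof
  assume y: "y \<in> V" and "J y = 0"
  then have N0: "N k i y = 0" for k i using T_N[OF y, of k i] by simp
  have "S 2 2 y = 0" "S 1 2 y = 0" using N0[of 1 1] N0[of 1 2] by (auto simp: N_def)
  then show False using chain[OF y, of 2 2] by simp
qed

lemma smooth_abs_J: "smooth_fun (\<lambda>y. \<bar>J y\<bar>) V"
proof -
  have "smooth_fun (\<lambda>y. sqrt ((J y)\<^sup>2)) V"
    using J_nz by (intro smooth_intros smooth_J V) auto
  then show ?thesis by simp
qed

text \<open>\<open>J\<close> may have different signs on different components of \<open>V\<close>.
  Its sign squares to 1, and differentiating the square shows that the derivative of the sign is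
  0.\<close>

lemma smooth_sgn_J: "smooth_fun (\<lambda>y. sgn (J y)) V" and pd_sgn_J: "y \<in> V \<Longrightarrow> pd k (\<lambda>y. sgn (J y)) y = 0"
proof -
  have "smooth_fun (\<lambda>y. J y / \<bar>J y\<bar>) V"
    using J_nz by (intro smooth_intros smooth_J smooth_abs_J V) auto
  then show s: "smooth_fun (\<lambda>y. sgn (J y)) V" by (simp add: real_sgn_eq)
  assume y: "y \<in> V"
  have d: "(\<lambda>y. sgn (J y)) differentiable (at y)" using s y by (rule smooth_fun_differentiable)
  have "pd k (\<lambda>y. sgn (J y) * sgn (J y)) y = pd k (\<lambda>y. 1) y"
    by (rule pd_cong[OF V y]) (use J_nz in \<open>auto simp: sgn_mult_self_eq sgn_if\<close>)
  then have "2 * (sgn (J y) * pd k (\<lambda>y. sgn (J y)) y) = 0" using pd_mult[OF d d, of k] by simp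
  then show "pd k (\<lambda>y. sgn (J y)) y = 0" using J_nz[OF y] by (simp add: sgn_eq_0_iff)
qed

lemma smooth_compose_\<sigma>: "smooth_fun \<phi> V' \<Longrightarrow> smooth_fun (\<lambda>y. \<phi> (\<sigma> y)) V"
  by (rule smooth_fun_compose[OF V V' \<sigma>])

text \<open>Extension by zero is legitimate because the image of the support under
  \<open>\<tau>\<close> is a compact subset of \<open>V\<close>.\<close>

lemma push_test:
  assumes "test_fun V' \<phi>" "smooth_fun a V"
  shows "test_fun V (\<lambda>y. if y \<in> V then a y * \<phi> (\<sigma> y) else 0)"
  using assms(1)
proof (rule test_funE)
  fix K assume K: "smooth_fun \<phi> UNIV" "compact K" "K \<subseteq> V'" "\<And>x. x \<notin> K \<Longrightarrow> \<phi> x = 0"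
  have "smooth_fun (\<lambda>y. a y * \<phi> (\<sigma> y)) V"
    by (intro smooth_fun_mult V assms(2) smooth_compose_\<sigma> smooth_fun_subset[OF K(1)]) simp
  then have "smooth_fun (\<lambda>y. if y \<in> V then a y * \<phi> (\<sigma> y) else 0) V"
    by (subst smooth_fun_cong[OF V]) auto
  moreover have "compact (\<tau> ` K)"
    by (rule compact_continuous_image[OF continuous_on_subset[OF continuous_\<tau> K(3)] K(2)])
  moreover have "\<tau> ` K \<subseteq> V" using K(3) \<tau>_mem by blast
  moreover have "(if y \<in> V then a y * \<phi> (\<sigma> y) else 0) = 0" if "y \<notin> \<tau> ` K" for y
    using that K(4)[of "\<sigma> y"] \<tau>\<sigma>[of y] by (metis image_eqI mult_zero_right)
  ultimately show ?thesis using V by (intro test_funI_local)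
qed

lemma change_of_variables:
  fixes f :: "real^2 \<Rightarrow> real"
  assumes K: "compact K" "K \<subseteq> V'"
  shows "f absolutely_integrable_on K \<longleftrightarrow> (\<lambda>y. \<bar>J y\<bar> * f (\<sigma> y)) absolutely_integrable_on (\<tau> ` K)"
    "f absolutely_integrable_on K \<Longrightarrow> integral (\<tau> ` K) (\<lambda>y. \<bar>J y\<bar> * f (\<sigma> y)) = integral K f"
proof -
  have c: "compact (\<tau> ` K)"
    by (rule compact_continuous_image[OF continuous_on_subset[OF continuous_\<tau> K(2)] K(1)])
  have sub: "\<tau> ` K \<subseteq> V" using K \<tau>_mem by blast
  have \<sigma>K: "\<sigma> ` \<tau> ` K = K" using K \<sigma>\<tau> by (force simp: image_image)
  have inj: "inj_on \<sigma> (\<tau> ` K)" using sub \<tau>\<sigma> by (metis inj_onI subsetD)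
  define D where "D y = (\<lambda>h. \<chi> k. \<Sum>j\<in>UNIV. h $ j * S k j y)" for y and h :: "real^2"
  have der: "(\<sigma> has_derivative D y) (at y within \<tau> ` K)" if "y \<in> \<tau> ` K" for y
  proof (rule has_derivative_at_withinI, rule has_derivative_vecI)
    fix k show "((\<lambda>y. \<sigma> y $ k) has_derivative (\<lambda>h. D y h $ k)) (at y)"
      using has_derivative_pd[OF smooth_fun_differentiable[OF smooth_\<sigma>]] that sub
      by (auto simp: D_def S_def)
  qed
  have det: "det (matrix (D y)) = J y" for y
    by (simp add: det_2 matrix_def D_def J_def sum_2 axis_def)
  \<comment> \<open>The change of variables theorem speaks of vector valued integrands;
    \<open>f\<close> is passed through it as a map into \<open>real^1\<close>.\<close>
  have *: "(\<lambda>y. \<bar>J y\<bar> *\<^sub>R (vec (f (\<sigma> y)) :: real^1)) absolutely_integrable_on (\<tau> ` K) \<and>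
      integral (\<tau> ` K) (\<lambda>y. \<bar>J y\<bar> *\<^sub>R (vec (f (\<sigma> y)) :: real^1)) = vec b \<longleftrightarrow>
      (\<lambda>x. vec (f x) :: real^1) absolutely_integrable_on K \<and> integral K (\<lambda>x. vec (f x) :: real^1) = vec b" for b
    using has_absolute_integral_change_of_variables_compact[OF c der inj, of "\<lambda>x. vec (f x) :: real^1" "vec b"]
    by (simp add: det \<sigma>K)
  then have **: "(\<lambda>y. \<bar>J y\<bar> * f (\<sigma> y)) absolutely_integrable_on (\<tau> ` K) \<and>
      integral (\<tau> ` K) (\<lambda>y. \<bar>J y\<bar> * f (\<sigma> y)) = b \<longleftrightarrow> f absolutely_integrable_on K \<and> integral K f = b" for b
    by (simp add: absolutely_integrable_on_1_iff integral_on_1_eq)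
  then show "f absolutely_integrable_on K \<longleftrightarrow> (\<lambda>y. \<bar>J y\<bar> * f (\<sigma> y)) absolutely_integrable_on (\<tau> ` K)"
    "f absolutely_integrable_on K \<Longrightarrow> integral (\<tau> ` K) (\<lambda>y. \<bar>J y\<bar> * f (\<sigma> y)) = integral K f"
    by blast+
qed

lemma L1_loc_compose:
  assumes "L1_loc f V"
  shows "L1_loc (\<lambda>x. f (\<tau> x)) V'"
  unfolding L1_loc_def
proof (intro allI impI)
  fix K assume K: "compact K \<and> K \<subseteq> V'"
  then have c: "compact (\<tau> ` K)"
    using compact_continuous_image continuous_on_subset[OF continuous_\<tau>] by blast
  have sub: "\<tau> ` K \<subseteq> V" using K \<tau>_mem by blast
  have "(\<lambda>y. \<bar>J y\<bar> * f y) absolutely_integrable_on (\<tau> ` K)"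
    using assms c sub continuous_on_subset[OF smooth_fun_continuous[OF smooth_abs_J]]
    by (intro absolutely_integrable_cont_mult) (auto simp: L1_loc_def)
  then have "(\<lambda>y. \<bar>J y\<bar> * f (\<tau> (\<sigma> y))) absolutely_integrable_on (\<tau> ` K)"
    by (rule absolutely_integrable_spike[OF _ negligible_empty]) (use sub \<tau>\<sigma> in auto)
  then show "(\<lambda>x. f (\<tau> x)) absolutely_integrable_on K" using change_of_variables(1) K by blast
qed

lemma dist_of_compose:
  assumes f: "L1_loc f V" and \<phi>: "test_fun V' \<phi>"
  shows "dist_of (\<lambda>x. f (\<tau> x)) \<phi> = dist_of f (\<lambda>y. if y \<in> V then \<bar>J y\<bar> * \<phi> (\<sigma> y) else 0)"
  using \<phi>
proof (rule test_funE)
  fix K assume K: "smooth_fun \<phi> UNIV" "compact K" "K \<subseteq> V'" "\<And>x. x \<notin> K \<Longrightarrow> \<phi> x = 0"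
  have sub: "\<tau> ` K \<subseteq> V" using K \<tau>_mem by blast
  have int: "(\<lambda>x. f (\<tau> x) * \<phi> x) absolutely_integrable_on K"
    using absolutely_integrable_cont_mult[OF K(2), of "\<lambda>x. f (\<tau> x)" \<phi>] L1_loc_compose[OF f] K
      smooth_fun_continuous[OF smooth_fun_subset[OF K(1)]] by (simp add: L1_loc_def mult.commute)
  have "dist_of (\<lambda>x. f (\<tau> x)) \<phi> = integral K (\<lambda>x. f (\<tau> x) * \<phi> x)"
    unfolding dist_of_def by (rule dist_of_supported[OF int]) (simp add: K)
  also have "\<dots> = integral (\<tau> ` K) (\<lambda>y. \<bar>J y\<bar> * (f (\<tau> (\<sigma> y)) * \<phi> (\<sigma> y)))"
    by (rule change_of_variables(2)[OF K(2,3) int, symmetric])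
  also have "\<dots> = integral (\<tau> ` K) (\<lambda>y. f y * (if y \<in> V then \<bar>J y\<bar> * \<phi> (\<sigma> y) else 0))"
    by (rule integral_cong) (use sub \<tau>\<sigma> in auto)
  also have "\<dots> = dist_of f (\<lambda>y. if y \<in> V then \<bar>J y\<bar> * \<phi> (\<sigma> y) else 0)"
    unfolding dist_of_def
  proof (rule dist_of_supported[symmetric])
    have "(\<lambda>y. \<bar>J y\<bar> * (f (\<tau> (\<sigma> y)) * \<phi> (\<sigma> y))) absolutely_integrable_on (\<tau> ` K)"
      using change_of_variables(1)[OF K(2,3), of "\<lambda>x. f (\<tau> x) * \<phi> x"] int by simp
    then show "(\<lambda>y. f y * (if y \<in> V then \<bar>J y\<bar> * \<phi> (\<sigma> y) else 0)) absolutely_integrable_on (\<tau> ` K)"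
      by (rule absolutely_integrable_spike[OF _ negligible_empty]) (use sub \<tau>\<sigma> in auto)
    fix y assume "y \<notin> \<tau> ` K"
    then show "f y * (if y \<in> V then \<bar>J y\<bar> * \<phi> (\<sigma> y) else 0) = 0"
      using K(4)[of "\<sigma> y"] \<tau>\<sigma>[of y] by (metis image_eqI mult_zero_right)
  qed
  finally show ?thesis .
qed

text \<open>The identity holds because the rows of the cofactor matrix \<open>N\<close> are divergence free.\<close>

lemma piola:
  fixes i :: 2
  assumes \<phi>: "test_fun V' \<phi>" and y: "y \<in> V"
  defines "\<psi> \<equiv> \<lambda>k y. if y \<in> V then sgn (J y) * N k i y * \<phi> (\<sigma> y) else 0"
  shows "(\<Sum>k\<in>UNIV. pd k (\<psi> k) y) = \<bar>J y\<bar> * pd i \<phi> (\<sigma> y)"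
proof -
  have d\<phi>: "\<phi> differentiable (at (\<sigma> y))" by (rule test_fun_differentiable[OF \<phi>])
  have d\<sigma>: "(\<lambda>y. \<sigma> y $ k) differentiable (at y)" for k
    using smooth_\<sigma> y by (rule smooth_fun_differentiable)
  note comp = pd_compose[OF d\<sigma> d\<phi>]
  have dN: "N k i differentiable (at y)" for k i using smooth_N y by (rule smooth_fun_differentiable)
  have ds: "(\<lambda>y. sgn (J y)) differentiable (at y)" using smooth_sgn_J y by (rule smooth_fun_differentiable)
  have "pd k (\<psi> k) y = pd k (\<lambda>y. sgn (J y) * (N k i y * \<phi> (\<sigma> y))) y" for k
    by (rule pd_cong[OF V y]) (simp add: \<psi>_def)
  also have "pd k (\<lambda>y. sgn (J y) * (N k i y * \<phi> (\<sigma> y))) y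
    = sgn (J y) * (N k i y * (pd 1 \<phi> (\<sigma> y) * S 1 k y + pd 2 \<phi> (\<sigma> y) * S 2 k y) + pd k (N k i) y * \<phi> (\<sigma> y))" for k
    by (simp add: pd_mult ds dN comp differentiable_mult pd_sgn_J y sum_2 S_def)
  finally have eq: "pd k (\<psi> k) y
    = sgn (J y) * (N k i y * (pd 1 \<phi> (\<sigma> y) * S 1 k y + pd 2 \<phi> (\<sigma> y) * S 2 k y) + pd k (N k i) y * \<phi> (\<sigma> y))" for k .
  have dS: "S k l differentiable (at y)" for k l using smooth_S y by (rule smooth_fun_differentiable)
  have sym: "pd 1 (S k 2) y = pd 2 (S k 1) y" for k
    unfolding S_def[abs_def] by (rule pd_commute[OF smooth_\<sigma> V y])
  \<comment> \<open>Both terms are mixed second derivatives of one component of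
    \<open>\<sigma>\<close>, with opposite signs.\<close>
  have "pd 1 (N 1 i) y + pd 2 (N 2 i) y = 0"
    by (cases "i = 1") (simp_all add: N_def[abs_def] pd_minus dS sym)
  moreover have "N 1 i y * (p1 * S 1 1 y + p2 * S 2 1 y) + N 2 i y * (p1 * S 1 2 y + p2 * S 2 2 y)
    = J y * (if i = 1 then p1 else p2)" for p1 p2
    by (cases "i = 1") (auto simp: N_def J_def algebra_simps)
  moreover have "(\<Sum>k\<in>UNIV. pd k (\<psi> k) y) = sgn (J y) *
      (N 1 i y * (pd 1 \<phi> (\<sigma> y) * S 1 1 y + pd 2 \<phi> (\<sigma> y) * S 2 1 y) +
       N 2 i y * (pd 1 \<phi> (\<sigma> y) * S 1 2 y + pd 2 \<phi> (\<sigma> y) * S 2 2 y))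
      + sgn (J y) * (pd 1 (N 1 i) y + pd 2 (N 2 i) y) * \<phi> (\<sigma> y)"
    unfolding sum_2 eq by (simp add: algebra_simps)
  ultimately have "(\<Sum>k\<in>UNIV. pd k (\<psi> k) y) = sgn (J y) * (J y * (if i = 1 then pd 1 \<phi> (\<sigma> y) else pd 2 \<phi> (\<sigma> y)))"
    by simp
  then show ?thesis using exhaust_2[of i] by (auto simp: abs_sgn mult.assoc mult.left_commute mult.commute)
qed

text \<open>Weak gradients transform as one-forms. Pushed forward, the derivative of a test function
  is a divergence by \<open>piola\<close>, to which the hypothesis applies term by term;
  \<open>T_N\<close> turns the cofactors back into the Jacobian of \<open>\<tau>\<close>.\<close>

lemma weak_grad_compose:
  assumes "weak_grad V c w"
  shows "weak_grad V' (\<lambda>x. c (\<tau> x)) (\<lambda>i x. \<Sum>k\<in>UNIV. w k (\<tau> x) * T k i x)"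
proof -
  have c: "L1_loc c V" and w: "\<And>k. L1_loc (w k) V"
    and cw: "\<And>\<phi> k. test_fun V \<phi> \<Longrightarrow> dist_of c (pd k \<phi>) = - dist_of (w k) \<phi>"
    using assms by (auto simp: weak_grad_def)
  have T: "continuous_on V' (T k i)" for k i
    unfolding T_def[abs_def] by (intro smooth_fun_continuous smooth_fun_pd smooth_\<tau>)
  have wT: "L1_loc (\<lambda>x. w k (\<tau> x) * T k i x) V'" for k i
    using L1_loc_cont_mult[OF T L1_loc_compose[OF w]] by (simp add: mult.commute)
  have "dist_of (\<lambda>x. c (\<tau> x)) (pd i \<phi>) = - dist_of (\<lambda>x. \<Sum>k\<in>UNIV. w k (\<tau> x) * T k i x) \<phi>"
    if \<phi>: "test_fun V' \<phi>" for \<phi> i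
  proof -
    define \<psi> where "\<psi> k y = (if y \<in> V then sgn (J y) * N k i y * \<phi> (\<sigma> y) else 0)" for k y
    have \<psi>: "test_fun V (\<psi> k)" for k
      unfolding \<psi>_def by (intro push_test \<phi> smooth_fun_mult V smooth_sgn_J smooth_N)
    have "dist_of (\<lambda>x. c (\<tau> x)) (pd i \<phi>) = dist_of c (\<lambda>y. if y \<in> V then \<bar>J y\<bar> * pd i \<phi> (\<sigma> y) else 0)"
      by (rule dist_of_compose[OF c test_fun_pd[OF \<phi>]])
    also have "\<dots> = dist_of c (\<lambda>y. \<Sum>k\<in>UNIV. pd k (\<psi> k) y)"
    proof (rule dist_of_cong[of V])
      show "test_fun V (\<lambda>y. if y \<in> V then \<bar>J y\<bar> * pd i \<phi> (\<sigma> y) else 0)"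
        by (intro push_test test_fun_pd \<phi> smooth_abs_J)
      show "test_fun V (\<lambda>y. \<Sum>k\<in>UNIV. pd k (\<psi> k) y)"
        by (intro test_fun_sum test_fun_pd \<psi>) simp
      fix y assume "y \<in> V"
      then show "c y * (if y \<in> V then \<bar>J y\<bar> * pd i \<phi> (\<sigma> y) else 0) = c y * (\<Sum>k\<in>UNIV. pd k (\<psi> k) y)"
        using piola[OF \<phi>, of y i] by (simp add: \<psi>_def[abs_def])
    qed
    also have "\<dots> = (\<Sum>k\<in>UNIV. dist_of c (pd k (\<psi> k)))"
      by (intro dist_of_sum[OF c] test_fun_pd \<psi>) simp
    also have "\<dots> = (\<Sum>k\<in>UNIV. - dist_of (w k) (\<psi> k))" by (simp add: cw \<psi>)
    also have "\<dots> = - (\<Sum>k\<in>UNIV. dist_of (\<lambda>x. w k (\<tau> x) * T k i x) \<phi>)"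
    proof -
      have "dist_of (\<lambda>x. w k (\<tau> x) * T k i x) \<phi> = dist_of (w k) (\<psi> k)" for k
      proof -
        have T\<phi>: "test_fun V' (\<lambda>x. T k i x * \<phi> x)"
          unfolding T_def by (intro test_fun_mult V' smooth_fun_pd smooth_\<tau> \<phi>)
        have "dist_of (\<lambda>x. w k (\<tau> x) * T k i x) \<phi> = dist_of (\<lambda>x. w k (\<tau> x)) (\<lambda>x. T k i x * \<phi> x)"
          by (simp add: dist_of_def mult.assoc)
        also have "\<dots> = dist_of (w k) (\<lambda>y. if y \<in> V then \<bar>J y\<bar> * (T k i (\<sigma> y) * \<phi> (\<sigma> y)) else 0)"
          by (rule dist_of_compose[OF w T\<phi>])
        also have "(\<lambda>y. if y \<in> V then \<bar>J y\<bar> * (T k i (\<sigma> y) * \<phi> (\<sigma> y)) else 0) = \<psi> k"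
          by (auto simp: \<psi>_def fun_eq_iff T_N[symmetric] abs_sgn)
        finally show ?thesis .
      qed
      then show ?thesis by (simp add: sum_negf)
    qed
    also have "(\<Sum>k\<in>UNIV. dist_of (\<lambda>x. w k (\<tau> x) * T k i x) \<phi>) = dist_of (\<lambda>x. \<Sum>k\<in>UNIV. w k (\<tau> x) * T k i x) \<phi>"
      by (rule dist_of_sum_left[symmetric, OF _ wT \<phi>]) simp
    finally show ?thesis .
  qed
  then show ?thesis
    unfolding weak_grad_def using L1_loc_compose[OF c] by (auto intro: L1_loc_sum wT)
qed

end

section \<open>Local geometry\<close>

lemma matrix_inv_unique_2:
  fixes A B :: "real^2^2"
  assumes "A ** B = mat 1" "B ** A = mat 1"
  shows "matrix_inv A = B"
proof -
  have "A ** matrix_inv A = mat 1 \<and> matrix_inv A ** A = mat 1"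
    unfolding matrix_inv_def by (rule someI[of _ B]) (use assms in blast)
  then have "matrix_inv A = matrix_inv A ** (A ** B)" "matrix_inv A ** A = mat 1"
    using assms by simp_all
  then show ?thesis by (metis matrix_mul_assoc matrix_mul_lid)
qed

lemma matrix_inv_2:
  fixes A :: "real^2^2"
  assumes "det A \<noteq> 0"
  shows "matrix_inv A $ 1 $ 1 = A $ 2 $ 2 / det A" "matrix_inv A $ 1 $ 2 = - A $ 1 $ 2 / det A"
    "matrix_inv A $ 2 $ 1 = - A $ 2 $ 1 / det A" "matrix_inv A $ 2 $ 2 = A $ 1 $ 1 / det A"
proof -
  define B :: "real^2^2" where "B = (\<chi> i j. (if i = 1 then if j = 1 then A $ 2 $ 2 else - A $ 1 $ 2
    else if j = 1 then - A $ 2 $ 1 else A $ 1 $ 1) / det A)"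
  have d: "A $ 1 $ 1 * A $ 2 $ 2 - A $ 1 $ 2 * A $ 2 $ 1 = det A" by (simp add: det_2)
  have "matrix_inv A = B"
    using assms d
    by (intro matrix_inv_unique_2)
       (auto simp: B_def vec_eq_iff forall_2 matrix_matrix_mult_def sum_2 mat_def field_simps)
  then show "matrix_inv A $ 1 $ 1 = A $ 2 $ 2 / det A" "matrix_inv A $ 1 $ 2 = - A $ 1 $ 2 / det A"
    "matrix_inv A $ 2 $ 1 = - A $ 2 $ 1 / det A" "matrix_inv A $ 2 $ 2 = A $ 1 $ 1 / det A"
    by (simp_all add: B_def)
qed

lemma linear_2_zero:
  fixes a b c d p q :: real
  assumes "a * p + b * q = 0" "c * p + d * q = 0" "a * d - b * c \<noteq> 0"
  shows "p = 0" "q = 0"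
proof -
  have "p * a + q * b = 0" "p * c + q * d = 0" using assms(1,2) by (simp_all add: mult.commute)
  from cramer2[OF this] have "p * (a * d - c * b) = 0" "q * (a * d - c * b) = 0" by simp_all
  moreover have "a * d - c * b \<noteq> 0" using assms(3) by (simp add: mult.commute)
  ultimately show "p = 0" "q = 0" by simp_all
qed

section \<open>A metric and its Christoffel symbols in one chart\<close>

locale metric_chart =
  fixes G :: "real^2 \<Rightarrow> real^2^2" and V :: "(real^2) set"
  assumes V: "open V" and smooth_mat_G: "smooth_mat G V"
    and transpose_G: "\<And>x. x \<in> V \<Longrightarrow> transpose (G x) = G x"
    and det_pos: "\<And>x. x \<in> V \<Longrightarrow> det (G x) > 0"
begin

abbreviation "I i j x \<equiv> matrix_inv (G x) $ i $ j"
abbreviation "dG k i j x \<equiv> pd k (\<lambda>y. G y $ i $ j) x"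
abbreviation "\<Gamma> \<equiv> christoffel G"

lemma smooth_G: "smooth_fun (\<lambda>x. G x $ i $ j) V"
  using smooth_mat_G unfolding smooth_mat_def by blast

lemma G_sym: "x \<in> V \<Longrightarrow> G x $ i $ j = G x $ j $ i"
proof -
  assume "x \<in> V"
  then have "transpose (G x) $ i $ j = G x $ i $ j" by (simp add: transpose_G)
  then show ?thesis by (simp add: transpose_def)
qed

lemma dG_sym: "x \<in> V \<Longrightarrow> dG k i j x = dG k j i x"
  by (rule pd_cong[OF V]) (simp_all add: G_sym)

lemma det_G: "x \<in> V \<Longrightarrow> det (G x) = G x $ 1 $ 1 * G x $ 2 $ 2 - G x $ 1 $ 2 * G x $ 1 $ 2"
  using G_sym[of x 2 1] by (simp add: det_2)

lemma inv_G:
  assumes "x \<in> V"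
  shows "I 1 1 x = G x $ 2 $ 2 / det (G x)" "I 1 2 x = - G x $ 1 $ 2 / det (G x)"
    "I 2 1 x = - G x $ 1 $ 2 / det (G x)" "I 2 2 x = G x $ 1 $ 1 / det (G x)"
  using matrix_inv_2[of "G x"] det_pos[OF assms] G_sym[OF assms, of 2 1] by auto

lemma inv_sym: "x \<in> V \<Longrightarrow> I i j x = I j i x"
  using exhaust_2[of i] exhaust_2[of j] by (auto simp: inv_G)

lemma G_I: "x \<in> V \<Longrightarrow> G x $ i $ 1 * I 1 j x + G x $ i $ 2 * I 2 j x = (if i = j then 1 else 0)"
  using exhaust_2[of i] exhaust_2[of j] det_pos[of x] G_sym[of x 2 1]
  by (auto simp: inv_G det_G divide_simps)

lemma smooth_det: "smooth_fun (\<lambda>x. det (G x)) V"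
proof -
  have "smooth_fun (\<lambda>x. G x $ 1 $ 1 * G x $ 2 $ 2 - G x $ 1 $ 2 * G x $ 1 $ 2) V"
    by (intro smooth_intros smooth_G V)
  then show ?thesis by (subst smooth_fun_cong[OF V det_G])
qed

lemma smooth_I: "smooth_fun (I i j) V"
proof -
  have nz: "\<And>x. x \<in> V \<Longrightarrow> det (G x) \<noteq> 0" using det_pos by force
  have "smooth_fun (\<lambda>x. G x $ 2 $ 2 / det (G x)) V" "smooth_fun (\<lambda>x. - G x $ 1 $ 2 / det (G x)) V"
    "smooth_fun (\<lambda>x. G x $ 1 $ 1 / det (G x)) V"
    by (intro smooth_intros smooth_G smooth_det V nz; assumption)+
  then show ?thesis
    using exhaust_2[of i] exhaust_2[of j] by (auto simp: smooth_fun_cong[OF V inv_G(1)]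
      smooth_fun_cong[OF V inv_G(2)] smooth_fun_cong[OF V inv_G(3)] smooth_fun_cong[OF V inv_G(4)])
qed

lemma smooth_\<Gamma>: "smooth_fun (\<Gamma> k i j) V"
  unfolding christoffel_def[abs_def]
  by (intro smooth_intros smooth_fun_pd smooth_I smooth_G V finite)

lemma \<Gamma>_sym: "x \<in> V \<Longrightarrow> \<Gamma> k i j x = \<Gamma> k j i x"
  by (simp add: christoffel_def dG_sym[of x _ i j] add.commute)

text \<open>These are the Christoffel symbols of the first kind, free of the inverse metric.\<close>

lemma \<Gamma>_lower:
  assumes x: "x \<in> V"
  shows "G x $ m $ 1 * \<Gamma> 1 i j x + G x $ m $ 2 * \<Gamma> 2 i j x = (dG i j m x + dG j i m x - dG m i j x) / 2"
proof -
  define L where "L l = dG i j l x + dG j i l x - dG l i j x" for l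
  have \<Gamma>: "\<Gamma> k i j x = (I k 1 x * L 1 + I k 2 x * L 2) / 2" for k
    by (simp add: christoffel_def L_def sum_2)
  have "G x $ m $ 1 * \<Gamma> 1 i j x + G x $ m $ 2 * \<Gamma> 2 i j x
    = ((G x $ m $ 1 * I 1 1 x + G x $ m $ 2 * I 2 1 x) * L 1 + (G x $ m $ 1 * I 1 2 x + G x $ m $ 2 * I 2 2 x) * L 2) / 2"
    unfolding \<Gamma> by (simp add: field_simps)
  also have "\<dots> = L m / 2" unfolding G_I[OF x] using exhaust_2[of m] by auto
  finally show ?thesis by (simp add: L_def)
qed

text \<open>The metric is parallel.\<close>

lemma compat:
  assumes x: "x \<in> V"
  shows "dG k i j x = G x $ j $ 1 * \<Gamma> 1 k i x + G x $ j $ 2 * \<Gamma> 2 k i x + (G x $ i $ 1 * \<Gamma> 1 k j x + G x $ i $ 2 * \<Gamma> 2 k j x)"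
  unfolding \<Gamma>_lower[OF x] using dG_sym[OF x, of k i j] dG_sym[OF x, of i j k] dG_sym[OF x, of j i k] dG_sym[OF x, of i k j] dG_sym[OF x, of j k i]
  by (simp add: field_simps)

lemma G_nondeg:
  assumes x: "x \<in> V" and "\<And>m. G x $ m $ 1 * p + G x $ m $ 2 * q = 0"
  shows "p = 0" "q = 0"
proof -
  have "G x $ 1 $ 1 * G x $ 2 $ 2 - G x $ 1 $ 2 * G x $ 2 $ 1 \<noteq> 0"
    using det_pos[OF x] by (simp add: det_2)
  from linear_2_zero[OF assms(2) assms(2) this] show "p = 0" "q = 0" by auto
qed

text \<open>The inverse metric is parallel: differentiate the relation \<open>G_I\<close>, replace
  the derivatives of \<open>G\<close> by \<open>compat\<close>, and cancel the nondegenerate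
  \<open>G\<close>.\<close>

lemma pd_I:
  assumes x: "x \<in> V"
  shows "pd k (I l n) x = - (\<Gamma> l k 1 x * I 1 n x + \<Gamma> l k 2 x * I 2 n x) - (\<Gamma> n k 1 x * I l 1 x + \<Gamma> n k 2 x * I l 2 x)"
proof -
  define X where "X l = pd k (I l n) x + (\<Gamma> l k 1 x * I 1 n x + \<Gamma> l k 2 x * I 2 n x) + (\<Gamma> n k 1 x * I l 1 x + \<Gamma> n k 2 x * I l 2 x)" for l
  have dI: "I l n differentiable (at x)" for l n using smooth_I x by (rule smooth_fun_differentiable)
  have dGG: "(\<lambda>x. G x $ i $ j) differentiable (at x)" for i j using smooth_G x by (rule smooth_fun_differentiable)
  have "G x $ m $ 1 * X 1 + G x $ m $ 2 * X 2 = 0" for m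
  proof -
    have "pd k (\<lambda>x. G x $ m $ 1 * I 1 n x + G x $ m $ 2 * I 2 n x) x = pd k (\<lambda>x. if m = n then 1 else 0) x"
      by (rule pd_cong[OF V x]) (rule G_I)
    then have 1: "G x $ m $ 1 * pd k (I 1 n) x + dG k m 1 x * I 1 n x + (G x $ m $ 2 * pd k (I 2 n) x + dG k m 2 x * I 2 n x) = 0"
      by (simp add: pd_add pd_mult dI dGG differentiable_mult)
    have 2: "\<Gamma> 1 k m x * (G x $ 1 $ 1 * I 1 n x + G x $ 1 $ 2 * I 2 n x) + \<Gamma> 2 k m x * (G x $ 2 $ 1 * I 1 n x + G x $ 2 $ 2 * I 2 n x)
      = \<Gamma> n k m x"
      using exhaust_2[of n] by (auto simp: G_I[OF x])
    have 3: "\<Gamma> n k 1 x * (G x $ m $ 1 * I 1 1 x + G x $ m $ 2 * I 2 1 x) + \<Gamma> n k 2 x * (G x $ m $ 1 * I 1 2 x + G x $ m $ 2 * I 2 2 x)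
      = \<Gamma> n k m x"
      using exhaust_2[of m] by (auto simp: G_I[OF x])
    show ?thesis
      using 1 2 3 unfolding X_def compat[OF x] \<Gamma>_sym[OF x, of _ k] G_sym[OF x, of 2 1]
      by (simp add: algebra_simps)
  qed
  from G_nondeg[OF x this] have "X l = 0" using exhaust_2[of l] by auto
  then show ?thesis by (simp add: X_def)
qed

end

section \<open>The Lorentz form on triples\<close>

definition ip :: "(3 \<Rightarrow> real) \<Rightarrow> (3 \<Rightarrow> real) \<Rightarrow> real" where
  "ip u w = u 1 * w 1 + u 2 * w 2 - u 3 * w 3"

text \<open>As \<open>q\<close> and \<open>r\<close> are orthogonal to \<open>p\<close>, the Gram
  determinant of the three vectors is \<open>ip p p\<close> times that of \<open>q\<close> and
  \<open>r\<close>, hence nonzero; Cramer's rule then expresses \<open>w\<close> by its three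
  products.\<close>

lemma ip_nondeg:
  assumes "ip p p = -1" "ip p q = 0" "ip p r = 0" "ip q q * ip r r - ip q r * ip q r \<noteq> 0"
    and w: "ip w p = 0" "ip w q = 0" "ip w r = 0"
  shows "w a = 0"
proof -
  \<comment> \<open>The determinant of the three vectors; the signature makes the Gram determinant
    minus its square.\<close>
  define D where "D = p 1 * (q 2 * r 3 - q 3 * r 2) + p 2 * (q 3 * r 1 - q 1 * r 3) + p 3 * (q 1 * r 2 - q 2 * r 1)"
  have "- D * D = ip p p * (ip q q * ip r r - ip q r * ip q r) - ip p q * (ip p q * ip r r - ip q r * ip p r)
     + ip p r * (ip p q * ip q r - ip q q * ip p r)"
    by (simp add: D_def ip_def algebra_simps)
  then have "D \<noteq> 0" using assms by auto
  moreover have "D * w 1 = ip w p * (q 2 * r 3 - q 3 * r 2) + ip w q * (r 2 * p 3 - r 3 * p 2) + ip w r * (p 2 * q 3 - p 3 * q 2)"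
    "D * w 2 = ip w p * (q 3 * r 1 - q 1 * r 3) + ip w q * (r 3 * p 1 - r 1 * p 3) + ip w r * (p 3 * q 1 - p 1 * q 3)"
    "- D * w 3 = ip w p * (q 1 * r 2 - q 2 * r 1) + ip w q * (r 1 * p 2 - r 2 * p 1) + ip w r * (p 1 * q 2 - p 2 * q 1)"
    by (simp_all add: D_def ip_def algebra_simps)
  ultimately have "w 1 = 0 \<and> w 2 = 0 \<and> w 3 = 0" using w by simp
  then show ?thesis using exhaust_3[of a] by auto
qed

lemma pd_ip:
  assumes "\<And>a. f a differentiable (at x)" "\<And>a. h a differentiable (at x)"
  shows "pd k (\<lambda>x. ip (\<lambda>a. f a x) (\<lambda>a. h a x)) x = ip (\<lambda>a. pd k (f a) x) (\<lambda>a. h a x) + ip (\<lambda>a. f a x) (\<lambda>a. pd k (h a) x)"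
  unfolding ip_def by (simp add: pd_add pd_diff pd_mult assms differentiable_mult differentiable_add)

lemma ip_commute: "ip u w = ip w u"
  by (simp add: ip_def)

text \<open>\<open>e\<close> is an isometry, up to the factor \<open>-R\<close>, onto an open part of the hyperboloid in
  \<open>\<real>\<^bsup>2,1\<^esup>\<close>.  The condition involves only first derivatives, so it is obviously invariant under
  changes of charts.\<close>

locale hyp_frame = metric_chart +
  fixes R :: real and e :: "3 \<Rightarrow> real^2 \<Rightarrow> real"
  assumes R: "R < 0" and smooth_e: "\<And>a. smooth_fun (e a) V"
    and ip_e: "\<And>x. x \<in> V \<Longrightarrow> ip (\<lambda>a. e a x) (\<lambda>a. e a x) = -1"
    and ip_de: "\<And>x i j. x \<in> V \<Longrightarrow> ip (\<lambda>a. pd i (e a) x) (\<lambda>a. pd j (e a) x) = - R * G x $ i $ j"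
begin

lemma diff_e: "x \<in> V \<Longrightarrow> e a differentiable (at x)" "x \<in> V \<Longrightarrow> pd i (e a) differentiable (at x)"
  using smooth_e smooth_fun_pd smooth_fun_differentiable by blast+

lemma ip_e_de: "x \<in> V \<Longrightarrow> ip (\<lambda>a. e a x) (\<lambda>a. pd i (e a) x) = 0"
proof -
  assume x: "x \<in> V"
  have "pd i (\<lambda>x. ip (\<lambda>a. e a x) (\<lambda>a. e a x)) x = pd i (\<lambda>x. -1) x"
    by (rule pd_cong[OF V x]) (rule ip_e)
  then show ?thesis using pd_ip[of e x e i] diff_e[OF x] ip_commute by (simp add: ip_def algebra_simps)
qed

lemma frame_nondeg:
  assumes x: "x \<in> V" and "ip w (\<lambda>a. e a x) = 0" "\<And>m. ip w (\<lambda>a. pd m (e a) x) = 0"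
  shows "w a = 0"
proof (rule ip_nondeg[OF ip_e[OF x] ip_e_de[OF x, of 1] ip_e_de[OF x, of 2]])
  have "R * R * det (G x) \<noteq> 0" using R det_pos[OF x] by simp
  then show "ip (\<lambda>a. pd 1 (e a) x) (\<lambda>a. pd 1 (e a) x) * ip (\<lambda>a. pd 2 (e a) x) (\<lambda>a. pd 2 (e a) x)
    - ip (\<lambda>a. pd 1 (e a) x) (\<lambda>a. pd 2 (e a) x) * ip (\<lambda>a. pd 1 (e a) x) (\<lambda>a. pd 2 (e a) x) \<noteq> 0"
    by (simp add: ip_de[OF x] det_G[OF x] algebra_simps)
qed (use assms in auto)

lemma ip_dde_e: "x \<in> V \<Longrightarrow> ip (\<lambda>a. pd i (pd j (e a)) x) (\<lambda>a. e a x) = R * G x $ i $ j"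
proof -
  assume x: "x \<in> V"
  have "pd i (\<lambda>x. ip (\<lambda>a. e a x) (\<lambda>a. pd j (e a) x)) x = pd i (\<lambda>x. 0) x"
    by (rule pd_cong[OF V x]) (rule ip_e_de)
  then show ?thesis using pd_ip[of e x "\<lambda>a. pd j (e a)" i] diff_e[OF x] ip_de[OF x, of i j]
    by (simp add: ip_commute[of _ "\<lambda>a. e a x"])
qed

text \<open>Differentiating \<open>ip_de\<close> and permuting the indices solves for the second
  derivatives, as in the Koszul formula.\<close>

lemma ip_dde_de: "x \<in> V \<Longrightarrow> ip (\<lambda>a. pd i (pd j (e a)) x) (\<lambda>a. pd m (e a) x)
    = - R * ((dG i j m x + dG j i m x - dG m i j x) / 2)"
proof -
  assume x: "x \<in> V"
  define B where "B i j m = ip (\<lambda>a. pd i (pd j (e a)) x) (\<lambda>a. pd m (e a) x)" for i j m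
  have sym: "B i j m = B j i m" for i j m
    unfolding B_def using pd_commute[OF smooth_e V x] by simp
  have "- R * dG k i j x = B k i j + B k j i" for k i j
  proof -
    have "pd k (\<lambda>x. ip (\<lambda>a. pd i (e a) x) (\<lambda>a. pd j (e a) x)) x = pd k (\<lambda>x. - R * G x $ i $ j) x"
      by (rule pd_cong[OF V x]) (rule ip_de)
    also have "\<dots> = - R * dG k i j x"
      by (rule pd_cmult[OF smooth_fun_differentiable[OF smooth_G x]])
    finally show ?thesis using pd_ip[of "\<lambda>a. pd i (e a)" x "\<lambda>a. pd j (e a)" k] diff_e[OF x]
      by (simp add: B_def ip_commute)
  qed
  note this[of i j m] this[of j i m] this[of m i j]
  then have "2 * B i j m = - R * (dG i j m x + dG j i m x - dG m i j x)"
    using sym[of i j m] sym[of i m j] sym[of j m i] by (simp add: algebra_simps)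
  then show ?thesis by (simp add: B_def)
qed

text \<open>The Gauss formula: both sides have the same products with \<open>e\<close> and with its
  two derivatives, and these three vectors span.\<close>

lemma hessian_e:
  assumes x: "x \<in> V"
  shows "pd i (pd j (e a)) x = \<Gamma> 1 i j x * pd 1 (e a) x + \<Gamma> 2 i j x * pd 2 (e a) x - R * G x $ i $ j * e a x"
proof -
  define w where "w a = pd i (pd j (e a)) x - (\<Gamma> 1 i j x * pd 1 (e a) x + \<Gamma> 2 i j x * pd 2 (e a) x - R * G x $ i $ j * e a x)" for a
  have ipw: "ip w h = ip (\<lambda>a. pd i (pd j (e a)) x) h - \<Gamma> 1 i j x * ip (\<lambda>a. pd 1 (e a) x) h
     - \<Gamma> 2 i j x * ip (\<lambda>a. pd 2 (e a) x) h + R * G x $ i $ j * ip (\<lambda>a. e a x) h" for h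
    by (simp add: w_def ip_def algebra_simps)
  have "w a = 0"
  proof (rule frame_nondeg[OF x])
    show "ip w (\<lambda>a. e a x) = 0"
      using ip_e_de[OF x] unfolding ipw ip_dde_e[OF x] ip_e[OF x] by (simp add: ip_commute[of _ "\<lambda>a. e a x"])
    fix m show "ip w (\<lambda>a. pd m (e a) x) = 0"
      unfolding ipw ip_dde_de[OF x] ip_de[OF x] ip_e_de[OF x] \<Gamma>_lower[OF x, symmetric] G_sym[OF x, of _ m]
      by (simp add: algebra_simps)
  qed
  then show ?thesis by (simp add: w_def)
qed

text \<open>\<open>v l a\<close> is the \<open>l\<close>-th component of the gradient of \<open>e a\<close>.\<close>

definition v :: "2 \<Rightarrow> 3 \<Rightarrow> real^2 \<Rightarrow> real" where
  "v l a x = I l 1 x * pd 1 (e a) x + I l 2 x * pd 2 (e a) x"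

lemma smooth_v: "smooth_fun (v l a) V"
  unfolding v_def[abs_def] by (intro smooth_intros smooth_I smooth_fun_pd smooth_e V)

lemma diff_v: "x \<in> V \<Longrightarrow> v l a differentiable (at x)"
  using smooth_v by (rule smooth_fun_differentiable)

lemma G_v: "x \<in> V \<Longrightarrow> G x $ m $ 1 * v 1 a x + G x $ m $ 2 * v 2 a x = pd m (e a) x"
proof -
  assume x: "x \<in> V"
  have "G x $ m $ 1 * v 1 a x + G x $ m $ 2 * v 2 a x
    = (G x $ m $ 1 * I 1 1 x + G x $ m $ 2 * I 2 1 x) * pd 1 (e a) x + (G x $ m $ 1 * I 1 2 x + G x $ m $ 2 * I 2 2 x) * pd 2 (e a) x"
    by (simp add: v_def algebra_simps)
  also have "\<dots> = pd m (e a) x" unfolding G_I[OF x] using exhaust_2[of m] by auto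
  finally show ?thesis .
qed

text \<open>The Hessian equation with one index raised: since \<open>g\<close> is parallel, the
  metric turns into the identity tensor.\<close>

lemma pd_v:
  assumes x: "x \<in> V"
  shows "pd k (v l a) x = - (\<Gamma> l k 1 x * v 1 a x + \<Gamma> l k 2 x * v 2 a x) - R * (if k = l then 1 else 0) * e a x"
proof -
  have dI: "I l n differentiable (at x)" for l n using smooth_I x by (rule smooth_fun_differentiable)
  have 1: "pd k (v l a) x = I l 1 x * pd k (pd 1 (e a)) x + pd k (I l 1) x * pd 1 (e a) x
     + (I l 2 x * pd k (pd 2 (e a)) x + pd k (I l 2) x * pd 2 (e a) x)"
    unfolding v_def[abs_def] by (simp add: pd_add pd_mult dI diff_e[OF x] differentiable_mult)
  have 2: "I l 1 x * G x $ k $ 1 + I l 2 x * G x $ k $ 2 = (if k = l then 1 else 0)"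
    using G_I[OF x, of k l] inv_sym[OF x, of l] by (simp add: mult.commute)
  show ?thesis
    unfolding 1 pd_I[OF x] hessian_e[OF x] v_def 2[symmetric] \<Gamma>_sym[OF x, of _ _ k]
    by (simp add: algebra_simps)
qed

lemma ip_v_e: "x \<in> V \<Longrightarrow> ip (\<lambda>a. v l a x) (\<lambda>a. e a x) = 0"
  using ip_e_de[of x 1] ip_e_de[of x 2] by (simp add: v_def ip_def algebra_simps) algebra

text \<open>Up to the factor \<open>- R\<close> the gradients are dual to the derivatives of
  \<open>e\<close>; all components are extracted with this.\<close>

lemma ip_v_de: "x \<in> V \<Longrightarrow> ip (\<lambda>a. v l a x) (\<lambda>a. pd m (e a) x) = - R * (if l = m then 1 else 0)"
proof -
  assume x: "x \<in> V"
  have "ip (\<lambda>a. v l a x) (\<lambda>a. pd m (e a) x) = I l 1 x * ip (\<lambda>a. pd 1 (e a) x) (\<lambda>a. pd m (e a) x)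
    + I l 2 x * ip (\<lambda>a. pd 2 (e a) x) (\<lambda>a. pd m (e a) x)"
    by (simp add: v_def ip_def algebra_simps)
  also have "\<dots> = - R * (G x $ m $ 1 * I 1 l x + G x $ m $ 2 * I 2 l x)"
    unfolding ip_de[OF x] G_sym[OF x, of _ m] inv_sym[OF x, of l] by (simp add: algebra_simps)
  finally show ?thesis unfolding G_I[OF x] by auto
qed

end

lemma has_bochner_dist_of:
  "L1_loc f W \<Longrightarrow> test_fun W \<phi> \<Longrightarrow> has_bochner_integral lebesgue (\<lambda>x. f x * \<phi> x) (dist_of f \<phi>)"
  unfolding dist_of_def by (rule has_bochner_integral_integrable[OF L1_loc_test_integrable])

text \<open>The pattern of the weak identities: each side is recognised as the integral of an
  explicit function, and the two functions are compared pointwise.\<close>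

lemma has_bochner_unique:
  "has_bochner_integral M f I \<Longrightarrow> has_bochner_integral M g J \<Longrightarrow> (\<And>x. f x = g x) \<Longrightarrow> I = J"
  using has_bochner_integral_eq by (metis ext)

section \<open>The one-forms \<open>u\<close> attached to a symmetric tensor\<close>

locale frame_tensor = hyp_frame +
  fixes S :: "real^2 \<Rightarrow> real^2^2"
  assumes transpose_S: "\<And>x. x \<in> V \<Longrightarrow> transpose (S x) = S x"
begin

lemma S_sym: "x \<in> V \<Longrightarrow> S x $ i $ j = S x $ j $ i"
proof -
  assume "x \<in> V"
  then have "transpose (S x) $ i $ j = S x $ i $ j" by (simp add: transpose_S)
  then show ?thesis by (simp add: transpose_def)
qed

definition "A i j x = I i 1 x * S x $ 1 $ j + I i 2 x * S x $ 2 $ j"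

definition "b j x = - ((\<Gamma> 1 1 1 x + \<Gamma> 2 2 1 x) * A 1 j x + (\<Gamma> 1 1 2 x + \<Gamma> 2 2 2 x) * A 2 j x)
  + (\<Gamma> 1 1 j x * A 1 1 x + \<Gamma> 2 1 j x * A 1 2 x + \<Gamma> 1 2 j x * A 2 1 x + \<Gamma> 2 2 j x * A 2 2 x)"

abbreviation "st k m x \<equiv> star2 (G x) (S x) $ k $ m"

text \<open>\<open>A\<close> is \<open>S\<close> with an index raised and \<open>b\<close> collects the Christoffel terms of its divergence.  The
  one-forms \<open>u a = S\<^sup>*(grad e\<^sub>a)\<close> are closed if and only if \<open>D\<^sup>*S = 0\<close>.\<close>

definition "u a k x = st k 1 x * v 1 a x + st k 2 x * v 2 a x"

lemma G_A: "x \<in> V \<Longrightarrow> G x $ m $ 1 * A 1 j x + G x $ m $ 2 * A 2 j x = S x $ m $ j"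
proof -
  assume x: "x \<in> V"
  have "G x $ m $ 1 * A 1 j x + G x $ m $ 2 * A 2 j x
    = (G x $ m $ 1 * I 1 1 x + G x $ m $ 2 * I 2 1 x) * S x $ 1 $ j + (G x $ m $ 1 * I 1 2 x + G x $ m $ 2 * I 2 2 x) * S x $ 2 $ j"
    by (simp add: A_def algebra_simps)
  also have "\<dots> = S x $ m $ j" unfolding G_I[OF x] using exhaust_2[of m] by auto
  finally show ?thesis .
qed

lemma A_sym: "x \<in> V \<Longrightarrow> G x $ 1 $ 1 * A 1 2 x + G x $ 1 $ 2 * A 2 2 x = G x $ 1 $ 2 * A 1 1 x + G x $ 2 $ 2 * A 2 1 x"
  using G_A[of x 1 2] G_A[of x 2 1] S_sym[of x 1 2] G_sym[of x 2 1] by simp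

lemma det_I: "x \<in> V \<Longrightarrow> det (G x) * (I 1 1 x * I 2 2 x - I 1 2 x * I 1 2 x) = 1"
  using det_pos[of x] by (simp add: inv_G field_simps) (simp add: det_G algebra_simps power2_eq_square)

lemma star_entries:
  assumes x: "x \<in> V"
  shows "st 1 1 x = det (G x) * (A 2 1 x * I 1 2 x + A 2 2 x * I 2 2 x)"
    "st 1 2 x = - det (G x) * (A 2 1 x * I 1 1 x + A 2 2 x * I 1 2 x)"
    "st 2 1 x = - det (G x) * (A 1 1 x * I 1 2 x + A 1 2 x * I 2 2 x)"
    "st 2 2 x = det (G x) * (A 1 1 x * I 1 1 x + A 1 2 x * I 1 2 x)"
proof -
  define w where "w = sqrt (det (G x))"
  define Q where "Q = matrix_inv (G x) ** S x ** matrix_inv (G x)"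
  have w: "w * w = det (G x)" using det_pos[OF x] by (simp add: w_def)
  have star: "star2 (G x) (S x) = transpose (area_form (G x)) ** Q ** area_form (G x)"
    by (simp add: star2_def Q_def matrix_mul_assoc)
  have area: "area_form (G x) $ 1 $ 1 = 0" "area_form (G x) $ 2 $ 2 = 0"
    "area_form (G x) $ 1 $ 2 = w" "area_form (G x) $ 2 $ 1 = - w"
    by (simp_all add: area_form_def w_def)
  have Q: "Q $ i $ j = A i 1 x * I 1 j x + A i 2 x * I 2 j x" for i j
    by (simp add: Q_def matrix_matrix_mult_def sum_2 A_def)
  have "st 1 1 x = w * w * Q $ 2 $ 2" "st 1 2 x = - (w * w) * Q $ 2 $ 1"
    "st 2 1 x = - (w * w) * Q $ 1 $ 2" "st 2 2 x = w * w * Q $ 1 $ 1"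
    unfolding star by (simp_all add: matrix_matrix_mult_def transpose_def sum_2 area)
  then show "st 1 1 x = det (G x) * (A 2 1 x * I 1 2 x + A 2 2 x * I 2 2 x)"
    "st 1 2 x = - det (G x) * (A 2 1 x * I 1 1 x + A 2 2 x * I 1 2 x)"
    "st 2 1 x = - det (G x) * (A 1 1 x * I 1 2 x + A 1 2 x * I 2 2 x)"
    "st 2 2 x = det (G x) * (A 1 1 x * I 1 1 x + A 1 2 x * I 1 2 x)"
    unfolding w Q inv_sym[OF x, of 2 1] by simp_all
qed

text \<open>The inverse metrics that remain besides \<open>A\<close> form the determinant of
  \<open>I\<close>, which cancels against \<open>det (G x)\<close>; what is left is
  \<open>A\<close>, turned by a right angle, applied to \<open>de\<close>.\<close>

lemma u_eq:
  assumes x: "x \<in> V"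
  shows "u a 1 x = A 2 2 x * pd 1 (e a) x - A 2 1 x * pd 2 (e a) x"
    "u a 2 x = A 1 1 x * pd 2 (e a) x - A 1 2 x * pd 1 (e a) x"
proof -
  define D where "D = det (G x) * (I 1 1 x * I 2 2 x - I 1 2 x * I 1 2 x)"
  have "u a 1 x = D * (A 2 2 x * pd 1 (e a) x - A 2 1 x * pd 2 (e a) x)"
    "u a 2 x = D * (A 1 1 x * pd 2 (e a) x - A 1 2 x * pd 1 (e a) x)"
    unfolding u_def star_entries[OF x] v_def inv_sym[OF x, of 2 1] D_def by (simp_all add: algebra_simps)
  then show "u a 1 x = A 2 2 x * pd 1 (e a) x - A 2 1 x * pd 2 (e a) x"
    "u a 2 x = A 1 1 x * pd 2 (e a) x - A 1 2 x * pd 1 (e a) x"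
    using det_I[OF x] by (simp_all add: D_def)
qed

text \<open>\<open>u\<close> is a combination of the gradients, which are tangent to the
  hyperboloid.\<close>

lemma ip_u_e: "x \<in> V \<Longrightarrow> ip (\<lambda>a. u a k x) (\<lambda>a. e a x) = 0"
proof -
  assume x: "x \<in> V"
  have "ip (\<lambda>a. u a k x) (\<lambda>a. e a x) = st k 1 x * ip (\<lambda>a. v 1 a x) (\<lambda>a. e a x) + st k 2 x * ip (\<lambda>a. v 2 a x) (\<lambda>a. e a x)"
    by (simp add: ip_def u_def algebra_simps)
  then show ?thesis by (simp add: ip_v_e x)
qed

text \<open>By the duality of \<open>v\<close> and \<open>de\<close> the dual tensor is recovered
  from \<open>u\<close>; this leads from the closed forms back to a tensor equation.\<close>

lemma ip_u_de: "x \<in> V \<Longrightarrow> ip (\<lambda>a. u a k x) (\<lambda>a. pd m (e a) x) = - R * st k m x"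
proof -
  assume x: "x \<in> V"
  have "ip (\<lambda>a. u a k x) (\<lambda>a. pd m (e a) x) = st k 1 x * ip (\<lambda>a. v 1 a x) (\<lambda>a. pd m (e a) x) + st k 2 x * ip (\<lambda>a. v 2 a x) (\<lambda>a. pd m (e a) x)"
    by (simp add: ip_def u_def algebra_simps)
  then show ?thesis using exhaust_2[of m] by (auto simp: ip_v_de x)
qed

text \<open>The terms of the curl of \<open>u\<close> in which no derivative falls on
  \<open>S\<close>, with \<open>b\<close> added. When the Hessian of \<open>e\<close> is inserted,
  its Christoffel part is balanced by \<open>b\<close>, and the part along \<open>e\<close> vanishes
  by the symmetry of \<open>S\<close>.\<close>

lemma curl_algebra:
  assumes x: "x \<in> V"
  shows "A 1 2 x * pd 1 (pd 1 (e a)) x + A 2 2 x * pd 2 (pd 1 (e a)) x + b 2 x * pd 1 (e a) x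
    = A 1 1 x * pd 1 (pd 2 (e a)) x + A 2 1 x * pd 2 (pd 2 (e a)) x + b 1 x * pd 2 (e a) x"
proof -
  have "A 1 2 x * pd 1 (pd 1 (e a)) x + A 2 2 x * pd 2 (pd 1 (e a)) x + b 2 x * pd 1 (e a) x
    - (A 1 1 x * pd 1 (pd 2 (e a)) x + A 2 1 x * pd 2 (pd 2 (e a)) x + b 1 x * pd 2 (e a) x)
    = - R * e a x * ((G x $ 1 $ 1 * A 1 2 x + G x $ 1 $ 2 * A 2 2 x) - (G x $ 1 $ 2 * A 1 1 x + G x $ 2 $ 2 * A 2 1 x))"
    unfolding hessian_e[OF x] b_def G_sym[OF x, of 2 1] \<Gamma>_sym[OF x, of _ 2 1] by (simp add: algebra_simps)
  then show ?thesis using A_sym[OF x] by simp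
qed

context
  assumes smooth_S: "smooth_mat S V"
begin

lemma smooth_S': "smooth_fun (\<lambda>x. S x $ i $ j) V"
  using smooth_S by (simp add: smooth_mat_def)

lemma smooth_A: "smooth_fun (A i j) V"
  unfolding A_def[abs_def] by (intro smooth_intros smooth_I smooth_S' V)

lemma smooth_u: "smooth_fun (u a k) V"
proof -
  have "smooth_fun (\<lambda>x. A 2 2 x * pd 1 (e a) x - A 2 1 x * pd 2 (e a) x) V"
    "smooth_fun (\<lambda>x. A 1 1 x * pd 2 (e a) x - A 1 2 x * pd 1 (e a) x) V"
    by (intro smooth_intros smooth_A smooth_e V)+
  then show ?thesis
    using exhaust_2[of k] smooth_fun_cong[OF V u_eq(1)] smooth_fun_cong[OF V u_eq(2)] by auto
qed

text \<open>As the inverse metric is parallel, it may be moved inside the derivative, which then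
  acts on \<open>A\<close>; \<open>b\<close> holds the remaining Christoffel terms.\<close>

lemma Dstar_eq:
  assumes x: "x \<in> V"
  shows "Dstar G S j x = - (pd 1 (A 1 j) x + pd 2 (A 2 j) x) + b j x"
proof -
  have dI: "I l n differentiable (at x)" for l n using smooth_I x by (rule smooth_fun_differentiable)
  have dS: "(\<lambda>x. S x $ i $ j) differentiable (at x)" for i j using smooth_S' x by (rule smooth_fun_differentiable)
  have "pd i (A i j) x = I i 1 x * pd i (\<lambda>x. S x $ 1 $ j) x + pd i (I i 1) x * S x $ 1 $ j
     + (I i 2 x * pd i (\<lambda>x. S x $ 2 $ j) x + pd i (I i 2) x * S x $ 2 $ j)" for i
    unfolding A_def[abs_def] by (simp add: pd_add pd_mult dI dS differentiable_mult)
  note pA = this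
  show ?thesis
    unfolding pA pd_I[OF x] Dstar_def cov_deriv_def b_def A_def sum_2 \<Gamma>_sym[OF x, of _ 2 1] inv_sym[OF x, of 2 1]
    by (simp add: algebra_simps)
qed

lemma curl_u:
  assumes x: "x \<in> V"
  shows "pd 1 (u a 2) x - pd 2 (u a 1) x = Dstar G S 2 x * pd 1 (e a) x - Dstar G S 1 x * pd 2 (e a) x"
proof -
  have dA: "A i j differentiable (at x)" for i j using smooth_A x by (rule smooth_fun_differentiable)
  have 1: "pd 2 (u a 1) x = pd 2 (\<lambda>x. A 2 2 x * pd 1 (e a) x - A 2 1 x * pd 2 (e a) x) x"
    by (rule pd_cong[OF V x u_eq(1)])
  have 2: "pd 1 (u a 2) x = pd 1 (\<lambda>x. A 1 1 x * pd 2 (e a) x - A 1 2 x * pd 1 (e a) x) x"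
    by (rule pd_cong[OF V x u_eq(2)])
  show ?thesis
    using curl_algebra[OF x, of a]
    unfolding 1 2 by (simp add: Dstar_eq[OF x] pd_diff pd_mult dA diff_e[OF x] differentiable_mult algebra_simps)
qed

text \<open>Pairing the vector identity \<open>curl_u\<close> with the gradients \<open>v l\<close>,
  which are dual to \<open>de\<close>, isolates the two components of the divergence.\<close>

lemma Dstar_zero_if_closed:
  assumes x: "x \<in> V" and closed: "\<And>a. pd 1 (u a 2) x = pd 2 (u a 1) x"
  shows "Dstar G S j x = 0"
proof -
  have 0: "Dstar G S 2 x * pd 1 (e a) x - Dstar G S 1 x * pd 2 (e a) x = 0" for a
    using curl_u[OF x, of a] closed[of a] by simp
  have "Dstar G S 2 x * ip (\<lambda>a. v l a x) (\<lambda>a. pd 1 (e a) x) - Dstar G S 1 x * ip (\<lambda>a. v l a x) (\<lambda>a. pd 2 (e a) x)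
    = ip (\<lambda>a. v l a x) (\<lambda>a. Dstar G S 2 x * pd 1 (e a) x - Dstar G S 1 x * pd 2 (e a) x)" for l
    by (simp add: ip_def algebra_simps)
  then have "Dstar G S 2 x * ip (\<lambda>a. v l a x) (\<lambda>a. pd 1 (e a) x) - Dstar G S 1 x * ip (\<lambda>a. v l a x) (\<lambda>a. pd 2 (e a) x) = 0" for l
    unfolding 0 by (simp add: ip_def)
  from this[of 1] this[of 2] have "Dstar G S 2 x = 0" "Dstar G S 1 x = 0" using R by (auto simp: ip_v_de[OF x])
  then show ?thesis using exhaust_2[of j] by auto
qed

end

definition "is_hess E \<longleftrightarrow> (\<forall>x\<in>V. \<forall>i j. st i j x = pd i (pd j E) x - (\<Gamma> 1 i j x * pd 1 E x + \<Gamma> 2 i j x * pd 2 E x) + R * E x * G x $ i $ j)"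

lemma is_hess_iff: "is_hess E \<longleftrightarrow> (\<forall>x\<in>V. star2 (G x) (S x) = hessian G E x + (R * E x) *\<^sub>R G x)"
  unfolding is_hess_def by (simp add: vec_eq_iff hessian_def sum_2)

text \<open>The coordinates of the potential with respect to the parallel frame formed by \<open>e\<close> and its
  derivatives: \<open>E = ip e c\<close> and \<open>\<partial>\<^sub>k E = ip (\<partial>\<^sub>k e) c\<close>.\<close>

definition "fcoef E a x = (v 1 a x * pd 1 E x + v 2 a x * pd 2 E x) / (- R) - E x * e a x"

text \<open>The Christoffel terms of the Hessian of \<open>E\<close> cancel those of
  \<open>pd_v\<close>, and the products of \<open>E\<close> with \<open>de\<close> and of
  \<open>e\<close> with \<open>dE\<close> cancel against the \<open>R\<close> terms of the two
  Hessians; the dual of \<open>S\<close> is left.\<close>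

lemma fcoef:
  assumes E: "smooth_fun E V" "is_hess E"
  shows "smooth_fun (fcoef E a) V" "\<And>x. x \<in> V \<Longrightarrow> pd k (fcoef E a) x = u a k x / (- R)"
    "\<And>x. x \<in> V \<Longrightarrow> ip (\<lambda>a. e a x) (\<lambda>a. fcoef E a x) = E x"
proof -
  have R': "- R \<noteq> 0" using R by simp
  show "smooth_fun (fcoef E a) V"
    unfolding fcoef_def[abs_def] using R by (intro smooth_intros smooth_v smooth_e E V) simp
  fix x assume x: "x \<in> V"
  have dE: "E differentiable (at x)" "\<And>k. pd k E differentiable (at x)"
    using E(1) smooth_fun_pd x smooth_fun_differentiable by blast+
  have h: "pd k (pd m E) x = st k m x + (\<Gamma> 1 k m x * pd 1 E x + \<Gamma> 2 k m x * pd 2 E x) - R * E x * G x $ k $ m" for m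
    using E(2) x unfolding is_hess_def by (auto simp: algebra_simps)
  define r where "r = inverse (- R)"
  have "fcoef E a = (\<lambda>x. r * (v 1 a x * pd 1 E x + v 2 a x * pd 2 E x) - E x * e a x)"
    by (simp add: fcoef_def[abs_def] divide_inverse mult.commute r_def)
  then have "pd k (fcoef E a) x = r * (v 1 a x * pd k (pd 1 E) x + pd k (v 1 a) x * pd 1 E x
     + (v 2 a x * pd k (pd 2 E) x + pd k (v 2 a) x * pd 2 E x)) - (E x * pd k (e a) x + pd k E x * e a x)"
    by (simp add: pd_add pd_diff pd_mult pd_cmult diff_v[OF x] diff_e[OF x] dE differentiable_mult differentiable_add)
  also have "\<dots> = u a k x / (- R)"
    using R exhaust_2[of k] unfolding r_def pd_v[OF x] h u_def G_v[OF x, of k a, symmetric] \<Gamma>_sym[OF x, of _ 2 1]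
    by (auto simp: field_simps)
  finally show "pd k (fcoef E a) x = u a k x / (- R)" .
  have "ip (\<lambda>a. e a x) (\<lambda>a. fcoef E a x) = (ip (\<lambda>a. v 1 a x) (\<lambda>a. e a x) * pd 1 E x + ip (\<lambda>a. v 2 a x) (\<lambda>a. e a x) * pd 2 E x) / (- R)
    - E x * ip (\<lambda>a. e a x) (\<lambda>a. e a x)"
    using R by (simp add: ip_def fcoef_def field_simps)
  then show "ip (\<lambda>a. e a x) (\<lambda>a. fcoef E a x) = E x" by (simp add: ip_v_e ip_e x)
qed

text \<open>The coefficients of \<open>E\<close> have multiples of \<open>u\<close> as gradients,
  and their second derivatives commute; hence \<open>u\<close> is closed.\<close>

lemma is_hess_imp_divergence_free:
  assumes S: "smooth_mat S V" and E: "smooth_fun E V" "is_hess E" and x: "x \<in> V"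
  shows "Dstar G S j x = 0"
proof (rule Dstar_zero_if_closed[OF S x])
  fix a
  have du: "u a k differentiable (at x)" for k using smooth_u[OF S] x by (rule smooth_fun_differentiable)
  have pp: "pd l (pd k (fcoef E a)) x = inverse (- R) * pd l (u a k) x" for l k
  proof -
    have "pd l (pd k (fcoef E a)) x = pd l (\<lambda>x. inverse (- R) * u a k x) x"
      by (rule pd_cong[OF V x]) (simp add: fcoef(2)[OF E] divide_inverse mult.commute)
    then show ?thesis using pd_cmult[OF du, of l "inverse (- R)"] by (simp only:)
  qed
  show "pd 1 (u a 2) x = pd 2 (u a 1) x"
    using pd_commute[OF fcoef(1)[OF E, of a] V x, of 1 2] R unfolding pp by simp
qed

text \<open>\<open>u\<close> is orthogonal to \<open>e\<close>, so the derivative of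
  \<open>c\<close> drops out of the first derivative of \<open>E\<close>. It enters the second
  derivative through \<open>ip_u_de\<close> and contributes exactly the dual of
  \<open>S\<close>.\<close>

lemma is_hess_of_coeffs:
  assumes c: "\<And>a. smooth_fun (c a) V" "\<And>a k x. x \<in> V \<Longrightarrow> pd k (c a) x = u a k x / (- R)"
  defines "E \<equiv> \<lambda>x. ip (\<lambda>a. e a x) (\<lambda>a. c a x)"
  shows "smooth_fun E V" "is_hess E"
proof -
  have R': "R \<noteq> 0" using R by simp
  show "smooth_fun E V" unfolding E_def ip_def by (intro smooth_intros smooth_e c V)
  have dc: "x \<in> V \<Longrightarrow> c a differentiable (at x)" for a x using c(1) by (rule smooth_fun_differentiable)
  have ip_c: "ip h (\<lambda>a. pd k (c a) x) = ip (\<lambda>a. u a k x) h / (- R)" if "x \<in> V" for h k x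
    by (simp add: ip_def c(2)[OF that] add_divide_distrib diff_divide_distrib mult.commute[of "h _"])
  have 1: "pd k E x = ip (\<lambda>a. pd k (e a) x) (\<lambda>a. c a x)" if x: "x \<in> V" for k x
    unfolding E_def using pd_ip[of e x c k] dc[OF x] diff_e[OF x] by (simp add: ip_c x ip_u_e)
  have 2: "pd i (pd k E) x = ip (\<lambda>a. pd i (pd k (e a)) x) (\<lambda>a. c a x) + st i k x" if x: "x \<in> V" for i k x
  proof -
    have "pd i (pd k E) x = pd i (\<lambda>x. ip (\<lambda>a. pd k (e a) x) (\<lambda>a. c a x)) x"
      by (rule pd_cong[OF V x 1])
    then show ?thesis
      using pd_ip[of "\<lambda>a. pd k (e a)" x c i] dc[OF x] diff_e[OF x] R' by (simp add: ip_c x ip_u_de)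
  qed
  show "is_hess E"
    unfolding is_hess_def
  proof (intro ballI allI)
    fix x i j assume x: "x \<in> V"
    show "st i j x = pd i (pd j E) x - (\<Gamma> 1 i j x * pd 1 E x + \<Gamma> 2 i j x * pd 2 E x) + R * E x * G x $ i $ j"
      unfolding 1[OF x] 2[OF x] hessian_e[OF x] by (simp add: E_def ip_def algebra_simps)
  qed
qed

end

section \<open>The equations for locally integrable tensors\<close>

lemma L1_loc_smooth_mult: "smooth_fun a W \<Longrightarrow> L1_loc f W \<Longrightarrow> L1_loc (\<lambda>x. a x * f x) W"
  by (rule L1_loc_cont_mult[OF smooth_fun_continuous])

lemma L1_loc_minus: "L1_loc f W \<Longrightarrow> L1_loc (\<lambda>x. - f x) W"
  using L1_loc_cont_mult[of W "\<lambda>x. -1" f] by simp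

lemma L1_loc_diff: "L1_loc f W \<Longrightarrow> L1_loc g W \<Longrightarrow> L1_loc (\<lambda>x. f x - g x) W"
  using L1_loc_add[of f W "\<lambda>x. - g x"] L1_loc_minus by simp

lemmas has_bochner_intros = has_bochner_integral_minus has_bochner_integral_add
  has_bochner_integral_diff has_bochner_integral_sum

text \<open>Additivity is what \<open>local_imp_zero\<close> asks for in the passage from small open
  sets to a whole chart.\<close>

lemma (in metric_chart) dist_Dstar_additive:
  assumes S: "\<And>i j. L1_loc (\<lambda>x. S x $ i $ j) V" and \<phi>: "test_fun V \<phi>" "test_fun V \<psi>"
  shows "dist_Dstar G (\<lambda>k l. dist_of (\<lambda>x. S x $ k $ l)) j (\<lambda>x. \<phi> x + \<psi> x)
    = dist_Dstar G (\<lambda>k l. dist_of (\<lambda>x. S x $ k $ l)) j \<phi> + dist_Dstar G (\<lambda>k l. dist_of (\<lambda>x. S x $ k $ l)) j \<psi>"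
proof -
  note t = test_fun_mult[OF V smooth_I] test_fun_mult[OF V smooth_\<Gamma>]
  have p: "pd i (\<lambda>x. I i k x * \<phi> x + I i k x * \<psi> x) = (\<lambda>x. pd i (\<lambda>x. I i k x * \<phi> x) x + pd i (\<lambda>x. I i k x * \<psi> x) x)" for i k
    by (rule ext, rule pd_add[OF test_fun_differentiable test_fun_differentiable, OF t(1) t(1), OF \<phi>])
  show ?thesis
    unfolding dist_Dstar_def dist_scale_def dist_cov_deriv_def dist_pd_def distrib_left p
    by (simp add: dist_of_add[OF S] t \<phi> test_fun_pd sum.distrib sum_subtractf sum_negf)
qed

context frame_tensor
begin

context
  assumes L1_S: "\<And>i j. L1_loc (\<lambda>x. S x $ i $ j) V"
begin

abbreviation "TS \<equiv> \<lambda>k l. dist_of (\<lambda>x. S x $ k $ l)"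

lemma L1_A: "L1_loc (A i j) V"
  unfolding A_def[abs_def] by (intro L1_loc_add L1_loc_smooth_mult smooth_I L1_S)

lemma L1_b: "L1_loc (b j) V"
  unfolding b_def[abs_def]
  by (intro L1_loc_add L1_loc_minus L1_loc_smooth_mult smooth_fun_add smooth_\<Gamma> L1_A V)

lemma L1_st: "L1_loc (\<lambda>x. st k m x) V"
proof -
  have "L1_loc (\<lambda>x. det (G x) * (I 1 2 x * A 2 1 x + I 2 2 x * A 2 2 x)) V"
    "L1_loc (\<lambda>x. - (det (G x) * (I 1 1 x * A 2 1 x + I 1 2 x * A 2 2 x))) V"
    "L1_loc (\<lambda>x. - (det (G x) * (I 1 2 x * A 1 1 x + I 2 2 x * A 1 2 x))) V"
    "L1_loc (\<lambda>x. det (G x) * (I 1 1 x * A 1 1 x + I 1 2 x * A 1 2 x)) V"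
    by (intro L1_loc_minus L1_loc_add L1_loc_smooth_mult smooth_det smooth_I L1_A)+
  then show ?thesis
    using exhaust_2[of k] exhaust_2[of m]
    by (auto simp: L1_loc_cong[OF star_entries(1)] L1_loc_cong[OF star_entries(2)]
        L1_loc_cong[OF star_entries(3)] L1_loc_cong[OF star_entries(4)] mult.commute[of "A _ _ _"])
qed

lemma L1_u: "L1_loc (u a k) V"
proof -
  have "L1_loc (\<lambda>x. v 1 a x * st k 1 x + v 2 a x * st k 2 x) V"
    by (intro L1_loc_add L1_loc_smooth_mult smooth_v L1_st)
  then show ?thesis by (simp add: u_def[abs_def] mult.commute)
qed

text \<open>The weak counterpart of \<open>Dstar_eq\<close>: the derivative now falls on the inverse
  metric times the test function, and \<open>pd_I\<close> absorbs the part on the inverse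
  metric.\<close>

lemma weak_Dstar:
  assumes \<phi>: "test_fun V \<phi>"
  shows "dist_Dstar G TS j \<phi> = dist_of (A 1 j) (pd 1 \<phi>) + dist_of (A 2 j) (pd 2 \<phi>) + dist_of (b j) \<phi>"
proof (rule has_bochner_unique)
  note test = test_fun_pd test_fun_mult[OF V smooth_I] test_fun_mult[OF V smooth_\<Gamma>] \<phi>
  show "has_bochner_integral lebesgue
     (\<lambda>x. - (\<Sum>i\<in>UNIV. \<Sum>k\<in>UNIV. - (S x $ k $ j * pd i (\<lambda>x. I i k x * \<phi> x) x)
       - (\<Sum>l\<in>UNIV. S x $ l $ j * (\<Gamma> l i k x * (I i k x * \<phi> x)))
       - (\<Sum>l\<in>UNIV. S x $ k $ l * (\<Gamma> l i j x * (I i k x * \<phi> x)))))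
     (dist_Dstar G TS j \<phi>)"
    unfolding dist_Dstar_def dist_scale_def dist_cov_deriv_def dist_pd_def
    by (intro has_bochner_intros has_bochner_dist_of[where W = V] L1_S test)
  show "has_bochner_integral lebesgue (\<lambda>x. A 1 j x * pd 1 \<phi> x + A 2 j x * pd 2 \<phi> x + b j x * \<phi> x)
     (dist_of (A 1 j) (pd 1 \<phi>) + dist_of (A 2 j) (pd 2 \<phi>) + dist_of (b j) \<phi>)"
    by (intro has_bochner_intros has_bochner_dist_of[where W = V] L1_A L1_b test)
  fix x
  show "- (\<Sum>i\<in>UNIV. \<Sum>k\<in>UNIV. - (S x $ k $ j * pd i (\<lambda>x. I i k x * \<phi> x) x)
       - (\<Sum>l\<in>UNIV. S x $ l $ j * (\<Gamma> l i k x * (I i k x * \<phi> x)))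
       - (\<Sum>l\<in>UNIV. S x $ k $ l * (\<Gamma> l i j x * (I i k x * \<phi> x))))
    = A 1 j x * pd 1 \<phi> x + A 2 j x * pd 2 \<phi> x + b j x * \<phi> x"
  proof (cases "x \<in> V")
    case True
    show ?thesis
      unfolding pd_mult_test[OF smooth_I V \<phi>] pd_I[OF True] A_def b_def sum_2 \<Gamma>_sym[OF True, of _ 2 1] inv_sym[OF True, of 2 1]
      by (simp add: algebra_simps)
  next
    case False
    have "pd i (\<lambda>x. I i k x * \<phi> x) x = 0" "pd i \<phi> x = 0" "\<phi> x = 0" for i k
      using test_fun_outside[OF _ False] test by blast+
    then show ?thesis by simp
  qed
qed

lemma dist_Dstar_cmult:
  assumes "test_fun V \<phi>"
  shows "dist_Dstar G TS j (\<lambda>x. c * \<phi> x) = c * dist_Dstar G TS j \<phi>"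
proof -
  have "pd i (\<lambda>x. c * \<phi> x) = (\<lambda>x. c * pd i \<phi> x)" for i
    by (rule ext) (rule pd_cmult[OF test_fun_differentiable[OF assms]])
  then show ?thesis
    using assms by (simp add: weak_Dstar test_fun_cmult dist_of_cmult algebra_simps)
qed

text \<open>The weak counterpart of \<open>curl_u\<close>: with \<open>de\<close> times
  \<open>\<phi>\<close> as test function of the divergence, the second derivatives of
  \<open>e\<close> and the terms \<open>b\<close> cancel by \<open>curl_algebra\<close>.\<close>

lemma weak_curl:
  assumes \<phi>: "test_fun V \<phi>"
  shows "dist_of (u a 1) (pd 2 \<phi>) - dist_of (u a 2) (pd 1 \<phi>)
    = dist_Dstar G TS 2 (\<lambda>x. pd 1 (e a) x * \<phi> x) - dist_Dstar G TS 1 (\<lambda>x. pd 2 (e a) x * \<phi> x)"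
proof (rule has_bochner_unique)
  have te: "test_fun V (\<lambda>x. pd i (e a) x * \<phi> x)" for i
    by (rule test_fun_mult[OF V smooth_fun_pd[OF smooth_e] \<phi>])
  note test = test_fun_pd te \<phi>
  show "has_bochner_integral lebesgue (\<lambda>x. u a 1 x * pd 2 \<phi> x - u a 2 x * pd 1 \<phi> x)
    (dist_of (u a 1) (pd 2 \<phi>) - dist_of (u a 2) (pd 1 \<phi>))"
    by (intro has_bochner_intros has_bochner_dist_of[where W = V] L1_u test)
  show "has_bochner_integral lebesgue (\<lambda>x.
      (A 1 2 x * pd 1 (\<lambda>x. pd 1 (e a) x * \<phi> x) x + A 2 2 x * pd 2 (\<lambda>x. pd 1 (e a) x * \<phi> x) x + b 2 x * (pd 1 (e a) x * \<phi> x))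
      - (A 1 1 x * pd 1 (\<lambda>x. pd 2 (e a) x * \<phi> x) x + A 2 1 x * pd 2 (\<lambda>x. pd 2 (e a) x * \<phi> x) x + b 1 x * (pd 2 (e a) x * \<phi> x)))
    (dist_Dstar G TS 2 (\<lambda>x. pd 1 (e a) x * \<phi> x) - dist_Dstar G TS 1 (\<lambda>x. pd 2 (e a) x * \<phi> x))"
    unfolding weak_Dstar[OF te]
    by (intro has_bochner_intros has_bochner_dist_of[where W = V] L1_A L1_b test)
  fix x
  show "u a 1 x * pd 2 \<phi> x - u a 2 x * pd 1 \<phi> x
    = (A 1 2 x * pd 1 (\<lambda>x. pd 1 (e a) x * \<phi> x) x + A 2 2 x * pd 2 (\<lambda>x. pd 1 (e a) x * \<phi> x) x + b 2 x * (pd 1 (e a) x * \<phi> x))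
      - (A 1 1 x * pd 1 (\<lambda>x. pd 2 (e a) x * \<phi> x) x + A 2 1 x * pd 2 (\<lambda>x. pd 2 (e a) x * \<phi> x) x + b 1 x * (pd 2 (e a) x * \<phi> x))"
  proof (cases "x \<in> V")
    case True
    have p: "pd i (\<lambda>x. pd j (e a) x * \<phi> x) x = pd j (e a) x * pd i \<phi> x + pd i (pd j (e a)) x * \<phi> x" for i j
      by (rule pd_mult_test[OF smooth_fun_pd[OF smooth_e] V \<phi>])
    have "(A 1 2 x * pd 1 (\<lambda>x. pd 1 (e a) x * \<phi> x) x + A 2 2 x * pd 2 (\<lambda>x. pd 1 (e a) x * \<phi> x) x + b 2 x * (pd 1 (e a) x * \<phi> x))
      - (A 1 1 x * pd 1 (\<lambda>x. pd 2 (e a) x * \<phi> x) x + A 2 1 x * pd 2 (\<lambda>x. pd 2 (e a) x * \<phi> x) x + b 1 x * (pd 2 (e a) x * \<phi> x))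
      = u a 1 x * pd 2 \<phi> x - u a 2 x * pd 1 \<phi> x
      + ((A 1 2 x * pd 1 (pd 1 (e a)) x + A 2 2 x * pd 2 (pd 1 (e a)) x + b 2 x * pd 1 (e a) x)
         - (A 1 1 x * pd 1 (pd 2 (e a)) x + A 2 1 x * pd 2 (pd 2 (e a)) x + b 1 x * pd 2 (e a) x)) * \<phi> x"
      unfolding p u_eq[OF True] by (simp add: algebra_simps)
    then show ?thesis unfolding curl_algebra[OF True] by simp
  next
    case False
    have "pd i (\<lambda>x. pd j (e a) x * \<phi> x) x = 0" "pd i \<phi> x = 0" "\<phi> x = 0" for i j
      using test_fun_outside[OF _ False] test by blast+
    then show ?thesis by simp
  qed
qed

text \<open>As for smooth tensors the components are isolated by pairing with \<open>v\<close>; here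
  the factor \<open>v\<close> is put into the test function.\<close>

lemma weak_divergence_free_if_closed:
  assumes closed: "\<And>a \<phi>. test_fun V \<phi> \<Longrightarrow> dist_of (u a 1) (pd 2 \<phi>) = dist_of (u a 2) (pd 1 \<phi>)"
    and \<phi>: "test_fun V \<phi>"
  shows "dist_Dstar G TS j \<phi> = 0"
proof -
  have tv: "test_fun V (\<lambda>x. v l a x * \<phi> x)" for l a by (rule test_fun_mult[OF V smooth_v \<phi>])
  define D where "D j l i a = dist_Dstar G TS j (\<lambda>x. pd i (e a) x * (v l a x * \<phi> x))" for j l i a
  have D0: "D 2 l 1 a - D 1 l 2 a = 0" for l a
    unfolding D_def using weak_curl[OF tv[of l a], of a] closed[OF tv[of l a], of a] by simp
  \<comment> \<open>Summing the three components with the Lorentz signs reassembles the product of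
    \<open>v\<close> and \<open>de\<close>, which is constant, so that a multiple of
    \<open>\<phi>\<close> itself reappears.\<close>
  have sum: "D j l i 1 + D j l i 2 - D j l i 3 = (- R * (if l = i then 1 else 0)) * dist_Dstar G TS j \<phi>" for j l i
  proof -
    have t: "test_fun V (\<lambda>x. pd i (e a) x * (v l a x * \<phi> x))" for a
      by (rule test_fun_mult[OF V smooth_fun_pd[OF smooth_e] tv])
    have "D j l i 1 + D j l i 2 - D j l i 3
      = dist_Dstar G TS j (\<lambda>x. (pd i (e 1) x * (v l 1 x * \<phi> x) + pd i (e 2) x * (v l 2 x * \<phi> x)) + (-1) * (pd i (e 3) x * (v l 3 x * \<phi> x)))"
      unfolding D_def dist_Dstar_additive[OF L1_S test_fun_add[OF t t] test_fun_cmult[OF t]] dist_Dstar_additive[OF L1_S t t]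
        dist_Dstar_cmult[OF t]
      by simp
    also have "(\<lambda>x. (pd i (e 1) x * (v l 1 x * \<phi> x) + pd i (e 2) x * (v l 2 x * \<phi> x)) + (-1) * (pd i (e 3) x * (v l 3 x * \<phi> x)))
      = (\<lambda>x. (- R * (if l = i then 1 else 0)) * \<phi> x)"
    proof
      fix x
      have "(pd i (e 1) x * (v l 1 x * \<phi> x) + pd i (e 2) x * (v l 2 x * \<phi> x)) + (-1) * (pd i (e 3) x * (v l 3 x * \<phi> x))
        = ip (\<lambda>a. v l a x) (\<lambda>a. pd i (e a) x) * \<phi> x"
        by (simp add: ip_def algebra_simps)
      then show "(pd i (e 1) x * (v l 1 x * \<phi> x) + pd i (e 2) x * (v l 2 x * \<phi> x)) + (-1) * (pd i (e 3) x * (v l 3 x * \<phi> x))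
        = (- R * (if l = i then 1 else 0)) * \<phi> x"
        using ip_v_de[of x l i] test_fun_outside[OF \<phi>, of x] by (cases "x \<in> V") auto
    qed
    finally show ?thesis by (simp only: dist_Dstar_cmult[OF \<phi>])
  qed
  have "(- R * (if l = 1 then 1 else 0)) * dist_Dstar G TS 2 \<phi> - (- R * (if l = 2 then 1 else 0)) * dist_Dstar G TS 1 \<phi> = 0" for l :: 2
    unfolding sum[symmetric] using D0[of l 1] D0[of l 2] D0[of l 3] by simp
  from this[of 1] this[of 2] show ?thesis using R exhaust_2[of j] by auto
qed

lemma closed_if_weak_divergence_free:
  assumes div: "\<And>j \<phi>. test_fun V \<phi> \<Longrightarrow> dist_Dstar G TS j \<phi> = 0" and \<phi>: "test_fun V \<phi>"
  shows "dist_of (u a 1) (pd 2 \<phi>) = dist_of (u a 2) (pd 1 \<phi>)"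
  using weak_curl[OF \<phi>, of a] div test_fun_mult[OF V smooth_fun_pd[OF smooth_e] \<phi>] by simp

definition "weak_hess E \<longleftrightarrow> (\<forall>\<phi>. test_fun V \<phi> \<longrightarrow> (\<forall>i j. dist_of (\<lambda>x. st i j x) \<phi>
    = dist_hessian G (dist_of E) i j \<phi> + dist_of (\<lambda>x. R * G x $ i $ j * E x) \<phi>))"

text \<open>The formal adjoint of a component of \<nabla>d + R g: derivatives and coefficients act
  on the test function.\<close>

definition "hess_adj i j \<phi> x = pd j (pd i \<phi>) x + pd 1 (\<lambda>x. \<Gamma> 1 i j x * \<phi> x) x
  + pd 2 (\<lambda>x. \<Gamma> 2 i j x * \<phi> x) x + R * G x $ i $ j * \<phi> x"

lemma dist_hessian_eq:
  assumes E: "L1_loc E V" and \<phi>: "test_fun V \<phi>"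
  shows "dist_hessian G (dist_of E) i j \<phi> + dist_of (\<lambda>x. R * G x $ i $ j * E x) \<phi>
    = dist_of E (hess_adj i j \<phi>)" "test_fun V (hess_adj i j \<phi>)"
proof -
  have t: "test_fun V (pd j (pd i \<phi>))" "test_fun V (pd k (\<lambda>x. \<Gamma> k i j x * \<phi> x))" "test_fun V (\<lambda>x. R * G x $ i $ j * \<phi> x)" for k
    by (intro test_fun_pd test_fun_mult[OF V] smooth_\<Gamma> \<phi> smooth_fun_mult smooth_fun_const smooth_G V)+
  show "test_fun V (hess_adj i j \<phi>)" unfolding hess_adj_def[abs_def] by (intro test_fun_add t)
  have "dist_of (\<lambda>x. R * G x $ i $ j * E x) \<phi> = dist_of E (\<lambda>x. R * G x $ i $ j * \<phi> x)"
    by (simp add: dist_of_def mult.commute mult.left_commute)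
  then show "dist_hessian G (dist_of E) i j \<phi> + dist_of (\<lambda>x. R * G x $ i $ j * E x) \<phi> = dist_of E (hess_adj i j \<phi>)"
    by (simp add: hess_adj_def[abs_def] dist_hessian_def dist_pd_def dist_scale_def sum_2 dist_of_add[OF E] t test_fun_add)
qed

text \<open>The integrand is minus \<open>\<partial>\<^sub>k \<phi>\<close> tested against \<open>-R\<close> times the coefficients of \<open>E\<close> in the
  parallel frame.\<close>

lemma weak_hess_u:
  assumes E: "L1_loc E V" "weak_hess E" and \<phi>: "test_fun V \<phi>"
  shows "dist_of (u a k) \<phi>
    = dist_of E (\<lambda>x. pd 1 (\<lambda>x. v 1 a x * pd k \<phi> x) x + pd 2 (\<lambda>x. v 2 a x * pd k \<phi> x) x - R * (e a x * pd k \<phi> x))"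
    (is "_ = dist_of E ?\<Omega>")
proof -
  have tv: "test_fun V (\<lambda>x. v m a x * \<phi> x)" for m by (rule test_fun_mult[OF V smooth_v \<phi>])
  have tvk: "test_fun V (\<lambda>x. v m a x * pd k \<phi> x)" for m by (rule test_fun_mult[OF V smooth_v test_fun_pd[OF \<phi>]])
  have te: "test_fun V (\<lambda>x. e a x * \<phi> x)" by (rule test_fun_mult[OF V smooth_e \<phi>])
  have t\<Gamma>: "test_fun V (\<lambda>x. \<Gamma> l k m x * (v m a x * \<phi> x))" for l m
    by (rule test_fun_mult[OF V smooth_\<Gamma> tv])
  \<comment> \<open>\<open>hess_adj\<close> of \<open>v m a\<close> times \<open>\<phi>\<close>; the
    sum over \<open>m\<close> is the equation contracted with the gradient of
    \<open>e a\<close>.\<close>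
  define \<omega> where "\<omega> m x = pd m (pd k (\<lambda>x. v m a x * \<phi> x)) x + pd 1 (\<lambda>x. \<Gamma> 1 k m x * (v m a x * \<phi> x)) x
    + pd 2 (\<lambda>x. \<Gamma> 2 k m x * (v m a x * \<phi> x)) x + R * G x $ k $ m * (v m a x * \<phi> x)" for m x
  have \<omega>: "dist_of (\<lambda>x. st k m x) (\<lambda>x. v m a x * \<phi> x) = dist_of E (\<omega> m)" "test_fun V (\<omega> m)" for m
    using E(2) tv[of m] dist_hessian_eq[OF E(1) tv[of m], of k m] unfolding weak_hess_def \<omega>_def hess_adj_def[abs_def] by auto
  have "dist_of (u a k) \<phi> = dist_of (\<lambda>x. st k 1 x) (\<lambda>x. v 1 a x * \<phi> x) + dist_of (\<lambda>x. st k 2 x) (\<lambda>x. v 2 a x * \<phi> x)"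
  proof (rule has_bochner_unique)
    show "has_bochner_integral lebesgue (\<lambda>x. u a k x * \<phi> x) (dist_of (u a k) \<phi>)"
      by (rule has_bochner_dist_of[OF L1_u \<phi>])
    show "has_bochner_integral lebesgue (\<lambda>x. st k 1 x * (v 1 a x * \<phi> x) + st k 2 x * (v 2 a x * \<phi> x))
      (dist_of (\<lambda>x. st k 1 x) (\<lambda>x. v 1 a x * \<phi> x) + dist_of (\<lambda>x. st k 2 x) (\<lambda>x. v 2 a x * \<phi> x))"
      by (intro has_bochner_intros has_bochner_dist_of[where W = V] L1_st tv)
  qed (simp add: u_def algebra_simps)
  also have "\<dots> = dist_of E (\<lambda>x. \<omega> 1 x + \<omega> 2 x)"
    by (simp add: \<omega> dist_of_add[OF E(1)])
  also have "(\<lambda>x. \<omega> 1 x + \<omega> 2 x) = ?\<Omega>"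
  proof
    fix x
    \<comment> \<open>The Christoffel terms that come from \<open>pd_v\<close> cancel, after the
      second differentiation, those of \<open>\<omega>\<close> in the sum over
      \<open>m\<close>.\<close>
    have inner: "pd k (\<lambda>x. v m a x * \<phi> x) = (\<lambda>x. v m a x * pd k \<phi> x
        - (\<Gamma> m k 1 x * (v 1 a x * \<phi> x) + \<Gamma> m k 2 x * (v 2 a x * \<phi> x)) - (R * (if k = m then 1 else 0)) * (e a x * \<phi> x))" for m
    proof
      fix x
      show "pd k (\<lambda>x. v m a x * \<phi> x) x = v m a x * pd k \<phi> x
        - (\<Gamma> m k 1 x * (v 1 a x * \<phi> x) + \<Gamma> m k 2 x * (v 2 a x * \<phi> x)) - (R * (if k = m then 1 else 0)) * (e a x * \<phi> x)"
      proof (cases "x \<in> V")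
        case True
        show ?thesis unfolding pd_mult_test[OF smooth_v V \<phi>] pd_v[OF True] by (simp add: algebra_simps)
      next
        case False
        then show ?thesis
          unfolding pd_mult_test[OF smooth_v V \<phi>]
          by (simp add: test_fun_outside[OF \<phi>] test_fun_outside[OF test_fun_pd[OF \<phi>]])
      qed
    qed
    note d = test_fun_differentiable
    have mm: "pd m (pd k (\<lambda>x. v m a x * \<phi> x)) x = pd m (\<lambda>x. v m a x * pd k \<phi> x) x
       - (pd m (\<lambda>x. \<Gamma> m k 1 x * (v 1 a x * \<phi> x)) x + pd m (\<lambda>x. \<Gamma> m k 2 x * (v 2 a x * \<phi> x)) x)
       - (R * (if k = m then 1 else 0)) * pd m (\<lambda>x. e a x * \<phi> x) x" for m
      unfolding inner
      by (simp only: pd_diff[OF d d, OF test_fun_diff test_fun_cmult, OF tvk test_fun_add te, OF t\<Gamma> t\<Gamma>]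
        pd_diff[OF d d, OF tvk test_fun_add, OF t\<Gamma> t\<Gamma>] pd_add[OF d d, OF t\<Gamma> t\<Gamma>] pd_cmult[OF d, OF te])
    have Gv: "R * G x $ k $ 1 * (v 1 a x * \<phi> x) + R * G x $ k $ 2 * (v 2 a x * \<phi> x) = R * (pd k (e a) x * \<phi> x)"
    proof (cases "x \<in> V")
      case True
      show ?thesis unfolding G_v[OF True, symmetric] by (simp add: algebra_simps)
    qed (simp add: test_fun_outside[OF \<phi>])
    have "(R * (if k = 1 then 1 else 0)) * pd 1 (\<lambda>x. e a x * \<phi> x) x + (R * (if k = 2 then 1 else 0)) * pd 2 (\<lambda>x. e a x * \<phi> x) x
      = R * (e a x * pd k \<phi> x + pd k (e a) x * \<phi> x)"
      using exhaust_2[of k] by (auto simp: pd_mult_test[OF smooth_e V \<phi>])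
    then show "\<omega> 1 x + \<omega> 2 x = pd 1 (\<lambda>x. v 1 a x * pd k \<phi> x) x + pd 2 (\<lambda>x. v 2 a x * pd k \<phi> x) x - R * (e a x * pd k \<phi> x)"
      unfolding \<omega>_def mm using Gv by (simp add: algebra_simps)
  qed
  finally show ?thesis .
qed

text \<open>In \<open>weak_hess_u\<close> the test function occurs on the right only through
  \<open>pd k \<phi>\<close>; for the derivatives of a test function the two right-hand sides agree
  because second derivatives commute.\<close>

lemma weak_hess_imp_divergence_free:
  assumes E: "L1_loc E V" "weak_hess E" and \<phi>: "test_fun V \<phi>"
  shows "dist_Dstar G TS j \<phi> = 0"
proof (rule weak_divergence_free_if_closed[OF _ \<phi>])
  fix a \<phi> assume \<phi>: "test_fun V \<phi>"
  have "pd 1 (pd 2 \<phi>) = pd 2 (pd 1 \<phi>)"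
    by (rule ext) (rule pd_commute[OF test_fun_smooth[OF \<phi>, of UNIV] open_UNIV UNIV_I])
  then show "dist_of (u a 1) (pd 2 \<phi>) = dist_of (u a 2) (pd 1 \<phi>)"
    by (simp add: weak_hess_u[OF E test_fun_pd[OF \<phi>]])
qed

text \<open>As \<open>c\<close> is only weakly differentiable, the adjoint operator applied to
  \<open>\<phi>\<close> is multiplied by \<open>e a\<close> and rewritten as a sum of derivatives of
  test functions, on which \<open>c\<close> can be replaced by \<open>u\<close>.\<close>

lemma weak_hess_of_coeffs:
  assumes c: "\<And>a. weak_grad V (c a) (\<lambda>k x. u a k x / (- R))"
  defines "E \<equiv> \<lambda>x. ip (\<lambda>a. e a x) (\<lambda>a. c a x)"
  shows "L1_loc E V" "weak_hess E"
proof -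
  have cL: "L1_loc (c a) V" for a using c by (simp add: weak_grad_def)
  have cw: "dist_of (c a) (pd k \<psi>) = - dist_of (\<lambda>x. u a k x / (- R)) \<psi>" if "test_fun V \<psi>" for a k \<psi>
    using c that by (simp add: weak_grad_def)
  have uR: "dist_of (\<lambda>x. u a k x / (- R)) \<psi> = dist_of (u a k) \<psi> / (- R)" for a k \<psi>
    by (simp add: dist_of_def)
  show EL: "L1_loc E V"
    unfolding E_def ip_def by (intro L1_loc_add L1_loc_diff L1_loc_smooth_mult smooth_e cL)
  show "weak_hess E"
    unfolding weak_hess_def
  proof (intro allI impI)
    fix \<phi> i j assume \<phi>: "test_fun V \<phi>"
    define \<Omega> where "\<Omega> = hess_adj i j \<phi>"
    have \<Omega>: "dist_hessian G (dist_of E) i j \<phi> + dist_of (\<lambda>x. R * G x $ i $ j * E x) \<phi> = dist_of E \<Omega>" "test_fun V \<Omega>"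
      unfolding \<Omega>_def using dist_hessian_eq[OF EL \<phi>] by blast+
    have \<psi>: "test_fun V (\<lambda>x. e a x * pd i \<phi> x)" "test_fun V (\<lambda>x. pd j (e a) x * \<phi> x)"
      "test_fun V (\<lambda>x. e a x * (\<Gamma> k i j x * \<phi> x))" for a k
      by (intro test_fun_mult[OF V] smooth_e smooth_fun_pd smooth_\<Gamma> test_fun_pd \<phi>)+
    \<comment> \<open>By the product rule the two sides differ by the Hessian equation of
      \<open>e a\<close> times \<open>\<phi>\<close>, which is zero.\<close>
    have e\<Omega>: "e a x * \<Omega> x = pd j (\<lambda>x. e a x * pd i \<phi> x) x - pd i (\<lambda>x. pd j (e a) x * \<phi> x) x
      + pd 1 (\<lambda>x. e a x * (\<Gamma> 1 i j x * \<phi> x)) x + pd 2 (\<lambda>x. e a x * (\<Gamma> 2 i j x * \<phi> x)) x" for a x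
    proof -
      note p = pd_mult_test[OF smooth_e V test_fun_pd[OF \<phi>]] pd_mult_test[OF smooth_fun_pd[OF smooth_e] V \<phi>]
        pd_mult_test[OF smooth_e V test_fun_mult[OF V smooth_\<Gamma> \<phi>]]
      have "(pd i (pd j (e a)) x - \<Gamma> 1 i j x * pd 1 (e a) x - \<Gamma> 2 i j x * pd 2 (e a) x + R * G x $ i $ j * e a x) * \<phi> x = 0"
        using hessian_e[of x i j a] test_fun_outside[OF \<phi>, of x] by (cases "x \<in> V") auto
      then show ?thesis unfolding \<Omega>_def hess_adj_def p by (simp add: algebra_simps)
    qed
    have te\<Omega>: "test_fun V (\<lambda>x. e a x * \<Omega> x)" for a by (rule test_fun_mult[OF V smooth_e \<Omega>(2)])
    have part: "dist_of (c a) (\<lambda>x. e a x * \<Omega> x) = (dist_of (u a j) (\<lambda>x. e a x * pd i \<phi> x) - dist_of (u a i) (\<lambda>x. pd j (e a) x * \<phi> x)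
      + dist_of (u a 1) (\<lambda>x. e a x * (\<Gamma> 1 i j x * \<phi> x)) + dist_of (u a 2) (\<lambda>x. e a x * (\<Gamma> 2 i j x * \<phi> x))) / R" for a
    proof -
      note t = test_fun_pd[OF \<psi>(1)] test_fun_pd[OF \<psi>(2)] test_fun_pd[OF \<psi>(3)]
      have "dist_of (c a) (\<lambda>x. e a x * \<Omega> x) = dist_of (c a) (pd j (\<lambda>x. e a x * pd i \<phi> x)) - dist_of (c a) (pd i (\<lambda>x. pd j (e a) x * \<phi> x))
        + dist_of (c a) (pd 1 (\<lambda>x. e a x * (\<Gamma> 1 i j x * \<phi> x))) + dist_of (c a) (pd 2 (\<lambda>x. e a x * (\<Gamma> 2 i j x * \<phi> x)))"
        unfolding e\<Omega> by (simp add: dist_of_add[OF cL] dist_of_diff[OF cL] t test_fun_add test_fun_diff)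
      then show ?thesis unfolding cw[OF \<psi>(1)] cw[OF \<psi>(2)] cw[OF \<psi>(3)] uR
        by (simp add: add_divide_distrib diff_divide_distrib)
    qed
    have R': "R \<noteq> 0" using R by simp
    note tests = \<psi> \<Omega>(2) te\<Omega> \<phi>
    have 1: "dist_of E \<Omega> = dist_of (c 1) (\<lambda>x. e 1 x * \<Omega> x) + dist_of (c 2) (\<lambda>x. e 2 x * \<Omega> x) - dist_of (c 3) (\<lambda>x. e 3 x * \<Omega> x)"
    proof (rule has_bochner_unique)
      show "has_bochner_integral lebesgue (\<lambda>x. E x * \<Omega> x) (dist_of E \<Omega>)" by (rule has_bochner_dist_of[OF EL \<Omega>(2)])
      show "has_bochner_integral lebesgue (\<lambda>x. c 1 x * (e 1 x * \<Omega> x) + c 2 x * (e 2 x * \<Omega> x) - c 3 x * (e 3 x * \<Omega> x))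
        (dist_of (c 1) (\<lambda>x. e 1 x * \<Omega> x) + dist_of (c 2) (\<lambda>x. e 2 x * \<Omega> x) - dist_of (c 3) (\<lambda>x. e 3 x * \<Omega> x))"
        by (intro has_bochner_intros has_bochner_dist_of[where W = V] cL te\<Omega>)
    qed (simp add: E_def ip_def algebra_simps)
    \<comment> \<open>The integrand after the weak gradient of \<open>c a\<close> has been replaced
      by \<open>u a\<close>; its Lorentz sum is evaluated by \<open>ip_u_e\<close> and
      \<open>ip_u_de\<close>.\<close>
    define f where "f a x = (u a j x * (e a x * pd i \<phi> x) - u a i x * (pd j (e a) x * \<phi> x)
      + u a 1 x * (e a x * (\<Gamma> 1 i j x * \<phi> x)) + u a 2 x * (e a x * (\<Gamma> 2 i j x * \<phi> x))) / R" for a x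
    have 2: "has_bochner_integral lebesgue (f a) (dist_of (c a) (\<lambda>x. e a x * \<Omega> x))" for a
      unfolding part f_def
      by (intro has_bochner_integral_divide has_bochner_intros has_bochner_dist_of[where W = V] L1_u \<psi> R')
    have "dist_of (\<lambda>x. st i j x) \<phi> = dist_of E \<Omega>"
      unfolding 1
    proof (rule has_bochner_unique)
      show "has_bochner_integral lebesgue (\<lambda>x. st i j x * \<phi> x) (dist_of (\<lambda>x. st i j x) \<phi>)"
        by (rule has_bochner_dist_of[OF L1_st \<phi>])
      show "has_bochner_integral lebesgue (\<lambda>x. f 1 x + f 2 x - f 3 x)
        (dist_of (c 1) (\<lambda>x. e 1 x * \<Omega> x) + dist_of (c 2) (\<lambda>x. e 2 x * \<Omega> x) - dist_of (c 3) (\<lambda>x. e 3 x * \<Omega> x))"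
        by (intro has_bochner_intros 2)
      fix x
      show "st i j x * \<phi> x = f 1 x + f 2 x - f 3 x"
      proof (cases "x \<in> V")
        case True
        have "f 1 x + f 2 x - f 3 x = (ip (\<lambda>a. u a j x) (\<lambda>a. e a x) * pd i \<phi> x - ip (\<lambda>a. u a i x) (\<lambda>a. pd j (e a) x) * \<phi> x
          + ip (\<lambda>a. u a 1 x) (\<lambda>a. e a x) * (\<Gamma> 1 i j x * \<phi> x) + ip (\<lambda>a. u a 2 x) (\<lambda>a. e a x) * (\<Gamma> 2 i j x * \<phi> x)) / R"
          unfolding f_def ip_def add_divide_distrib[symmetric] diff_divide_distrib[symmetric] by (simp add: algebra_simps)
        then show ?thesis using R' by (simp add: ip_u_e[OF True] ip_u_de[OF True])
      next
        case False
        then show ?thesis using test_fun_outside[OF \<phi>] test_fun_outside[OF test_fun_pd[OF \<phi>]] by (simp add: f_def)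
      qed
    qed
    then show "dist_of (\<lambda>x. st i j x) \<phi> = dist_hessian G (dist_of E) i j \<phi> + dist_of (\<lambda>x. R * G x $ i $ j * E x) \<phi>"
      using \<Omega>(1) by simp
  qed
qed

end

end

section \<open>Restriction and change of charts for frames and for \<open>u\<close>\<close>

lemma metric_chart_subset:
  assumes "metric_chart G V" "open W" "W \<subseteq> V"
  shows "metric_chart G W"
  using assms smooth_fun_subset unfolding metric_chart_def smooth_mat_def by blast

lemma hyp_frame_subset:
  assumes "hyp_frame G V R e" "open W" "W \<subseteq> V"
  shows "hyp_frame G W R e"
  using assms metric_chart_subset smooth_fun_subset unfolding hyp_frame_def hyp_frame_axioms_def by blast

lemma jacobian_nth:
  fixes F :: "real^2 \<Rightarrow> real^2"
  assumes "\<And>k. (\<lambda>x. F x $ k) differentiable (at x)"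
  shows "jacobian F (at x) $ k $ i = pd i (\<lambda>x. F x $ k) x"
proof -
  have "(F has_derivative (\<lambda>h. \<chi> k. \<Sum>j\<in>UNIV. h $ j * pd j (\<lambda>x. F x $ k) x)) (at x)"
    by (rule has_derivative_vecI) (simp add: has_derivative_pd assms)
  then have "frechet_derivative F (at x) = (\<lambda>h. \<chi> k. \<Sum>j\<in>UNIV. h $ j * pd j (\<lambda>x. F x $ k) x)"
    by (rule frechet_derivative_at[symmetric])
  then show ?thesis by (simp add: jacobian_def matrix_def)
qed

lemma pullback_nth:
  fixes F :: "real^2 \<Rightarrow> real^2"
  assumes "\<And>k. (\<lambda>x. F x $ k) differentiable (at x)"
  defines "J \<equiv> \<lambda>k i. pd i (\<lambda>x. F x $ k) x"
  shows "pullback F T x $ i $ j = J 1 i * (T (F x) $ 1 $ 1 * J 1 j + T (F x) $ 1 $ 2 * J 2 j)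
    + J 2 i * (T (F x) $ 2 $ 1 * J 1 j + T (F x) $ 2 $ 2 * J 2 j)"
  unfolding pullback_def J_def
  by (simp add: matrix_matrix_mult_def transpose_def sum_2 jacobian_nth[OF assms(1)] algebra_simps)

lemma hyp_frame_pullback:
  assumes "hyp_frame G V R e" and G': "metric_chart G' V'"
    and \<tau>: "smooth_map \<tau> V'" "\<tau> ` V' \<subseteq> V" and pb: "\<And>x. x \<in> V' \<Longrightarrow> G' x = pullback \<tau> G x"
  shows "hyp_frame G' V' R (\<lambda>a x. e a (\<tau> x))"
proof -
  interpret hyp_frame G V R e by fact
  interpret G': metric_chart G' V' by fact
  show ?thesis
  proof unfold_locales
    show "R < 0" by (rule R)
    show "smooth_fun (\<lambda>x. e a (\<tau> x)) V'" for a
      by (rule smooth_fun_compose[OF G'.V V \<tau> smooth_e])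
    fix x assume x: "x \<in> V'"
    then have \<tau>x: "\<tau> x \<in> V" using \<tau> by blast
    show "ip (\<lambda>a. e a (\<tau> x)) (\<lambda>a. e a (\<tau> x)) = -1" by (rule ip_e[OF \<tau>x])
    fix i j
    define J where "J k i = pd i (\<lambda>x. \<tau> x $ k) x" for k i
    have d\<tau>: "(\<lambda>x. \<tau> x $ k) differentiable (at x)" for k
      using \<tau>(1) x smooth_fun_differentiable unfolding smooth_map_def by blast
    have p: "pd i (\<lambda>x. e a (\<tau> x)) x = pd 1 (e a) (\<tau> x) * J 1 i + pd 2 (e a) (\<tau> x) * J 2 i" for a i
      using pd_compose(2)[OF d\<tau> diff_e(1)[OF \<tau>x]] by (simp add: sum_2 J_def)
    have "ip (\<lambda>a. pd i (\<lambda>x. e a (\<tau> x)) x) (\<lambda>a. pd j (\<lambda>x. e a (\<tau> x)) x)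
      = J 1 i * (ip (\<lambda>a. pd 1 (e a) (\<tau> x)) (\<lambda>a. pd 1 (e a) (\<tau> x)) * J 1 j + ip (\<lambda>a. pd 1 (e a) (\<tau> x)) (\<lambda>a. pd 2 (e a) (\<tau> x)) * J 2 j)
      + J 2 i * (ip (\<lambda>a. pd 2 (e a) (\<tau> x)) (\<lambda>a. pd 1 (e a) (\<tau> x)) * J 1 j + ip (\<lambda>a. pd 2 (e a) (\<tau> x)) (\<lambda>a. pd 2 (e a) (\<tau> x)) * J 2 j)"
      unfolding p by (simp add: ip_def algebra_simps)
    then show "ip (\<lambda>a. pd i (\<lambda>x. e a (\<tau> x)) x) (\<lambda>a. pd j (\<lambda>x. e a (\<tau> x)) x) = - R * G' x $ i $ j"
      unfolding ip_de[OF \<tau>x] pb[OF x] pullback_nth[OF d\<tau>] J_def by (simp add: algebra_simps)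
  qed
qed

text \<open>Multiplied by the determinant, \<open>u\<close> becomes polynomial in \<open>G\<close>,
  \<open>S\<close> and \<open>de\<close>, so that its transformation law is a polynomial
  identity.\<close>

lemma (in frame_tensor) det_u:
  assumes x: "x \<in> V"
  shows "det (G x) * u a 1 x = (G x $ 1 $ 1 * S x $ 2 $ 2 - G x $ 1 $ 2 * S x $ 1 $ 2) * pd 1 (e a) x
      - (G x $ 1 $ 1 * S x $ 1 $ 2 - G x $ 1 $ 2 * S x $ 1 $ 1) * pd 2 (e a) x"
    "det (G x) * u a 2 x = (G x $ 2 $ 2 * S x $ 1 $ 1 - G x $ 1 $ 2 * S x $ 1 $ 2) * pd 2 (e a) x
      - (G x $ 2 $ 2 * S x $ 1 $ 2 - G x $ 1 $ 2 * S x $ 2 $ 2) * pd 1 (e a) x"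
proof -
  have d: "det (G x) \<noteq> 0" using det_pos[OF x] by simp
  have "det (G x) * A i j x = (det (G x) * I i 1 x) * S x $ 1 $ j + (det (G x) * I i 2 x) * S x $ 2 $ j" for i j
    by (simp add: A_def algebra_simps)
  note A' = this
  have I': "det (G x) * I 1 1 x = G x $ 2 $ 2" "det (G x) * I 1 2 x = - G x $ 1 $ 2"
    "det (G x) * I 2 1 x = - G x $ 1 $ 2" "det (G x) * I 2 2 x = G x $ 1 $ 1"
    using d by (simp_all add: inv_G[OF x])
  have "det (G x) * u a 1 x = (det (G x) * A 2 2 x) * pd 1 (e a) x - (det (G x) * A 2 1 x) * pd 2 (e a) x"
    "det (G x) * u a 2 x = (det (G x) * A 1 1 x) * pd 2 (e a) x - (det (G x) * A 1 2 x) * pd 1 (e a) x"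
    unfolding u_eq[OF x] by (simp_all add: algebra_simps)
  then show "det (G x) * u a 1 x = (G x $ 1 $ 1 * S x $ 2 $ 2 - G x $ 1 $ 2 * S x $ 1 $ 2) * pd 1 (e a) x
      - (G x $ 1 $ 1 * S x $ 1 $ 2 - G x $ 1 $ 2 * S x $ 1 $ 1) * pd 2 (e a) x"
    "det (G x) * u a 2 x = (G x $ 2 $ 2 * S x $ 1 $ 1 - G x $ 1 $ 2 * S x $ 1 $ 2) * pd 2 (e a) x
      - (G x $ 2 $ 2 * S x $ 1 $ 2 - G x $ 1 $ 2 * S x $ 2 $ 2) * pd 1 (e a) x"
    unfolding A' I' S_sym[OF x, of 2 1] by (simp_all add: algebra_simps)
qed

text \<open>\<open>u\<close> is a genuine one-form: the star is applied to both indices, so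
  orientation does not matter. The determinants of the two metrics differ by the square of the
  Jacobian determinant \<open>j\<close>, and after multiplication by them the claim is
  algebraic.\<close>

lemma u_pullback:
  assumes "frame_tensor G V R e S" and "frame_tensor G' V' R (\<lambda>a x. e a (\<tau> x)) S'"
    and \<tau>: "smooth_map \<tau> V'" "\<tau> ` V' \<subseteq> V"
    and pb: "\<And>x. x \<in> V' \<Longrightarrow> G' x = pullback \<tau> G x" "\<And>x. x \<in> V' \<Longrightarrow> S' x = pullback \<tau> S x" and x: "x \<in> V'"
  shows "frame_tensor.u G' (\<lambda>a x. e a (\<tau> x)) S' a i x
    = (\<Sum>k\<in>UNIV. frame_tensor.u G e S a k (\<tau> x) * pd i (\<lambda>x. \<tau> x $ k) x)"
proof -
  interpret frame_tensor G V R e S by fact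
  interpret F': frame_tensor G' V' R "\<lambda>a x. e a (\<tau> x)" S' by fact
  have \<tau>x: "\<tau> x \<in> V" using \<tau> x by blast
  define J where "J k i = pd i (\<lambda>x. \<tau> x $ k) x" for k i
  have d\<tau>: "(\<lambda>x. \<tau> x $ k) differentiable (at x)" for k
    using \<tau>(1) x smooth_fun_differentiable unfolding smooth_map_def by blast
  have p: "pd i (\<lambda>x. e a (\<tau> x)) x = pd 1 (e a) (\<tau> x) * J 1 i + pd 2 (e a) (\<tau> x) * J 2 i" for i
    using pd_compose(2)[OF d\<tau> diff_e(1)[OF \<tau>x]] by (simp add: sum_2 J_def)
  define j where "j = J 1 1 * J 2 2 - J 1 2 * J 2 1"
  have G'x: "G' x $ i $ l = J 1 i * (G (\<tau> x) $ 1 $ 1 * J 1 l + G (\<tau> x) $ 1 $ 2 * J 2 l) + J 2 i * (G (\<tau> x) $ 1 $ 2 * J 1 l + G (\<tau> x) $ 2 $ 2 * J 2 l)"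
    and S'x: "S' x $ i $ l = J 1 i * (S (\<tau> x) $ 1 $ 1 * J 1 l + S (\<tau> x) $ 1 $ 2 * J 2 l) + J 2 i * (S (\<tau> x) $ 1 $ 2 * J 1 l + S (\<tau> x) $ 2 $ 2 * J 2 l)" for i l
    using pb[OF x] G_sym[OF \<tau>x, of 2 1] S_sym[OF \<tau>x, of 2 1] by (simp_all add: pullback_nth[OF d\<tau>] J_def)
  have det: "det (G' x) = j * j * det (G (\<tau> x))"
    unfolding F'.det_G[OF x] det_G[OF \<tau>x] G'x j_def by (simp add: algebra_simps)
  then have j: "j * j * det (G (\<tau> x)) \<noteq> 0" using F'.det_pos[OF x] by linarith
  define U where "U k = det (G (\<tau> x)) * u a k (\<tau> x)" for k
  have "j * j * det (G (\<tau> x)) * F'.u a i x = j * j * (J 1 i * U 1 + J 2 i * U 2)"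
  proof -
    have "det (G' x) * F'.u a 1 x = j * j * (J 1 1 * U 1 + J 2 1 * U 2)"
      unfolding F'.det_u[OF x] U_def det_u[OF \<tau>x] p G'x S'x j_def by algebra
    moreover have "det (G' x) * F'.u a 2 x = j * j * (J 1 2 * U 1 + J 2 2 * U 2)"
      unfolding F'.det_u[OF x] U_def det_u[OF \<tau>x] p G'x S'x j_def by algebra
    ultimately show ?thesis using exhaust_2[of i] det by auto
  qed
  also have "\<dots> = j * j * det (G (\<tau> x)) * (J 1 i * u a 1 (\<tau> x) + J 2 i * u a 2 (\<tau> x))"
    by (simp add: U_def algebra_simps)
  finally have "F'.u a i x = J 1 i * u a 1 (\<tau> x) + J 2 i * u a 2 (\<tau> x)" using j by simp
  then show ?thesis by (simp add: sum_2 J_def mult.commute)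
qed

section \<open>The hyperboloid model of the upper half plane\<close>

lemma vector_3_nth: "(vector [x, y, z] :: real^3) $ 1 = x" "(vector [x, y, z] :: real^3) $ 2 = y" "(vector [x, y, z] :: real^3) $ 3 = z"
  by (rule vector_3)+

lemma open_H2: "open H2"
  unfolding H2_def by (intro open_Collect_less continuous_intros)

lemma hyp_metric_nth: "hyp_metric R z $ i $ j = (if i = j then 1 / (- R * (z $ 2)\<^sup>2) else 0)"
  by (simp add: hyp_metric_def mat_def)

lemma det_hyp_metric: "det (hyp_metric R z) = (1 / (- R * (z $ 2)\<^sup>2))\<^sup>2"
  by (simp add: det_2 hyp_metric_nth power2_eq_square)

lemma metric_chart_hyp:
  assumes R: "R < 0"
  shows "metric_chart (hyp_metric R) H2"
proof
  show "smooth_mat (hyp_metric R) H2"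
    unfolding smooth_mat_def hyp_metric_nth
    by (auto intro!: smooth_intros open_H2) (use R in \<open>auto simp: H2_def\<close>)
  fix x assume "x \<in> H2"
  then show "det (hyp_metric R x) > 0" using R by (auto simp: det_hyp_metric H2_def)
  show "transpose (hyp_metric R x) = hyp_metric R x"
    by (auto simp: vec_eq_iff transpose_def hyp_metric_nth)
qed (rule open_H2)

lemma hyperboloid_derivs:
  assumes z: "z \<in> H2"
  shows "pd 1 (\<lambda>z. hyperboloid z $ 1) z = 1 / z $ 2" "pd 2 (\<lambda>z. hyperboloid z $ 1) z = - z $ 1 / (z $ 2)\<^sup>2"
    "pd 1 (\<lambda>z. hyperboloid z $ 2) z = z $ 1 / z $ 2" "pd 2 (\<lambda>z. hyperboloid z $ 2) z = ((z $ 2)\<^sup>2 - (z $ 1)\<^sup>2 + 1) / (2 * (z $ 2)\<^sup>2)"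
    "pd 1 (\<lambda>z. hyperboloid z $ 3) z = z $ 1 / z $ 2" "pd 2 (\<lambda>z. hyperboloid z $ 3) z = ((z $ 2)\<^sup>2 - (z $ 1)\<^sup>2 - 1) / (2 * (z $ 2)\<^sup>2)"
proof -
  have z2: "z $ 2 \<noteq> 0" using z by (auto simp: H2_def)
  have 1: "((\<lambda>z. hyperboloid z $ 1) has_derivative (\<lambda>h. (h $ 1 * z $ 2 - z $ 1 * h $ 2) / (z $ 2)\<^sup>2)) (at z)"
    unfolding hyperboloid_def vector_3_nth using z2
    by (auto intro!: derivative_eq_intros has_derivative_coord simp: field_simps power2_eq_square)
  have 2: "((\<lambda>z. hyperboloid z $ 2) has_derivative (\<lambda>h. (2 * z $ 1 * h $ 1 * z $ 2 + ((z $ 2)\<^sup>2 - (z $ 1)\<^sup>2 + 1) * h $ 2) / (2 * (z $ 2)\<^sup>2))) (at z)"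
    unfolding hyperboloid_def vector_3_nth using z2
    by (auto intro!: derivative_eq_intros has_derivative_coord simp: field_simps power2_eq_square)
  have 3: "((\<lambda>z. hyperboloid z $ 3) has_derivative (\<lambda>h. (2 * z $ 1 * h $ 1 * z $ 2 + ((z $ 2)\<^sup>2 - (z $ 1)\<^sup>2 - 1) * h $ 2) / (2 * (z $ 2)\<^sup>2))) (at z)"
    unfolding hyperboloid_def vector_3_nth using z2
    by (auto intro!: derivative_eq_intros has_derivative_coord simp: field_simps power2_eq_square)
  show "pd 1 (\<lambda>z. hyperboloid z $ 1) z = 1 / z $ 2" "pd 2 (\<lambda>z. hyperboloid z $ 1) z = - z $ 1 / (z $ 2)\<^sup>2"
    "pd 1 (\<lambda>z. hyperboloid z $ 2) z = z $ 1 / z $ 2" "pd 2 (\<lambda>z. hyperboloid z $ 2) z = ((z $ 2)\<^sup>2 - (z $ 1)\<^sup>2 + 1) / (2 * (z $ 2)\<^sup>2)"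
    "pd 1 (\<lambda>z. hyperboloid z $ 3) z = z $ 1 / z $ 2" "pd 2 (\<lambda>z. hyperboloid z $ 3) z = ((z $ 2)\<^sup>2 - (z $ 1)\<^sup>2 - 1) / (2 * (z $ 2)\<^sup>2)"
    using z2 by (simp_all add: pd_eqI[OF 1] pd_eqI[OF 2] pd_eqI[OF 3] axis_def power2_eq_square)
qed

lemma hyp_frame_hyperboloid:
  assumes R: "R < 0"
  shows "hyp_frame (hyp_metric R) H2 R (\<lambda>a z. hyperboloid z $ a)"
proof -
  interpret metric_chart "hyp_metric R" H2 by (rule metric_chart_hyp[OF R])
  show ?thesis
  proof unfold_locales
    show "R < 0" by fact
    have nz: "z $ 2 \<noteq> 0" "2 * z $ 2 \<noteq> 0" if "z \<in> H2" for z using that by (auto simp: H2_def)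
    have "smooth_fun (\<lambda>z. hyperboloid z $ 1) H2" "smooth_fun (\<lambda>z. hyperboloid z $ 2) H2" "smooth_fun (\<lambda>z. hyperboloid z $ 3) H2"
      unfolding hyperboloid_def vector_3_nth by (intro smooth_intros open_H2 nz; assumption)+
    then show "smooth_fun (\<lambda>z. hyperboloid z $ a) H2" for a using exhaust_3[of a] by auto
    fix z assume z: "z \<in> H2"
    then have z2: "z $ 2 \<noteq> 0" by (auto simp: H2_def)
    then show "ip (\<lambda>a. hyperboloid z $ a) (\<lambda>a. hyperboloid z $ a) = -1"
      by (simp add: ip_def hyperboloid_def vector_3_nth field_simps power2_eq_square)
    fix i j
    show "ip (\<lambda>a. pd i (\<lambda>z. hyperboloid z $ a) z) (\<lambda>a. pd j (\<lambda>z. hyperboloid z $ a) z) = - R * hyp_metric R z $ i $ j"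
      using exhaust_2[of i] exhaust_2[of j] z2 R
      by (auto simp: ip_def hyperboloid_derivs[OF z] hyp_metric_nth field_simps power2_eq_square)
  qed
qed

section \<open>Killing fields\<close>

lemma equal_pd_imp_diff_const:
  assumes "open W" "connected W" "smooth_fun E W" "smooth_fun E' W"
    and eq: "\<And>x j. x \<in> W \<Longrightarrow> pd j E x = pd j E' x"
  shows "\<exists>a. \<forall>x\<in>W. E' x = E x + a"
proof (cases "W = {}")
  case False
  then obtain x0 where x0: "x0 \<in> W" by blast
  have D: "((\<lambda>x. E' x - E x) has_derivative (\<lambda>h. 0)) (at x)" if x: "x \<in> W" for x
  proof -
    have "((\<lambda>x. E' x - E x) has_derivative (\<lambda>h. (\<Sum>j\<in>UNIV. h $ j * pd j E' x) - (\<Sum>j\<in>UNIV. h $ j * pd j E x))) (at x)"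
      using assms(3,4) x by (intro has_derivative_diff has_derivative_pd smooth_fun_differentiable)
    then show ?thesis by (simp add: eq x)
  qed
  have "E' x - E x = E' x0 - E x0" if "x \<in> W" for x
    by (rule has_derivative_zero_unique_connected[OF assms(1,2) D that x0])
  then show ?thesis by (intro exI[of _ "E' x0 - E x0"]) (simp add: algebra_simps)
qed simp

context metric_chart
begin

lemma hamiltonian_iff:
  "hamiltonian_field G V E X \<longleftrightarrow>
    (\<forall>x\<in>V. pd 1 E x = - (X x $ 2 * sqrt (det (G x))) \<and> pd 2 E x = X x $ 1 * sqrt (det (G x)))"
  by (auto simp: hamiltonian_field_def forall_2 sum_2 area_form_def)

lemma in_kernel_iff:
  "in_kernel G R V E \<longleftrightarrow> smooth_fun E V \<and> (\<forall>x\<in>V. \<forall>i j.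
    pd i (pd j E) x = \<Gamma> 1 i j x * pd 1 E x + \<Gamma> 2 i j x * pd 2 E x - R * E x * G x $ i $ j)"
  by (auto simp: in_kernel_def hessian_def vec_eq_iff sum_2 algebra_simps)

lemma in_kernel_cong:
  assumes "\<And>x. x \<in> V \<Longrightarrow> E x = E' x"
  shows "in_kernel G R V E \<longleftrightarrow> in_kernel G R V E'"
proof -
  have 1: "pd j E x = pd j E' x" if "x \<in> V" for j x
    by (rule pd_cong[OF V that assms])
  have 2: "pd i (pd j E) x = pd i (pd j E') x" if "x \<in> V" for i j x
    by (rule pd_cong[OF V that 1])
  show ?thesis
    unfolding in_kernel_iff using smooth_fun_cong[OF V, of E E'] assms 1 2 by auto
qed

text \<open>Two Hamiltonians of one field differ by a constant on the connected \<open>V\<close>,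
  and a constant \<open>a\<close> between two kernel elements gives \<open>R * a * G = 0\<close>,
  hence \<open>a = 0\<close>. Existence in both directions therefore suffices.\<close>

lemma kernel_correspondsI:
  assumes R: "R \<noteq> 0" and "connected V"
    and 1: "\<And>E. in_kernel G R V E \<Longrightarrow> \<exists>X. F X \<and> hamiltonian_field G V E X"
    and 2: "\<And>X. F X \<Longrightarrow> \<exists>E. in_kernel G R V E \<and> hamiltonian_field G V E X"
  shows "kernel_corresponds G R V F"
proof -
  have const: "\<exists>a. \<forall>x\<in>V. E' x = E x + a"
    if "smooth_fun E V" "smooth_fun E' V" "hamiltonian_field G V E X" "hamiltonian_field G V E' X" for E E' X
  proof (rule equal_pd_imp_diff_const[OF V \<open>connected V\<close> that(1,2)])
    fix x j assume "x \<in> V"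
    then show "pd j E x = pd j E' x"
      using that(3,4) exhaust_2[of j] unfolding hamiltonian_iff by auto
  qed
  have pd_plus: "pd j (\<lambda>x. E x + a) x = pd j E x" if "smooth_fun E V" "x \<in> V" for E a j x
    using that by (subst pd_add) (auto intro: smooth_fun_differentiable)
  have uniq: "E' x = E x" if k: "in_kernel G R V E" "in_kernel G R V E'" and h: "hamiltonian_field G V E X" "hamiltonian_field G V E' X"
    and x: "x \<in> V" for E E' X x
  proof -
    have s: "smooth_fun E V" "smooth_fun E' V" using k in_kernel_def by blast+
    obtain a where a: "\<And>x. x \<in> V \<Longrightarrow> E' x = E x + a" using const[OF s h] by blast
    have "in_kernel G R V (\<lambda>x. E x + a)" using k(2) in_kernel_cong[OF a] by simp
    moreover have "pd i (pd j (\<lambda>x. E x + a)) x = pd i (pd j E) x" for i j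
      by (rule pd_cong[OF V x pd_plus[OF s(1)]])
    ultimately have K: "pd i (pd j E) x = \<Gamma> 1 i j x * pd 1 E x + \<Gamma> 2 i j x * pd 2 E x - R * (E x + a) * G x $ i $ j" for i j
      using x pd_plus[OF s(1) x] unfolding in_kernel_iff by simp
    have "R * a * G x $ i $ j = 0" for i j
    proof -
      have "pd i (pd j E) x = \<Gamma> 1 i j x * pd 1 E x + \<Gamma> 2 i j x * pd 2 E x - R * E x * G x $ i $ j"
        using k(1) x unfolding in_kernel_iff by blast
      with K[of i j] have "R * (E x + a) * G x $ i $ j = R * E x * G x $ i $ j" by linarith
      then show ?thesis by (simp add: algebra_simps)
    qed
    then have "a = 0" using R det_G[OF x] det_pos[OF x] by (cases "a = 0") auto
    then show ?thesis using a x by simp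
  qed
  have "(\<exists>X. F X \<and> hamiltonian_field G V E X) \<longleftrightarrow> (\<exists>a. in_kernel G R V (\<lambda>x. E x + a))" if E: "smooth_fun E V" for E
  proof
    assume "\<exists>X. F X \<and> hamiltonian_field G V E X"
    then obtain X where X: "F X" "hamiltonian_field G V E X" by blast
    obtain E0 where E0: "in_kernel G R V E0" "hamiltonian_field G V E0 X" using 2[OF X(1)] by blast
    have "smooth_fun E0 V" using E0 in_kernel_def by blast
    from const[OF E this X(2) E0(2)] obtain a where "\<And>x. x \<in> V \<Longrightarrow> E0 x = E x + a" by blast
    then have "in_kernel G R V (\<lambda>x. E x + a)" using E0(1) in_kernel_cong[of E0 "\<lambda>x. E x + a"] by simp
    then show "\<exists>a. in_kernel G R V (\<lambda>x. E x + a)" ..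
  next
    assume "\<exists>a. in_kernel G R V (\<lambda>x. E x + a)"
    then obtain a where "in_kernel G R V (\<lambda>x. E x + a)" by blast
    from 1[OF this] obtain X where "F X" "hamiltonian_field G V (\<lambda>x. E x + a) X" by blast
    then have "F X \<and> hamiltonian_field G V E X" by (simp add: hamiltonian_iff pd_plus[OF E])
    then show "\<exists>X. F X \<and> hamiltonian_field G V E X" by blast
  qed
  then show ?thesis
    unfolding kernel_corresponds_def using 1 2 uniq by blast
qed

definition "w x = sqrt (det (G x))"

lemma w_pos: "x \<in> V \<Longrightarrow> w x > 0" and w_sq: "x \<in> V \<Longrightarrow> w x * w x = det (G x)"
  using det_pos[of x] by (auto simp: w_def)

lemma smooth_w: "smooth_fun w V"
  unfolding w_def[abs_def] using det_pos by (intro smooth_fun_sqrt V smooth_det)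

text \<open>The logarithmic derivative of the area density is the trace of the Christoffel symbols;
  equivalently, the area form is parallel.\<close>

lemma pd_w:
  assumes x: "x \<in> V"
  shows "pd i w x = w x * (\<Gamma> 1 i 1 x + \<Gamma> 2 i 2 x)"
proof -
  have dw: "w differentiable (at x)" using smooth_w x by (rule smooth_fun_differentiable)
  have dGG: "(\<lambda>x. G x $ i $ j) differentiable (at x)" for i j using smooth_G x by (rule smooth_fun_differentiable)
  have "pd i (\<lambda>x. w x * w x) x = pd i (\<lambda>x. G x $ 1 $ 1 * G x $ 2 $ 2 - G x $ 1 $ 2 * G x $ 1 $ 2) x"
    by (rule pd_cong[OF V x]) (simp add: w_sq det_G)
  then have "2 * (w x * pd i w x) = G x $ 1 $ 1 * dG i 2 2 x + dG i 1 1 x * G x $ 2 $ 2 - 2 * (G x $ 1 $ 2 * dG i 1 2 x)"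
    by (simp add: pd_mult pd_diff dw dGG differentiable_mult)
  also have "\<dots> = 2 * (det (G x) * (\<Gamma> 1 i 1 x + \<Gamma> 2 i 2 x))"
    unfolding compat[OF x] det_G[OF x] G_sym[OF x, of 2 1] by (simp add: algebra_simps)
  finally have "w x * pd i w x = w x * (w x * (\<Gamma> 1 i 1 x + \<Gamma> 2 i 2 x))"
    by (simp add: w_sq[OF x, symmetric])
  then show ?thesis using w_pos[OF x] by simp
qed

text \<open>The components of \<nabla>X, with direction of differentiation \<open>i\<close> and
  vector index \<open>k\<close>; \<open>nlow\<close> lowers the vector index.\<close>

definition "nab X i k x = pd i (\<lambda>y. X y $ k) x + \<Gamma> k i 1 x * X x $ 1 + \<Gamma> k i 2 x * X x $ 2" for X :: "real^2 \<Rightarrow> real^2"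

definition "nlow X i j x = G x $ j $ 1 * nab X i 1 x + G x $ j $ 2 * nab X i 2 x"

text \<open>As \<open>g\<close> is parallel, its Lie derivative along \<open>X\<close> is twice the
  symmetric part of \<nabla>X.\<close>

lemma killing_iff:
  "killing_field G V X \<longleftrightarrow> smooth_map X V \<and> (\<forall>x\<in>V. \<forall>i j. nlow X i j x + nlow X j i x = 0)"
proof -
  have "(\<Sum>k\<in>UNIV. X x $ k * dG k i j x + G x $ k $ j * pd i (\<lambda>y. X y $ k) x + G x $ i $ k * pd j (\<lambda>y. X y $ k) x)
    = nlow X i j x + nlow X j i x" if x: "x \<in> V" for x i j
    unfolding sum_2 compat[OF x] nlow_def nab_def G_sym[OF x, of _ j] \<Gamma>_sym[OF x, of _ i] \<Gamma>_sym[OF x, of _ j]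
    by (simp add: algebra_simps)
  then show ?thesis by (simp add: killing_field_def)
qed

text \<open>Since the area form is parallel, differentiating the Hamiltonian relation turns
  \<nabla>X into the Hessian of \<open>E\<close> with one index rotated.\<close>

lemma ham_nab:
  assumes E: "smooth_fun E V"
    and X: "\<And>x. x \<in> V \<Longrightarrow> pd 1 E x = - (X x $ 2 * w x)" "\<And>x. x \<in> V \<Longrightarrow> pd 2 E x = X x $ 1 * w x"
    and sX: "smooth_map X V" and x: "x \<in> V"
  shows "w x * nab X i 1 x = pd i (pd 2 E) x - (\<Gamma> 1 i 2 x * pd 1 E x + \<Gamma> 2 i 2 x * pd 2 E x)"
    "w x * nab X i 2 x = - (pd i (pd 1 E) x - (\<Gamma> 1 i 1 x * pd 1 E x + \<Gamma> 2 i 1 x * pd 2 E x))"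
proof -
  have dX: "(\<lambda>y. X y $ k) differentiable (at x)" for k
    using sX x smooth_fun_differentiable unfolding smooth_map_def by blast
  have dw: "w differentiable (at x)" using smooth_w x by (rule smooth_fun_differentiable)
  have 2: "pd i (pd 2 E) x = pd i (\<lambda>x. X x $ 1 * w x) x" by (rule pd_cong[OF V x X(2)])
  have 1: "pd i (pd 1 E) x = pd i (\<lambda>x. - (X x $ 2 * w x)) x" by (rule pd_cong[OF V x X(1)])
  show "w x * nab X i 1 x = pd i (pd 2 E) x - (\<Gamma> 1 i 2 x * pd 1 E x + \<Gamma> 2 i 2 x * pd 2 E x)"
    unfolding 2 X[OF x] pd_mult[OF dX dw] pd_w[OF x] nab_def by (simp add: algebra_simps)
  show "w x * nab X i 2 x = - (pd i (pd 1 E) x - (\<Gamma> 1 i 1 x * pd 1 E x + \<Gamma> 2 i 1 x * pd 2 E x))"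
    unfolding 1 pd_minus[OF differentiable_mult[OF dX dw]] X[OF x] pd_mult[OF dX dw] pd_w[OF x] nab_def
    by (simp add: algebra_simps)
qed

text \<open>For a kernel function the Hessian is a multiple of \<open>g\<close>, and rotating one
  index of \<open>g\<close> gives an antisymmetric tensor.\<close>

lemma kernel_imp_killing:
  assumes "in_kernel G R V E"
  shows "\<exists>X. killing_field G V X \<and> hamiltonian_field G V E X"
proof -
  have E: "smooth_fun E V" and h: "\<And>x i j. x \<in> V \<Longrightarrow> pd i (pd j E) x = \<Gamma> 1 i j x * pd 1 E x + \<Gamma> 2 i j x * pd 2 E x - R * E x * G x $ i $ j"
    using assms by (auto simp: in_kernel_iff)
  define X :: "real^2 \<Rightarrow> real^2" where "X x = (\<chi> k. if k = 1 then pd 2 E x / w x else - pd 1 E x / w x)" for x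
  have w0: "x \<in> V \<Longrightarrow> w x \<noteq> 0" for x using w_pos[of x] by simp
  have X: "\<And>x. x \<in> V \<Longrightarrow> pd 1 E x = - (X x $ 2 * w x)" "\<And>x. x \<in> V \<Longrightarrow> pd 2 E x = X x $ 1 * w x"
    using w0 by (auto simp: X_def)
  have sX: "smooth_map X V"
    unfolding smooth_map_def X_def using w0 E smooth_w V by (auto intro!: smooth_intros)
  have "nlow X i j x + nlow X j i x = 0" if x: "x \<in> V" for x i j
  proof -
    have n: "w x * nab X i 1 x = - R * E x * G x $ i $ 2" "w x * nab X i 2 x = R * E x * G x $ i $ 1" for i
      using ham_nab[OF E X sX x, of i] h[OF x] by simp_all
    have "w x * (nlow X i j x + nlow X j i x) = G x $ j $ 1 * (w x * nab X i 1 x) + G x $ j $ 2 * (w x * nab X i 2 x)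
      + (G x $ i $ 1 * (w x * nab X j 1 x) + G x $ i $ 2 * (w x * nab X j 2 x))"
      by (simp add: nlow_def algebra_simps)
    also have "\<dots> = 0" unfolding n by (simp add: algebra_simps)
    finally show ?thesis using w0[OF x] by simp
  qed
  then have "killing_field G V X" using sX by (simp add: killing_iff)
  moreover have "hamiltonian_field G V E X" using X by (simp add: hamiltonian_iff w_def)
  ultimately show ?thesis by blast
qed

text \<open>A Killing field \<open>X\<close> satisfies \<open>\<nabla>\<^sub>i X\<^sub>j = f \<omega>\<^sub>i\<^sub>j\<close> for the area form \<open>\<omega>\<close>, and the curvature
  identity makes \<open>df\<close> a multiple of \<open>R \<iota>\<^sub>X \<omega>\<close>.  As \<open>R \<noteq> 0\<close>, the Hamiltonian is a multiple of \<open>f\<close>,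
  which exists on all of \<open>V\<close> although \<open>V\<close> need not be simply connected.\<close>

lemma killing_imp_kernel:
  assumes R: "R < 0" and K: "killing_field G V X"
    and frame: "\<And>x. x \<in> V \<Longrightarrow> \<exists>V' e. x \<in> V' \<and> V' \<subseteq> V \<and> hyp_frame G V' R e"
  shows "\<exists>E. in_kernel G R V E \<and> hamiltonian_field G V E X"
proof -
  have sX: "smooth_map X V" and kill: "\<And>x i j. x \<in> V \<Longrightarrow> nlow X i j x + nlow X j i x = 0"
    using K by (auto simp: killing_iff)
  have sXk: "smooth_fun (\<lambda>y. X y $ k) V" for k using sX by (simp add: smooth_map_def)
  have w0: "x \<in> V \<Longrightarrow> w x \<noteq> 0" for x using w_pos[of x] by simp
  \<comment> \<open>\<open>nlow\<close> is antisymmetric, so a single function describes it;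
    \<open>F\<close> is \<open>- f / w\<close> for the \<open>f\<close> of the description
    above.\<close>
  define F where "F x = - nlow X 1 2 x / (w x * w x)" for x
  have snab: "smooth_fun (nab X i k) V" for i k
    unfolding nab_def[abs_def] by (intro smooth_intros sXk smooth_\<Gamma> V)
  have sF: "smooth_fun F V"
    unfolding F_def[abs_def] nlow_def[abs_def] using w0
    by (intro smooth_fun_divide smooth_intros snab smooth_G smooth_w V) auto
  have nab: "nab X i 1 x = F x * G x $ i $ 2" "nab X i 2 x = - F x * G x $ i $ 1" if x: "x \<in> V" for i x
  proof -
    have F: "F x * det (G x) = - nlow X 1 2 x" using w0[OF x] by (simp add: F_def w_sq[OF x, symmetric])
    have low: "nlow X i j x = F x * (G x $ j $ 1 * G x $ i $ 2 - G x $ j $ 2 * G x $ i $ 1)" for j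
      using kill[OF x, of 1 1] kill[OF x, of 2 2] kill[OF x, of 1 2] F exhaust_2[of i] exhaust_2[of j]
      unfolding det_G[OF x] by (auto simp: G_sym[OF x, of 2 1] algebra_simps)
    have "G x $ m $ 1 * (nab X i 1 x - F x * G x $ i $ 2) + G x $ m $ 2 * (nab X i 2 x + F x * G x $ i $ 1) = 0" for m
      using low[of m] by (simp add: nlow_def algebra_simps)
    from G_nondeg[OF x this] show "nab X i 1 x = F x * G x $ i $ 2" "nab X i 2 x = - F x * G x $ i $ 1" by simp_all
  qed
  have dF: "pd 1 F x + F x * (\<Gamma> 1 1 1 x + \<Gamma> 2 1 2 x) = R * X x $ 2"
    "pd 2 F x + F x * (\<Gamma> 1 2 1 x + \<Gamma> 2 2 2 x) = - R * X x $ 1" if xV: "x \<in> V" for x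
  proof -
    obtain V' e where x: "x \<in> V'" and sub: "V' \<subseteq> V" and "hyp_frame G V' R e" using frame[OF xV] by blast
    interpret h: hyp_frame G V' R e by fact
    have d: "F differentiable (at x)" "(\<lambda>y. X y $ k) differentiable (at x)" "(\<lambda>x. G x $ i $ j) differentiable (at x)" for k i j
      using xV sF sXk smooth_G smooth_fun_differentiable by blast+
    note de = h.diff_e[OF x]
    \<comment> \<open>The derivative of \<open>e\<close> along \<open>X\<close>. Its second
      derivatives commute, and this vector identity carries the information on \<open>dF\<close>
      that the curvature identity would give.\<close>
    define Y where "Y a y = X y $ 1 * pd 1 (e a) y + X y $ 2 * pd 2 (e a) y" for a y
    have sY: "smooth_fun (Y a) V'" for a
      unfolding Y_def by (intro smooth_intros smooth_fun_subset[OF sXk sub] h.smooth_e h.V)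
    have pY: "pd i (Y a) y = F y * (G y $ i $ 2 * pd 1 (e a) y - G y $ i $ 1 * pd 2 (e a) y)
      + (- R) * ((G y $ i $ 1 * X y $ 1 + G y $ i $ 2 * X y $ 2) * e a y)" if y: "y \<in> V'" for i a y
    proof -
      have yV: "y \<in> V" using y sub by blast
      have dy: "(\<lambda>y. X y $ k) differentiable (at y)" for k using yV sXk smooth_fun_differentiable by blast
      have "pd i (Y a) y = X y $ 1 * pd i (pd 1 (e a)) y + pd i (\<lambda>y. X y $ 1) y * pd 1 (e a) y
        + (X y $ 2 * pd i (pd 2 (e a)) y + pd i (\<lambda>y. X y $ 2) y * pd 2 (e a) y)"
        unfolding Y_def by (simp add: pd_add pd_mult dy h.diff_e[OF y] differentiable_mult)
      also have "\<dots> = nab X i 1 y * pd 1 (e a) y + nab X i 2 y * pd 2 (e a) y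
        + (- R) * ((G y $ i $ 1 * X y $ 1 + G y $ i $ 2 * X y $ 2) * e a y)"
        unfolding h.hessian_e[OF y] nab_def by (simp add: algebra_simps)
      finally show ?thesis unfolding nab[OF yV] by (simp add: algebra_simps)
    qed
    define p where "p = pd 1 F x + F x * (\<Gamma> 1 1 1 x + \<Gamma> 2 1 2 x) - R * X x $ 2"
    define q where "q = pd 2 F x + F x * (\<Gamma> 1 2 1 x + \<Gamma> 2 2 2 x) + R * X x $ 1"
    \<comment> \<open>\<open>z\<close> enters only the component \<open>z'\<close> along
      \<open>e\<close>, which disappears on pairing with the gradients since they are orthogonal to
      \<open>e\<close>.\<close>
    define z where "z = pd 2 (\<lambda>x. G x $ 1 $ 1 * X x $ 1 + G x $ 1 $ 2 * X x $ 2) x - pd 1 (\<lambda>x. G x $ 2 $ 1 * X x $ 1 + G x $ 2 $ 2 * X x $ 2) x"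
    define z' where "z' = - R * z + F x * R * (G x $ 1 $ 1 * G x $ 2 $ 2 - G x $ 1 $ 2 * G x $ 1 $ 2) * 2"
    have eq: "(q * G x $ 1 $ 2 - p * G x $ 2 $ 2) * pd 1 (e a) x + (p * G x $ 1 $ 2 - q * G x $ 1 $ 1) * pd 2 (e a) x + z' * e a x = 0" for a
    proof -
      define XL where "XL i x = G x $ i $ 1 * X x $ 1 + G x $ i $ 2 * X x $ 2" for i x
      have dXL: "XL i differentiable (at x)" for i
        unfolding XL_def[abs_def] using d by (intro differentiable_add differentiable_mult)
      have pp: "pd k (pd i (Y a)) x = F x * (G x $ i $ 2 * pd k (pd 1 (e a)) x + dG k i 2 x * pd 1 (e a) x
          - (G x $ i $ 1 * pd k (pd 2 (e a)) x + dG k i 1 x * pd 2 (e a) x))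
        + pd k F x * (G x $ i $ 2 * pd 1 (e a) x - G x $ i $ 1 * pd 2 (e a) x)
        + (- R) * (XL i x * pd k (e a) x + pd k (XL i) x * e a x)" for i k
      proof -
        have "pd k (pd i (Y a)) x = pd k (\<lambda>y. F y * (G y $ i $ 2 * pd 1 (e a) y - G y $ i $ 1 * pd 2 (e a) y)
          + (- R) * (XL i y * e a y)) x"
          by (rule pd_cong[OF h.V x]) (simp add: pY XL_def)
        also have "\<dots> = pd k (\<lambda>y. F y * (G y $ i $ 2 * pd 1 (e a) y - G y $ i $ 1 * pd 2 (e a) y)) x + pd k (\<lambda>y. (- R) * (XL i y * e a y)) x"
          using d de dXL by (intro pd_add differentiable_mult differentiable_diff differentiable_const)
        also have "pd k (\<lambda>y. (- R) * (XL i y * e a y)) x = (- R) * pd k (\<lambda>y. XL i y * e a y) x"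
          using de dXL by (intro pd_cmult differentiable_mult)
        finally show ?thesis
          by (simp add: pd_mult pd_diff d de dXL differentiable_mult differentiable_diff)
      qed
      have "pd 2 (pd 1 (Y a)) x - pd 1 (pd 2 (Y a)) x = 0"
        using pd_commute[OF sY h.V x, of 2 1] by simp
      moreover have "pd 2 (pd 1 (Y a)) x - pd 1 (pd 2 (Y a)) x
        = (q * G x $ 1 $ 2 - p * G x $ 2 $ 2) * pd 1 (e a) x + (p * G x $ 1 $ 2 - q * G x $ 1 $ 1) * pd 2 (e a) x + z' * e a x"
        unfolding pp h.hessian_e[OF x] compat[OF xV] p_def q_def z'_def z_def XL_def[abs_def, symmetric]
          \<Gamma>_sym[OF xV, of _ 2 1] G_sym[OF xV, of 2 1]
        unfolding XL_def G_sym[OF xV, of 2 1] by (simp add: algebra_simps)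
      ultimately show ?thesis by simp
    qed
    have "(q * G x $ 1 $ 2 - p * G x $ 2 $ 2) * ip (\<lambda>a. h.v l a x) (\<lambda>a. pd 1 (e a) x)
      + (p * G x $ 1 $ 2 - q * G x $ 1 $ 1) * ip (\<lambda>a. h.v l a x) (\<lambda>a. pd 2 (e a) x) + z' * ip (\<lambda>a. h.v l a x) (\<lambda>a. e a x) = 0" for l
    proof -
      have "(q * G x $ 1 $ 2 - p * G x $ 2 $ 2) * ip (\<lambda>a. h.v l a x) (\<lambda>a. pd 1 (e a) x)
      + (p * G x $ 1 $ 2 - q * G x $ 1 $ 1) * ip (\<lambda>a. h.v l a x) (\<lambda>a. pd 2 (e a) x) + z' * ip (\<lambda>a. h.v l a x) (\<lambda>a. e a x)
      = ip (\<lambda>a. h.v l a x) (\<lambda>a. (q * G x $ 1 $ 2 - p * G x $ 2 $ 2) * pd 1 (e a) x + (p * G x $ 1 $ 2 - q * G x $ 1 $ 1) * pd 2 (e a) x + z' * e a x)"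
        by (simp add: ip_def algebra_simps)
      then show ?thesis unfolding eq by (simp add: ip_def)
    qed
    from this[of 1] this[of 2] have "q * G x $ 1 $ 2 - p * G x $ 2 $ 2 = 0" "p * G x $ 1 $ 2 - q * G x $ 1 $ 1 = 0"
      using R by (simp_all add: h.ip_v_de[OF x] h.ip_v_e[OF x])
    then have "(- G x $ 2 $ 2) * p + G x $ 1 $ 2 * q = 0" "G x $ 1 $ 2 * p + (- G x $ 1 $ 1) * q = 0"
      by (simp_all add: algebra_simps)
    moreover have "(- G x $ 2 $ 2) * (- G x $ 1 $ 1) - G x $ 1 $ 2 * G x $ 1 $ 2 \<noteq> 0"
      using det_pos[OF xV] by (simp add: det_G[OF xV] mult.commute)
    ultimately have "p = 0" "q = 0" using linear_2_zero by blast+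
    then show "pd 1 F x + F x * (\<Gamma> 1 1 1 x + \<Gamma> 2 1 2 x) = R * X x $ 2"
      "pd 2 F x + F x * (\<Gamma> 1 2 1 x + \<Gamma> 2 2 2 x) = - R * X x $ 1" by (simp_all add: p_def q_def)
  qed
  \<comment> \<open>\<open>w * F\<close> is the scalar \<open>- f\<close>; the factor
    \<open>-1/R\<close> compensates the \<open>R\<close> with which \<open>X\<close> occurs in
    \<open>dF\<close>.\<close>
  define E where "E x = inverse (- R) * (w x * F x)" for x
  have sE: "smooth_fun E V" unfolding E_def[abs_def] by (intro smooth_intros smooth_w sF V)
  have pE: "pd i E x = inverse (- R) * (w x * (pd i F x + F x * (\<Gamma> 1 i 1 x + \<Gamma> 2 i 2 x)))" if x: "x \<in> V" for i x
  proof -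
    have d: "w differentiable (at x)" "F differentiable (at x)" using smooth_w sF x smooth_fun_differentiable by blast+
    have "pd i E x = inverse (- R) * pd i (\<lambda>x. w x * F x) x"
      unfolding E_def[abs_def] by (rule pd_cmult[OF differentiable_mult[OF d]])
    then show ?thesis by (simp add: pd_mult d pd_w[OF x] algebra_simps)
  qed
  have X: "\<And>x. x \<in> V \<Longrightarrow> pd 1 E x = - (X x $ 2 * w x)" "\<And>x. x \<in> V \<Longrightarrow> pd 2 E x = X x $ 1 * w x"
    using R by (simp_all add: pE dF)
  have "hamiltonian_field G V E X" using X by (simp add: hamiltonian_iff w_def)
  moreover have "in_kernel G R V E"
    unfolding in_kernel_iff
  proof (intro conjI ballI allI sE)
    fix x i j assume x: "x \<in> V"
    have wF: "w x * F x = - R * E x" using R by (simp add: E_def)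
    have wF': "w x * (F x * g) = - R * E x * g" for g using wF by (simp flip: mult.assoc)
    note h = ham_nab[OF sE X sX x, of i, unfolded nab[OF x]]
    show "pd i (pd j E) x = \<Gamma> 1 i j x * pd 1 E x + \<Gamma> 2 i j x * pd 2 E x - R * E x * G x $ i $ j"
      using h exhaust_2[of j] wF'[of "G x $ i $ 1"] wF'[of "G x $ i $ 2"] by auto
  qed
  ultimately show ?thesis by blast
qed

end

section \<open>The action of SO(2,1)\<close>

definition sg :: "3 \<Rightarrow> real" where "sg a = (if a = 3 then -1 else 1)"

lemma lorentz_nth: "lorentz $ i $ j = (if i = j then sg i else 0)"
  by (simp add: lorentz_def sg_def)

lemma SO21_ip:
  assumes "A \<in> SO21"
  shows "ip (\<lambda>a. (A *v x) $ a) (\<lambda>a. (A *v y) $ a) = ip (\<lambda>a. x $ a) (\<lambda>a. y $ a)"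
proof -
  have L: "(transpose A ** lorentz ** A) $ i $ j = lorentz $ i $ j" for i j
    using assms by (simp add: SO21_def)
  have e: "ip (\<lambda>a. A $ a $ i) (\<lambda>a. A $ a $ j) = (if i = j then sg i else 0)" for i j
    using L[of i j] by (simp add: matrix_matrix_mult_def transpose_def sum_3 lorentz_nth ip_def sg_def)
  have "ip (\<lambda>a. (A *v x) $ a) (\<lambda>a. (A *v y) $ a) = (\<Sum>i\<in>UNIV. \<Sum>j\<in>UNIV. x $ i * y $ j * ip (\<lambda>a. A $ a $ i) (\<lambda>a. A $ a $ j))"
    by (simp add: matrix_vector_mult_def sum_3 ip_def algebra_simps)
  also have "\<dots> = ip (\<lambda>a. x $ a) (\<lambda>a. y $ a)"
    unfolding e by (simp add: sum_3 ip_def sg_def)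
  finally show ?thesis .
qed

text \<open>The inverse of \<open>hyperboloid\<close> on the upper sheet, read off from the
  light-cone coordinate \<open>v $ 3 - v $ 2\<close>, the reciprocal of the height.\<close>

definition hyproj :: "real^3 \<Rightarrow> real^2" where
  "hyproj v = vector [v $ 1 / (v $ 3 - v $ 2), 1 / (v $ 3 - v $ 2)]"

lemma hyperboloid_nth:
  "hyperboloid z $ 1 = z $ 1 / z $ 2" "hyperboloid z $ 2 = ((z $ 1)\<^sup>2 + (z $ 2)\<^sup>2 - 1) / (2 * z $ 2)"
  "hyperboloid z $ 3 = ((z $ 1)\<^sup>2 + (z $ 2)\<^sup>2 + 1) / (2 * z $ 2)"
  by (simp_all add: hyperboloid_def)

lemma hyperboloid_32: "z \<in> H2 \<Longrightarrow> hyperboloid z $ 3 - hyperboloid z $ 2 = 1 / z $ 2"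
  by (auto simp: H2_def hyperboloid_nth diff_divide_distrib[symmetric])

lemma hyperboloid_3_pos: "z \<in> H2 \<Longrightarrow> hyperboloid z $ 3 > 0"
  by (auto simp: H2_def hyperboloid_nth intro!: divide_pos_pos add_nonneg_pos)

lemma hyproj_hyperboloid: "z \<in> H2 \<Longrightarrow> hyproj (hyperboloid z) = z"
  using hyperboloid_32[of z] by (auto simp: hyproj_def vec_eq_iff forall_2 hyperboloid_nth(1) H2_def)

lemma ip_hyperboloid: "z \<in> H2 \<Longrightarrow> ip (\<lambda>a. hyperboloid z $ a) (\<lambda>a. hyperboloid z $ a) = -1"
  using hyp_frame.ip_e[OF hyp_frame_hyperboloid[of "-1"]] by simp

text \<open>On the hyperboloid \<open>(v $ 3 - v $ 2) * (v $ 3 + v $ 2)\<close> equals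
  \<open>1 + (v $ 1)\<^sup>2\<close>, which is positive; on the upper sheet both factors are then
  positive.\<close>

lemma hyproj:
  assumes v: "ip (\<lambda>a. v $ a) (\<lambda>a. v $ a) = -1" "v $ 3 > 0"
  shows "v $ 3 - v $ 2 > 0" "hyproj v \<in> H2" "hyperboloid (hyproj v) = v"
proof -
  have eq: "(v $ 3 - v $ 2) * (v $ 3 + v $ 2) = 1 + (v $ 1)\<^sup>2"
    using v(1) by (simp add: ip_def algebra_simps power2_eq_square)
  then have pos: "(v $ 3 - v $ 2) * (v $ 3 + v $ 2) > 0" by (simp add: add_pos_nonneg)
  then show d: "v $ 3 - v $ 2 > 0" using v(2) by (auto simp: zero_less_mult_iff)
  then show "hyproj v \<in> H2" by (simp add: hyproj_def H2_def)
  define d where "d = v $ 3 - v $ 2"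
  have d0: "d \<noteq> 0" and v2: "v $ 3 = v $ 2 + d" using d by (auto simp: d_def)
  have eq': "(v $ 1)\<^sup>2 = d * (2 * v $ 2 + d) - 1" using eq by (simp add: d_def algebra_simps)
  have h: "hyproj v $ 1 = v $ 1 / d" "hyproj v $ 2 = 1 / d" by (simp_all add: hyproj_def d_def)
  show "hyperboloid (hyproj v) = v"
    unfolding vec_eq_iff forall_3 hyperboloid_nth h v2 power_divide eq'
    using d0 by (simp add: field_simps power2_eq_square)
qed

text \<open>The sign left open in \<open>so21_act\<close> is settled here: the other alternative
  would place a point of \<open>H2\<close> on the lower sheet.\<close>

lemma so21_act_eq:
  assumes A: "A \<in> SO21" and z: "z \<in> H2" and pos: "(A *v hyperboloid z) $ 3 > 0"
  shows "so21_act A z = hyproj (A *v hyperboloid z)" "hyperboloid (so21_act A z) = A *v hyperboloid z"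
proof -
  have ip: "ip (\<lambda>a. (A *v hyperboloid z) $ a) (\<lambda>a. (A *v hyperboloid z) $ a) = -1"
    by (simp add: SO21_ip[OF A] ip_hyperboloid[OF z])
  note p = hyproj[OF ip pos]
  show 1: "so21_act A z = hyproj (A *v hyperboloid z)"
    unfolding so21_act_def
  proof (rule the_equality)
    show "hyproj (A *v hyperboloid z) \<in> H2 \<and> (hyperboloid (hyproj (A *v hyperboloid z)) = A *v hyperboloid z
      \<or> hyperboloid (hyproj (A *v hyperboloid z)) = - (A *v hyperboloid z))" using p by simp
    fix w assume w: "w \<in> H2 \<and> (hyperboloid w = A *v hyperboloid z \<or> hyperboloid w = - (A *v hyperboloid z))"
    have "hyperboloid w \<noteq> - (A *v hyperboloid z)"
    proof
      assume "hyperboloid w = - (A *v hyperboloid z)"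
      then have "hyperboloid w $ 3 = - (A *v hyperboloid z) $ 3" by simp
      then show False using hyperboloid_3_pos[of w] w pos by simp
    qed
    then show "w = hyproj (A *v hyperboloid z)" using w hyproj_hyperboloid[of w] by metis
  qed
  show "hyperboloid (so21_act A z) = A *v hyperboloid z" using p(3) 1 by simp
qed

text \<open>An invertible idempotent is the identity.\<close>

lemma one_parameter_0:
  assumes "one_parameter_subgroup \<gamma>"
  shows "\<gamma> 0 = mat 1"
proof -
  have "\<gamma> 0 = \<gamma> 0 ** \<gamma> 0" "det (\<gamma> 0) \<noteq> 0"
    using assms unfolding one_parameter_subgroup_def SO21_def by (metis add_0, auto)
  then obtain B where B: "B ** \<gamma> 0 = mat 1" "\<gamma> 0 ** B = mat 1" using invertible_det_nz[of "\<gamma> 0"] unfolding invertible_def by blast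
  then have "mat 1 = B ** (\<gamma> 0 ** \<gamma> 0)" using \<open>\<gamma> 0 = \<gamma> 0 ** \<gamma> 0\<close> by simp
  then show ?thesis using B by (simp add: matrix_mul_assoc)
qed

text \<open>By continuity at the identity; for such \<open>t\<close> the action is given by
  \<open>hyproj\<close>.\<close>

lemma eventually_upper_sheet:
  assumes "one_parameter_subgroup \<gamma>" "z \<in> H2"
  shows "\<forall>\<^sub>F t in nhds 0. (\<gamma> t *v hyperboloid z) $ 3 > 0"
proof -
  have c: "isCont (\<lambda>t. (\<gamma> t *v hyperboloid z) $ 3) 0"
  proof -
    have "continuous_on UNIV \<gamma>" using assms(1) by (simp add: one_parameter_subgroup_def)
    then have "continuous_on UNIV (\<lambda>t. (\<gamma> t *v hyperboloid z) $ 3)"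
      unfolding matrix_vector_mult_def by (auto intro!: continuous_intros)
    then show ?thesis by (simp add: continuous_on_eq_continuous_at)
  qed
  have "(\<gamma> 0 *v hyperboloid z) $ 3 > 0" by (simp add: one_parameter_0[OF assms(1)] hyperboloid_3_pos[OF assms(2)])
  then show ?thesis
    using c unfolding isCont_def tendsto_def eventually_nhds_conv_at
    by (auto dest!: spec[of _ "{0<..}"])
qed

text \<open>\<open>so21_field p q r\<close> is the derivative at \<open>t = 0\<close> of the action of \<open>exp (t so21_mat p q r)\<close>.\<close>

definition so21_mat :: "real \<Rightarrow> real \<Rightarrow> real \<Rightarrow> real^3^3" where
  "so21_mat p q r = vector [vector [0, - p, q], vector [p, 0, r], vector [q, r, 0]]"

definition so21_field :: "real \<Rightarrow> real \<Rightarrow> real \<Rightarrow> real^2 \<Rightarrow> real^2" where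
  "so21_field p q r z = vector [(q - p) * ((z $ 2)\<^sup>2 - (z $ 1)\<^sup>2) / 2 + (p + q) / 2 + r * z $ 1,
     z $ 2 * (r - (q - p) * z $ 1)]"

lemma so21_mat_nth:
  "so21_mat p q r $ 1 $ 1 = 0" "so21_mat p q r $ 1 $ 2 = - p" "so21_mat p q r $ 1 $ 3 = q"
  "so21_mat p q r $ 2 $ 1 = p" "so21_mat p q r $ 2 $ 2 = 0" "so21_mat p q r $ 2 $ 3 = r"
  "so21_mat p q r $ 3 $ 1 = q" "so21_mat p q r $ 3 $ 2 = r" "so21_mat p q r $ 3 $ 3 = 0"
  by (simp_all add: so21_mat_def)

lemma has_vector_derivative_nth:
  fixes f :: "real \<Rightarrow> real^2"
  assumes "\<And>k. ((\<lambda>t. f t $ k) has_real_derivative D $ k) (at t)"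
  shows "(f has_vector_derivative D) (at t)"
  unfolding has_vector_derivative_def
  by (rule has_derivative_vecI) (use assms in \<open>simp add: has_field_derivative_def mult_commute_abs\<close>)

text \<open>Near 0 the action is the rational map \<open>hyproj\<close> along a curve of vectors
  with a known derivative at 0, so the quotient rule applies.\<close>

lemma so21_act_has_derivative:
  assumes \<gamma>: "one_parameter_subgroup \<gamma>"
    and d: "\<And>i j. ((\<lambda>t. \<gamma> t $ i $ j) has_real_derivative so21_mat p q r $ i $ j) (at 0)" and z: "z \<in> H2"
  shows "((\<lambda>t. so21_act (\<gamma> t) z) has_vector_derivative so21_field p q r z) (at 0)"
proof -
  define v where "v t = \<gamma> t *v hyperboloid z" for t
  define B where "B = so21_mat p q r"
  define V where "V = B *v hyperboloid z"
  have z2: "z $ 2 > 0" using z by (simp add: H2_def)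
  have dv: "((\<lambda>t. v t $ k) has_real_derivative V $ k) (at 0)" for k
    unfolding v_def V_def matrix_vector_mult_def B_def
    by (auto simp: sum_3 intro!: derivative_eq_intros d)
  have v0: "v 0 = hyperboloid z" by (simp add: v_def one_parameter_0[OF \<gamma>])
  have ne: "v 0 $ 3 - v 0 $ 2 \<noteq> 0" using hyperboloid_32[OF z] z2 by (simp add: v0)
  have h32: "hyperboloid z $ 3 - hyperboloid z $ 2 = 1 / z $ 2" by (rule hyperboloid_32[OF z])
  have V: "V $ 1 = - p * hyperboloid z $ 2 + q * hyperboloid z $ 3" "V $ 2 = p * hyperboloid z $ 1 + r * hyperboloid z $ 3"
    "V $ 3 = q * hyperboloid z $ 1 + r * hyperboloid z $ 2"
    by (simp_all add: V_def B_def matrix_vector_mult_def sum_3 so21_mat_nth)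
  have V32: "V $ 3 - V $ 2 = ((q - p) * z $ 1 - r) / z $ 2"
  proof -
    have "V $ 3 - V $ 2 = (q - p) * hyperboloid z $ 1 - r * (hyperboloid z $ 3 - hyperboloid z $ 2)"
      by (simp add: V algebra_simps)
    then show ?thesis unfolding h32 by (simp add: hyperboloid_nth(1) diff_divide_distrib)
  qed
  have V1: "V $ 1 = ((q - p) * ((z $ 1)\<^sup>2 + (z $ 2)\<^sup>2) + (p + q)) / (2 * z $ 2)"
    unfolding V hyperboloid_nth using z2 by (simp add: field_simps)
  have "((\<lambda>t. hyproj (v t)) has_vector_derivative so21_field p q r z) (at 0)"
  proof (rule has_vector_derivative_nth)
    fix k :: 2
    have d2: "((\<lambda>t. 1 / (v t $ 3 - v t $ 2)) has_real_derivative - (V $ 3 - V $ 2) * (z $ 2 * z $ 2)) (at 0)"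
      using ne z2 by (auto intro!: derivative_eq_intros dv simp: v0 h32)
    have d1: "((\<lambda>t. v t $ 1 / (v t $ 3 - v t $ 2)) has_real_derivative (V $ 1 * (1 / z $ 2) - z $ 1 / z $ 2 * (V $ 3 - V $ 2)) * (z $ 2 * z $ 2)) (at 0)"
      using ne z2 by (auto intro!: derivative_eq_intros dv simp: v0 h32 hyperboloid_nth(1))
    have e2: "- (V $ 3 - V $ 2) * (z $ 2 * z $ 2) = so21_field p q r z $ 2"
      using z2 unfolding V32 by (simp add: so21_field_def field_simps)
    have e1: "(V $ 1 * (1 / z $ 2) - z $ 1 / z $ 2 * (V $ 3 - V $ 2)) * (z $ 2 * z $ 2) = so21_field p q r z $ 1"
      using z2 unfolding V32 V1 by (simp add: so21_field_def field_simps power2_eq_square)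
    show "((\<lambda>t. hyproj (v t) $ k) has_real_derivative so21_field p q r z $ k) (at 0)"
      using exhaust_2[of k] d1 d2 unfolding e1 e2 by (auto simp: hyproj_def)
  qed
  moreover have "\<forall>\<^sub>F t in nhds 0. hyproj (v t) = so21_act (\<gamma> t) z"
    using eventually_upper_sheet[OF \<gamma> z]
  proof (rule eventually_mono)
    fix t assume "(\<gamma> t *v hyperboloid z) $ 3 > 0"
    moreover have "\<gamma> t \<in> SO21" using \<gamma> by (simp add: one_parameter_subgroup_def)
    ultimately show "hyproj (v t) = so21_act (\<gamma> t) z" unfolding v_def using z by (intro so21_act_eq[symmetric])
  qed
  then obtain N where "open N" "0 \<in> N" "\<And>t. t \<in> N \<Longrightarrow> hyproj (v t) = so21_act (\<gamma> t) z"
    unfolding eventually_nhds by blast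
  ultimately show ?thesis
    unfolding has_vector_derivative_def by (rule has_derivative_transform_within_open)
qed

text \<open>Replaces the exponential series: as \<open>B\<^sup>3 = k B\<close>, the exponential of \<open>t B\<close> is
  \<open>1 + s(t) B + c(t) B\<^sup>2\<close>.\<close>

lemma exp_coeffs_exist:
  fixes k :: real
  shows "\<exists>s c :: real \<Rightarrow> real. s 0 = 0 \<and> c 0 = 0 \<and> (s has_real_derivative 1) (at 0) \<and> (c has_real_derivative 0) (at 0) \<and>
    continuous_on UNIV s \<and> continuous_on UNIV c \<and> (\<forall>t. s (- t) = - s t) \<and> (\<forall>t. c (- t) = c t) \<and>
    (\<forall>a b. s (a + b) = s a + s b + k * (s a * c b + c a * s b)) \<and> (\<forall>a b. c (a + b) = c a + c b + s a * s b + k * (c a * c b))"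
proof -
  \<comment> \<open>The hyperbolic, parabolic and elliptic generators; the addition formulas are
    those which make the resulting exponential multiplicative.\<close>
  consider "k > 0" | "k = 0" | "k < 0" by linarith
  then show ?thesis
  proof cases
    case 1
    define m where "m = sqrt k"
    have m: "m \<noteq> 0" "k = m\<^sup>2" using 1 by (auto simp: m_def)
    show ?thesis
      by (rule exI[of _ "\<lambda>t. sinh (m * t) / m"], rule exI[of _ "\<lambda>t. (cosh (m * t) - 1) / m\<^sup>2"])
         (use m in \<open>auto intro!: derivative_eq_intros continuous_intros simp: sinh_add cosh_add distrib_left field_simps power2_eq_square\<close>)
  next
    case 2
    show ?thesis
      by (rule exI[of _ "\<lambda>t. t"], rule exI[of _ "\<lambda>t. t\<^sup>2 / 2"])
         (use 2 in \<open>auto intro!: derivative_eq_intros continuous_intros simp: field_simps power2_eq_square\<close>)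
  next
    case 3
    define m where "m = sqrt (- k)"
    have m: "m \<noteq> 0" "k = - m\<^sup>2" using 3 by (auto simp: m_def)
    show ?thesis
      by (rule exI[of _ "\<lambda>t. sin (m * t) / m"], rule exI[of _ "\<lambda>t. (1 - cos (m * t)) / m\<^sup>2"])
         (use m in \<open>auto intro!: derivative_eq_intros continuous_intros simp: sin_add cos_add distrib_left field_simps power2_eq_square\<close>)
  qed
qed

lemma one_parameter_subgroup_exists:
  "\<exists>\<gamma>. one_parameter_subgroup \<gamma> \<and> (\<forall>i j. ((\<lambda>t. \<gamma> t $ i $ j) has_real_derivative so21_mat p q r $ i $ j) (at 0))"
proof -
  \<comment> \<open>The characteristic polynomial of \<open>so21_mat p q r\<close> is
    \<open>x^3 - k x\<close>, so its cube is \<open>k\<close> times the matrix itself.\<close>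
  define k where "k = q * q + r * r - p * p"
  obtain s c :: "real \<Rightarrow> real" where sc: "s 0 = 0" "c 0 = 0" "(s has_real_derivative 1) (at 0)" "(c has_real_derivative 0) (at 0)"
    "continuous_on UNIV s" "continuous_on UNIV c" "\<And>t. s (- t) = - s t" "\<And>t. c (- t) = c t"
    "\<And>a b. s (a + b) = s a + s b + k * (s a * c b + c a * s b)" "\<And>a b. c (a + b) = c a + c b + s a * s b + k * (c a * c b)"
    using exp_coeffs_exist[of k] by blast
  define B where "B = so21_mat p q r"
  define B2 where "B2 = B ** B"
  define \<gamma> :: "real \<Rightarrow> real^3^3" where "\<gamma> t = (\<chi> i j. (if i = j then 1 else 0) + s t * B $ i $ j + c t * B2 $ i $ j)" for t
  have B2: "B2 $ 1 $ 1 = q * q - p * p" "B2 $ 1 $ 2 = q * r" "B2 $ 1 $ 3 = - (p * r)"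
    "B2 $ 2 $ 1 = q * r" "B2 $ 2 $ 2 = r * r - p * p" "B2 $ 2 $ 3 = p * q"
    "B2 $ 3 $ 1 = p * r" "B2 $ 3 $ 2 = - (p * q)" "B2 $ 3 $ 3 = q * q + r * r"
    by (simp_all add: B2_def B_def matrix_matrix_mult_def sum_3 so21_mat_nth algebra_simps)
  note entries = B2 so21_mat_nth[of p q r, folded B_def]
  have mult: "\<gamma> (a + b) = \<gamma> a ** \<gamma> b" for a b
    unfolding vec_eq_iff forall_3
    by (simp add: \<gamma>_def matrix_matrix_mult_def sum_3 entries sc k_def algebra_simps)
  have \<gamma>0: "\<gamma> 0 = mat 1" by (simp add: \<gamma>_def sc mat_def vec_eq_iff)
  \<comment> \<open>\<open>B\<close> is antisymmetric for the Lorentz form, \<open>s\<close> is odd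
    and \<open>c\<close> is even; taking the adjoint therefore reverses \<open>t\<close>.\<close>
  have adj: "transpose (\<gamma> t) ** lorentz = lorentz ** \<gamma> (- t)" for t
    unfolding vec_eq_iff forall_3
    by (simp add: \<gamma>_def matrix_matrix_mult_def transpose_def sum_3 entries sc lorentz_nth sg_def algebra_simps)
  have pres: "transpose (\<gamma> t) ** lorentz ** \<gamma> t = lorentz" for t
  proof -
    have "\<gamma> (- t) ** \<gamma> t = mat 1" using mult[of "- t" t] \<gamma>0 by simp
    then show ?thesis unfolding adj by (simp flip: matrix_mul_assoc)
  qed
  \<comment> \<open>Lorentz matrices have determinant 1 or -1, and \<open>\<gamma> t\<close> is the
    square of \<open>\<gamma> (t / 2)\<close>.\<close>
  have "det (\<gamma> t) = 1" for t
  proof -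
    have "det lorentz \<noteq> 0" by (simp add: det_3 lorentz_nth sg_def)
    moreover have "det (\<gamma> (t / 2)) * det lorentz * det (\<gamma> (t / 2)) = det lorentz"
      using arg_cong[OF pres[of "t / 2"], of det] by (simp add: det_mul)
    ultimately have "det (\<gamma> (t / 2)) * det (\<gamma> (t / 2)) = 1" by (simp add: field_simps)
    then show ?thesis using mult[of "t / 2" "t / 2"] by (simp add: det_mul)
  qed
  then have "one_parameter_subgroup \<gamma>"
    unfolding one_parameter_subgroup_def SO21_def using pres mult
    by (auto simp: \<gamma>_def[abs_def] intro!: continuous_on_vec_lambda continuous_intros sc)
  moreover have "((\<lambda>t. \<gamma> t $ i $ j) has_real_derivative B $ i $ j) (at 0)" for i j
    unfolding \<gamma>_def by (auto intro!: derivative_eq_intros sc)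
  ultimately show ?thesis unfolding B_def by blast
qed

text \<open>Three points of \<open>W\<close> on a horizontal line are mapped to a basis of \<open>\<real>\<^sup>3\<close>, so the
  differentiability of three orbits gives that of \<open>\<gamma>\<close>.\<close>

lemma one_parameter_generator:
  assumes \<gamma>: "one_parameter_subgroup \<gamma>" and W: "open W" "W \<subseteq> H2" "z0 \<in> W"
    and d: "\<And>z. z \<in> W \<Longrightarrow> ((\<lambda>t. so21_act (\<gamma> t) z) has_vector_derivative X z) (at 0)"
  shows "\<exists>p q r. \<forall>i j. ((\<lambda>t. \<gamma> t $ i $ j) has_real_derivative so21_mat p q r $ i $ j) (at 0)"
proof -
  define D where "D v \<longleftrightarrow> (\<forall>i. (\<lambda>t. (\<gamma> t *v v) $ i) differentiable (at 0))" for v :: "real^3"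
  have D_lin: "D (a *\<^sub>R v + b *\<^sub>R w)" if "D v" "D w" for a b v w
    using that unfolding D_def
    by (simp add: matrix_vector_right_distrib matrix_vector_mult_scaleR differentiable_add differentiable_mult)
  have D_h: "D (hyperboloid z)" if z: "z \<in> W" for z
    unfolding D_def
  proof
    fix i
    have zH: "z \<in> H2" using z W by blast
    have act0: "so21_act (\<gamma> 0) z = z"
    proof -
      have "\<gamma> 0 \<in> SO21" using \<gamma> by (simp add: one_parameter_subgroup_def)
      from so21_act_eq(1)[OF this zH] show ?thesis
        by (simp add: one_parameter_0[OF \<gamma>] hyperboloid_3_pos[OF zH] hyproj_hyperboloid[OF zH])
    qed
    have "(\<lambda>z. hyperboloid z $ i) differentiable (at z)"
      using hyp_frame.diff_e(1)[OF hyp_frame_hyperboloid[of "-1"] zH] by simp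
    then have "(\<lambda>z. hyperboloid z $ i) differentiable (at (so21_act (\<gamma> 0) z))" by (simp add: act0)
    moreover have "(\<lambda>t. so21_act (\<gamma> t) z) differentiable (at 0)"
      using d[OF z] has_vector_derivative_def differentiable_def by blast
    ultimately have "((\<lambda>z. hyperboloid z $ i) \<circ> (\<lambda>t. so21_act (\<gamma> t) z)) differentiable (at 0)"
      by (rule differentiable_chain_at[rotated])
    then obtain D' where D': "((\<lambda>t. hyperboloid (so21_act (\<gamma> t) z) $ i) has_derivative D') (at 0)"
      unfolding differentiable_def o_def by blast
    have ev: "\<forall>\<^sub>F t in nhds 0. hyperboloid (so21_act (\<gamma> t) z) $ i = (\<gamma> t *v hyperboloid z) $ i"
      using eventually_upper_sheet[OF \<gamma> zH]
    proof (rule eventually_mono)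
      fix t assume "(\<gamma> t *v hyperboloid z) $ 3 > 0"
      moreover have "\<gamma> t \<in> SO21" using \<gamma> by (simp add: one_parameter_subgroup_def)
      ultimately show "hyperboloid (so21_act (\<gamma> t) z) $ i = (\<gamma> t *v hyperboloid z) $ i"
        using so21_act_eq(2) zH by simp
    qed
    then obtain N where N: "open N" "0 \<in> N" "\<And>t. t \<in> N \<Longrightarrow> hyperboloid (so21_act (\<gamma> t) z) $ i = (\<gamma> t *v hyperboloid z) $ i"
      unfolding eventually_nhds by blast
    have "((\<lambda>t. (\<gamma> t *v hyperboloid z) $ i) has_derivative D') (at 0)"
      by (rule has_derivative_transform_within_open[OF D' N])
    then show "(\<lambda>t. (\<gamma> t *v hyperboloid z) $ i) differentiable (at 0)" unfolding differentiable_def by blast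
  qed
  obtain \<delta> where \<delta>: "\<delta> > 0" "cball z0 \<delta> \<subseteq> W" using W open_contains_cball by metis
  define x y where "x = z0 $ 1" and "y = z0 $ 2"
  have y: "y > 0" using W by (auto simp: y_def H2_def)
  \<comment> \<open>Scaled by the height \<open>y\<close>, the image of a horizontal line is a
    quadratic curve in \<open>s\<close>, so finite differences of it are exact.\<close>
  define h where "h s = y *\<^sub>R hyperboloid (z0 + s *\<^sub>R axis 1 1)" for s
  have Dh: "D (h s)" if "\<bar>s\<bar> \<le> \<delta>" for s
  proof -
    have "dist z0 (z0 + s *\<^sub>R axis 1 1) = \<bar>s\<bar>" by (simp add: dist_norm norm_axis_1)
    then have "z0 + s *\<^sub>R axis 1 1 \<in> cball z0 \<delta>" using that by simp
    then have "z0 + s *\<^sub>R axis 1 1 \<in> W" using \<delta> by blast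
    from D_lin[OF D_h[OF this] D_h[OF this], of y 0] show ?thesis by (simp add: h_def)
  qed
  have hs: "h s $ 1 = x + s" "h s $ 2 = ((x + s)\<^sup>2 + y\<^sup>2 - 1) / 2" "h s $ 3 = ((x + s)\<^sup>2 + y\<^sup>2 + 1) / 2" for s
    using y by (simp_all add: h_def hyperboloid_nth x_def y_def axis_def)
  \<comment> \<open>The second difference of \<open>h\<close>, which is its constant second
    derivative.\<close>
  define f where "f = (1 / \<delta>\<^sup>2) *\<^sub>R (1 *\<^sub>R h \<delta> + 1 *\<^sub>R h (- \<delta>)) + (- 2 / \<delta>\<^sup>2) *\<^sub>R h 0"
  have f: "f $ 1 = 0" "f $ 2 = 1" "f $ 3 = 1"
    using \<delta>(1) by (simp_all add: f_def hs field_simps power2_eq_square del: scaleR_one)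
  have Df: "D f"
    unfolding f_def by (intro D_lin Dh) (use \<delta>(1) in auto)
  \<comment> \<open>The central first difference of \<open>h\<close>, with its part along
    \<open>f\<close> removed.\<close>
  define e1 where "e1 = (1 / (2 * \<delta>)) *\<^sub>R (1 *\<^sub>R h \<delta> + (-1) *\<^sub>R h (- \<delta>)) + (- x) *\<^sub>R f"
  have e1: "e1 $ 1 = 1" "e1 $ 2 = 0" "e1 $ 3 = 0"
    using \<delta>(1) by (simp_all add: e1_def hs f field_simps power2_eq_square del: scaleR_one)
  have De1: "D e1"
    unfolding e1_def by (intro D_lin Dh Df) (use \<delta>(1) in auto)
  \<comment> \<open>What remains of \<open>2 *\<^sub>R h 0\<close> after removing multiples of
    \<open>e1\<close> and \<open>f\<close>; together with \<open>f\<close> it spans the last two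
    axes.\<close>
  define g where "g = 1 *\<^sub>R (2 *\<^sub>R h 0 + (- 2 * x) *\<^sub>R e1) + (- (x\<^sup>2 + y\<^sup>2)) *\<^sub>R f"
  have g: "g $ 1 = 0" "g $ 2 = -1" "g $ 3 = 1"
    using \<delta>(1) by (simp_all add: g_def hs f e1 field_simps power2_eq_square del: scaleR_one)
  have Dg: "D g"
    unfolding g_def by (intro D_lin Dh Df De1) (use \<delta>(1) in auto)
  have D_axis: "D (axis k 1)" for k
  proof -
    have "axis 1 1 = 1 *\<^sub>R e1 + 0 *\<^sub>R e1" "axis 2 1 = (1/2) *\<^sub>R f + (-1/2) *\<^sub>R g" "axis 3 1 = (1/2) *\<^sub>R f + (1/2) *\<^sub>R g"
      by (simp_all add: vec_eq_iff forall_3 f e1 g axis_def)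
    then have "D (axis 1 1)" "D (axis 2 1)" "D (axis 3 1)" using D_lin Df De1 Dg by metis+
    then show ?thesis using exhaust_3[of k] by auto
  qed
  have "\<exists>b. ((\<lambda>t. \<gamma> t $ i $ k) has_real_derivative b) (at 0)" for i k
  proof -
    have "(\<lambda>t. (\<gamma> t *v axis k 1) $ i) differentiable (at 0)" using D_axis[of k] unfolding D_def by blast
    then have "(\<lambda>t. \<gamma> t $ i $ k) differentiable (at 0)" by (simp add: matrix_vector_mult_basis column_def)
    then show ?thesis using real_differentiable_def by blast
  qed
  then obtain b where b: "\<And>i k. ((\<lambda>t. \<gamma> t $ i $ k) has_real_derivative b i k) (at 0)" by metis
  have \<gamma>0: "\<gamma> 0 $ i $ k = (if i = k then 1 else 0)" for i k by (simp add: one_parameter_0[OF \<gamma>] mat_def)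
  \<comment> \<open>The Lorentz products of the columns of \<open>\<gamma> t\<close> do not depend
    on \<open>t\<close>; their derivative at 0 is the antisymmetry that leaves three
    parameters.\<close>
  have skew: "sg i * b i k + sg k * b k i = 0" for i k
  proof -
    have "((\<lambda>t. ip (\<lambda>a. \<gamma> t $ a $ i) (\<lambda>a. \<gamma> t $ a $ k)) has_real_derivative
      (\<Sum>a\<in>UNIV. sg a * (b a i * \<gamma> 0 $ a $ k + \<gamma> 0 $ a $ i * b a k))) (at 0)"
      unfolding ip_def by (auto simp: sum_3 sg_def intro!: derivative_eq_intros b)
    moreover have "(\<lambda>t. ip (\<lambda>a. \<gamma> t $ a $ i) (\<lambda>a. \<gamma> t $ a $ k)) = (\<lambda>t. ip (\<lambda>a. axis i 1 $ a) (\<lambda>a. axis k 1 $ a))"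
    proof
      fix t
      have "\<gamma> t \<in> SO21" using \<gamma> by (simp add: one_parameter_subgroup_def)
      from SO21_ip[OF this, of "axis i 1" "axis k 1"]
      show "ip (\<lambda>a. \<gamma> t $ a $ i) (\<lambda>a. \<gamma> t $ a $ k) = ip (\<lambda>a. axis i 1 $ a) (\<lambda>a. axis k 1 $ a)"
        by (simp add: matrix_vector_mult_basis column_def)
    qed
    ultimately have "((\<lambda>t. ip (\<lambda>a. axis i 1 $ a) (\<lambda>a. axis k 1 $ a)) has_real_derivative
      (\<Sum>a\<in>UNIV. sg a * (b a i * \<gamma> 0 $ a $ k + \<gamma> 0 $ a $ i * b a k))) (at 0)" by simp
    then have "(\<Sum>a\<in>UNIV. sg a * (b a i * \<gamma> 0 $ a $ k + \<gamma> 0 $ a $ i * b a k)) = 0"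
      using DERIV_unique DERIV_const by blast
    then show ?thesis
      unfolding \<gamma>0 using exhaust_3[of i] exhaust_3[of k] by (auto simp: sum_3 sg_def)
  qed
  have "b i k = so21_mat (b 2 1) (b 1 3) (b 2 3) $ i $ k" for i k
    using skew[of 1 1] skew[of 2 2] skew[of 3 3] skew[of 1 2] skew[of 1 3] skew[of 2 3] exhaust_3[of i] exhaust_3[of k]
    by (auto simp: so21_mat_nth sg_def)
  then show ?thesis using b by metis
qed

text \<open>Differentiable orbits force a generator of the form \<open>so21_mat\<close>, and every
  such matrix generates a one-parameter subgroup; so the fields are a three-parameter
  family.\<close>

lemma infinitesimal_action_iff:
  assumes W: "open W" "W \<subseteq> H2"
  shows "infinitesimal_action W X \<longleftrightarrow> (\<exists>p q r. \<forall>z\<in>W. X z = so21_field p q r z)"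
proof
  assume "infinitesimal_action W X"
  then obtain \<gamma> where \<gamma>: "one_parameter_subgroup \<gamma>"
    and d: "\<And>z. z \<in> W \<Longrightarrow> ((\<lambda>t. so21_act (\<gamma> t) z) has_vector_derivative X z) (at 0)"
    unfolding infinitesimal_action_def by blast
  show "\<exists>p q r. \<forall>z\<in>W. X z = so21_field p q r z"
  proof (cases "W = {}")
    case False
    then obtain z0 where "z0 \<in> W" by blast
    from one_parameter_generator[OF \<gamma> W this d] obtain p q r
      where g: "\<And>i j. ((\<lambda>t. \<gamma> t $ i $ j) has_real_derivative so21_mat p q r $ i $ j) (at 0)" by blast
    have "X z = so21_field p q r z" if "z \<in> W" for z
      using vector_derivative_unique_at[OF d[OF that] so21_act_has_derivative[OF \<gamma> g]] that W by blast
    then show ?thesis by blast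
  qed simp
next
  assume "\<exists>p q r. \<forall>z\<in>W. X z = so21_field p q r z"
  then obtain p q r where X: "\<And>z. z \<in> W \<Longrightarrow> X z = so21_field p q r z" by blast
  obtain \<gamma> where "one_parameter_subgroup \<gamma>" "\<And>i j. ((\<lambda>t. \<gamma> t $ i $ j) has_real_derivative so21_mat p q r $ i $ j) (at 0)"
    using one_parameter_subgroup_exists[of p q r] by blast
  then show "infinitesimal_action W X"
    unfolding infinitesimal_action_def using so21_act_has_derivative[of \<gamma> p q r] X W
    by (intro exI[of _ \<gamma>]) auto
qed

section \<open>The kernel on the hyperbolic plane\<close>

lemma star2_zero: "star2 G 0 = 0"
  by (simp add: star2_def matrix_matrix_mult_def vec_eq_iff)

lemma kernel_corresponds_H2:
  assumes R: "R < 0" and W: "open W" "connected W" "W \<subseteq> H2"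
  shows "kernel_corresponds (hyp_metric R) R W (infinitesimal_action W)"
proof -
  let ?h = "\<lambda>a z. hyperboloid z $ a"
  interpret hyp_frame "hyp_metric R" W R ?h
    by (rule hyp_frame_subset[OF hyp_frame_hyperboloid[OF R] W(1,3)])
  interpret frame_tensor "hyp_metric R" W R ?h "\<lambda>x. 0"
    by unfold_locales (simp add: transpose_def vec_eq_iff)
  have u0: "u a k x = 0" for a k x by (simp add: u_def star2_zero)
  have kernel: "in_kernel (hyp_metric R) R W E \<longleftrightarrow> smooth_fun E W \<and> is_hess E" for E
    by (auto simp: in_kernel_def is_hess_iff star2_zero)
  \<comment> \<open>The identification of the coefficients \<open>c\<close> with generators:
    \<open>q * q + r * r - p * p\<close> becomes \<open>R * R * ip c c\<close>. The factors of
    \<open>R\<close> come from the area form of \<open>hyp_metric R\<close>, which is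
    \<open>-1/R\<close> times that of curvature -1.\<close>
  have ham: "hamiltonian_field (hyp_metric R) W E (so21_field (- R * c 3) (- R * c 2) (R * c 1))"
    if E: "\<And>z. z \<in> W \<Longrightarrow> E z = ip (\<lambda>a. hyperboloid z $ a) c" for E c
    unfolding hamiltonian_iff
  proof
    fix z assume z: "z \<in> W"
    then have zH: "z \<in> H2" using W by blast
    then have z2: "z $ 2 > 0" by (simp add: H2_def)
    have w: "sqrt (det (hyp_metric R z)) = 1 / (- R * (z $ 2)\<^sup>2)"
    proof -
      have "1 / (- R * (z $ 2)\<^sup>2) > 0" using R z2 by (simp add: mult_neg_pos)
      then show ?thesis unfolding det_hyp_metric real_sqrt_abs by (rule abs_of_pos)
    qed
    have p: "pd k E z = ip (\<lambda>a. pd k (?h a) z) c" for k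
    proof -
      have "pd k E z = pd k (\<lambda>z. ip (\<lambda>a. hyperboloid z $ a) (\<lambda>a. (\<lambda>z. c a) z)) z"
        by (rule pd_cong[OF W(1) z]) (simp add: E)
      also have "\<dots> = ip (\<lambda>a. pd k (?h a) z) c"
        using pd_ip[of ?h z "\<lambda>a z. c a" k] diff_e[OF z] by (simp add: ip_def)
      finally show ?thesis .
    qed
    show "pd 1 E z = - (so21_field (- R * c 3) (- R * c 2) (R * c 1) z $ 2 * sqrt (det (hyp_metric R z)))
      \<and> pd 2 E z = so21_field (- R * c 3) (- R * c 2) (R * c 1) z $ 1 * sqrt (det (hyp_metric R z))"
      unfolding w p ip_def hyperboloid_derivs[OF zH] using z2 R
      by (simp add: so21_field_def field_simps power2_eq_square)
  qed
  show ?thesis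
  proof (rule kernel_correspondsI)
    show "R \<noteq> 0" "connected W" using R W by auto
  next
    fix E assume "in_kernel (hyp_metric R) R W E"
    then have E: "smooth_fun E W" "is_hess E" using kernel by auto
    have "\<exists>c. \<forall>x\<in>W. fcoef E a x = 0 + c" for a
      using equal_pd_imp_diff_const[OF W(1,2), of "\<lambda>x. 0" "fcoef E a"] fcoef(1,2)[OF E] by (simp add: u0)
    then obtain c where c: "\<And>a x. x \<in> W \<Longrightarrow> fcoef E a x = c a" by (metis add_0)
    have "E z = ip (\<lambda>a. hyperboloid z $ a) c" if "z \<in> W" for z
      using fcoef(3)[OF E that] by (simp add: c[OF that])
    from ham[OF this] show "\<exists>X. infinitesimal_action W X \<and> hamiltonian_field (hyp_metric R) W E X"
      using infinitesimal_action_iff[OF W(1,3)] by blast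
  next
    fix X assume "infinitesimal_action W X"
    then obtain p q r where X: "\<And>z. z \<in> W \<Longrightarrow> X z = so21_field p q r z"
      using infinitesimal_action_iff[OF W(1,3)] by blast
    \<comment> \<open>The inverse of the identification in \<open>ham\<close>.\<close>
    define c :: "3 \<Rightarrow> real" where "c a = (if a = 1 then r / R else if a = 2 then q / - R else p / - R)" for a
    define E where "E z = ip (\<lambda>a. hyperboloid z $ a) c" for z
    have "smooth_fun E W" "is_hess E"
      unfolding E_def using is_hess_of_coeffs[of "\<lambda>a z. c a"] by (simp_all add: u0)
    moreover have "hamiltonian_field (hyp_metric R) W E X"
    proof -
      have "- R * c 3 = p" "- R * c 2 = q" "R * c 1 = r" using R by (simp_all add: c_def)
      then have "hamiltonian_field (hyp_metric R) W E (so21_field p q r)" using ham[of E c] by (simp add: E_def)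
      then show ?thesis unfolding hamiltonian_field_def using X by simp
    qed
    ultimately show "\<exists>E. in_kernel (hyp_metric R) R W E \<and> hamiltonian_field (hyp_metric R) W E X"
      using kernel by blast
  qed
qed

section \<open>Hyperbolic surfaces\<close>

lemma det_pos_if_posdef:
  fixes M :: "real^2^2"
  assumes "transpose M = M" and pos: "\<And>v. v \<noteq> 0 \<Longrightarrow> v \<bullet> (M *v v) > 0"
  shows "det M > 0"
proof -
  have sym: "M $ 2 $ 1 = M $ 1 $ 2"
    using arg_cong[OF assms(1), of "\<lambda>M. M $ 1 $ 2"] by (simp add: transpose_def)
  have q: "v \<bullet> (M *v v) = M $ 1 $ 1 * (v $ 1 * v $ 1) + 2 * (M $ 1 $ 2 * (v $ 1 * v $ 2)) + M $ 2 $ 2 * (v $ 2 * v $ 2)" for v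
    by (simp add: inner_vec_def matrix_vector_mult_def sum_2 sym algebra_simps)
  have 1: "M $ 1 $ 1 > 0" using pos[of "vector [1, 0]"] by (simp add: q vec_eq_iff forall_2)
  \<comment> \<open>At this vector the quadratic form takes the value
    \<open>M $ 1 $ 1 * det M\<close>.\<close>
  have "vector [- M $ 1 $ 2, M $ 1 $ 1] \<noteq> (0 :: real^2)" using 1 by (simp add: vec_eq_iff forall_2)
  from pos[OF this] have "M $ 1 $ 1 * det M > 0" unfolding q det_2 sym by (simp add: algebra_simps)
  then show ?thesis using 1 by (simp add: zero_less_mult_iff)
qed

lemma weak_grad_cong:
  assumes "weak_grad W c u" "\<And>k x. x \<in> W \<Longrightarrow> u k x = u' k x"
  shows "weak_grad W c u'"
proof -
  have "dist_of (u k) \<phi> = dist_of (u' k) \<phi>" if "test_fun W \<phi>" for k \<phi>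
    by (rule dist_of_cong[OF _ that that]) (simp add: assms(2))
  moreover have "L1_loc (u k) W \<longleftrightarrow> L1_loc (u' k) W" for k
    by (rule L1_loc_cong) (rule assms(2))
  ultimately show ?thesis using assms(1) by (simp add: weak_grad_def)
qed

locale hyp_surface =
  fixes A :: "'a::{t2_space,second_countable_topology} chart set"
    and g :: "'a chart \<Rightarrow> real^2 \<Rightarrow> real^2^2" and R :: real
  assumes hyp: "hyperbolic_surface A g R"
begin

lemma R: "R < 0" and atlas: "smooth_atlas A" and metric: "riemannian_metric A g" and loc: "locally_hyperbolic A g R"
  using hyp by (auto simp: hyperbolic_surface_def)

lemma chart:
  assumes "c \<in> A"
  shows "open (cdom c)" "open (cimg c UNIV)" "homeomorphism (cdom c) (cimg c UNIV) (cmap c) (cinv c)"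
  using atlas assms by (auto simp: smooth_atlas_def)

lemma cmap_cinv:
  assumes "c \<in> A" "x \<in> cimg c U"
  shows "cmap c (cinv c x) = x" "cinv c x \<in> cdom c" "cinv c x \<in> U"
proof -
  obtain p where p: "p \<in> cdom c" "p \<in> U" "x = cmap c p" using assms(2) by (auto simp: cimg_def)
  have "cinv c (cmap c p) = p" using chart(3)[OF assms(1)] p(1) by (auto simp: homeomorphism_def)
  then show "cmap c (cinv c x) = x" "cinv c x \<in> cdom c" "cinv c x \<in> U" using p by auto
qed

lemma cinv_cmap: "c \<in> A \<Longrightarrow> p \<in> cdom c \<Longrightarrow> cinv c (cmap c p) = p"
  using chart(3) by (auto simp: homeomorphism_def)

lemma cimg_iff: "c \<in> A \<Longrightarrow> x \<in> cimg c U \<longleftrightarrow> x \<in> cimg c UNIV \<and> cinv c x \<in> U"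
proof
  assume "c \<in> A" "x \<in> cimg c U"
  then show "x \<in> cimg c UNIV \<and> cinv c x \<in> U" using cmap_cinv(3) by (auto simp: cimg_def)
next
  assume c: "c \<in> A" and x: "x \<in> cimg c UNIV \<and> cinv c x \<in> U"
  then have "x = cmap c (cinv c x)" "cinv c x \<in> cdom c \<inter> U" using cmap_cinv[OF c, of x UNIV] by auto
  then show "x \<in> cimg c U" unfolding cimg_def by (rule image_eqI)
qed

lemma cimg_mono: "U \<subseteq> U' \<Longrightarrow> cimg c U \<subseteq> cimg c U'"
  by (auto simp: cimg_def)

lemma open_cimg:
  assumes "c \<in> A" "open U"
  shows "open (cimg c U)"
proof -
  have "continuous_on (cimg c UNIV) (cinv c)" using chart(3)[OF assms(1)] by (simp add: homeomorphism_def)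
  from continuous_open_preimage[OF this chart(2)[OF assms(1)] assms(2)]
  have "open (cimg c UNIV \<inter> cinv c -` U)" .
  also have "cimg c UNIV \<inter> cinv c -` U = cimg c U" using cimg_iff[OF assms(1), of _ U] by blast
  finally show ?thesis .
qed

lemma metric_chart_g:
  assumes "c \<in> A" "open W" "W \<subseteq> cimg c UNIV"
  shows "metric_chart (g c) W"
proof (rule metric_chart_subset[OF _ assms(2,3)], unfold_locales)
  show "open (cimg c UNIV)" using chart assms by blast
  show "smooth_mat (g c) (cimg c UNIV)" using metric assms by (auto simp: riemannian_metric_def smooth_tensor_def)
  fix x assume x: "x \<in> cimg c UNIV"
  then show t: "transpose (g c x) = g c x" using metric assms(1) by (auto simp: riemannian_metric_def sym2_tensor_def)
  show "det (g c x) > 0"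
    by (rule det_pos_if_posdef[OF t]) (use metric assms(1) x in \<open>auto simp: riemannian_metric_def\<close>)
qed

lemma transition_smooth: "c \<in> A \<Longrightarrow> d \<in> A \<Longrightarrow> smooth_map (transition c d) (cimg c (cdom d))"
  using atlas by (auto simp: smooth_atlas_def)

lemma transition_mem: "d \<in> A \<Longrightarrow> U \<subseteq> cdom c \<Longrightarrow> x \<in> cimg d U \<Longrightarrow> transition d c x \<in> cimg c (U \<inter> cdom d)"
  using cmap_cinv[of d x U] by (auto simp: transition_def cimg_def)

lemma transition_inverse: "c \<in> A \<Longrightarrow> d \<in> A \<Longrightarrow> x \<in> cimg d (cdom c) \<Longrightarrow> transition c d (transition d c x) = x"
  using cmap_cinv[of d x "cdom c"] by (simp add: transition_def cinv_cmap)

lemma tensor_pullback: "sym2_tensor A S \<Longrightarrow> c \<in> A \<Longrightarrow> d \<in> A \<Longrightarrow> x \<in> cimg d (cdom c) \<Longrightarrow> S d x = pullback (transition d c) (S c) x"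
  by (simp add: sym2_tensor_def)

lemma smooth_map_subset: "smooth_map F W \<Longrightarrow> V \<subseteq> W \<Longrightarrow> smooth_map F V"
  unfolding smooth_map_def using smooth_fun_subset by blast

text \<open>The local isometry into the half plane followed by \<open>hyperboloid\<close> gives the
  frame in one chart, and transition maps carry it to all others. \<open>U\<close> is a box in that
  chart for the sake of the Poincare lemmas; the closed box stays inside \<open>W\<close>, so
  locally integrable functions are integrable on it.\<close>

lemma local_frame:
  "\<exists>c\<in>A. \<exists>U W \<epsilon> a b. open U \<and> p \<in> U \<and> U \<subseteq> cdom c \<and> cimg c U = box a b \<and> (\<forall>k. a $ k < b $ k) \<and>
    cbox a b \<subseteq> W \<and> W \<subseteq> cimg c UNIV \<and> hyp_frame (g c) W R \<epsilon> \<and>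
    (\<forall>d\<in>A. hyp_frame (g d) (cimg d U) R (\<lambda>a x. \<epsilon> a (transition d c x)))"
proof -
  obtain c W f where c: "c \<in> A" "p \<in> cdom c" and W: "open W" "cmap c p \<in> W" "W \<subseteq> cimg c UNIV"
    and f: "f ` W \<subseteq> H2" "smooth_map f W" "\<And>x. x \<in> W \<Longrightarrow> g c x = pullback f (hyp_metric R) x"
    using loc unfolding locally_hyperbolic_def by metis
  define \<epsilon> where "\<epsilon> a x = hyperboloid (f x) $ a" for a x
  have \<epsilon>: "hyp_frame (g c) W R \<epsilon>"
    using hyp_frame_pullback[OF hyp_frame_hyperboloid[OF R] metric_chart_g[OF c(1) W(1,3)] f(2,1,3)]
    by (simp add: \<epsilon>_def[abs_def])
  obtain a b where ab: "cbox a b \<subseteq> W" "cmap c p \<in> box a b"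
    using open_contains_cbox[OF W(1,2)] by metis
  have ab': "a $ k < b $ k" for k using ab(2) by (meson less_trans mem_box_cart(1))
  define U where "U = cdom c \<inter> cmap c -` box a b"
  have U: "open U" unfolding U_def
    using continuous_open_preimage[OF _ chart(1)[OF c(1)] open_box] chart(3)[OF c(1)] by (auto simp: homeomorphism_def)
  have pU: "p \<in> U" "U \<subseteq> cdom c" using c ab by (auto simp: U_def)
  have img: "cimg c U = box a b"
  proof
    show "cimg c U \<subseteq> box a b" by (auto simp: cimg_def U_def)
    show "box a b \<subseteq> cimg c U"
    proof
      fix x assume x: "x \<in> box a b"
      then have "x \<in> cimg c UNIV" using ab W box_subset_cbox by blast
      then show "x \<in> cimg c U" using x by (auto simp: cimg_def U_def)
    qed
  qed
  have "hyp_frame (g d) (cimg d U) R (\<lambda>a x. \<epsilon> a (transition d c x))" if d: "d \<in> A" for d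
  proof (rule hyp_frame_pullback[OF \<epsilon>])
    show "metric_chart (g d) (cimg d U)" by (rule metric_chart_g[OF d open_cimg[OF d U] cimg_mono]) simp
    show "smooth_map (transition d c) (cimg d U)"
      by (rule smooth_map_subset[OF transition_smooth[OF d c(1)] cimg_mono[OF pU(2)]])
    show "transition d c ` cimg d U \<subseteq> W"
      using transition_mem[OF d pU(2)] cimg_mono[of "U \<inter> cdom d" U c] img ab box_subset_cbox by blast
    fix x assume "x \<in> cimg d U"
    then have "x \<in> cimg d (cdom c)" using cimg_mono[OF pU(2)] by blast
    then show "g d x = pullback (transition d c) (g c) x"
      using tensor_pullback[of g] metric c(1) d by (simp add: riemannian_metric_def)
  qed
  then show ?thesis
    using c(1) U pU img ab' ab(1) W(3) \<epsilon>
    by (intro bexI[of _ c] exI[of _ U] exI[of _ W] exI[of _ \<epsilon>] exI[of _ a] exI[of _ b] conjI ballI allI)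
qed

text \<open>Frames exist near each point, whereas \<open>W\<close> is any connected open set inside
  a chart; \<open>killing_imp_kernel\<close> therefore asks for frames locally and builds the
  Hamiltonian from the first derivatives of the field, without integration.\<close>

lemma killing_part:
  assumes c: "c \<in> A" and W: "open W" "connected W" "W \<subseteq> cimg c UNIV"
  shows "kernel_corresponds (g c) R W (killing_field (g c) W)"
proof -
  interpret metric_chart "g c" W by (rule metric_chart_g[OF c W(1,3)])
  show ?thesis
  proof (rule kernel_correspondsI)
    show "R \<noteq> 0" "connected W" using R W by auto
    show "\<exists>X. killing_field (g c) W X \<and> hamiltonian_field (g c) W E X" if "in_kernel (g c) R W E" for E
      by (rule kernel_imp_killing[OF that])
    show "\<exists>E. in_kernel (g c) R W E \<and> hamiltonian_field (g c) W E X" if "killing_field (g c) W X" for X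
    proof (rule killing_imp_kernel[OF R that])
      fix x assume x: "x \<in> W"
      obtain c' U \<epsilon> where "open U" "cinv c x \<in> U" and fr: "\<And>d. d \<in> A \<Longrightarrow> hyp_frame (g d) (cimg d U) R (\<lambda>a x. \<epsilon> a (transition d c' x))"
        using local_frame[of "cinv c x"] by metis
      have "x \<in> cimg c U \<inter> W" using x W(3) \<open>cinv c x \<in> U\<close> cimg_iff[OF c, of x U] by blast
      moreover have "open (cimg c U \<inter> W)" using open_cimg[OF c \<open>open U\<close>] W(1) by (rule open_Int)
      moreover from this have "hyp_frame (g c) (cimg c U \<inter> W) R (\<lambda>a x. \<epsilon> a (transition c c' x))"
        by (intro hyp_frame_subset[OF fr[OF c]]) auto
      ultimately show "\<exists>V' e. x \<in> V' \<and> V' \<subseteq> W \<and> hyp_frame (g c) V' R e" by blast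
    qed
  qed
qed

section \<open>The two equivalences on a surface\<close>

lemma frame_tensorI:
  assumes "hyp_frame (g c) V R e" "sym2_tensor A S" "c \<in> A" "V \<subseteq> cimg c UNIV"
  shows "frame_tensor (g c) V R e (S c)"
  using assms unfolding frame_tensor_def frame_tensor_axioms_def sym2_tensor_def by blast

lemma smooth_part:
  assumes S: "sym2_tensor A S" "smooth_tensor A S"
  shows "divergence_free A g S \<longleftrightarrow> (\<forall>p. \<exists>U E. open U \<and> p \<in> U \<and> potential_on A g R S U E)"
proof
  assume div: "divergence_free A g S"
  show "\<forall>p. \<exists>U E. open U \<and> p \<in> U \<and> potential_on A g R S U E"
  proof
    fix p
    obtain c U W \<epsilon> a b where c: "c \<in> A" and U: "open U" "p \<in> U" "U \<subseteq> cdom c" "cimg c U = box a b" "cbox a b \<subseteq> W" "W \<subseteq> cimg c UNIV"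
      and \<epsilon>: "hyp_frame (g c) W R \<epsilon>" and frames: "\<And>d. d \<in> A \<Longrightarrow> hyp_frame (g d) (cimg d U) R (\<lambda>a x. \<epsilon> a (transition d c x))"
      using local_frame[of p] by metis
    have sub: "box a b \<subseteq> W" "box a b \<subseteq> cimg c UNIV" using U box_subset_cbox by blast+
    interpret F: frame_tensor "g c" "box a b" R \<epsilon> "S c"
      by (rule frame_tensorI[OF hyp_frame_subset[OF \<epsilon> open_box sub(1)] S(1) c sub(2)])
    have Sc: "smooth_mat (S c) (box a b)"
      using S(2) c sub smooth_fun_subset unfolding smooth_tensor_def smooth_mat_def by blast
    have closed: "pd k (F.u l i) x = pd i (F.u l k) x" if "x \<in> box a b" for x l i k
    proof -
      have "pd 1 (F.u l 2) x = pd 2 (F.u l 1) x"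
        using F.curl_u[OF Sc that, of l] div c sub that by (auto simp: divergence_free_def)
      then show ?thesis using exhaust_2[of i] exhaust_2[of k] by auto
    qed
    have "cmap c p \<in> box a b" using U by (auto simp: cimg_def)
    then have "\<exists>C. smooth_fun C (box a b) \<and> (\<forall>x\<in>box a b. \<forall>k. pd k C x = F.u l k x)" for l
      by (rule poincare_smooth[OF open_box convex_box(2) _ F.smooth_u[OF Sc] closed])
    then obtain C0 where C0: "\<And>l. smooth_fun (C0 l) (box a b)" "\<And>l k x. x \<in> box a b \<Longrightarrow> pd k (C0 l) x = F.u l k x" by metis
    define C where "C l x = inverse (- R) * C0 l x" for l x
    have C: "smooth_fun (C l) (box a b)" "x \<in> box a b \<Longrightarrow> pd k (C l) x = F.u l k x / (- R)" for l k x
    proof -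
      show "smooth_fun (C l) (box a b)" unfolding C_def[abs_def] by (intro smooth_intros C0 open_box)
      assume x: "x \<in> box a b"
      show "pd k (C l) x = F.u l k x / (- R)"
        unfolding C_def[abs_def] pd_cmult[OF smooth_fun_differentiable[OF C0(1) x]] C0(2)[OF x] by (simp add: divide_inverse mult.commute)
    qed
    \<comment> \<open>\<open>E\<close> is defined on the surface through the chart \<open>c\<close>;
      in any other chart the transported frame and coefficients satisfy the same equations, so
      \<open>is_hess_of_coeffs\<close> applies there anew.\<close>
    define E where "E q = ip (\<lambda>l. \<epsilon> l (cmap c q)) (\<lambda>l. C l (cmap c q))" for q
    have "potential_on A g R S U E"
      unfolding potential_on_def
    proof
      fix d assume d: "d \<in> A"
      define \<tau> where "\<tau> = transition d c"
      have oV: "open (cimg d U)" by (rule open_cimg[OF d U(1)])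
      interpret F': frame_tensor "g d" "cimg d U" R "\<lambda>a x. \<epsilon> a (\<tau> x)" "S d"
        unfolding \<tau>_def by (rule frame_tensorI[OF frames[OF d] S(1) d]) (rule cimg_mono, simp)
      have dc: "x \<in> cimg d U \<Longrightarrow> x \<in> cimg d (cdom c)" for x using cimg_mono[OF U(3)] by blast
      have \<tau>: "smooth_map \<tau> (cimg d U)" "\<tau> ` cimg d U \<subseteq> box a b"
        unfolding \<tau>_def using transition_mem[OF d U(3)] cimg_mono[of "U \<inter> cdom d" U c] U(4)
        by (auto intro: smooth_map_subset[OF transition_smooth[OF d c] cimg_mono[OF U(3)]])
      have pb: "g d x = pullback \<tau> (g c) x" "S d x = pullback \<tau> (S c) x" if "x \<in> cimg d U" for x
        using tensor_pullback[OF S(1) c d dc[OF that]] tensor_pullback[of g, OF _ c d dc[OF that]] metric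
        by (simp_all add: \<tau>_def riemannian_metric_def)
      have c': "smooth_fun (\<lambda>x. C l (\<tau> x)) (cimg d U)" for l
        by (rule smooth_fun_compose[OF oV open_box \<tau> C(1)])
      have pc': "pd k (\<lambda>x. C l (\<tau> x)) x = F'.u l k x / (- R)" if x: "x \<in> cimg d U" for l k x
      proof -
        have \<tau>x: "\<tau> x \<in> box a b" using \<tau> x by blast
        have d\<tau>: "(\<lambda>x. \<tau> x $ i) differentiable (at x)" for i
          using \<tau>(1) x smooth_fun_differentiable unfolding smooth_map_def by blast
        have "pd k (\<lambda>x. C l (\<tau> x)) x = (\<Sum>i\<in>UNIV. pd i (C l) (\<tau> x) * pd k (\<lambda>x. \<tau> x $ i) x)"
          by (rule pd_compose(2)[OF d\<tau> smooth_fun_differentiable[OF C(1) \<tau>x]])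
        also have "\<dots> = F'.u l k x / (- R)"
        proof -
          have "F'.u l k x = (\<Sum>i\<in>UNIV. F.u l i (\<tau> x) * pd k (\<lambda>x. \<tau> x $ i) x)"
            by (rule u_pullback[OF F.frame_tensor_axioms F'.frame_tensor_axioms \<tau> pb x])
          then show ?thesis unfolding C(2)[OF \<tau>x] by (simp add: sum_2 add_divide_distrib)
        qed
        finally show ?thesis .
      qed
      have "E \<circ> cinv d = (\<lambda>x. ip (\<lambda>l. \<epsilon> l (\<tau> x)) (\<lambda>l. C l (\<tau> x)))"
        by (simp add: E_def fun_eq_iff \<tau>_def transition_def)
      then show "smooth_fun (E \<circ> cinv d) (cimg d U) \<and> (\<forall>x\<in>cimg d U. star_tensor g S d x
        = hessian (g d) (E \<circ> cinv d) x + (R * (E \<circ> cinv d) x) *\<^sub>R g d x)"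
        using F'.is_hess_of_coeffs[OF c' pc'] by (simp add: F'.is_hess_iff star_tensor_def)
    qed
    then show "\<exists>U E. open U \<and> p \<in> U \<and> potential_on A g R S U E" using U by blast
  qed
next
  assume pot: "\<forall>p. \<exists>U E. open U \<and> p \<in> U \<and> potential_on A g R S U E"
  show "divergence_free A g S"
    unfolding divergence_free_def
  proof (intro ballI allI)
    fix c x j assume c: "c \<in> A" and x: "x \<in> cimg c UNIV"
    obtain U E where U: "open U" "cinv c x \<in> U" "potential_on A g R S U E" using pot by blast
    obtain c' U' \<epsilon> where U': "open U'" "cinv c x \<in> U'" and fr: "\<And>d. d \<in> A \<Longrightarrow> hyp_frame (g d) (cimg d U') R (\<lambda>a x. \<epsilon> a (transition d c' x))"
      using local_frame[of "cinv c x"] by metis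
    define V where "V = cimg c (U \<inter> U')"
    have V: "open V" "x \<in> V" "V \<subseteq> cimg c U" "V \<subseteq> cimg c U'" "V \<subseteq> cimg c UNIV"
      unfolding V_def using U U' x by (auto intro!: open_cimg[OF c] cimg_mono simp: cimg_iff[OF c, of x "U \<inter> U'"])
    interpret F: frame_tensor "g c" V R "\<lambda>a x. \<epsilon> a (transition c c' x)" "S c"
      by (rule frame_tensorI[OF hyp_frame_subset[OF fr[OF c] V(1,4)] S(1) c V(5)])
    show "Dstar (g c) (S c) j x = 0"
    proof (rule F.is_hess_imp_divergence_free[OF _ _ _ V(2)])
      show "smooth_mat (S c) V"
        using S(2) c V(5) smooth_fun_subset unfolding smooth_tensor_def smooth_mat_def by blast
      show "smooth_fun (E \<circ> cinv c) V" "F.is_hess (E \<circ> cinv c)"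
        using U(3) c V(3) smooth_fun_subset unfolding potential_on_def F.is_hess_iff star_tensor_def by blast+
    qed
  qed
qed

lemma dist_of_divide: "dist_of (\<lambda>x. f x / r) \<phi> = dist_of f \<phi> / r"
  by (simp add: dist_of_def)

lemma L1_loc_divide: "L1_loc f W \<Longrightarrow> L1_loc (\<lambda>x. f x / r) W"
  using L1_loc_cont_mult[of W "\<lambda>x. inverse r" f] by (simp add: divide_inverse mult.commute)

lemma weak_part:
  assumes S: "sym2_tensor A S" "L1_loc_tensor A S"
  shows "dist_divergence_free A g S \<longleftrightarrow> (\<forall>p. \<exists>U E. open U \<and> p \<in> U \<and> dist_potential_on A g R S U E)"
proof
  assume div: "dist_divergence_free A g S"
  show "\<forall>p. \<exists>U E. open U \<and> p \<in> U \<and> dist_potential_on A g R S U E"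
  proof
    fix p
    obtain c U W \<epsilon> a b where c: "c \<in> A" and U: "open U" "p \<in> U" "U \<subseteq> cdom c" "cimg c U = box a b" "cbox a b \<subseteq> W" "W \<subseteq> cimg c UNIV"
      and ab: "\<And>k. a $ k < b $ k"
      and \<epsilon>: "hyp_frame (g c) W R \<epsilon>" and frames: "\<And>d. d \<in> A \<Longrightarrow> hyp_frame (g d) (cimg d U) R (\<lambda>a x. \<epsilon> a (transition d c x))"
      using local_frame[of p] by metis
    have sub: "box a b \<subseteq> W" "box a b \<subseteq> cimg c UNIV" using U box_subset_cbox by blast+
    have L1S: "L1_loc (\<lambda>x. S d x $ i $ j) V" if "d \<in> A" "V \<subseteq> cimg d UNIV" for d V i j
      using S(2) that L1_loc_subset unfolding L1_loc_tensor_def by blast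
    interpret FW: frame_tensor "g c" W R \<epsilon> "S c"
      by (rule frame_tensorI[OF \<epsilon> S(1) c U(6)])
    interpret F: frame_tensor "g c" "box a b" R \<epsilon> "S c"
      by (rule frame_tensorI[OF hyp_frame_subset[OF \<epsilon> open_box sub(1)] S(1) c sub(2)])
    have "\<exists>C. weak_grad (box a b) C (\<lambda>k x. F.u l k x / (- R))" for l
    proof (rule poincare_weak[OF ab _ U(5)])
      show "L1_loc (\<lambda>x. F.u l k x / (- R)) W" for k
        by (rule L1_loc_divide[OF FW.L1_u[OF L1S[OF c U(6)]]])
      fix \<psi> assume \<psi>: "test_fun (box a b) \<psi>"
      have "dist_of (F.u l 1) (pd 2 \<psi>) = dist_of (F.u l 2) (pd 1 \<psi>)"
      proof (rule F.closed_if_weak_divergence_free[OF L1S[OF c sub(2)] _ \<psi>])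
        fix j \<phi> assume "test_fun (box a b) \<phi>"
        then have "test_fun (cimg c UNIV) \<phi>" using sub(2) by (rule test_fun_subset)
        then show "dist_Dstar (g c) (\<lambda>k l. dist_of (\<lambda>x. S c x $ k $ l)) j \<phi> = 0"
          using div c by (simp add: dist_divergence_free_def)
      qed
      then show "dist_of (\<lambda>x. F.u l 2 x / (- R)) (pd 1 \<psi>) = dist_of (\<lambda>x. F.u l 1 x / (- R)) (pd 2 \<psi>)"
        by (simp only: dist_of_divide)
    qed
    then obtain C where C: "\<And>l. weak_grad (box a b) (C l) (\<lambda>k x. F.u l k x / (- R))" by metis
    define E where "E q = ip (\<lambda>l. \<epsilon> l (cmap c q)) (\<lambda>l. C l (cmap c q))" for q
    have "dist_potential_on A g R S U E"
      unfolding dist_potential_on_def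
    proof
      fix d assume d: "d \<in> A"
      define \<tau> where "\<tau> = transition d c"
      have oV: "open (cimg d U)" by (rule open_cimg[OF d U(1)])
      interpret F': frame_tensor "g d" "cimg d U" R "\<lambda>a x. \<epsilon> a (\<tau> x)" "S d"
        unfolding \<tau>_def by (rule frame_tensorI[OF frames[OF d] S(1) d]) (rule cimg_mono, simp)
      have dc: "x \<in> cimg d U \<Longrightarrow> x \<in> cimg d (cdom c)" for x using cimg_mono[OF U(3)] by blast
      have \<tau>: "smooth_map \<tau> (cimg d U)" "\<tau> ` cimg d U \<subseteq> cimg c (U \<inter> cdom d)"
        unfolding \<tau>_def using transition_mem[OF d U(3)]
        by (auto intro: smooth_map_subset[OF transition_smooth[OF d c] cimg_mono[OF U(3)]])
      have sub': "cimg c (U \<inter> cdom d) \<subseteq> box a b" using cimg_mono[of "U \<inter> cdom d" U c] U(4) by blast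
      then have \<tau>box: "\<tau> ` cimg d U \<subseteq> box a b" using \<tau>(2) by blast
      \<comment> \<open>Weak gradients are transported by mutually inverse maps of open sets, so the
        box is cut down to the part that \<open>d\<close> also covers.\<close>
      interpret CC: chart_change "cimg c (U \<inter> cdom d)" "cimg d U" \<tau> "transition c d"
      proof
        show "open (cimg c (U \<inter> cdom d))" by (rule open_cimg[OF c]) (use U chart d in blast)
        show "open (cimg d U)" by fact
        show "smooth_map \<tau> (cimg d U)" "\<tau> ` cimg d U \<subseteq> cimg c (U \<inter> cdom d)" by fact+
        show "smooth_map (transition c d) (cimg c (U \<inter> cdom d))"
          by (rule smooth_map_subset[OF transition_smooth[OF c d] cimg_mono]) simp
        show "transition c d ` cimg c (U \<inter> cdom d) \<subseteq> cimg d U"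
          using transition_mem[OF c, of "U \<inter> cdom d" d] cimg_mono[of "U \<inter> cdom d \<inter> cdom c" U d] by blast
        show "\<tau> (transition c d y) = y" if "y \<in> cimg c (U \<inter> cdom d)" for y
          unfolding \<tau>_def by (rule transition_inverse[OF d c]) (use that cimg_mono[of "U \<inter> cdom d" "cdom d" c] in blast)
        show "transition c d (\<tau> x) = x" if "x \<in> cimg d U" for x
          unfolding \<tau>_def by (rule transition_inverse[OF c d dc[OF that]])
      qed
      have pb: "g d x = pullback \<tau> (g c) x" "S d x = pullback \<tau> (S c) x" if "x \<in> cimg d U" for x
        using tensor_pullback[OF S(1) c d dc[OF that]] tensor_pullback[of g, OF _ c d dc[OF that]] metric
        by (simp_all add: \<tau>_def riemannian_metric_def)
      have u': "(\<Sum>i\<in>UNIV. F.u l i (\<tau> x) / (- R) * CC.T i k x) = F'.u l k x / (- R)" if x: "x \<in> cimg d U" for l k x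
      proof -
        have "F'.u l k x = (\<Sum>i\<in>UNIV. F.u l i (\<tau> x) * pd k (\<lambda>x. \<tau> x $ i) x)"
          by (rule u_pullback[OF F.frame_tensor_axioms F'.frame_tensor_axioms \<tau>(1) \<tau>box pb x])
        then show ?thesis by (simp add: CC.T_def sum_2 add_divide_distrib)
      qed
      have c': "weak_grad (cimg d U) (\<lambda>x. C l (\<tau> x)) (\<lambda>k x. F'.u l k x / (- R))" for l
        using CC.weak_grad_compose[OF weak_grad_subset[OF C sub']]
        by (rule weak_grad_cong) (rule u')
      have E: "E \<circ> cinv d = (\<lambda>x. ip (\<lambda>l. \<epsilon> l (\<tau> x)) (\<lambda>l. C l (\<tau> x)))"
        by (simp add: E_def fun_eq_iff \<tau>_def transition_def)
      have L1d: "L1_loc (\<lambda>x. S d x $ i $ j) (cimg d U)" for i j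
        by (rule L1S[OF d cimg_mono]) simp
      show "L1_loc (E \<circ> cinv d) (cimg d U) \<and> (\<forall>\<phi>. test_fun (cimg d U) \<phi> \<longrightarrow> (\<forall>i j.
          dist_of (\<lambda>x. star_tensor g S d x $ i $ j) \<phi> = dist_hessian (g d) (dist_of (E \<circ> cinv d)) i j \<phi>
          + dist_of (\<lambda>x. R * g d x $ i $ j * (E \<circ> cinv d) x) \<phi>))"
        using F'.weak_hess_of_coeffs[OF L1d c'] unfolding F'.weak_hess_def[OF L1d] E star_tensor_def by simp
    qed
    then show "\<exists>U E. open U \<and> p \<in> U \<and> dist_potential_on A g R S U E" using U by blast
  qed
next
  assume pot: "\<forall>p. \<exists>U E. open U \<and> p \<in> U \<and> dist_potential_on A g R S U E"
  show "dist_divergence_free A g S"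
    unfolding dist_divergence_free_def
  proof (intro ballI allI impI)
    fix c \<phi> j assume c: "c \<in> A" and \<phi>: "test_fun (cimg c UNIV) \<phi>"
    have L1S: "L1_loc (\<lambda>x. S c x $ i $ j) V" if "V \<subseteq> cimg c UNIV" for V i j
      using S(2) c that L1_loc_subset unfolding L1_loc_tensor_def by blast
    interpret M: metric_chart "g c" "cimg c UNIV" by (rule metric_chart_g[OF c chart(2)[OF c]]) simp
    \<comment> \<open>The support of the test function may meet many of the sets \<open>U\<close>;
      the divergence is an additive functional that vanishes locally, hence on all of them
      together.\<close>
    show "dist_Dstar (g c) (\<lambda>k l. dist_of (\<lambda>x. S c x $ k $ l)) j \<phi> = 0"
    proof (rule local_imp_zero[OF M.V _ _ \<phi>])
      show "dist_Dstar (g c) (\<lambda>k l. dist_of (\<lambda>x. S c x $ k $ l)) j (\<lambda>x. \<phi> x + \<psi> x)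
        = dist_Dstar (g c) (\<lambda>k l. dist_of (\<lambda>x. S c x $ k $ l)) j \<phi> + dist_Dstar (g c) (\<lambda>k l. dist_of (\<lambda>x. S c x $ k $ l)) j \<psi>"
        if "test_fun (cimg c UNIV) \<phi>" "test_fun (cimg c UNIV) \<psi>" for \<phi> \<psi>
        by (rule M.dist_Dstar_additive[OF L1S that]) simp
      fix x assume x: "x \<in> cimg c UNIV"
      obtain U E where U: "open U" "cinv c x \<in> U" "dist_potential_on A g R S U E" using pot by blast
      obtain c' U' \<epsilon> where U': "open U'" "cinv c x \<in> U'" and fr: "\<And>d. d \<in> A \<Longrightarrow> hyp_frame (g d) (cimg d U') R (\<lambda>a x. \<epsilon> a (transition d c' x))"
        using local_frame[of "cinv c x"] by metis
      define V where "V = cimg c (U \<inter> U')"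
      have V: "open V" "x \<in> V" "V \<subseteq> cimg c U" "V \<subseteq> cimg c U'" "V \<subseteq> cimg c UNIV"
        unfolding V_def using U U' x by (auto intro!: open_cimg[OF c] cimg_mono simp: cimg_iff[OF c, of x "U \<inter> U'"])
      interpret F: frame_tensor "g c" V R "\<lambda>a x. \<epsilon> a (transition c c' x)" "S c"
        by (rule frame_tensorI[OF hyp_frame_subset[OF fr[OF c] V(1,4)] S(1) c V(5)])
      have E: "L1_loc (E \<circ> cinv c) V" "F.weak_hess (E \<circ> cinv c)"
        using U(3) c V(3) L1_loc_subset test_fun_subset
        unfolding dist_potential_on_def F.weak_hess_def[OF L1S[OF V(5)]] star_tensor_def by blast+
      show "\<exists>V. open V \<and> x \<in> V \<and> V \<subseteq> cimg c UNIV \<and> (\<forall>\<phi>. test_fun V \<phi> \<longrightarrow>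
          dist_Dstar (g c) (\<lambda>k l. dist_of (\<lambda>x. S c x $ k $ l)) j \<phi> = 0)"
        using V(1,2,5) F.weak_hess_imp_divergence_free[OF L1S[OF V(5)] E] by blast
    qed
  qed
qed

end

theorem theorem3:
  fixes A :: "'a::{t2_space,second_countable_topology} chart set"
    and g S :: "'a chart \<Rightarrow> real^2 \<Rightarrow> real^2^2"
    and R :: real
  assumes "hyperbolic_surface A g R"
    and "sym2_tensor A S"
  shows "(smooth_tensor A S \<longrightarrow>
           (divergence_free A g S \<longleftrightarrow>
              (\<forall>p. \<exists>U E. open U \<and> p \<in> U \<and> potential_on A g R S U E))) \<and>
         (L1_loc_tensor A S \<longrightarrow>
           (dist_divergence_free A g S \<longleftrightarrow>
              (\<forall>p. \<exists>U E. open U \<and> p \<in> U \<and> dist_potential_on A g R S U E))) \<and>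
         (\<forall>W. open W \<and> connected W \<and> W \<subseteq> H2 \<longrightarrow>
            kernel_corresponds (hyp_metric R) R W (infinitesimal_action W)) \<and>
         (\<forall>c\<in>A. \<forall>W. open W \<and> connected W \<and> W \<subseteq> cimg c UNIV \<longrightarrow>
            kernel_corresponds (g c) R W (killing_field (g c) W))"
proof -
  interpret hyp_surface A g R by (rule hyp_surface.intro) fact
  show ?thesis
  proof (intro conjI impI allI ballI)
    show "divergence_free A g S \<longleftrightarrow> (\<forall>p. \<exists>U E. open U \<and> p \<in> U \<and> potential_on A g R S U E)"
      if "smooth_tensor A S" by (rule smooth_part[OF assms(2) that])
    show "dist_divergence_free A g S \<longleftrightarrow> (\<forall>p. \<exists>U E. open U \<and> p \<in> U \<and> dist_potential_on A g R S U E)"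
      if "L1_loc_tensor A S" by (rule weak_part[OF assms(2) that])
    show "kernel_corresponds (hyp_metric R) R W (infinitesimal_action W)"
      if "open W \<and> connected W \<and> W \<subseteq> H2" for W
      using that by (intro kernel_corresponds_H2 R) auto
    show "kernel_corresponds (g c) R W (killing_field (g c) W)"
      if "c \<in> A" "open W \<and> connected W \<and> W \<subseteq> cimg c UNIV" for c W
      using that by (intro killing_part) auto
  qed
qed

end
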